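(* Let $A$ be a ring and let $\mathfrak{C}$ be an $A$-coring. The following statements are equivalent: (i) $\mathfrak{C}$ is a cosemisimple $A$-coring; (ii) there exist a family $\Lambda$ of finitely generated projective right $A$-modules and, for every $\Sigma\in\Lambda$, a division subring $D_\Sigma\subseteq\mathrm{End}(\Sigma_A)$, such that $\mathfrak{C}\cong\bigoplus_{\Sigma\in\Lambda}\left(\Sigma^*\otimes_{D_\Sigma}\Sigma\right)$ as $A$-corings. Furthermore, if $\mathfrak{C}$ satisfies one of these conditions, then the family $\Lambda$ is a set of representatives of all simple right $\mathfrak{C}$-comodules, and the decomposition is unique in the following sense: given any other family $\Lambda'$ (with division subrings $D_{\Sigma'}\subseteq\mathrm{End}(\Sigma'_A)$, $\Sigma'\in\Lambda'$) satisfying (ii), there exist a bijective map $\phi:\Lambda\to\Lambda'$ and, for every $\Sigma\in\Lambda$, an isomorphism of right $A$-modules $g_\Sigma:\Sigma\to\phi(\Sigma)$ such that $D_{\phi(\Sigma)}=g_\Sigma D_\Sigma g_\Sigma^{-1}$.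
   Context: All rings are associative unital algebras over a fixed commutative ring $K$; all bimodules centralize $K$. An $A$-coring is an $A$-bimodule $\mathfrak{C}$ with $A$-bimodule maps $\Delta:\mathfrak{C}\to\mathfrak{C}\otimes_A\mathfrak{C}$ and $\epsilon:\mathfrak{C}\to A$ satisfying coassociativity and the counit axioms; homomorphisms of $A$-corings are $A$-bimodule maps commuting with $\Delta$ and $\epsilon$. A direct sum of $A$-corings is an $A$-coring with componentwise comultiplication and counit. A right $\mathfrak{C}$-comodule is a right $A$-module $M$ with a right $A$-linear coassociative and counital map $\rho_M:M\to M\otimes_A\mathfrak{C}$; morphisms $f:M\to N$ are right $A$-linear maps with $(f\otimes_A\mathfrak{C})\rho_M=\rho_Nf$. $\mathcal{M}^{\mathfrak{C}}$ denotes the category of right $\mathfrak{C}$-comodules and ${}^{\mathfrak{C}}\mathcal{M}$ that of left ones. An $A$-coring $\mathfrak{C}$ is cosemisimple if it satisfies the following conditions, which are known to be equivalent: every left $\mathfrak{C}$-comodule is semisimple and ${}^{\mathfrak{C}}\mathcal{M}$ is abelian; every right $\mathfrak{C}$-comodule is semisimple and $\mathcal{M}^{\mathfrak{C}}$ is abelian; $\mathfrak{C}$ is semisimple as a left $\mathfrak{C}$-comodule and $\mathfrak{C}_A$ is flat; $\mathfrak{C}$ is semisimple as a right $\mathfrak{C}$-comodule and ${}_A\mathfrak{C}$ is flat. Comatrix coring: for a $B$-$A$-bimodule $\Sigma$ with $\Sigma_A$ finitely generated projective, $\Sigma^*=\mathrm{Hom}_A(\Sigma,A)$ is an $A$-$B$-bimodule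 via $(a\varphi b)(u)=a\varphi(bu)$. With a finite dual basis $\{e_i^*,e_i\}\subseteq\Sigma^*\times\Sigma$ (so $u=\sum_i e_ie_i^*(u)$ for all $u\in\Sigma$), $\Sigma^*\otimes_B\Sigma$ is an $A$-coring with $\Delta(\varphi\otimes_B u)=\sum_i\varphi\otimes_B e_i\otimes_A e_i^*\otimes_B u$ and $\epsilon(\varphi\otimes_B u)=\varphi(u)$. $\Sigma$ is a right $\Sigma^*\otimes_B\Sigma$-comodule via $u\mapsto\sum_i e_i\otimes_A e_i^*\otimes_B u$. For a division subring $D_\Sigma\subseteq\mathrm{End}(\Sigma_A)$ (same unit), $\Sigma$ is regarded as a $D_\Sigma$-$A$-bimodule by evaluation. In (ii), each $\Sigma\in\Lambda$ is regarded as a right $\mathfrak{C}$-comodule by composing its canonical coaction over $\Sigma^*\otimes_{D_\Sigma}\Sigma$ with the inclusion into the direct sum and the isomorphism with $\mathfrak{C}$. "Set of representatives" means that every simple right $\mathfrak{C}$-comodule is isomorphic, as a comodule, to exactly one member of the family, and all members are simple. $\Lambda$ is an indexed family: its different members may be isomorphic as $A$-modules. *)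

theory Defs
  imports "HOL-Algebra.Free_Abelian_Groups" "HOL-Algebra.Subrings"
begin

section \<open>Modules and bimodules over rings that need not be commutative\<close>

text \<open>
  As for the library's modules, the underlying abelian group is the additive part of a ring
  record, whose fields \<^const>\<open>mult\<close> and \<^const>\<open>one\<close> are never looked at.
\<close>

record ('a, 'm) rmod = "'m ring" +
  ract :: "'m \<Rightarrow> 'a \<Rightarrow> 'm"  (infixl \<open>\<triangleleft>\<index>\<close> 75)

record ('b, 'a, 'm) bimod = "('a, 'm) rmod" +
  lact :: "'b \<Rightarrow> 'm \<Rightarrow> 'm"  (infixr \<open>\<triangleright>\<index>\<close> 75)

locale right_module = A: ring A + abelian_group M
  for A :: "('a, 'p) ring_scheme" and M :: "('a, 'm, 'q) rmod_scheme" (structure) +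
  assumes ract_closed: "\<lbrakk>x \<in> carrier M; a \<in> carrier A\<rbrakk> \<Longrightarrow> x \<triangleleft> a \<in> carrier M"
    and ract_add_left:
      "\<lbrakk>x \<in> carrier M; y \<in> carrier M; a \<in> carrier A\<rbrakk> \<Longrightarrow> (x \<oplus> y) \<triangleleft> a = x \<triangleleft> a \<oplus> y \<triangleleft> a"
    and ract_add_right:
      "\<lbrakk>x \<in> carrier M; a \<in> carrier A; b \<in> carrier A\<rbrakk>
        \<Longrightarrow> x \<triangleleft> (a \<oplus>\<^bsub>A\<^esub> b) = x \<triangleleft> a \<oplus> x \<triangleleft> b"
    and ract_mult:
      "\<lbrakk>x \<in> carrier M; a \<in> carrier A; b \<in> carrier A\<rbrakk> \<Longrightarrow> x \<triangleleft> (a \<otimes>\<^bsub>A\<^esub> b) = (x \<triangleleft> a) \<triangleleft> b"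
    and ract_one: "x \<in> carrier M \<Longrightarrow> x \<triangleleft> \<one>\<^bsub>A\<^esub> = x"

locale bimodule = B: ring B + right_module A M
  for B :: "('b, 'r) ring_scheme" and A :: "('a, 'p) ring_scheme"
    and M :: "('b, 'a, 'm, 'q) bimod_scheme" (structure) +
  assumes lact_closed: "\<lbrakk>b \<in> carrier B; x \<in> carrier M\<rbrakk> \<Longrightarrow> b \<triangleright> x \<in> carrier M"
    and lact_add_right:
      "\<lbrakk>b \<in> carrier B; x \<in> carrier M; y \<in> carrier M\<rbrakk> \<Longrightarrow> b \<triangleright> (x \<oplus> y) = b \<triangleright> x \<oplus> b \<triangleright> y"
    and lact_add_left:
      "\<lbrakk>b \<in> carrier B; c \<in> carrier B; x \<in> carrier M\<rbrakk>
        \<Longrightarrow> (b \<oplus>\<^bsub>B\<^esub> c) \<triangleright> x = b \<triangleright> x \<oplus> c \<triangleright> x"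
    and lact_mult:
      "\<lbrakk>b \<in> carrier B; c \<in> carrier B; x \<in> carrier M\<rbrakk> \<Longrightarrow> (b \<otimes>\<^bsub>B\<^esub> c) \<triangleright> x = b \<triangleright> (c \<triangleright> x)"
    and lact_one: "x \<in> carrier M \<Longrightarrow> \<one>\<^bsub>B\<^esub> \<triangleright> x = x"
    and lact_ract:
      "\<lbrakk>b \<in> carrier B; x \<in> carrier M; a \<in> carrier A\<rbrakk> \<Longrightarrow> (b \<triangleright> x) \<triangleleft> a = b \<triangleright> (x \<triangleleft> a)"

text \<open>An associative unital algebra over a commutative ring, given by its structure map.\<close>

locale ring_algebra = K: cring K + A: ring A
  for K :: "('k, 'r) ring_scheme" and A :: "('a, 'p) ring_scheme" and \<eta> :: "'k \<Rightarrow> 'a" +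
  assumes scalar_hom: "\<eta> \<in> ring_hom K A"
    and scalar_central: "\<lbrakk>k \<in> carrier K; a \<in> carrier A\<rbrakk> \<Longrightarrow> \<eta> k \<otimes>\<^bsub>A\<^esub> a = a \<otimes>\<^bsub>A\<^esub> \<eta> k"

definition centralizes ::
    "('k, 'r) ring_scheme \<Rightarrow> ('k \<Rightarrow> 'a) \<Rightarrow> ('a, 'a, 'm, 'q) bimod_scheme \<Rightarrow> bool" where
  "centralizes K \<eta> M \<longleftrightarrow> (\<forall>k\<in>carrier K. \<forall>x\<in>carrier M. \<eta> k \<triangleright>\<^bsub>M\<^esub> x = x \<triangleleft>\<^bsub>M\<^esub> \<eta> k)"

definition rmod_hom ::
    "('a, 'p) ring_scheme \<Rightarrow> ('a, 'm, 'q) rmod_scheme \<Rightarrow> ('a, 'n, 's) rmod_scheme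
      \<Rightarrow> ('m \<Rightarrow> 'n) set" where
  "rmod_hom A M N =
    {f \<in> carrier M \<rightarrow> carrier N.
      (\<forall>x\<in>carrier M. \<forall>y\<in>carrier M. f (x \<oplus>\<^bsub>M\<^esub> y) = f x \<oplus>\<^bsub>N\<^esub> f y) \<and>
      (\<forall>x\<in>carrier M. \<forall>a\<in>carrier A. f (x \<triangleleft>\<^bsub>M\<^esub> a) = f x \<triangleleft>\<^bsub>N\<^esub> a)}"

definition rmod_iso ::
    "('a, 'p) ring_scheme \<Rightarrow> ('a, 'm, 'q) rmod_scheme \<Rightarrow> ('a, 'n, 's) rmod_scheme
      \<Rightarrow> ('m \<Rightarrow> 'n) set" where
  "rmod_iso A M N = {f \<in> rmod_hom A M N. bij_betw f (carrier M) (carrier N)}"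

definition bimod_hom ::
    "('b, 'r) ring_scheme \<Rightarrow> ('a, 'p) ring_scheme \<Rightarrow> ('b, 'a, 'm, 'q) bimod_scheme
      \<Rightarrow> ('b, 'a, 'n, 's) bimod_scheme \<Rightarrow> ('m \<Rightarrow> 'n) set" where
  "bimod_hom B A M N =
    {f \<in> rmod_hom A M N.
      \<forall>b\<in>carrier B. \<forall>x\<in>carrier M. f (b \<triangleright>\<^bsub>M\<^esub> x) = b \<triangleright>\<^bsub>N\<^esub> f x}"

definition regular_rmod :: "('a, 'p) ring_scheme \<Rightarrow> ('a, 'a) rmod" where
  "regular_rmod A =
    \<lparr>carrier = carrier A, mult = undefined, one = undefined,
     zero = \<zero>\<^bsub>A\<^esub>, add = (\<oplus>\<^bsub>A\<^esub>), ract = (\<otimes>\<^bsub>A\<^esub>)\<rparr>"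

definition free_rmod :: "('a, 'p) ring_scheme \<Rightarrow> 'x set \<Rightarrow> ('a, 'x \<Rightarrow> 'a) rmod" where
  "free_rmod A X =
    (let G = sum_group X (\<lambda>_. add_monoid A) in
      \<lparr>carrier = carrier G, mult = undefined, one = undefined,
       zero = \<one>\<^bsub>G\<^esub>, add = (\<otimes>\<^bsub>G\<^esub>),
       ract = (\<lambda>f a. \<lambda>x\<in>X. f x \<otimes>\<^bsub>A\<^esub> a)\<rparr>)"

definition finitely_generated ::
    "('a, 'p) ring_scheme \<Rightarrow> ('a, 'm, 'q) rmod_scheme \<Rightarrow> bool" where
  "finitely_generated A M \<longleftrightarrow>
    (\<exists>F. finite F \<and> F \<subseteq> carrier M \<and>
      (\<forall>x\<in>carrier M. \<exists>a\<in>F \<rightarrow> carrier A. x = (\<Oplus>\<^bsub>M\<^esub> e\<in>F. e \<triangleleft>\<^bsub>M\<^esub> a e)))"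

text \<open>
  A module is projective if it is (isomorphic to) a direct summand of a free module. A basis
  that is a set of elements of the module suffices, since every module is a quotient of the
  free module on its own carrier.
\<close>

definition projective ::
    "('a, 'p) ring_scheme \<Rightarrow> ('a, 'm, 'q) rmod_scheme \<Rightarrow> bool" where
  "projective A M \<longleftrightarrow>
    (\<exists>(X :: 'm set) s p. s \<in> rmod_hom A M (free_rmod A X) \<and> p \<in> rmod_hom A (free_rmod A X) M \<and>
      (\<forall>x\<in>carrier M. p (s x) = x))"


section \<open>Tensor products\<close>

definition tensor_relations ::
    "('r, 'p) ring_scheme \<Rightarrow> ('r, 'm, 'q) rmod_scheme \<Rightarrow> ('r, 'a, 'n, 's) bimod_scheme
      \<Rightarrow> ('m \<times> 'n \<Rightarrow>\<^sub>0 int) set" where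
  "tensor_relations R M N =
    {frag_of (x \<oplus>\<^bsub>M\<^esub> x', y) - frag_of (x, y) - frag_of (x', y) | x x' y.
      x \<in> carrier M \<and> x' \<in> carrier M \<and> y \<in> carrier N} \<union>
    {frag_of (x, y \<oplus>\<^bsub>N\<^esub> y') - frag_of (x, y) - frag_of (x, y') | x y y'.
      x \<in> carrier M \<and> y \<in> carrier N \<and> y' \<in> carrier N} \<union>
    {frag_of (x \<triangleleft>\<^bsub>M\<^esub> r, y) - frag_of (x, r \<triangleright>\<^bsub>N\<^esub> y) | x r y.
      x \<in> carrier M \<and> r \<in> carrier R \<and> y \<in> carrier N}"

definition tensor_kernel ::
    "('r, 'p) ring_scheme \<Rightarrow> ('r, 'm, 'q) rmod_scheme \<Rightarrow> ('r, 'a, 'n, 's) bimod_scheme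
      \<Rightarrow> ('m \<times> 'n \<Rightarrow>\<^sub>0 int) set" where
  "tensor_kernel R M N =
    generate (free_Abelian_group (carrier M \<times> carrier N)) (tensor_relations R M N)"

definition tensor_group ::
    "('r, 'p) ring_scheme \<Rightarrow> ('r, 'm, 'q) rmod_scheme \<Rightarrow> ('r, 'a, 'n, 's) bimod_scheme
      \<Rightarrow> ('m \<times> 'n \<Rightarrow>\<^sub>0 int) set ring" where
  "tensor_group R M N =
    (let Q = free_Abelian_group (carrier M \<times> carrier N) Mod tensor_kernel R M N in
      \<lparr>carrier = carrier Q, mult = undefined, one = undefined,
       zero = \<one>\<^bsub>Q\<^esub>, add = (\<otimes>\<^bsub>Q\<^esub>)\<rparr>)"

definition tensor ::
    "('r, 'p) ring_scheme \<Rightarrow> ('r, 'm, 'q) rmod_scheme \<Rightarrow> ('r, 'a, 'n, 's) bimod_scheme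
      \<Rightarrow> 'm \<Rightarrow> 'n \<Rightarrow> ('m \<times> 'n \<Rightarrow>\<^sub>0 int) set" where
  "tensor R M N x y =
    tensor_kernel R M N #>\<^bsub>free_Abelian_group (carrier M \<times> carrier N)\<^esub> frag_of (x, y)"

text \<open>
  The map out of a tensor product that is induced by a balanced biadditive map into the
  abelian group \<open>G\<close>: all representatives of the class \<open>X\<close> have the same value.
\<close>

definition tensor_lift ::
    "('g, 'p) ring_scheme \<Rightarrow> ('m \<times> 'n \<Rightarrow> 'g) \<Rightarrow> ('m \<times> 'n \<Rightarrow>\<^sub>0 int) set \<Rightarrow> 'g" where
  "tensor_lift G \<beta> X =
    the_elem ((\<lambda>t. \<Oplus>\<^bsub>G\<^esub> p\<in>Poly_Mapping.keys t. [Poly_Mapping.lookup t p] \<cdot>\<^bsub>G\<^esub> \<beta> p) ` X)"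

definition tensor_rmod ::
    "('r, 'p) ring_scheme \<Rightarrow> ('r, 'm, 'q) rmod_scheme \<Rightarrow> ('r, 'a, 'n, 's) bimod_scheme
      \<Rightarrow> ('a, ('m \<times> 'n \<Rightarrow>\<^sub>0 int) set) rmod" where
  "tensor_rmod R M N =
    (let T = tensor_group R M N in
      \<lparr>carrier = carrier T, mult = undefined, one = undefined,
       zero = \<zero>\<^bsub>T\<^esub>, add = (\<oplus>\<^bsub>T\<^esub>),
       ract = (\<lambda>X a. tensor_lift T (\<lambda>(x, y). tensor R M N x (y \<triangleleft>\<^bsub>N\<^esub> a)) X)\<rparr>)"

definition tensor_bimod ::
    "('r, 'p) ring_scheme \<Rightarrow> ('b, 'r, 'm, 'q) bimod_scheme \<Rightarrow> ('r, 'a, 'n, 's) bimod_scheme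
      \<Rightarrow> ('b, 'a, ('m \<times> 'n \<Rightarrow>\<^sub>0 int) set) bimod" where
  "tensor_bimod R M N =
    (let T = tensor_rmod R M N in
      \<lparr>carrier = carrier T, mult = undefined, one = undefined,
       zero = \<zero>\<^bsub>T\<^esub>, add = (\<oplus>\<^bsub>T\<^esub>), ract = ract T,
       lact = (\<lambda>b X. tensor_lift T (\<lambda>(x, y). tensor R M N (b \<triangleright>\<^bsub>M\<^esub> x) y) X)\<rparr>)"

text \<open>
  The map \<open>f \<otimes> g\<close> with values in \<open>M' \<otimes> N'\<close>; the domain of the two maps does not enter.
\<close>

definition tensor_map ::
    "('r, 'p) ring_scheme \<Rightarrow> ('r, 'm1, 'q) rmod_scheme \<Rightarrow> ('r, 'a, 'n1, 's) bimod_scheme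
      \<Rightarrow> ('m \<Rightarrow> 'm1) \<Rightarrow> ('n \<Rightarrow> 'n1) \<Rightarrow> ('m \<times> 'n \<Rightarrow>\<^sub>0 int) set \<Rightarrow> ('m1 \<times> 'n1 \<Rightarrow>\<^sub>0 int) set" where
  "tensor_map R M' N' f g =
    tensor_lift (tensor_group R M' N') (\<lambda>(x, y). tensor R M' N' (f x) (g y))"

text \<open>The canonical map from \<open>(M \<otimes> N) \<otimes> P\<close> to \<open>M \<otimes> (N \<otimes> P)\<close>, all tensor products over \<open>A\<close>.\<close>

definition tensor_assoc ::
    "('a, 'p) ring_scheme \<Rightarrow> ('a, 'm, 'q) rmod_scheme \<Rightarrow> ('a, 'a, 'n, 's) bimod_scheme
      \<Rightarrow> ('a, 'a, 'l, 't) bimod_scheme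
      \<Rightarrow> (('m \<times> 'n \<Rightarrow>\<^sub>0 int) set \<times> 'l \<Rightarrow>\<^sub>0 int) set
      \<Rightarrow> ('m \<times> ('n \<times> 'l \<Rightarrow>\<^sub>0 int) set \<Rightarrow>\<^sub>0 int) set" where
  "tensor_assoc A M N P =
    (let NP = tensor_bimod A N P; T = tensor_group A M NP in
      tensor_lift T (\<lambda>(t, z). tensor_lift T (\<lambda>(x, y). tensor A M NP x (tensor A N P y z)) t))"

text \<open>
  Flatness of the left \<open>A\<close>-module underlying \<open>N\<close>, tested on injective maps between right
  \<open>A\<close>-modules carried by the type \<open>'u\<close>. Only finitely generated modules matter for this,
  and each of them is isomorphic to a quotient of some \<open>A\<^sup>n\<close>; hence the test type
  \<^typ>\<open>(nat \<Rightarrow> 'a) set\<close> gives flatness with respect to modules of every type.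
\<close>

definition left_flat ::
    "'u itself \<Rightarrow> ('a, 'p) ring_scheme \<Rightarrow> ('a, 'a, 'n, 's) bimod_scheme \<Rightarrow> bool" where
  "left_flat _ A N \<longleftrightarrow>
    (\<forall>(M :: ('a, 'u) rmod) (M' :: ('a, 'u) rmod) f.
      right_module A M \<and> right_module A M' \<and> f \<in> rmod_hom A M M' \<and> inj_on f (carrier M) \<longrightarrow>
      inj_on (tensor_map A M' N f id) (carrier (tensor_group A M N)))"


section \<open>Corings and comodules\<close>

record ('a, 'c) coring = "('a, 'a, 'c) bimod" +
  comult :: "'c \<Rightarrow> ('c \<times> 'c \<Rightarrow>\<^sub>0 int) set"
  counit :: "'c \<Rightarrow> 'a"

record ('a, 'c, 'm) comod = "('a, 'm) rmod" +
  coact :: "'m \<Rightarrow> ('m \<times> 'c \<Rightarrow>\<^sub>0 int) set"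

locale coring = bimodule A A C
  for A :: "('a, 'p) ring_scheme" and C :: "('a, 'c, 'q) coring_scheme" (structure) +
  assumes comult_hom: "comult C \<in> bimod_hom A A C (tensor_bimod A C C)"
    and counit_right_linear: "counit C \<in> rmod_hom A C (regular_rmod A)"
    and counit_left_linear:
      "\<lbrakk>a \<in> carrier A; c \<in> carrier C\<rbrakk> \<Longrightarrow> counit C (a \<triangleright> c) = a \<otimes>\<^bsub>A\<^esub> counit C c"
    and coassociative:
      "c \<in> carrier C \<Longrightarrow>
        tensor_assoc A C C C (tensor_map A (tensor_rmod A C C) C (comult C) id (comult C c)) =
        tensor_map A C (tensor_bimod A C C) id (comult C) (comult C c)"
    and counit_right:
      "c \<in> carrier C \<Longrightarrow> tensor_lift C (\<lambda>(x, y). x \<triangleleft> counit C y) (comult C c) = c"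
    and counit_left:
      "c \<in> carrier C \<Longrightarrow> tensor_lift C (\<lambda>(x, y). counit C x \<triangleright> y) (comult C c) = c"

definition coring_iso ::
    "('a, 'p) ring_scheme \<Rightarrow> ('a, 'c, 'q) coring_scheme \<Rightarrow> ('a, 'd, 's) coring_scheme
      \<Rightarrow> ('c \<Rightarrow> 'd) set" where
  "coring_iso A C D =
    {f \<in> bimod_hom A A C D. bij_betw f (carrier C) (carrier D) \<and>
      (\<forall>c\<in>carrier C. comult D (f c) = tensor_map A D D f f (comult C c)) \<and>
      (\<forall>c\<in>carrier C. counit D (f c) = counit C c)}"

locale right_comodule = right_module A M
  for A :: "('a, 'p) ring_scheme" and C :: "('a, 'c, 'q) coring_scheme"
    and M :: "('a, 'c, 'm, 's) comod_scheme" (structure) +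
  assumes coact_hom: "coact M \<in> rmod_hom A M (tensor_rmod A M C)"
    and coact_coassociative:
      "x \<in> carrier M \<Longrightarrow>
        tensor_assoc A M C C (tensor_map A (tensor_rmod A M C) C (coact M) id (coact M x)) =
        tensor_map A M (tensor_bimod A C C) id (comult C) (coact M x)"
    and coact_counital:
      "x \<in> carrier M \<Longrightarrow> tensor_lift M (\<lambda>(y, c). y \<triangleleft> counit C c) (coact M x) = x"

definition comod_hom ::
    "('a, 'p) ring_scheme \<Rightarrow> ('a, 'c, 'q) coring_scheme \<Rightarrow> ('a, 'c, 'm, 's) comod_scheme
      \<Rightarrow> ('a, 'c, 'n, 't) comod_scheme \<Rightarrow> ('m \<Rightarrow> 'n) set" where
  "comod_hom A C M N =
    {f \<in> rmod_hom A M N.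
      \<forall>x\<in>carrier M. tensor_map A N C f id (coact M x) = coact N (f x)}"

definition comod_iso ::
    "('a, 'p) ring_scheme \<Rightarrow> ('a, 'c, 'q) coring_scheme \<Rightarrow> ('a, 'c, 'm, 's) comod_scheme
      \<Rightarrow> ('a, 'c, 'n, 't) comod_scheme \<Rightarrow> ('m \<Rightarrow> 'n) set" where
  "comod_iso A C M N = {f \<in> comod_hom A C M N. bij_betw f (carrier M) (carrier N)}"

definition subcomodule ::
    "('a, 'p) ring_scheme \<Rightarrow> ('a, 'c, 'q) coring_scheme \<Rightarrow> ('a, 'c, 'm) comod
      \<Rightarrow> ('a, 'c, 'm) comod \<Rightarrow> bool" where
  "subcomodule A C N M \<longleftrightarrow>
    right_comodule A C N \<and> carrier N \<subseteq> carrier M \<and> id \<in> comod_hom A C N M"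

definition simple_comodule ::
    "('a, 'p) ring_scheme \<Rightarrow> ('a, 'c, 'q) coring_scheme \<Rightarrow> ('a, 'c, 'm) comod \<Rightarrow> bool" where
  "simple_comodule A C M \<longleftrightarrow>
    right_comodule A C M \<and> carrier M \<noteq> {\<zero>\<^bsub>M\<^esub>} \<and>
    (\<forall>N. subcomodule A C N M \<longrightarrow> carrier N = {\<zero>\<^bsub>M\<^esub>} \<or> carrier N = carrier M)"

text \<open>A comodule is semisimple if it is an (internal) direct sum of simple subcomodules.\<close>

definition semisimple_comodule ::
    "('a, 'p) ring_scheme \<Rightarrow> ('a, 'c, 'q) coring_scheme \<Rightarrow> ('a, 'c, 'm) comod \<Rightarrow> bool" where
  "semisimple_comodule A C M \<longleftrightarrow>
    right_comodule A C M \<and>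
    (\<exists>\<S>. (\<forall>N\<in>\<S>. simple_comodule A C N \<and> subcomodule A C N M) \<and>
      bij_betw (\<lambda>f. \<Oplus>\<^bsub>M\<^esub> N\<in>{N\<in>\<S>. f N \<noteq> \<zero>\<^bsub>M\<^esub>}. f N)
        (carrier (sum_group \<S> add_monoid)) (carrier M))"

definition regular_comod :: "('a, 'c, 'q) coring_scheme \<Rightarrow> ('a, 'c, 'c) comod" where
  "regular_comod C =
    \<lparr>carrier = carrier C, mult = undefined, one = undefined,
     zero = \<zero>\<^bsub>C\<^esub>, add = (\<oplus>\<^bsub>C\<^esub>), ract = ract C,
     coact = comult C\<rparr>"

text \<open>
  Of the equivalent conditions that define cosemisimplicity, this is the one that asks the
  coring to be semisimple as a right comodule and flat as a left module. The type argument
  is the one of \<^const>\<open>left_flat\<close>.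
\<close>

definition cosemisimple ::
    "'u itself \<Rightarrow> ('a, 'p) ring_scheme \<Rightarrow> ('a, 'c, 'q) coring_scheme \<Rightarrow> bool" where
  "cosemisimple u A C \<longleftrightarrow>
    coring A C \<and> semisimple_comodule A C (regular_comod C) \<and> left_flat u A C"

text \<open>The coaction of a comodule pushed forward along a coring homomorphism \<open>h\<close> into \<open>C\<close>.\<close>

definition corestrict ::
    "('a, 'p) ring_scheme \<Rightarrow> ('a, 'd, 'q) coring_scheme \<Rightarrow> ('c \<Rightarrow> 'd) \<Rightarrow> ('a, 'c, 'm) comod
      \<Rightarrow> ('a, 'd, 'm) comod" where
  "corestrict A C h M =
    \<lparr>carrier = carrier M, mult = undefined, one = undefined,
     zero = \<zero>\<^bsub>M\<^esub>, add = (\<oplus>\<^bsub>M\<^esub>), ract = ract M,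
     coact = (\<lambda>x. tensor_map A M C id h (coact M x))\<rparr>"

definition set_of_representatives ::
    "'s itself \<Rightarrow> ('a, 'p) ring_scheme \<Rightarrow> ('a, 'c, 'q) coring_scheme \<Rightarrow> 'i set
      \<Rightarrow> ('i \<Rightarrow> ('a, 'c, 'm) comod) \<Rightarrow> bool" where
  "set_of_representatives _ A C I \<Sigma> \<longleftrightarrow>
    (\<forall>i\<in>I. simple_comodule A C (\<Sigma> i)) \<and>
    (\<forall>X :: ('a, 'c, 's) comod. simple_comodule A C X \<longrightarrow>
      (\<exists>!i. i \<in> I \<and> comod_iso A C X (\<Sigma> i) \<noteq> {}))"


section \<open>Direct sums of corings\<close>

definition dsum_incl :: "'i set \<Rightarrow> ('i \<Rightarrow> ('c, 'q) ring_scheme) \<Rightarrow> 'i \<Rightarrow> 'c \<Rightarrow> 'i \<Rightarrow> 'c" where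
  "dsum_incl I C i x = (\<lambda>j\<in>I. if j = i then x else \<zero>\<^bsub>C j\<^esub>)"

definition dsum_bimod ::
    "'i set \<Rightarrow> ('i \<Rightarrow> ('b, 'a, 'c, 'q) bimod_scheme) \<Rightarrow> ('b, 'a, 'i \<Rightarrow> 'c) bimod" where
  "dsum_bimod I C =
    (let G = sum_group I (\<lambda>i. add_monoid (C i)) in
      \<lparr>carrier = carrier G, mult = undefined, one = undefined,
       zero = \<one>\<^bsub>G\<^esub>, add = (\<otimes>\<^bsub>G\<^esub>),
       ract = (\<lambda>f a. \<lambda>i\<in>I. f i \<triangleleft>\<^bsub>C i\<^esub> a),
       lact = (\<lambda>b f. \<lambda>i\<in>I. b \<triangleright>\<^bsub>C i\<^esub> f i)\<rparr>)"

definition dsum_coring ::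
    "('a, 'p) ring_scheme \<Rightarrow> 'i set \<Rightarrow> ('i \<Rightarrow> ('a, 'c, 'q) coring_scheme)
      \<Rightarrow> ('a, 'i \<Rightarrow> 'c) coring" where
  "dsum_coring A I C =
    (let S = dsum_bimod I C in
      \<lparr>carrier = carrier S, mult = undefined, one = undefined,
       zero = \<zero>\<^bsub>S\<^esub>, add = (\<oplus>\<^bsub>S\<^esub>),
       ract = ract S, lact = lact S,
       comult = (\<lambda>f. \<Oplus>\<^bsub>tensor_group A S S\<^esub> i\<in>{i\<in>I. f i \<noteq> \<zero>\<^bsub>C i\<^esub>}.
         tensor_map A S S (dsum_incl I C i) (dsum_incl I C i) (comult (C i) (f i))),
       counit = (\<lambda>f. \<Oplus>\<^bsub>A\<^esub> i\<in>{i\<in>I. f i \<noteq> \<zero>\<^bsub>C i\<^esub>}. counit (C i) (f i))\<rparr>)"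


section \<open>Comatrix corings\<close>

text \<open>
  Endomorphisms and linear forms are made extensional, so that equality of functions is
  equality of maps on the carrier.
\<close>

definition End_ring ::
    "('a, 'p) ring_scheme \<Rightarrow> ('a, 'm, 'q) rmod_scheme \<Rightarrow> ('m \<Rightarrow> 'm) ring" where
  "End_ring A M =
    \<lparr>carrier = rmod_hom A M M \<inter> extensional (carrier M),
     mult = (\<lambda>f g. compose (carrier M) f g),
     one = (\<lambda>x\<in>carrier M. x),
     zero = (\<lambda>x\<in>carrier M. \<zero>\<^bsub>M\<^esub>),
     add = (\<lambda>f g. \<lambda>x\<in>carrier M. f x \<oplus>\<^bsub>M\<^esub> g x)\<rparr>"

text \<open>
  Rings being \<open>K\<close>-algebras, a subring of \<open>End(M\<^sub>A)\<close> contains the image of \<open>K\<close>; over the integers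
  this is no condition.
\<close>

definition division_subring ::
    "('k, 'r) ring_scheme \<Rightarrow> ('k \<Rightarrow> 'a) \<Rightarrow> ('a, 'p) ring_scheme \<Rightarrow> ('a, 'm, 'q) rmod_scheme
      \<Rightarrow> ('m \<Rightarrow> 'm) set \<Rightarrow> bool" where
  "division_subring K \<eta> A M D \<longleftrightarrow>
    subring D (End_ring A M) \<and>
    Units (End_ring A M\<lparr>carrier := D\<rparr>) = D - {\<zero>\<^bsub>End_ring A M\<^esub>} \<and>
    (\<forall>k\<in>carrier K. (\<lambda>x\<in>carrier M. x \<triangleleft>\<^bsub>M\<^esub> \<eta> k) \<in> D)"

definition eval_bimod :: "('a, 'm, 'q) rmod_scheme \<Rightarrow> ('m \<Rightarrow> 'm, 'a, 'm) bimod" where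
  "eval_bimod M =
    \<lparr>carrier = carrier M, mult = undefined, one = undefined,
     zero = \<zero>\<^bsub>M\<^esub>, add = (\<oplus>\<^bsub>M\<^esub>), ract = ract M,
     lact = (\<lambda>d x. d x)\<rparr>"

definition dual_bimod ::
    "('a, 'p) ring_scheme \<Rightarrow> ('a, 'm, 'q) rmod_scheme \<Rightarrow> ('a, 'm \<Rightarrow> 'm, 'm \<Rightarrow> 'a) bimod" where
  "dual_bimod A M =
    \<lparr>carrier = rmod_hom A M (regular_rmod A) \<inter> extensional (carrier M),
     mult = undefined, one = undefined,
     zero = (\<lambda>x\<in>carrier M. \<zero>\<^bsub>A\<^esub>),
     add = (\<lambda>\<phi> \<psi>. \<lambda>x\<in>carrier M. \<phi> x \<oplus>\<^bsub>A\<^esub> \<psi> x),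
     ract = (\<lambda>\<phi> d. \<lambda>x\<in>carrier M. \<phi> (d x)),
     lact = (\<lambda>a \<phi>. \<lambda>x\<in>carrier M. a \<otimes>\<^bsub>A\<^esub> \<phi> x)\<rparr>"

definition dual_basis ::
    "('a, 'p) ring_scheme \<Rightarrow> ('a, 'm, 'q) rmod_scheme
      \<Rightarrow> nat \<times> (nat \<Rightarrow> 'm \<Rightarrow> 'a) \<times> (nat \<Rightarrow> 'm) \<Rightarrow> bool" where
  "dual_basis A M = (\<lambda>(n, es, e).
    es \<in> {..<n} \<rightarrow> carrier (dual_bimod A M) \<and> e \<in> {..<n} \<rightarrow> carrier M \<and>
    (\<forall>x\<in>carrier M. x = (\<Oplus>\<^bsub>M\<^esub> i\<in>{..<n}. e i \<triangleleft>\<^bsub>M\<^esub> es i x)))"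

definition comatrix_bimod ::
    "('a, 'p) ring_scheme \<Rightarrow> ('a, 'm, 'q) rmod_scheme \<Rightarrow> ('m \<Rightarrow> 'm) set
      \<Rightarrow> ('a, 'a, (('m \<Rightarrow> 'a) \<times> 'm \<Rightarrow>\<^sub>0 int) set) bimod" where
  "comatrix_bimod A M D =
    tensor_bimod (End_ring A M\<lparr>carrier := D\<rparr>) (dual_bimod A M) (eval_bimod M)"

definition comatrix_tensor ::
    "('a, 'p) ring_scheme \<Rightarrow> ('a, 'm, 'q) rmod_scheme \<Rightarrow> ('m \<Rightarrow> 'm) set
      \<Rightarrow> ('m \<Rightarrow> 'a) \<Rightarrow> 'm \<Rightarrow> (('m \<Rightarrow> 'a) \<times> 'm \<Rightarrow>\<^sub>0 int) set" where
  "comatrix_tensor A M D =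
    tensor (End_ring A M\<lparr>carrier := D\<rparr>) (dual_bimod A M) (eval_bimod M)"

text \<open>
  The comultiplication and the coaction below do not depend on the dual basis that is used.
\<close>

definition comatrix_coring ::
    "('a, 'p) ring_scheme \<Rightarrow> ('a, 'm, 'q) rmod_scheme \<Rightarrow> ('m \<Rightarrow> 'm) set
      \<Rightarrow> ('a, (('m \<Rightarrow> 'a) \<times> 'm \<Rightarrow>\<^sub>0 int) set) coring" where
  "comatrix_coring A M D =
    (let T = comatrix_bimod A M D; (n, es, e) = (SOME b. dual_basis A M b) in
      \<lparr>carrier = carrier T, mult = undefined, one = undefined,
       zero = \<zero>\<^bsub>T\<^esub>, add = (\<oplus>\<^bsub>T\<^esub>),
       ract = ract T, lact = lact T,
       comult = tensor_lift (tensor_group A T T) (\<lambda>(\<phi>, x).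
         \<Oplus>\<^bsub>tensor_group A T T\<^esub> i\<in>{..<n}.
           tensor A T T (comatrix_tensor A M D \<phi> (e i)) (comatrix_tensor A M D (es i) x)),
       counit = tensor_lift A (\<lambda>(\<phi>, x). \<phi> x)\<rparr>)"

definition comatrix_comod ::
    "('a, 'p) ring_scheme \<Rightarrow> ('a, 'm, 'q) rmod_scheme \<Rightarrow> ('m \<Rightarrow> 'm) set
      \<Rightarrow> ('a, (('m \<Rightarrow> 'a) \<times> 'm \<Rightarrow>\<^sub>0 int) set, 'm) comod" where
  "comatrix_comod A M D =
    (let T = comatrix_bimod A M D; (n, es, e) = (SOME b. dual_basis A M b) in
      \<lparr>carrier = carrier M, mult = undefined, one = undefined,
       zero = \<zero>\<^bsub>M\<^esub>, add = (\<oplus>\<^bsub>M\<^esub>), ract = ract M,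
       coact = (\<lambda>x. \<Oplus>\<^bsub>tensor_group A M T\<^esub> i\<in>{..<n}.
         tensor A M T (e i) (comatrix_tensor A M D (es i) x))\<rparr>)"

text \<open>
  A family \<open>S\<close> of finitely generated projective modules, indexed by \<open>I\<close>, with division
  subrings \<open>D\<close> and an isomorphism \<open>\<theta>\<close> from the direct sum of the comatrix corings to \<open>C\<close>.
\<close>

definition comatrix_decomposition ::
    "('k, 'r) ring_scheme \<Rightarrow> ('k \<Rightarrow> 'a) \<Rightarrow> ('a, 'p) ring_scheme \<Rightarrow> ('a, 'c, 'q) coring_scheme
      \<Rightarrow> 'i set \<Rightarrow> ('i \<Rightarrow> ('a, 'm) rmod) \<Rightarrow> ('i \<Rightarrow> ('m \<Rightarrow> 'm) set)
      \<Rightarrow> (('i \<Rightarrow> (('m \<Rightarrow> 'a) \<times> 'm \<Rightarrow>\<^sub>0 int) set) \<Rightarrow> 'c) \<Rightarrow> bool" where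
  "comatrix_decomposition K \<eta> A C I S D \<theta> \<longleftrightarrow>
    (\<forall>i\<in>I. right_module A (S i) \<and> finitely_generated A (S i) \<and> projective A (S i) \<and>
      division_subring K \<eta> A (S i) (D i)) \<and>
    \<theta> \<in> coring_iso A (dsum_coring A I (\<lambda>i. comatrix_coring A (S i) (D i))) C"

definition summand_comod ::
    "('a, 'p) ring_scheme \<Rightarrow> ('a, 'c, 'q) coring_scheme
      \<Rightarrow> 'i set \<Rightarrow> ('i \<Rightarrow> ('a, 'm) rmod) \<Rightarrow> ('i \<Rightarrow> ('m \<Rightarrow> 'm) set)
      \<Rightarrow> (('i \<Rightarrow> (('m \<Rightarrow> 'a) \<times> 'm \<Rightarrow>\<^sub>0 int) set) \<Rightarrow> 'c) \<Rightarrow> 'i \<Rightarrow> ('a, 'c, 'm) comod" where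
  "summand_comod A C I S D \<theta> i =
    corestrict A C (\<lambda>x. \<theta> (dsum_incl I (\<lambda>j. comatrix_coring A (S j) (D j)) i x))
      (comatrix_comod A (S i) (D i))"

text \<open>The conjugate \<open>g D g\<^sup>-\<^sup>1\<close> of a set \<open>D\<close> of endomorphisms of \<open>M\<close> under a bijection \<open>g\<close> to \<open>N\<close>.\<close>

definition conjugate ::
    "('a, 'm, 'q) rmod_scheme \<Rightarrow> ('a, 'n, 's) rmod_scheme \<Rightarrow> ('m \<Rightarrow> 'n) \<Rightarrow> ('m \<Rightarrow> 'm) set
      \<Rightarrow> ('n \<Rightarrow> 'n) set" where
  "conjugate M N g D = (\<lambda>d. \<lambda>y\<in>carrier N. g (d (inv_into (carrier M) g y))) ` D"

end

theory Submission
  imports Defs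
begin

text \<open>
  If the coring is flat on the left, stable subsets of a comodule are subcomodules and Schur's lemma
  holds, and a homomorphism into a finite sum of images of simple comodules lifts to the summands.
  Lifting the coaction of a simple comodule to a semisimple coring exhibits a finite dual basis, and
  lifting the matrix coefficient maps shows that the sum of the comatrix corings of the simple
  comodules, over their endomorphism division rings, maps injectively to the coring.

  Conversely, coordinates with respect to a basis of each summand over its division ring yield
  left linear functionals on a sum of comatrix corings. They form an infinite dual basis, which gives
  flatness, and slicing coactions with them computes all subcomodules and homomorphisms. So the
  summands are simple and pairwise non-isomorphic with the given endomorphism rings, and these data
  are determined by the coring.
\<close>

\<comment> \<open>A tensor product is a quotient of a free abelian group on pairs, so W (x) C for W
  inside M is not a subset of M (x) C. Stability of W is therefore expressed by
  \<open>tspan\<close>, the image of W (x) C in M (x) C; flatness turns this back into a coaction on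
  W. Flatness itself is given only for test modules of one type. The criterion by right ideals,
  \<open>ideal_flat\<close>, is extracted from it and carries it to modules of every type, in
  particular to tensor products. Lifting works without projectivity of the simple comodules: when a
  simple image meets the sum of the remaining ones trivially, the projection to it is well defined,
  and exactness forces its defect of colinearity to vanish. Injectivity of the map from the comatrix
  corings is an argument by shortest relation: a pure tensor whose image depends on the others can
  be moved into them. The functionals of the converse exist because a coordinate over a division
  ring is linear over that ring; evaluating the coordinate at an arbitrary vector, and not only at a
  basis vector, gives enough of them to reach every vector of a summand.\<close>
syntax "_index" :: "logic \<Rightarrow> index"  (\<open>{|_|}\<close>)
notation ract (infixl \<open><|\<index>\<close> 75) and lact (infixr \<open>|>\<index>\<close> 75)
abbreviation elem :: "'m \<Rightarrow> ('m, 'q) partial_object_scheme \<Rightarrow> bool" (infix \<open>.:\<close> 50)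
  where "x .: M \<equiv> x \<in> carrier M"
abbreviation "TG \<equiv> tensor_group"
abbreviation "tmap \<equiv> tensor_map"
abbreviation "TR \<equiv> tensor_rmod"
abbreviation "TB \<equiv> tensor_bimod"
abbreviation "regc \<equiv> regular_comod"
lemmas (in right_module) is_rmod = right_module_axioms

section \<open>Additive maps and tensor products\<close>

definition add_maps :: "('m, 'q) ring_scheme => ('n, 's) ring_scheme => ('m => 'n) set" where
 "add_maps M N = {f : carrier M \<rightarrow> carrier N.
   ALL x:carrier M. ALL y:carrier M. f (x \<oplus>{|M|} y) = f x \<oplus>{|N|} f y}"

lemma add_mapsI:
 assumes "!!x. x .: M ==> f x .: N"
  and "!!x y. [|x .: M; y .: M|] ==> f (x \<oplus>{|M|} y) = f x \<oplus>{|N|} f y"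
 shows "f : add_maps M N"
 using assms by (auto simp: add_maps_def)

lemma add_maps_closed: "[|f : add_maps M N; x .: M|] ==> f x .: N"
 by (auto simp: add_maps_def)

lemma add_maps_add:
 "[|f : add_maps M N; x .: M; y .: M|] ==> f (x \<oplus>{|M|} y) = f x \<oplus>{|N|} f y"
 by (auto simp: add_maps_def)

lemma add_maps_comp: "[|f : add_maps M N; g : add_maps N P|] ==> (%x. g (f x)) : add_maps M P"
 by (auto simp: add_maps_def Pi_iff)

lemma add_maps_cong:
 assumes "abelian_group M" "!!x. x .: M ==> f x = g x"
 shows "f : add_maps M N \<longleftrightarrow> g : add_maps M N"
proof -
 interpret abelian_group M by fact
 show ?thesis using assms(2) by (simp add: add_maps_def Pi_def)
qed

context
 fixes M :: "('m, 'q) ring_scheme" and N :: "('n, 's) ring_scheme" and f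
 assumes ab: "abelian_group M" "abelian_group N" and f: "f : add_maps M N"
begin

interpretation M: abelian_group M by (rule ab)
interpretation N: abelian_group N by (rule ab)

lemma add_maps_zero: "f \<zero>{|M|} = \<zero>{|N|}"
proof -
 have "f \<zero>{|M|} \<oplus>{|N|} f \<zero>{|M|} = f \<zero>{|M|}"
  using add_maps_add[OF f, of "\<zero>{|M|}" "\<zero>{|M|}"] by simp
 then show ?thesis using add_maps_closed[OF f, of "\<zero>{|M|}"] N.add.l_cancel_one by simp
qed

lemma add_maps_uminus: "x .: M ==> f (\<ominus>{|M|} x) = \<ominus>{|N|} f x"
 using add_maps_add[OF f, of x "\<ominus>{|M|} x"] add_maps_zero add_maps_closed[OF f]
 by (metis M.a_inv_closed M.r_neg N.add.inv_equality N.a_comm)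

lemma add_maps_minus:
 "[|x .: M; y .: M|] ==> f (x \<ominus>{|M|} y) = f x \<ominus>{|N|} f y"
 by (simp add: M.minus_eq N.minus_eq add_maps_add[OF f] add_maps_uminus)

lemma add_maps_finsum:
 assumes "finite J" "g : J \<rightarrow> carrier M"
 shows "f (finsum M g J) = (\<Oplus>{|N|} j\<in>J. f (g j))"
 using assms
proof (induction J rule: finite_induct)
 case (insert a J)
 then have "finsum M g J .: M" by auto
 with insert show ?case
  using add_maps_closed[OF f] add_maps_add[OF f]
  by (simp add: Pi_def)
qed (simp add: add_maps_zero)

end

text \<open>Factor groups and direct sums are written multiplicatively in the library; this turns
  them into additive parts of ring records, the form that modules have here.\<close>

definition add_ring :: "('g, 'q) monoid_scheme => 'g ring" where
 "add_ring Q = (|carrier = carrier Q, mult = undefined, one = undefined, zero = \<one>{|Q|}, add = (\<otimes>{|Q|})|)"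

lemma add_ring_simps [simp]:
 "carrier (add_ring Q) = carrier Q" "\<zero>{|add_ring Q|} = \<one>{|Q|}" "(\<oplus>{|add_ring Q|}) = (\<otimes>{|Q|})"
 by (simp_all add: add_ring_def)

lemma abelian_group_add_ring:
 assumes "comm_group Q" shows "abelian_group (add_ring Q)"
proof -
 interpret comm_group Q by fact
 show ?thesis
  by (rule abelian_groupI) (auto simp: m_ac intro!: bexI[of _ "inv{|Q|} _"])
qed

lemma abelian_group_transfer:
 assumes "abelian_group M" "carrier N = carrier M" "\<zero>{|N|} = \<zero>{|M|}"
  and "!!x y. x .: M ==> y .: M ==> x \<oplus>{|N|} y = x \<oplus>{|M|} y"
 shows "abelian_group N"
proof -
 interpret abelian_group M by fact
 show ?thesis
  by (rule abelian_groupI) (use assms(2-) in \<open>auto simp: a_ac intro!: bexI[of _ "\<ominus>{|M|} _"] l_neg r_neg\<close>)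
qed

lemma add_maps_sum:
 assumes M: "abelian_group M" and N: "abelian_group N" and f: "!!k. k : J ==> f k : add_maps M N"
 shows "(%x. \<Oplus>{|N|} k\<in>J. f k x) : add_maps M N"
proof (rule add_mapsI)
 interpret N: abelian_group N by fact
 fix x assume x: "x .: M"
 show "(\<Oplus>{|N|} k\<in>J. f k x) .: N" using add_maps_closed[OF f x] by (intro N.finsum_closed) auto
 fix y assume y: "y .: M"
 have "(\<Oplus>{|N|} k\<in>J. f k (x \<oplus>{|M|} y)) = (\<Oplus>{|N|} k\<in>J. f k x \<oplus>{|N|} f k y)"
  by (rule N.finsum_cong') (use add_maps_closed[OF f] add_maps_add[OF f] x y in auto)
 also have "... = (\<Oplus>{|N|} k\<in>J. f k x) \<oplus>{|N|} (\<Oplus>{|N|} k\<in>J. f k y)"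
  by (rule N.finsum_addf) (use add_maps_closed[OF f] x y in auto)
 finally show "(\<Oplus>{|N|} k\<in>J. f k (x \<oplus>{|M|} y)) = (\<Oplus>{|N|} k\<in>J. f k x) \<oplus>{|N|} (\<Oplus>{|N|} k\<in>J. f k y)" .
qed

text \<open>A membership x : W is proved later by sending x to zero in this quotient, which can
  serve as the target of a map built by \<open>tensor_lift\<close>.\<close>

definition quot_group :: "('m, 'q) ring_scheme => 'm set => 'm set ring" where
 "quot_group M W = add_ring (add_monoid M Mod W)"

definition quot_proj :: "('m, 'q) ring_scheme => 'm set => 'm => 'm set" where
 "quot_proj M W x = W #>{|add_monoid M|} x"

context
 fixes M :: "('m, 'q) ring_scheme" and W
 assumes ab: "abelian_group M" and W: "additive_subgroup W M"
begin

interpretation M: abelian_group M by (rule ab)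
interpretation W: additive_subgroup W M by (rule W)
interpretation WN: normal W "add_monoid M"
 by (rule M.add.subgroup_imp_normal[OF W.a_subgroup])

lemma abelian_quot_group: "abelian_group (quot_group M W)"
 unfolding quot_group_def
 by (rule abelian_group_add_ring, rule M.add.abelian_FactGroup[OF W.a_subgroup])

lemma quot_proj_add_maps: "quot_proj M W : add_maps M (quot_group M W)"
 by (rule add_mapsI)
  (use WN.rcos_sum in "auto simp: quot_group_def quot_proj_def carrier_FactGroup")

lemma quot_proj_zero_iff:
 "x .: M ==> quot_proj M W x = \<zero>{|quot_group M W|} \<longleftrightarrow> x : W"
 unfolding quot_group_def quot_proj_def
 using M.add.coset_join1[of W x] M.add.coset_join2[of x W] W.a_subgroup W.a_subset
  M.add.subgroup_self by auto

end

lemma (in abelian_group) a_inv_zero: "\<ominus> \<zero> = \<zero>"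
 by (metis a_inv_closed l_zero r_neg zero_closed)

lemma (in abelian_group) add_minus_minus:
 assumes "x .: G" "y .: G" shows "x \<oplus> y \<ominus> x \<ominus> y = \<zero>"
 using assms r_neg[of "x \<oplus> y"] by (simp add: minus_eq a_assoc minus_add)

lemma (in abelian_group) additive_subgroupI:
 assumes "W <= carrier G" "\<zero> : W" "!!x y. x : W ==> y : W ==> x \<oplus> y : W"
  "!!x. x : W ==> \<ominus> x : W"
 shows "additive_subgroup W G"
 using assms by (auto intro!: additive_subgroup.intro subgroup.intro simp: a_inv_def)

lemma additive_subgroup_uminus:
 assumes "abelian_group M" "additive_subgroup W M" "x : W" shows "\<ominus>{|M|} x : W"
 using assms additive_subgroup.a_subgroup subgroup.m_inv_closed unfolding a_inv_def by fastforce

lemma additive_subgroup_minus: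
 assumes "abelian_group M" "additive_subgroup W M" "x : W" "y : W" shows "x \<ominus>{|M|} y : W"
 using assms additive_subgroup_uminus additive_subgroup.a_closed unfolding a_minus_def by metis

lemma additive_subgroup_finsum:
 assumes "abelian_group M" "additive_subgroup W M" "g : J \<rightarrow> W"
 shows "finsum M g J : W"
proof -
 interpret M: abelian_group M by fact
 interpret W: additive_subgroup W M by fact
 show ?thesis using assms(3)
 proof (induction J rule: infinite_finite_induct)
  case (insert x F)
  then have "g : F \<rightarrow> carrier M" "g x .: M" using W.a_subset by auto
  with insert show ?case by (simp add: M.finsum_insert)
 qed auto
qed

definition balanced ::
  "('r, 'p) ring_scheme => ('r, 'm, 'q) rmod_scheme => ('r, 'a, 'n, 's) bimod_scheme
   => ('g, 't) ring_scheme => ('m => 'n => 'g) => bool" where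
 "balanced R M N G b \<longleftrightarrow>
  (ALL x:carrier M. ALL y:carrier N. b x y .: G) \<and>
  (ALL x:carrier M. ALL x':carrier M. ALL y:carrier N. b (x \<oplus>{|M|} x') y = b x y \<oplus>{|G|} b x' y) \<and>
  (ALL x:carrier M. ALL y:carrier N. ALL y':carrier N. b x (y \<oplus>{|N|} y') = b x y \<oplus>{|G|} b x y') \<and>
  (ALL x:carrier M. ALL r:carrier R. ALL y:carrier N. b (x <|{|M|} r) y = b x (r |>{|N|} y))"

lemma balancedI:
 assumes "!!x y. [|x .: M; y .: N|] ==> b x y .: G"
  and "!!x x' y. [|x .: M; x' .: M; y .: N|]
   ==> b (x \<oplus>{|M|} x') y = b x y \<oplus>{|G|} b x' y"
  and "!!x y y'. [|x .: M; y .: N; y' .: N|]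
   ==> b x (y \<oplus>{|N|} y') = b x y \<oplus>{|G|} b x y'"
  and "!!x r y. [|x .: M; r .: R; y .: N|]
   ==> b (x <|{|M|} r) y = b x (r |>{|N|} y)"
 shows "balanced R M N G b"
 using assms by (auto simp: balanced_def)

text \<open>These conditions place the relations of the tensor product in the free group on pairs of
  carrier elements, so that \<open>tensor_group\<close> is an abelian group with the universal
  property. One locale serves for tensor products over A and over the division subrings.\<close>

locale tensor_pair =
 fixes R :: "('r, 'p) ring_scheme" and M :: "('r, 'm, 'q) rmod_scheme"
  and N :: "('r, 'a, 'n, 's) bimod_scheme"
 assumes tp_left: "abelian_group M" and tp_right: "abelian_group N"
  and tp_ract: "[|x .: M; r .: R|] ==> x <|{|M|} r .: M"
  and tp_lact: "[|y .: N; r .: R|] ==> r |>{|N|} y .: N"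
begin

lemmas is_pair = tensor_pair_axioms

interpretation M: abelian_group M by (rule tp_left)
interpretation N: abelian_group N by (rule tp_right)

abbreviation "FG \<equiv> free_Abelian_group (carrier M \<times> carrier N)"
abbreviation "KK \<equiv> tensor_kernel R M N"

interpretation F: comm_group FG by (rule abelian_free_Abelian_group)

lemma relations_keys:
 assumes "t : tensor_relations R M N" shows "Poly_Mapping.keys t <= carrier M \<times> carrier N"
proof -
 have k: "Poly_Mapping.keys (a - b) <= U" if "Poly_Mapping.keys a <= U" "Poly_Mapping.keys b <= U"
  for a b :: "'m \<times> 'n \<Rightarrow>\<^sub>0 int" and U
  using keys_diff[of a b] that by blast
 show ?thesis
  using assms unfolding tensor_relations_def
  by (elim UnE CollectE exE conjE; hypsubst; intro k) (simp_all add: tp_ract tp_lact)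
qed

lemma kernel_subgroup: "subgroup KK FG"
 unfolding tensor_kernel_def
 by (rule F.generate_is_subgroup, rule subsetI) (simp add: relations_keys)

interpretation K: normal KK FG
 by (rule F.subgroup_imp_normal[OF kernel_subgroup])

lemma kernel_keys: "t : KK ==> Poly_Mapping.keys t <= carrier M \<times> carrier N"
 using subsetD[OF K.subset, of t] by simp

lemma tensor_group_eq: "TG R M N = add_ring (FG Mod KK)"
 by (simp add: tensor_group_def add_ring_def)

lemma ab_tensor: "abelian_group (TG R M N)"
 unfolding tensor_group_eq
 by (rule abelian_group_add_ring, rule F.abelian_FactGroup[OF kernel_subgroup])

lemma carrier_tensor_group: "carrier (TG R M N) = (%t. KK #>{|FG|} t) ` carrier FG"
 by (simp add: tensor_group_eq carrier_FactGroup)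

lemma tensor_group_coset_add:
 "[|s .: FG; t .: FG|] ==>
  (KK #>{|FG|} s) \<oplus>{|TG R M N|} (KK #>{|FG|} t) = KK #>{|FG|} (s + t)"
 using K.rcos_sum[of s t] by (simp add: tensor_group_eq)

lemma coset_eq_iff:
 assumes "s .: FG" "t .: FG"
 shows "KK #>{|FG|} s = KK #>{|FG|} t \<longleftrightarrow> s - t : KK"
proof -
 have "s : KK #>{|FG|} t \<longleftrightarrow> s - t : KK"
  using K.rcos_module[OF F.is_group, of t s] assms by simp
 then show ?thesis
  using F.repr_independence[OF _ _ kernel_subgroup] F.rcos_self[OF _ kernel_subgroup] assms
  by metis
qed

lemma tensor_closed:
 "[|x .: M; y .: N|] ==> tensor R M N x y .: (TG R M N)"
 unfolding carrier_tensor_group tensor_def by auto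

lemma rel_in_kernel: "t : tensor_relations R M N ==> t : KK"
 unfolding tensor_kernel_def by (rule generate.incl)

lemma tensor_add_left:
 assumes "x .: M" "x' .: M" "y .: N"
 shows "tensor R M N (x \<oplus>{|M|} x') y = tensor R M N x y \<oplus>{|TG R M N|} tensor R M N x' y"
proof -
 have "frag_of (x \<oplus>{|M|} x', y) - frag_of (x, y) - frag_of (x', y) : KK"
  by (rule rel_in_kernel) (use assms in "unfold tensor_relations_def, blast")
 moreover have "Poly_Mapping.keys (frag_of (x, y) + frag_of (x', y)) <= carrier M \<times> carrier N"
  using keys_add[of "frag_of (x, y)" "frag_of (x', y)"] assms by fastforce
 ultimately show ?thesis
  unfolding tensor_def using assms
  by (subst tensor_group_coset_add) (auto simp: coset_eq_iff diff_diff_eq)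
qed

lemma tensor_add_right:
 assumes "x .: M" "y .: N" "y' .: N"
 shows "tensor R M N x (y \<oplus>{|N|} y') = tensor R M N x y \<oplus>{|TG R M N|} tensor R M N x y'"
proof -
 have "frag_of (x, y \<oplus>{|N|} y') - frag_of (x, y) - frag_of (x, y') : KK"
  by (rule rel_in_kernel) (use assms in "unfold tensor_relations_def, blast")
 moreover have "Poly_Mapping.keys (frag_of (x, y) + frag_of (x, y')) <= carrier M \<times> carrier N"
  using keys_add[of "frag_of (x, y)" "frag_of (x, y')"] assms by fastforce
 ultimately show ?thesis
  unfolding tensor_def using assms
  by (subst tensor_group_coset_add) (auto simp: coset_eq_iff diff_diff_eq)
qed

lemma tensor_balanced:
 assumes "x .: M" "r .: R" "y .: N"
 shows "tensor R M N (x <|{|M|} r) y = tensor R M N x (r |>{|N|} y)"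
proof -
 have "frag_of (x <|{|M|} r, y) - frag_of (x, r |>{|N|} y) : KK"
  by (rule rel_in_kernel) (use assms in "unfold tensor_relations_def, blast")
 then show ?thesis
  unfolding tensor_def using assms by (auto simp: coset_eq_iff tp_ract tp_lact)
qed

lemma tensor_left_add_maps:
 "y .: N ==> (%x. tensor R M N x y) : add_maps M (TG R M N)"
 by (rule add_mapsI) (auto simp: tensor_closed tensor_add_left)

lemma tensor_right_add_maps:
 "x .: M ==> (%y. tensor R M N x y) : add_maps N (TG R M N)"
 by (rule add_mapsI) (auto simp: tensor_closed tensor_add_right)

lemma tensor_induct [consumes 1, case_names zero tensor add]:
 assumes t: "t .: (TG R M N)"
  and zero: "P \<zero>{|TG R M N|}"
  and pure: "!!x y. [|x .: M; y .: N|] ==> P (tensor R M N x y)"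
  and add: "!!s t. [|s .: (TG R M N); t .: (TG R M N); P s; P t|]
   ==> P (s \<oplus>{|TG R M N|} t)"
 shows "P t"
proof -
 let ?T = "TG R M N"
 interpret T: abelian_group ?T by (rule ab_tensor)
 have pm: "P (\<ominus>{|?T|} tensor R M N x y)" if "x .: M" "y .: N" for x y
  using add_maps_uminus[OF tp_left ab_tensor tensor_left_add_maps, of y x]
   pure[of "\<ominus>{|M|} x" y] that by simp
 \<comment> \<open>Induction on the free group proceeds by differences, so the claim carries the
   negative along; the negative of a pure tensor is again pure, which is \<open>pm\<close>.\<close>
 have "P (KK #>{|FG|} s) & P (\<ominus>{|?T|} (KK #>{|FG|} s))"
  if "Poly_Mapping.keys s <= carrier M \<times> carrier N" for s
  using that
 proof (induction s rule: free_Abelian_group_induct[consumes 1, case_names 1 2 3])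
  case 1
  have "KK #>{|FG|} 0 = \<zero>{|?T|}" using F.coset_mult_one[OF K.subset] by (simp add: tensor_group_eq)
  then show ?case using zero by (simp only: T.a_inv_zero simp_thms)
 next
  case (2 a b)
  have kb: "Poly_Mapping.keys (a - b) <= carrier M \<times> carrier N"
   using order_trans[OF keys_diff[of a b]] 2 by simp
  have ca: "KK #>{|FG|} a .: ?T" "KK #>{|FG|} b .: ?T"
   "KK #>{|FG|} (a - b) .: ?T"
   using 2 kb by (auto simp only: carrier_tensor_group carrier_free_Abelian_group_iff intro!: imageI)
  have "(KK #>{|FG|} (a - b)) \<oplus>{|?T|} (KK #>{|FG|} b) = KK #>{|FG|} a"
   using 2 kb by (simp add: tensor_group_coset_add)
  then have e: "KK #>{|FG|} (a - b) = (KK #>{|FG|} a) \<oplus>{|?T|} \<ominus>{|?T|} (KK #>{|FG|} b)"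
   using ca T.a_assoc[OF ca(3) ca(2), of "\<ominus>{|?T|} (KK #>{|FG|} b)"] by (simp add: T.r_neg)
  then show ?case using 2 ca by (simp add: add T.minus_add)
 next
  case (3 p)
  then show ?case using pm pure by (auto simp: tensor_def)
 qed
 then show ?thesis using t by (auto simp: carrier_tensor_group)
qed

text \<open>The uniqueness half of the universal property. Almost every identity in a tensor product
  below is obtained by writing both sides as additive maps of one element and comparing them on pure
  tensors.\<close>

lemma tensor_ext:
 assumes "f : add_maps (TG R M N) G" "g : add_maps (TG R M N) G"
  and "abelian_group G" "t .: (TG R M N)"
  and "!!x y. [|x .: M; y .: N|] ==> f (tensor R M N x y) = g (tensor R M N x y)"
 shows "f t = g t"
 using assms(4)
proof (induction rule: tensor_induct)
 case zero
 then show ?case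
  using add_maps_zero[OF ab_tensor assms(3,1)] add_maps_zero[OF ab_tensor assms(3,2)]
  by simp
next
 case (add s t)
 then show ?case by (simp add: add_maps_add[OF assms(1)] add_maps_add[OF assms(2)])
qed (use assms in auto)

context
 fixes G :: "('g, 'h) ring_scheme" and b
 assumes G: "abelian_group G" and b: "balanced R M N G b"
begin

interpretation G: abelian_group G by (rule G)

private definition "ev (t :: 'm \<times> 'n \<Rightarrow>\<^sub>0 int) = (\<Oplus>{|G|} p\<in>Poly_Mapping.keys t. [Poly_Mapping.lookup t p] \<cdot>{|G|} case_prod b p)"

private lemma b_closed: "p : carrier M \<times> carrier N ==> case_prod b p .: G"
 using b by (auto simp: balanced_def)

private lemma pow_closed:
 "p : carrier M \<times> carrier N ==> [(k::int)] \<cdot>{|G|} case_prod b p .: G"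
 using group.int_pow_closed[OF G.a_group, of "case_prod b p" k] b_closed[of p]
 by (simp add: add_pow_def)

private lemma pow_zero: "[(0::int)] \<cdot>{|G|} x = \<zero>{|G|}"
 by (simp add: add_pow_def)

text \<open>Additivity has to compare sums over the supports of s, t and s + t; a common finite
  superset makes the index sets equal.\<close>

private lemma ev_superset:
 assumes "finite B" "Poly_Mapping.keys t <= B" "B <= carrier M \<times> carrier N"
 shows "ev t = (\<Oplus>{|G|} p\<in>B. [Poly_Mapping.lookup t p] \<cdot>{|G|} case_prod b p)"
 unfolding ev_def
proof (rule G.add.finprod_mono_neutral_cong_left)
 show "[Poly_Mapping.lookup t p] \<cdot>{|G|} case_prod b p = \<zero>{|G|}" if "p : B - Poly_Mapping.keys t" for p
  using that pow_zero by (simp add: in_keys_iff)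
 show "(%p. [Poly_Mapping.lookup t p] \<cdot>{|G|} case_prod b p) : B \<rightarrow> carrier G"
  using pow_closed assms(3) by blast
qed (use assms in auto)

private lemma ev_hom: "ev : hom FG (add_monoid G)"
proof (rule homI)
 fix s t assume st: "s .: FG" "t .: FG"
 let ?B = "Poly_Mapping.keys s \<union> Poly_Mapping.keys t"
 have B: "finite ?B" "?B <= carrier M \<times> carrier N" "Poly_Mapping.keys (s + t) <= ?B"
  using st keys_add[of s t] by auto
 have c: "[k] \<cdot>{|G|} case_prod b p .: G" if "p : ?B" for p and k :: int
  using pow_closed B(2) that by blast
 have d: "[(k + l)] \<cdot>{|G|} case_prod b p = [k] \<cdot>{|G|} case_prod b p \<oplus>{|G|} [l] \<cdot>{|G|} case_prod b p"
  if "p : ?B" for p and k l :: int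
  using group.int_pow_mult[OF G.a_group, of "case_prod b p" k l] b_closed[of p] subsetD[OF B(2) that]
  by (simp add: add_pow_def)
 have "ev (s + t) = (\<Oplus>{|G|} p\<in>?B. [Poly_Mapping.lookup s p] \<cdot>{|G|} case_prod b p
   \<oplus>{|G|} [Poly_Mapping.lookup t p] \<cdot>{|G|} case_prod b p)"
  unfolding ev_superset[OF B(1,3,2)]
  by (rule G.finsum_cong') (use c d in "auto simp: lookup_add")
 also have "... = ev s \<oplus>{|G|} ev t"
  using B(1,2) c by (subst G.finsum_addf) (auto simp: ev_superset[of ?B])
 finally have "ev (s + t) = ev s \<oplus>{|G|} ev t" .
 then show "ev (s \<otimes>{|FG|} t) = ev s \<otimes>{|add_monoid G|} ev t" by simp
next
 fix s assume "s .: FG"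
 then show "ev s .: (add_monoid G)"
  unfolding ev_def using pow_closed by (auto intro!: G.finsum_closed simp del: split_paired_All)
qed

interpretation EV: group_hom FG "add_monoid G" ev
 by unfold_locales (rule ev_hom)

private lemma ev_frag: "p : carrier M \<times> carrier N ==> ev (frag_of p) = case_prod b p"
 using ev_superset[of "{p}" "frag_of p"] b_closed[of p] by simp

private lemma ev_diff: "[|s .: FG; t .: FG|] ==> ev (s - t) = ev s \<ominus>{|G|} ev t"
 using EV.hom_mult[of s "- t"] EV.hom_inv[of t] by (simp add: G.minus_eq a_inv_def)

private lemma ev_relation: "t : tensor_relations R M N ==> ev t = \<zero>{|G|}"
proof -
 have keys2: "Poly_Mapping.keys (frag_of p - frag_of q) <= carrier M \<times> carrier N"
  if "p : carrier M \<times> carrier N" "q : carrier M \<times> carrier N" for p q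
  using keys_diff[of "frag_of p" "frag_of q"] that by fastforce
 have ev2: "ev (frag_of p - frag_of q) = case_prod b p \<ominus>{|G|} case_prod b q"
  if "p : carrier M \<times> carrier N" "q : carrier M \<times> carrier N" for p q
  using that by (simp add: ev_diff ev_frag)
 have ev3: "ev (frag_of p - frag_of q - frag_of r) = \<zero>{|G|}"
  if "p : carrier M \<times> carrier N" "q : carrier M \<times> carrier N" "r : carrier M \<times> carrier N"
   "case_prod b p = case_prod b q \<oplus>{|G|} case_prod b r" for p q r
 proof -
  have c: "case_prod b q .: G" "case_prod b r .: G" using that b_closed by blast+
  have "ev (frag_of p - frag_of q - frag_of r)
    = case_prod b p \<ominus>{|G|} case_prod b q \<ominus>{|G|} case_prod b r"
   using that by (subst ev_diff) (simp_all add: keys2 ev2 ev_frag)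
  also have "... = \<zero>{|G|}"
   unfolding that(4) using c by (rule G.add_minus_minus)
  finally show ?thesis .
 qed
 have b': "!!x y. [|x .: M; y .: N|] ==> b x y .: G"
  "!!x x' y. [|x .: M; x' .: M; y .: N|] ==> b (x \<oplus>{|M|} x') y = b x y \<oplus>{|G|} b x' y"
  "!!x y y'. [|x .: M; y .: N; y' .: N|] ==> b x (y \<oplus>{|N|} y') = b x y \<oplus>{|G|} b x y'"
  "!!x y r. [|x .: M; y .: N; r .: R|] ==> b (x <|{|M|} r) y = b x (r |>{|N|} y)"
  using b by (auto simp: balanced_def)
 assume "t : tensor_relations R M N"
 then show ?thesis
  unfolding tensor_relations_def
 proof (elim UnE CollectE exE conjE, goal_cases)
  case (1 x x' y)
  show ?case unfolding 1(1) by (rule ev3) (use 1 b' in "simp_all")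
 next
  case (2 x y y')
  show ?case unfolding 2(1) by (rule ev3) (use 2 b' in "simp_all")
 next
  case (3 x r y)
  then show ?case using b' by (simp add: ev2 tp_ract tp_lact G.r_neg G.minus_eq)
 qed
qed

private lemma ev_kernel: "t : KK ==> ev t = \<zero>{|G|}"
 unfolding tensor_kernel_def
proof (induction rule: generate.induct)
 case (incl t)
 then show ?case by (rule ev_relation)
next
 case (inv t)
 have "t .: FG" using relations_keys[OF inv] by simp
 then show ?case using EV.hom_inv[of t] ev_relation[OF inv] by simp
next
 case (eng s t)
 then have "s : KK" "t : KK" unfolding tensor_kernel_def by simp_all
 then have "s .: FG" "t .: FG" using kernel_keys by auto
 then show ?case using EV.hom_mult[of s t] eng by simp
qed (use EV.hom_one in simp)

text \<open>\<open>tensor_lift\<close> takes \<open>the_elem\<close> of the values on all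
  representatives. Since \<open>ev\<close> vanishes on the kernel, these values form a singleton,
  and the lift is well defined on classes.\<close>

private lemma lift_coset:
 assumes "t .: FG" shows "tensor_lift G (case_prod b) (KK #>{|FG|} t) = ev t"
proof -
 have "ev s = ev t" if "s : KK #>{|FG|} t" for s
 proof -
  obtain k where k: "k : KK" "s = k + t" using \<open>s : KK #>{|FG|} t\<close>
   unfolding r_coset_def mult_free_Abelian_group by blast
  then have "k .: FG" using kernel_keys by auto
  then show ?thesis using k ev_kernel[OF k(1)] EV.hom_mult[of k t] EV.hom_closed[OF assms] assms by simp
 qed
 moreover have "t : KK #>{|FG|} t" by (rule F.rcos_self[OF assms kernel_subgroup])
 ultimately have "ev ` (KK #>{|FG|} t) = {ev t}" by blast
 then show ?thesis unfolding tensor_lift_def ev_def[abs_def] by simp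
qed

lemma tensor_lift_add_maps: "tensor_lift G (case_prod b) : add_maps (TG R M N) G"
proof (rule add_mapsI)
 fix x assume "x .: (TG R M N)"
 then show "tensor_lift G (case_prod b) x .: G"
  using lift_coset EV.hom_closed by (auto simp: carrier_tensor_group)
next
 fix x y assume "x .: (TG R M N)" "y .: (TG R M N)"
 then obtain s t where st: "s .: FG" "t .: FG" "x = KK #>{|FG|} s" "y = KK #>{|FG|} t"
  by (auto simp: carrier_tensor_group)
 moreover have "s + t .: FG" using F.m_closed[OF st(1,2)] by simp
 ultimately show "tensor_lift G (case_prod b) (x \<oplus>{|TG R M N|} y)
   = tensor_lift G (case_prod b) x \<oplus>{|G|} tensor_lift G (case_prod b) y"
  using EV.hom_mult[OF st(1,2)] by (simp add: tensor_group_coset_add lift_coset)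
qed

lemma tensor_lift_tensor:
 assumes "x .: M" "y .: N"
 shows "tensor_lift G (case_prod b) (tensor R M N x y) = b x y"
 unfolding tensor_def using assms by (subst lift_coset) (auto simp: ev_frag)

end

end

lemma add_maps_plus:
 assumes "abelian_group N" "f : add_maps M N" "g : add_maps M N"
 shows "(%x. f x \<oplus>{|N|} g x) : add_maps M N"
proof -
 interpret abelian_group N by fact
 show ?thesis
  by (rule add_mapsI) (simp_all add: add_maps_closed[OF assms(2)] add_maps_closed[OF assms(3)]
    add_maps_add[OF assms(2)] add_maps_add[OF assms(3)] a_ac)
qed

lemma add_maps_zero_map: "abelian_group N ==> (%x. \<zero>{|N|}) : add_maps M N"
 by (rule add_mapsI) (simp_all add: abelian_group_def abelian_monoid.l_zero abelian_monoid.zero_closed)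

lemma add_maps_uminus_map:
 assumes "abelian_group N" "f : add_maps M N"
 shows "(%x. \<ominus>{|N|} f x) : add_maps M N"
proof -
 interpret abelian_group N by fact
 show ?thesis
  by (rule add_mapsI) (simp_all add: add_maps_closed[OF assms(2)] add_maps_add[OF assms(2)] minus_add)
qed

lemma rmod_hom_iff:
 "f : rmod_hom A M N \<longleftrightarrow> f : add_maps M N \<and>
  (ALL x:carrier M. ALL a:carrier A. f (x <|{|M|} a) = f x <|{|N|} a)"
 by (auto simp: rmod_hom_def add_maps_def)

lemma rmod_hom_add_maps: "f : rmod_hom A M N ==> f : add_maps M N"
 by (simp add: rmod_hom_iff)

lemma rmod_hom_ract:
 "[|f : rmod_hom A M N; x .: M; a .: A|] ==> f (x <|{|M|} a) = f x <|{|N|} a"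
 by (simp add: rmod_hom_iff)

lemmas rmod_hom_closed = add_maps_closed[OF rmod_hom_add_maps]
lemmas rmod_hom_add = add_maps_add[OF rmod_hom_add_maps]

lemma rmod_hom_comp:
 assumes "f : rmod_hom A M N" "g : rmod_hom A N P" shows "(%x. g (f x)) : rmod_hom A M P"
 using assms add_maps_comp[of f M N g P] add_maps_closed[of f M N] by (simp add: rmod_hom_iff)

text \<open>The right actions may come from different rings and are not looked at: the second factor
  of \<open>tensor_map\<close> has to be linear over the middle ring only.\<close>

definition lmod_hom ::
  "('b, 'p) ring_scheme => ('b, 'a, 'm, 'q) bimod_scheme => ('b, 'a1, 'n, 's) bimod_scheme
   => ('m => 'n) set" where
 "lmod_hom B M N = {f : add_maps M N.
   ALL b:carrier B. ALL x:carrier M. f (b |>{|M|} x) = b |>{|N|} f x}"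

lemma lmod_hom_add_maps: "f : lmod_hom B M N ==> f : add_maps M N"
 by (simp add: lmod_hom_def)

lemma lmod_hom_lact:
 "[|f : lmod_hom B M N; b .: B; x .: M|] ==> f (b |>{|M|} x) = b |>{|N|} f x"
 by (simp add: lmod_hom_def)

lemma lmod_hom_id: "id : lmod_hom B M M"
 by (simp add: lmod_hom_def add_maps_def)

lemma rmod_hom_id: "id : rmod_hom A M M"
 by (simp add: rmod_hom_iff add_maps_def)

lemma bimod_hom_iff: "f : bimod_hom B A M N \<longleftrightarrow> f : rmod_hom A M N & f : lmod_hom B M N"
 by (auto simp: bimod_hom_def lmod_hom_def rmod_hom_iff)

lemma (in right_module) ract_add_maps: "a .: A ==> (%x. x <| a) : add_maps M M"
 by (rule add_mapsI) (simp_all add: ract_closed ract_add_left)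

lemma (in right_module) ract_right_add_maps: "x .: M ==> (%a. x <| a) : add_maps A M"
 by (rule add_mapsI) (simp_all add: ract_closed ract_add_right)

lemma (in right_module) ab: "abelian_group M" by (rule abelian_group_axioms)

lemma (in right_module) ract_zero_right: "x .: M ==> x <| \<zero>{|A|} = \<zero>"
 using add_maps_zero[OF A.abelian_group_axioms ab ract_right_add_maps] by blast

lemma (in right_module) ract_zero_left: "a .: A ==> \<zero> <| a = \<zero>"
 using add_maps_zero[OF ab ab ract_add_maps] by blast

lemma (in right_module) ract_uminus_left:
 "[|x .: M; a .: A|] ==> (\<ominus> x) <| a = \<ominus> (x <| a)"
 using add_maps_uminus[OF ab ab ract_add_maps] by blast

lemma (in bimodule) lact_add_maps: "b .: B ==> (%x. b |> x) : add_maps M M"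
 by (rule add_mapsI) (simp_all add: lact_closed lact_add_right)

lemma (in bimodule) lact_left_add_maps: "x .: M ==> (%b. b |> x) : add_maps B M"
 by (rule add_mapsI) (simp_all add: lact_closed lact_add_left)

lemma (in bimodule) lact_zero_right: "b .: B ==> b |> \<zero> = \<zero>"
 using add_maps_zero[OF ab ab lact_add_maps] by blast

lemma (in bimodule) lact_zero_left: "x .: M ==> \<zero>{|B|} |> x = \<zero>"
 using add_maps_zero[OF B.abelian_group_axioms ab lact_left_add_maps] by blast

lemma bimodule_right: "bimodule B A M ==> right_module A M"
 by (simp add: bimodule_def)

lemma right_module_ab: "right_module A M ==> abelian_group M"
 by (simp add: right_module_def)

lemma bimodule_ab: "bimodule B A M ==> abelian_group M"
 by (simp add: bimodule_def right_module_def)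

lemma tensor_pairI: "[|right_module R M; bimodule R A N|] ==> tensor_pair R M N"
 by (simp add: tensor_pair_def right_module_ab bimodule_ab bimodule.lact_closed right_module.ract_closed)

context
 fixes R :: "('r, 'p) ring_scheme" and M :: "('r, 'm, 'q) rmod_scheme" and M' :: "('r, 'm, 'q1) rmod_scheme"
 assumes same: "carrier M = carrier M'" "add M = add M'" "ract M = ract M'"
begin

text \<open>The constructions read only three fields of the left factor, so a module and a comodule
  record over it have literally equal tensor products.\<close>

lemma tensor_cong_left:
 "TG R M N = TG R M' N" "tensor R M N = tensor R M' N"
 "TR R M N = TR R M' N" "tmap R M N = tmap R M' N"
proof -
 have r: "tensor_relations R M N = tensor_relations R M' N"
  using same by (simp add: tensor_relations_def)
 have k: "tensor_kernel R M N = tensor_kernel R M' N"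
  using same by (simp add: tensor_kernel_def r)
 show g: "TG R M N = TG R M' N"
  using same by (simp add: tensor_group_def k)
 show t: "tensor R M N = tensor R M' N"
  using same by (simp add: k tensor_def fun_eq_iff)
 show "TR R M N = TR R M' N" by (simp add: tensor_rmod_def g t)
 show "tmap R M N = tmap R M' N" by (simp add: fun_eq_iff tensor_map_def g t)
qed

lemma tensor_assoc_cong_left: "tensor_assoc R M N P = tensor_assoc R M' N P"
 by (simp add: fun_eq_iff tensor_assoc_def tensor_cong_left)

end

lemma tmap_add_maps:
 assumes "tensor_pair R M N" "tensor_pair R M' N'" "f : rmod_hom R M M'" "g : lmod_hom R N N'"
 shows "tmap R M' N' f g : add_maps (TG R M N) (TG R M' N')"
  and "[|x .: M; y .: N|] ==>
   tmap R M' N' f g (tensor R M N x y) = tensor R M' N' (f x) (g y)"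
proof -
 interpret P: tensor_pair R M N by fact
 interpret Q: tensor_pair R M' N' by fact
 note f = rmod_hom_closed[OF assms(3)] rmod_hom_add[OF assms(3)] rmod_hom_ract[OF assms(3)]
 note g = add_maps_closed[OF lmod_hom_add_maps[OF assms(4)]]
  add_maps_add[OF lmod_hom_add_maps[OF assms(4)]] lmod_hom_lact[OF assms(4)]
 have b: "balanced R M N (TG R M' N') (%x y. tensor R M' N' (f x) (g y))"
  by (rule balancedI)
   (simp_all add: f g Q.tensor_closed Q.tensor_add_left Q.tensor_add_right Q.tensor_balanced)
 show "tmap R M' N' f g : add_maps (TG R M N) (TG R M' N')"
  unfolding tensor_map_def by (rule P.tensor_lift_add_maps[OF Q.ab_tensor b])
 show "tmap R M' N' f g (tensor R M N x y) = tensor R M' N' (f x) (g y)"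
  if "x .: M" "y .: N"
  unfolding tensor_map_def by (rule P.tensor_lift_tensor[OF Q.ab_tensor b that])
qed

text \<open>Functoriality, with the composite given as separate data \<open>f''\<close> and
  \<open>g''\<close> that agree with the composition on carriers only. This lets \<open>id\<close>,
  inclusions and restricted functions stand in for literal compositions.\<close>

lemma tensor_map_comp:
 assumes "tensor_pair R M N" "tensor_pair R M' N'" "tensor_pair R M'' N''"
  and "f : rmod_hom R M M'" "g : lmod_hom R N N'"
  and "f' : rmod_hom R M' M''" "g' : lmod_hom R N' N''"
  and "f'' : rmod_hom R M M''" "g'' : lmod_hom R N N''"
  and "!!x. x .: M ==> f' (f x) = f'' x" "!!y. y .: N ==> g' (g y) = g'' y"
  and t: "t .: (TG R M N)"
 shows "tmap R M'' N'' f' g' (tmap R M' N' f g t) = tmap R M'' N'' f'' g'' t"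
proof (rule tensor_pair.tensor_ext[OF assms(1) _ _ _ t])
 show "abelian_group (TG R M'' N'')" by (rule tensor_pair.ab_tensor) fact
 show "(%t. tmap R M'' N'' f' g' (tmap R M' N' f g t))
   : add_maps (TG R M N) (TG R M'' N'')"
  by (rule add_maps_comp; rule tmap_add_maps(1)) (rule assms)+
 show "tmap R M'' N'' f'' g'' : add_maps (TG R M N) (TG R M'' N'')"
  by (rule tmap_add_maps(1)) (rule assms)+
 show "tmap R M'' N'' f' g' (tmap R M' N' f g (tensor R M N x y))
   = tmap R M'' N'' f'' g'' (tensor R M N x y)"
  if "x .: M" "y .: N" for x y
  using that assms(10,11) rmod_hom_closed[OF assms(4)]
   add_maps_closed[OF lmod_hom_add_maps[OF assms(5)]]
  by (simp add: tmap_add_maps(2)[OF assms(1,2,4,5)] tmap_add_maps(2)[OF assms(2,3,6,7)]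
    tmap_add_maps(2)[OF assms(1,3,8,9)])
qed

lemma tensor_map_ident:
 assumes "tensor_pair R M N" "t .: (TG R M N)"
  and "!!x. x .: M ==> f x = x" "!!y. y .: N ==> g y = y"
 shows "tmap R M N f g t = t"
proof (rule tensor_pair.tensor_ext[OF assms(1) _ _ _ assms(2)])
 have tp: "x <|{|M|} r .: M" "r |>{|N|} y .: N"
  if "x .: M" "y .: N" "r .: R" for x y r
  using that assms(1) by (simp_all add: tensor_pair_def)
 have f: "f : rmod_hom R M M"
  unfolding rmod_hom_iff add_maps_def
  using assms(3) tensor_pair.tp_ract[OF assms(1)]
   abelian_monoid.a_closed[OF abelian_group.axioms(1)[OF tensor_pair.tp_left[OF assms(1)]]]
  by simp
 have g: "g : lmod_hom R N N"
  unfolding lmod_hom_def add_maps_def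
  using assms(4) tensor_pair.tp_lact[OF assms(1)]
   abelian_monoid.a_closed[OF abelian_group.axioms(1)[OF tensor_pair.tp_right[OF assms(1)]]]
  by simp
 show "tmap R M N f g : add_maps (TG R M N) (TG R M N)"
  by (rule tmap_add_maps(1)[OF assms(1,1) f g])
 show "tmap R M N f g (tensor R M N x y) = tensor R M N x y"
  if "x .: M" "y .: N" for x y
  using that tmap_add_maps(2)[OF assms(1,1) f g] assms(3,4) by simp
 show "(%t. t) : add_maps (TG R M N) (TG R M N)"
  by (rule add_mapsI) simp_all
qed (rule tensor_pair.ab_tensor[OF assms(1)])

lemma tensor_rmod_simps [simp]:
 "carrier (TR R M N) = carrier (TG R M N)"
 "\<zero>{|TR R M N|} = \<zero>{|TG R M N|}"
 "(\<oplus>{|TR R M N|}) = (\<oplus>{|TG R M N|})"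
 by (simp_all add: tensor_rmod_def Let_def)

lemma tensor_bimod_simps [simp]:
 "carrier (TB R M N) = carrier (TG R M N)"
 "\<zero>{|TB R M N|} = \<zero>{|TG R M N|}"
 "(\<oplus>{|TB R M N|}) = (\<oplus>{|TG R M N|})"
 "ract (TB R M N) = ract (TR R M N)"
 by (simp_all add: tensor_bimod_def Let_def)

lemma add_maps_tensor_rmod [simp]:
 "add_maps (TR R M N) P = add_maps (TG R M N) P"
 "add_maps P (TR R M N) = add_maps P (TG R M N)"
 by (simp_all add: add_maps_def)

lemma add_maps_tensor_bimod [simp]:
 "add_maps (TB R M N) P = add_maps (TG R M N) P"
 "add_maps P (TB R M N) = add_maps P (TG R M N)"
 by (simp_all add: add_maps_def)

lemma tensor_ract:
 assumes "tensor_pair R M N" "bimodule R A N" "a .: A"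
 shows "(%t. t <|{|TR R M N|} a) : add_maps (TG R M N) (TG R M N)"
  and "[|x .: M; y .: N|] ==>
   tensor R M N x y <|{|TR R M N|} a = tensor R M N x (y <|{|N|} a)"
proof -
 interpret P: tensor_pair R M N by fact
 interpret N: bimodule R A N by fact
 have b: "balanced R M N (TG R M N) (%x y. tensor R M N x (y <|{|N|} a))"
  by (rule balancedI)
   (use assms(3) in "simp_all add: P.tensor_closed P.tensor_add_left P.tensor_add_right P.tensor_balanced
    N.ract_closed N.ract_add_left N.lact_ract")
 show "(%t. t <|{|TR R M N|} a) : add_maps (TG R M N) (TG R M N)"
  using P.tensor_lift_add_maps[OF P.ab_tensor b] by (simp add: tensor_rmod_def Let_def)
 show "tensor R M N x y <|{|TR R M N|} a = tensor R M N x (y <|{|N|} a)"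
  if "x .: M" "y .: N"
  using P.tensor_lift_tensor[OF P.ab_tensor b that] by (simp add: tensor_rmod_def Let_def)
qed

lemma right_module_tensor_rmod:
 assumes "tensor_pair R M N" "bimodule R A N"
 shows "right_module A (TR R M N)"
proof -
 interpret P: tensor_pair R M N by fact
 interpret N: bimodule R A N by fact
 let ?T = "TG R M N" and ?S = "TR R M N"
 interpret T: abelian_group ?T by (rule P.ab_tensor)
 note t1 = tensor_ract(1)[OF assms] and t2 = tensor_ract(2)[OF assms]
 have cl: "t <|{|?S|} a .: ?T" if "t .: ?T" "a .: A" for t a
  using add_maps_closed[OF t1] that by blast
 interpret S: abelian_group ?S
  by (rule abelian_group_transfer[OF T.abelian_group_axioms]) simp_all
 show ?thesis
 proof (unfold_locales, simp_all add: cl)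
  fix x y a assume "x .: ?T" "y .: ?T" "a .: A"
  then show "(x \<oplus>{|?T|} y) <|{|?S|} a = x <|{|?S|} a \<oplus>{|?T|} y <|{|?S|} a"
   using add_maps_add[OF t1] by blast
 next
  fix x a b assume x: "x .: ?T" and a: "a .: A" "b .: A"
  show "x <|{|?S|} (a \<oplus>{|A|} b) = x <|{|?S|} a \<oplus>{|?T|} x <|{|?S|} b"
   by (rule P.tensor_ext[OF t1 add_maps_plus[OF T.abelian_group_axioms t1 t1] T.abelian_group_axioms x])
    (simp_all add: a t2 N.ract_add_right P.tensor_add_right N.ract_closed)
  show "x <|{|?S|} (a \<otimes>{|A|} b) = x <|{|?S|} a <|{|?S|} b"
   by (rule P.tensor_ext[OF t1 add_maps_comp[OF t1 t1] T.abelian_group_axioms x])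
    (simp_all add: a t2 N.ract_mult N.ract_closed)
 next
  fix x assume x: "x .: ?T"
  show "x <|{|?S|} \<one>{|A|} = x"
   by (rule P.tensor_ext[OF t1 _ T.abelian_group_axioms x, where g = "%x. x"])
    (simp_all add: t2 N.ract_one add_mapsI)
 qed
qed

lemma tensor_lact:
 assumes "bimodule B R M" "bimodule R A N" "b .: B"
 shows "(%t. b |>{|TB R M N|} t) : add_maps (TG R M N) (TG R M N)"
  and "[|x .: M; y .: N|] ==>
   b |>{|TB R M N|} tensor R M N x y = tensor R M N (b |>{|M|} x) y"
proof -
 interpret M: bimodule B R M by fact
 interpret N: bimodule R A N by fact
 interpret P: tensor_pair R M N
  by (rule tensor_pairI[OF M.is_rmod N.bimodule_axioms])
 let ?T = "TG R M N"
 have T: "abelian_group (TR R M N)"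
  by (rule right_module_ab[OF right_module_tensor_rmod[OF P.is_pair assms(2)]])
 have b: "balanced R M N (TR R M N) (%x y. tensor R M N (b |>{|M|} x) y)"
  by (rule balancedI)
   (use assms(3) in "simp_all add: P.tensor_closed P.tensor_add_left P.tensor_add_right P.tensor_balanced
    M.lact_closed M.lact_add_right M.lact_ract flip: P.tensor_balanced")
 show "(%t. b |>{|TB R M N|} t) : add_maps ?T ?T"
  using P.tensor_lift_add_maps[OF T b] by (simp add: tensor_bimod_def Let_def)
 show "b |>{|TB R M N|} tensor R M N x y = tensor R M N (b |>{|M|} x) y"
  if "x .: M" "y .: N"
  using P.tensor_lift_tensor[OF T b that] by (simp add: tensor_bimod_def Let_def)
qed

lemma bimodule_tensor_bimod:
 assumes "bimodule B R M" "bimodule R A N"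
 shows "bimodule B A (TB R M N)"
proof -
 interpret M: bimodule B R M by fact
 interpret N: bimodule R A N by fact
 interpret P: tensor_pair R M N
  by (rule tensor_pairI[OF M.is_rmod N.bimodule_axioms])
 let ?T = "TG R M N" and ?S = "TB R M N"
 interpret S0: right_module A "TR R M N"
  by (rule right_module_tensor_rmod[OF P.is_pair assms(2)])
 interpret T: abelian_group ?T by (rule P.ab_tensor)
 interpret S: abelian_group ?S
  by (rule abelian_group_transfer[OF T.abelian_group_axioms]) simp_all
 note t1 = tensor_lact(1)[OF assms] and t2 = tensor_lact(2)[OF assms]
 note r1 = tensor_ract(1)[OF P.is_pair assms(2)]
  and r2 = tensor_ract(2)[OF P.is_pair assms(2)]
 have cl: "b |>{|?S|} t .: ?T" if "t .: ?T" "b .: B" for t b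
  using add_maps_closed[OF t1] that by blast
 show ?thesis
 proof (unfold_locales, simp_all add: cl S0.ract_closed[simplified] S0.ract_add_left[simplified]
   S0.ract_add_right[simplified] S0.ract_mult[simplified] S0.ract_one[simplified])
  fix b x y assume "b .: B" "x .: ?T" "y .: ?T"
  then show "b |>{|?S|} (x \<oplus>{|?T|} y) = b |>{|?S|} x \<oplus>{|?T|} b |>{|?S|} y"
   using add_maps_add[OF t1] by blast
 next
  fix a b x assume a: "a .: B" "b .: B" and x: "x .: ?T"
  show "(a \<oplus>{|B|} b) |>{|?S|} x = a |>{|?S|} x \<oplus>{|?T|} b |>{|?S|} x"
   by (rule P.tensor_ext[OF t1 add_maps_plus[OF T.abelian_group_axioms t1 t1] T.abelian_group_axioms x])
    (simp_all add: a t2 M.lact_add_left P.tensor_add_left M.lact_closed)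
  show "(a \<otimes>{|B|} b) |>{|?S|} x = a |>{|?S|} b |>{|?S|} x"
   by (rule P.tensor_ext[OF t1 add_maps_comp[OF t1 t1] T.abelian_group_axioms x])
    (simp_all add: a t2 M.lact_mult M.lact_closed)
 next
  fix x assume x: "x .: ?T"
  show "\<one>{|B|} |>{|?S|} x = x"
   by (rule P.tensor_ext[OF t1 _ T.abelian_group_axioms x, where g = "%x. x"])
    (simp_all add: t2 M.lact_one add_mapsI)
 next
  fix b x a assume a: "b .: B" "a .: A" and x: "x .: ?T"
  show "(b |>{|?S|} x) <|{|TR R M N|} a = b |>{|?S|} (x <|{|TR R M N|} a)"
   by (rule P.tensor_ext[OF add_maps_comp[OF t1 r1] add_maps_comp[OF r1 t1] T.abelian_group_axioms x])
    (simp_all add: a t2 r2 M.lact_closed N.ract_closed)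
 qed
qed

lemma tensor_map_rmod_hom:
 assumes "tensor_pair R M N" "tensor_pair R M' N'" "bimodule R A N" "bimodule R A N'"
  and "f : rmod_hom R M M'" "g : bimod_hom R A N N'"
 shows "tmap R M' N' f g : rmod_hom A (TR R M N) (TR R M' N')"
proof -
 interpret P: tensor_pair R M N by fact
 interpret Q: tensor_pair R M' N' by fact
 interpret N: bimodule R A N by fact
 have g: "g : rmod_hom A N N'" "g : lmod_hom R N N'" using assms(6) by (simp_all add: bimod_hom_iff)
 note T1 = tmap_add_maps(1)[OF assms(1,2,5) g(2)] and T2 = tmap_add_maps(2)[OF assms(1,2,5) g(2)]
 have "tmap R M' N' f g (t <|{|TR R M N|} a) = tmap R M' N' f g t <|{|TR R M' N'|} a"
  if "t .: (TG R M N)" and a: "a .: A" for t a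
  by (rule P.tensor_ext[OF add_maps_comp[OF tensor_ract(1)[OF assms(1,3) a] T1]
    add_maps_comp[OF T1 tensor_ract(1)[OF assms(2,4) a]] Q.ab_tensor that(1)])
   (simp_all add: tensor_ract(2)[OF assms(1,3) a] T2 tensor_ract(2)[OF assms(2,4) a]
    rmod_hom_closed[OF assms(5)] rmod_hom_closed[OF g(1)] rmod_hom_ract[OF g(1)] N.ract_closed a)
 then show ?thesis using T1 by (simp add: rmod_hom_iff)
qed

section \<open>Associativity\<close>

text \<open>The inverse of \<open>tensor_assoc\<close>. Comultiplying the second factor of M (x) C
  lands in M (x) (C (x) C), while a coaction on M (x) C must land in (M (x) C) (x) C.\<close>

definition tensor_unassoc ::
  "('a, 'p) ring_scheme => ('a, 'm, 'q) rmod_scheme => ('a, 'a, 'n, 's) bimod_scheme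
   => ('a, 'a, 'l, 't) bimod_scheme
   => ('m \<times> ('n \<times> 'l \<Rightarrow>\<^sub>0 int) set \<Rightarrow>\<^sub>0 int) set
   => (('m \<times> 'n \<Rightarrow>\<^sub>0 int) set \<times> 'l \<Rightarrow>\<^sub>0 int) set" where
 "tensor_unassoc A M N P =
  (let MN = TR A M N; T = TG A MN P in
   tensor_lift T (%(x, s). tensor_lift T (%(y, z). tensor A MN P (tensor A M N x y) z) s))"

locale tensor_triple = M: right_module A M + N: bimodule A A N + P: bimodule A A P
 for A :: "('a, 'p) ring_scheme" and M :: "('a, 'm, 'q) rmod_scheme"
  and N :: "('a, 'a, 'n, 's) bimod_scheme" and P :: "('a, 'a, 'l, 't) bimod_scheme"
begin

abbreviation "MN \<equiv> TR A M N"
abbreviation "NP \<equiv> TB A N P"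
abbreviation "T1 \<equiv> TG A MN P"
abbreviation "T2 \<equiv> TG A M NP"

lemma tpMN: "tensor_pair A M N" by (rule tensor_pairI[OF M.is_rmod N.bimodule_axioms])
lemma tpNP: "tensor_pair A N P" by (rule tensor_pairI[OF N.is_rmod P.bimodule_axioms])
lemma rMN: "right_module A MN" by (rule right_module_tensor_rmod[OF tpMN N.bimodule_axioms])
lemma bNP: "bimodule A A NP" by (rule bimodule_tensor_bimod[OF N.bimodule_axioms P.bimodule_axioms])
lemma tp1: "tensor_pair A MN P" by (rule tensor_pairI[OF rMN P.bimodule_axioms])
lemma tp2: "tensor_pair A M NP" by (rule tensor_pairI[OF M.is_rmod bNP])

interpretation MN: tensor_pair A M N by (rule tpMN)
interpretation NP: tensor_pair A N P by (rule tpNP)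
interpretation X1: tensor_pair A MN P by (rule tp1)
interpretation X2: tensor_pair A M NP by (rule tp2)

lemmas ab1 = X1.ab_tensor
lemmas ab2 = X2.ab_tensor

lemma assoc_inner:
 assumes z: "z .: P"
 shows "tensor_lift T2 (%(x, y). tensor A M NP x (tensor A N P y z)) : add_maps (TG A M N) T2"
  and "[|x .: M; y .: N|] ==>
   tensor_lift T2 (%(x, y). tensor A M NP x (tensor A N P y z)) (tensor A M N x y)
    = tensor A M NP x (tensor A N P y z)"
proof -
 have b: "balanced A M N T2 (%x y. tensor A M NP x (tensor A N P y z))"
 proof (rule balancedI, goal_cases)
  case (2 x x' y)
  then show ?case using X2.tensor_add_left[of x x' "tensor A N P y z"] z by (simp add: NP.tensor_closed)
 next
  case (3 x y y')
  then show ?case using X2.tensor_add_right[of x "tensor A N P y z" "tensor A N P y' z"] z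
   by (simp add: NP.tensor_closed NP.tensor_add_left)
 next
  case (4 x r y)
  then show ?case using X2.tensor_balanced[of x r "tensor A N P y z"] z
   by (simp add: NP.tensor_closed tensor_lact(2)[OF N.bimodule_axioms P.bimodule_axioms])
 qed (use z in "simp add: X2.tensor_closed NP.tensor_closed")
 show "tensor_lift T2 (%(x, y). tensor A M NP x (tensor A N P y z)) : add_maps (TG A M N) T2"
  by (rule MN.tensor_lift_add_maps[OF ab2 b])
 show "tensor_lift T2 (%(x, y). tensor A M NP x (tensor A N P y z)) (tensor A M N x y)
    = tensor A M NP x (tensor A N P y z)" if "x .: M" "y .: N"
  by (rule MN.tensor_lift_tensor[OF ab2 b that])
qed

lemma assoc_balanced: "balanced A MN P T2
 (%t z. tensor_lift T2 (%(x, y). tensor A M NP x (tensor A N P y z)) t)"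
proof (rule balancedI, goal_cases)
 case (1 x y)
 then show ?case using add_maps_closed[OF assoc_inner(1)] by simp
next
 case (2 x x' y)
 then show ?case using add_maps_add[OF assoc_inner(1)] by simp
next
 case (3 t z z')
 show ?case
  by (rule MN.tensor_ext[OF assoc_inner(1) add_maps_plus[OF ab2 assoc_inner(1) assoc_inner(1)] ab2])
   (use 3 in "simp_all add: assoc_inner(2) NP.tensor_add_right X2.tensor_add_right[simplified] NP.tensor_closed")
next
 case (4 t r z)
 show ?case
  by (rule MN.tensor_ext[OF add_maps_comp[OF tensor_ract(1)[OF tpMN N.bimodule_axioms] assoc_inner(1)]
    assoc_inner(1) ab2])
   (use 4 in "simp_all add: assoc_inner(2) tensor_ract(2)[OF tpMN N.bimodule_axioms] NP.tensor_balanced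
    N.ract_closed P.lact_closed")
qed

lemma tensor_assoc_add_maps: "tensor_assoc A M N P : add_maps T1 T2"
 unfolding tensor_assoc_def Let_def by (rule X1.tensor_lift_add_maps[OF ab2 assoc_balanced])

lemma tensor_assoc_tensor:
 assumes "x .: M" "y .: N" "z .: P"
 shows "tensor_assoc A M N P (tensor A MN P (tensor A M N x y) z) = tensor A M NP x (tensor A N P y z)"
 unfolding tensor_assoc_def Let_def
 using assms by (subst X1.tensor_lift_tensor[OF ab2 assoc_balanced])
  (simp_all add: MN.tensor_closed assoc_inner(2))

lemma unassoc_inner:
 assumes x: "x .: M"
 shows "tensor_lift T1 (%(y, z). tensor A MN P (tensor A M N x y) z) : add_maps (TG A N P) T1"
  and "[|y .: N; z .: P|] ==>
   tensor_lift T1 (%(y, z). tensor A MN P (tensor A M N x y) z) (tensor A N P y z)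
    = tensor A MN P (tensor A M N x y) z"
proof -
 have b: "balanced A N P T1 (%y z. tensor A MN P (tensor A M N x y) z)"
 proof (rule balancedI, goal_cases)
  case (2 y y' z)
  then show ?case using X1.tensor_add_left[of "tensor A M N x y" "tensor A M N x y'" z] x
   by (simp add: MN.tensor_closed MN.tensor_add_right)
 next
  case (3 x' y y')
  then show ?case using X1.tensor_add_right[of "tensor A M N x x'" y y'] x by (simp add: MN.tensor_closed)
 next
  case (4 y r z)
  then show ?case using X1.tensor_balanced[of "tensor A M N x y" r z] x
   by (simp add: MN.tensor_closed tensor_ract(2)[OF tpMN N.bimodule_axioms])
 qed (use x in "simp add: X1.tensor_closed MN.tensor_closed")
 show "tensor_lift T1 (%(y, z). tensor A MN P (tensor A M N x y) z) : add_maps (TG A N P) T1"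
  by (rule NP.tensor_lift_add_maps[OF ab1 b])
 show "tensor_lift T1 (%(y, z). tensor A MN P (tensor A M N x y) z) (tensor A N P y z)
    = tensor A MN P (tensor A M N x y) z" if "y .: N" "z .: P"
  by (rule NP.tensor_lift_tensor[OF ab1 b that])
qed

lemma unassoc_balanced: "balanced A M NP T1
 (%x s. tensor_lift T1 (%(y, z). tensor A MN P (tensor A M N x y) z) s)"
proof (rule balancedI, goal_cases)
 case (1 x y)
 then show ?case using add_maps_closed[OF unassoc_inner(1)] by simp
next
 case (3 x y y')
 then show ?case using add_maps_add[OF unassoc_inner(1)] by simp
next
 case (2 x x' s)
 show ?case
  by (rule NP.tensor_ext[OF unassoc_inner(1) add_maps_plus[OF ab1 unassoc_inner(1) unassoc_inner(1)] ab1])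
   (use 2 in "simp_all add: unassoc_inner(2) MN.tensor_add_left X1.tensor_add_left[simplified] MN.tensor_closed")
next
 case (4 x r s)
 show ?case
  by (rule NP.tensor_ext[OF unassoc_inner(1)
    add_maps_comp[OF tensor_lact(1)[OF N.bimodule_axioms P.bimodule_axioms] unassoc_inner(1)] ab1])
   (use 4 in "simp_all add: unassoc_inner(2) tensor_lact(2)[OF N.bimodule_axioms P.bimodule_axioms] MN.tensor_balanced
    M.ract_closed N.lact_closed")
qed

lemma tensor_unassoc_add_maps: "tensor_unassoc A M N P : add_maps T2 T1"
 unfolding tensor_unassoc_def Let_def by (rule X2.tensor_lift_add_maps[OF ab1 unassoc_balanced])

lemma tensor_unassoc_tensor:
 assumes "x .: M" "y .: N" "z .: P"
 shows "tensor_unassoc A M N P (tensor A M NP x (tensor A N P y z)) = tensor A MN P (tensor A M N x y) z"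
 unfolding tensor_unassoc_def Let_def
 using assms by (subst X2.tensor_lift_tensor[OF ab1 unassoc_balanced])
  (simp_all add: NP.tensor_closed unassoc_inner(2))

lemma T2_ext:
 assumes "f : add_maps T2 G" "g : add_maps T2 G" "abelian_group G" "t .: T2"
  and "!!x y z. [|x .: M; y .: N; z .: P|] ==>
   f (tensor A M NP x (tensor A N P y z)) = g (tensor A M NP x (tensor A N P y z))"
 shows "f t = g t"
proof (rule X2.tensor_ext[OF assms(1-4)])
 fix x s assume x: "x .: M" and s: "s .: NP"
 have r: "(%s. tensor A M NP x s) : add_maps (TG A N P) T2"
  using X2.tensor_right_add_maps[OF x] by simp
 show "f (tensor A M NP x s) = g (tensor A M NP x s)"
  by (rule NP.tensor_ext[OF add_maps_comp[OF r assms(1)] add_maps_comp[OF r assms(2)] assms(3)])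
   (use s in "simp_all add: assms(5) x")
qed

lemma T1_ext:
 assumes "f : add_maps T1 G" "g : add_maps T1 G" "abelian_group G" "t .: T1"
  and "!!x y z. [|x .: M; y .: N; z .: P|] ==>
   f (tensor A MN P (tensor A M N x y) z) = g (tensor A MN P (tensor A M N x y) z)"
 shows "f t = g t"
proof (rule X1.tensor_ext[OF assms(1-4)])
 fix s z assume z: "z .: P" and s: "s .: MN"
 have r: "(%s. tensor A MN P s z) : add_maps (TG A M N) T1"
  using X1.tensor_left_add_maps[OF z] by simp
 show "f (tensor A MN P s z) = g (tensor A MN P s z)"
  by (rule MN.tensor_ext[OF add_maps_comp[OF r assms(1)] add_maps_comp[OF r assms(2)] assms(3)])
   (use s in "simp_all add: assms(5) z")
qed

lemma assoc_unassoc: "t .: T2 ==> tensor_assoc A M N P (tensor_unassoc A M N P t) = t"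
 by (rule T2_ext[OF add_maps_comp[OF tensor_unassoc_add_maps tensor_assoc_add_maps] _ ab2, where g = "%t. t"])
  (simp_all add: tensor_unassoc_tensor tensor_assoc_tensor add_mapsI)

lemma unassoc_assoc: "t .: T1 ==> tensor_unassoc A M N P (tensor_assoc A M N P t) = t"
 by (rule T1_ext[OF add_maps_comp[OF tensor_assoc_add_maps tensor_unassoc_add_maps] _ ab1, where g = "%t. t"])
  (simp_all add: tensor_unassoc_tensor tensor_assoc_tensor add_mapsI)

end

section \<open>Submodules and the spans of tensors that they generate\<close>

lemma (in abelian_group) add_diff_cancel:
 "[|x .: G; y .: G|] ==> x \<oplus> (y \<ominus> x) = y"
 by (simp add: minus_eq a_lcomm[of x y "\<ominus> x"] r_neg)

definition submod :: "('a, 'p) ring_scheme => ('a, 'm, 'q) rmod_scheme => 'm set => bool" where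
 "submod A M W \<longleftrightarrow> additive_subgroup W M & (ALL x:W. ALL a:carrier A. x <|{|M|} a : W)"

lemma submodI:
 assumes "abelian_group M" "W <= carrier M" "\<zero>{|M|} : W" "!!x y. [|x : W; y : W|] ==> x \<oplus>{|M|} y : W"
  "!!x. x : W ==> \<ominus>{|M|} x : W" "!!x a. [|x : W; a .: A|] ==> x <|{|M|} a : W"
 shows "submod A M W"
 using assms abelian_group.additive_subgroupI[of M W] by (simp add: submod_def)

text \<open>Negatives come for free from the action of -1.\<close>

lemma (in right_module) submodI':
 assumes "W <= carrier M" "\<zero> : W" "!!x y. [|x : W; y : W|] ==> x \<oplus> y : W"
  "!!x a. [|x : W; a .: A|] ==> x <| a : W"
 shows "submod A M W"
proof (rule submodI[OF ab])
 fix x assume x: "x : W"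
 then have c: "x .: M" using assms(1) by blast
 have "x <| (\<ominus>{|A|} \<one>{|A|}) = \<ominus> x"
  using add_maps_uminus[OF A.abelian_group_axioms ab ract_right_add_maps[OF c], of "\<one>{|A|}"] c
  by (simp add: ract_one)
 then show "\<ominus> x : W" using assms(4)[OF x, of "\<ominus>{|A|} \<one>{|A|}"] by simp
qed (use assms in auto)

lemma submod_subgroup: "submod A M W ==> additive_subgroup W M"
 by (simp add: submod_def)

lemma submod_subset: "submod A M W ==> W <= carrier M"
 by (simp add: submod_def additive_subgroup.a_subset)

lemma submod_closed:
 "submod A M W ==> x : W ==> x .: M"
 "submod A M W ==> \<zero>{|M|} : W"
 "submod A M W ==> x : W ==> y : W ==> x \<oplus>{|M|} y : W"
 "submod A M W ==> x : W ==> a .: A ==> x <|{|M|} a : W"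
 using submod_subset[of A M W]
 by (auto simp: submod_def additive_subgroup.zero_closed additive_subgroup.a_closed)

lemma submod_uminus:
 "abelian_group M ==> submod A M W ==> x : W ==> \<ominus>{|M|} x : W"
 by (simp add: submod_def additive_subgroup_uminus)

lemma submod_minus:
 "abelian_group M ==> submod A M W ==> x : W ==> y : W ==> x \<ominus>{|M|} y : W"
 by (simp add: submod_def additive_subgroup_minus)

lemma (in right_module) submod_carrier: "submod A M (carrier M)"
 by (rule submodI') (simp_all add: ract_closed)

lemma (in right_module) submod_zero: "submod A M {\<zero>}"
 by (rule submodI') (simp_all add: ract_zero_left)

lemma (in right_module) right_module_sub:
 assumes "submod A M W" shows "right_module A (M(|carrier := W|))"
proof -
 note W = submod_closed[OF assms]
 interpret S: abelian_group "M(|carrier := W|)"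
 proof (rule abelian_groupI, goal_cases)
  case (6 x)
  then show ?case using W(1) submod_uminus[OF ab assms]
   by (auto intro!: bexI[of _ "\<ominus> x"] simp: l_neg)
 qed (use W in "simp_all add: a_ac")
 show ?thesis
  by unfold_locales (use W in "simp_all add: ract_closed ract_add_left ract_add_right ract_mult ract_one")
qed

text \<open>This is the image of W (x) N in M (x) N, kept as a subset of the larger tensor product.
  The group W (x) N itself consists of cosets of another kernel and embeds only under flatness.
  Closure under negatives is derived when W has it.\<close>

inductive_set tspan ::
  "('r, 'p) ring_scheme => ('r, 'm, 'q) rmod_scheme => ('r, 'a, 'n, 's) bimod_scheme
   => 'm set => ('m \<times> 'n \<Rightarrow>\<^sub>0 int) set set"
 for R M N W where
 zero: "\<zero>{|TG R M N|} : tspan R M N W"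
| pure: "[|x : W; y .: N|] ==> tensor R M N x y : tspan R M N W"
| add: "[|s : tspan R M N W; t : tspan R M N W|] ==> s \<oplus>{|TG R M N|} t : tspan R M N W"

lemma tspan_mono:
 assumes "t : tspan R M N W" "W <= W'" shows "t : tspan R M N W'"
 using assms(1) by (induction rule: tspan.induct) (use assms(2) in "auto intro: tspan.intros")

context tensor_pair begin

lemma tspan_closed: "t : tspan R M N W ==> W <= carrier M ==> t .: (TG R M N)"
proof -
 interpret T: abelian_group "TG R M N" by (rule ab_tensor)
 show "t : tspan R M N W ==> W <= carrier M ==> t .: (TG R M N)"
  by (induction rule: tspan.induct) (auto simp: tensor_closed)
qed

lemma tspan_subgroup:
 assumes "W <= carrier M" "!!x. x : W ==> \<ominus>{|M|} x : W"
 shows "additive_subgroup (tspan R M N W) (TG R M N)"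
proof -
 interpret T: abelian_group "TG R M N" by (rule ab_tensor)
 show ?thesis
 proof (rule T.additive_subgroupI)
  show "tspan R M N W <= carrier (TG R M N)"
   using tspan_closed assms(1) by blast
  fix x assume "x : tspan R M N W"
  then show "\<ominus>{|TG R M N|} x : tspan R M N W"
  proof (induction rule: tspan.induct)
   case zero
   then show ?case by (simp add: T.a_inv_zero tspan.zero)
  next
   case (pure x y)
   then have "\<ominus>{|TG R M N|} tensor R M N x y = tensor R M N (\<ominus>{|M|} x) y"
    using add_maps_uminus[OF tp_left ab_tensor tensor_left_add_maps, of y x] assms(1) by auto
   then show ?case using pure assms(2) tspan.pure by metis
  next
   case (add s t)
   then show ?case using tspan_closed[OF _ assms(1)] by (simp add: T.minus_add tspan.add)
  qed
 qed (auto intro: tspan.intros)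
qed

lemma tspan_subgroup_submod: "submod A0 M W ==> additive_subgroup (tspan R M N W) (TG R M N)"
 by (rule tspan_subgroup) (auto simp: submod_subset submod_uminus[OF tp_left] dest: submod_closed(1))

lemma tspan_full: "t .: (TG R M N) ==> t : tspan R M N (carrier M)"
 by (induction rule: tensor_induct) (auto intro: tspan.intros)

lemma tspan_image:
 assumes "t : tspan R M N W" "W <= carrier M" "f : add_maps (TG R M N) G" "abelian_group G"
  and "additive_subgroup U G" "!!x y. [|x : W; y .: N|] ==> f (tensor R M N x y) : U"
 shows "f t : U"
 using assms(1)
proof (induction rule: tspan.induct)
 case zero
 then show ?case using add_maps_zero[OF ab_tensor assms(4,3)] additive_subgroup.zero_closed[OF assms(5)]
  by simp
next
 case (add s t)
 then show ?case
  using add_maps_add[OF assms(3)] tspan_closed[OF _ assms(2)] additive_subgroup.a_closed[OF assms(5)] by simp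
qed (use assms(6) in simp)

lemma tspan_triv: "t : tspan R M N {\<zero>{|M|}} ==> t = \<zero>{|TG R M N|}"
proof (induction rule: tspan.induct)
 case (pure x y)
 then show ?case using add_maps_zero[OF tp_left ab_tensor tensor_left_add_maps] by simp
next
 case (add s t)
 interpret T: abelian_group "TG R M N" by (rule ab_tensor)
 from add show ?case by simp
qed simp

end

lemma tspan_tensor_map:
 assumes "tensor_pair R M N" "tensor_pair R M' N'" "f : rmod_hom R M M'" "g : lmod_hom R N N'"
  and "t : tspan R M N W" "W <= carrier M" "!!x. x : W ==> f x : W'"
 shows "tmap R M' N' f g t : tspan R M' N' W'"
 using assms(5)
proof (induction rule: tspan.induct)
 case zero
 then show ?case
  using add_maps_zero[OF _ _ tmap_add_maps(1)[OF assms(1-4)]] tspan.zero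
   tensor_pair.ab_tensor[OF assms(1)] tensor_pair.ab_tensor[OF assms(2)] by metis
next
 case (pure x y)
 then show ?case
  using tmap_add_maps(2)[OF assms(1-4), of x y] subsetD[OF assms(6), of x] assms(7)[of x]
   add_maps_closed[OF lmod_hom_add_maps[OF assms(4)], of y] tspan.pure[of "f x" W' "g y" N' R M'] by simp
next
 case (add s t)
 then show ?case
  using add_maps_add[OF tmap_add_maps(1)[OF assms(1-4)]] tensor_pair.tspan_closed[OF assms(1) _ assms(6)]
  by (auto intro!: tspan.add)
qed

section \<open>Flatness\<close>

text \<open>The direct sum of two groups, needed for the pushout in
  \<open>one_step_injective\<close>.\<close>

definition pair_group :: "('g, 'p) ring_scheme => ('h, 'q) ring_scheme => ('g \<times> 'h) ring" where
 "pair_group G H = (|carrier = carrier G \<times> carrier H, mult = undefined, one = undefined,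
   zero = (\<zero>{|G|}, \<zero>{|H|}), add = (%(x, y) (x', y'). (x \<oplus>{|G|} x', y \<oplus>{|H|} y'))|)"

lemma pair_group_simps [simp]:
 "carrier (pair_group G H) = carrier G \<times> carrier H"
 "\<zero>{|pair_group G H|} = (\<zero>{|G|}, \<zero>{|H|})"
 "(x, y) \<oplus>{|pair_group G H|} (x', y') = (x \<oplus>{|G|} x', y \<oplus>{|H|} y')"
 by (simp_all add: pair_group_def)

lemma abelian_pair_group:
 assumes "abelian_group G" "abelian_group H" shows "abelian_group (pair_group G H)"
proof -
 interpret G: abelian_group G by fact
 interpret H: abelian_group H by fact
 show ?thesis
 proof (rule abelian_groupI, goal_cases)
  case (6 p)
  then show ?case
   by (cases p) (auto intro!: bexI[of _ "(\<ominus>{|G|} fst p, \<ominus>{|H|} snd p)"] simp: G.l_neg H.l_neg)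
 qed (auto simp: G.a_ac H.a_ac)
qed

text \<open>The criterion of flatness by right ideals: the contraction J (x) C -> C has zero kernel.
  It quantifies over subsets of the carrier of A only, so it does not depend on a type of test
  modules.\<close>

definition ideal_flat :: "('a, 'p) ring_scheme => ('a, 'a, 'c, 'q) bimod_scheme => bool" where
 "ideal_flat A C \<longleftrightarrow>
  (ALL J. submod A (regular_rmod A) J -->
   (ALL z:carrier (TG A (regular_rmod A(|carrier := J|)) C).
    tensor_lift C (%(a, c). a |>{|C|} c) z = \<zero>{|C|} -->
    z = \<zero>{|TG A (regular_rmod A(|carrier := J|)) C|}))"

lemma regular_rmod_simps [simp]:
 "carrier (regular_rmod A) = carrier A" "\<zero>{|regular_rmod A|} = \<zero>{|A|}"
 "(\<oplus>{|regular_rmod A|}) = (\<oplus>{|A|})" "ract (regular_rmod A) = (\<otimes>{|A|})"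
 by (simp_all add: regular_rmod_def)

lemma right_module_regular:
 assumes "ring A" shows "right_module A (regular_rmod A)"
proof -
 interpret A: ring A by fact
 interpret abelian_group "regular_rmod A"
  by (rule abelian_group_transfer[OF A.abelian_group_axioms]) simp_all
 show ?thesis by unfold_locales (simp_all add: A.l_distr A.r_distr A.m_assoc)
qed

context bimodule begin

lemma contract_add_maps:
 assumes "submod B (regular_rmod B) J"
 shows "tensor_lift M (%(a, c). a |> c) : add_maps (TG B (regular_rmod B(|carrier := J|)) M) M"
  and "[|a : J; c .: M|] ==>
   tensor_lift M (%(a, c). a |> c) (tensor B (regular_rmod B(|carrier := J|)) M a c) = a |> c"
proof -
 interpret R: right_module B "regular_rmod B" by (rule right_module_regular) (rule B.ring_axioms)
 interpret J: right_module B "regular_rmod B(|carrier := J|)" by (rule R.right_module_sub[OF assms])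
 have tp: "tensor_pair B (regular_rmod B(|carrier := J|)) M"
  by (rule tensor_pairI[OF J.is_rmod bimodule_axioms])
 have b: "balanced B (regular_rmod B(|carrier := J|)) M M (%a c. a |> c)"
  by (rule balancedI)
   (use submod_closed(1)[OF assms] in "simp_all add: lact_closed lact_add_left lact_add_right lact_mult")
 show "tensor_lift M (%(a, c). a |> c) : add_maps (TG B (regular_rmod B(|carrier := J|)) M) M"
  by (rule tensor_pair.tensor_lift_add_maps[OF tp ab b])
 show "[|a : J; c .: M|] ==>
   tensor_lift M (%(a, c). a |> c) (tensor B (regular_rmod B(|carrier := J|)) M a c) = a |> c"
  using tensor_pair.tensor_lift_tensor[OF tp ab b, of a c] by simp
qed

end

lemma rmod_hom_incl:
 assumes "W <= W'"
 shows "id : rmod_hom A (P(|carrier := W|)) (P(|carrier := W'|))" "W <= carrier P ==> id : rmod_hom A (P(|carrier := W|)) P"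
 using assms by (auto simp: rmod_hom_def)

locale flat_bimodule = bimodule A A C for A :: "('a, 'p) ring_scheme" and C :: "('a, 'a, 'c, 'q) bimod_scheme" +
 assumes iflat: "ideal_flat A C"
begin

text \<open>With J the right ideal of all a such that pa lies in L, the module L' = L + pA is the
  pushout of L and A along J. This gives a map from L' (x) C to the sum of L (x) C and C modulo W,
  where W consists of the pairs (pz, - contraction of z) for z in J (x) C. An element t that dies in
  L' (x) C yields (t, 0) in W; the corresponding z has contraction 0, hence z = 0 by
  \<open>iflat\<close>, and t = 0.\<close>

lemma one_step_injective:
 fixes P :: "('a, 'm, 's) rmod_scheme"
 assumes "right_module A P" and L: "submod A P L" and p: "p .: P"
  and L': "L' = {x \<oplus>{|P|} p <|{|P|} a | x a. x : L & a .: A}"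
 shows "submod A P L'" "L <= L'" "p : L'"
  "[|t .: (TG A (P(|carrier := L|)) C);
   tmap A (P(|carrier := L'|)) C id id t = \<zero>{|TG A (P(|carrier := L'|)) C|}|]
   ==> t = \<zero>{|TG A (P(|carrier := L|)) C|}"
proof -
 interpret P: right_module A P by fact
 note Lc = submod_closed[OF L]
 have sum4: "(x \<oplus>{|P|} u) \<oplus>{|P|} (y \<oplus>{|P|} v) = (x \<oplus>{|P|} y) \<oplus>{|P|} (u \<oplus>{|P|} v)"
  if "x .: P" "y .: P" "u .: P" "v .: P" for x y u v
  using that by (simp add: P.a_ac)
 show L'sub: "submod A P L'"
 proof (rule P.submodI')
  show "L' <= carrier P" unfolding L' using p Lc(1) by (auto simp: P.ract_closed)
  show "\<zero>{|P|} : L'" unfolding L' using p Lc(2)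
   by (auto intro!: exI[of _ "\<zero>{|P|}"] exI[of _ "\<zero>{|A|}"] simp: P.ract_zero_right)
 next
  fix y y' assume "y : L'" "y' : L'"
  then obtain x a x' a' where "y = x \<oplus>{|P|} p <|{|P|} a" "y' = x' \<oplus>{|P|} p <|{|P|} a'" "x : L" "x' : L"
   "a .: A" "a' .: A" unfolding L' by blast
  then show "y \<oplus>{|P|} y' : L'" unfolding L' using p Lc
   by (auto intro!: exI[of _ "x \<oplus>{|P|} x'"] exI[of _ "a \<oplus>{|A|} a'"] simp: P.ract_closed P.ract_add_right sum4)
 next
  fix y r assume "y : L'" "r .: A"
  then obtain x a where "y = x \<oplus>{|P|} p <|{|P|} a" "x : L" "a .: A" unfolding L' by blast
  then show "y <|{|P|} r : L'" unfolding L' using p Lc \<open>r : carrier A\<close>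
   by (auto intro!: exI[of _ "x <|{|P|} r"] exI[of _ "a \<otimes>{|A|} r"] simp: P.ract_closed P.ract_add_left P.ract_mult)
 qed
 show LL': "L <= L'"
 proof
  fix x assume "x : L"
  then have "x = x \<oplus>{|P|} p <|{|P|} \<zero>{|A|}" using p Lc(1) by (simp add: P.ract_zero_right)
  with \<open>x : L\<close> show "x : L'" unfolding L' by blast
 qed
 show "p : L'"
 proof -
  have "p = \<zero>{|P|} \<oplus>{|P|} p <|{|P|} \<one>{|A|}" using p by (simp add: P.ract_one)
  with Lc(2) show "p : L'" unfolding L' by blast
 qed
 define PL where "PL = P(|carrier := L|)"
 define PL' where "PL' = P(|carrier := L'|)"
 define J where "J = {a : carrier A. p <|{|P|} a : L}"
 define RJ where "RJ = regular_rmod A(|carrier := J|)"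
 have PLs: "carrier PL = L" "ract PL = ract P" "add PL = add P" "carrier PL' = L'" "ract PL' = ract P" "add PL' = add P"
  "carrier RJ = J" "ract RJ = (\<otimes>{|A|})" "add RJ = (\<oplus>{|A|})"
  by (simp_all add: PL_def PL'_def RJ_def)
 interpret R: right_module A "regular_rmod A" by (rule right_module_regular) (rule B.ring_axioms)
 have J: "submod A (regular_rmod A) J"
  by (rule R.submodI') (use p Lc in "auto simp: J_def P.ract_zero_right P.ract_add_right P.ract_mult")
 interpret PL: right_module A PL unfolding PL_def by (rule P.right_module_sub[OF L])
 interpret PL': right_module A PL' unfolding PL'_def by (rule P.right_module_sub[OF L'sub])
 interpret RJ: right_module A RJ unfolding RJ_def by (rule R.right_module_sub[OF J])
 interpret TL: tensor_pair A PL C by (rule tensor_pairI[OF PL.is_rmod bimodule_axioms])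
 interpret TL': tensor_pair A PL' C by (rule tensor_pairI[OF PL'.is_rmod bimodule_axioms])
 interpret TJ: tensor_pair A RJ C by (rule tensor_pairI[OF RJ.is_rmod bimodule_axioms])
 let ?T = "TG A PL C" and ?TJ = "TG A RJ C"
 interpret T: abelian_group ?T by (rule TL.ab_tensor)
 define \<mu> where "\<mu> = tensor_lift C (%(a, c). a |>{|C|} c)"
 define \<kappa> where "\<kappa> = tmap A PL C (%a. p <|{|P|} a) id"
 have \<mu>: "\<mu> : add_maps ?TJ C" "!!a c. [|a : J; c .: C|] ==> \<mu> (tensor A RJ C a c) = a |>{|C|} c"
  unfolding \<mu>_def RJ_def by (rule contract_add_maps(1)[OF J], rule contract_add_maps(2)[OF J])
 have pm: "(%a. p <|{|P|} a) : rmod_hom A RJ PL"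
  using p by (auto simp: rmod_hom_def PLs J_def P.ract_add_right P.ract_mult)
 have \<kappa>: "\<kappa> : add_maps ?TJ ?T" "!!a c. [|a : J; c .: C|] ==> \<kappa> (tensor A RJ C a c) = tensor A PL C (p <|{|P|} a) c"
  unfolding \<kappa>_def using tmap_add_maps[OF TJ.is_pair TL.is_pair pm lmod_hom_id]
  by (simp_all add: PLs)
 define G where "G = pair_group ?T C"
 have G: "abelian_group G" unfolding G_def by (rule abelian_pair_group[OF T.abelian_group_axioms ab])
 interpret G: abelian_group G by (rule G)
 \<comment> \<open>The relations that identify pa, taken in L, with a, taken in A, for all a in
   J.\<close>
 define W where "W = (%z. (\<kappa> z, \<ominus>{|C|} \<mu> z)) ` carrier ?TJ"
 interpret TJg: abelian_group ?TJ by (rule TJ.ab_tensor)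
 have wm: "(%z. (\<kappa> z, \<ominus>{|C|} \<mu> z)) : add_maps ?TJ G"
  by (rule add_mapsI) (simp_all add: G_def add_maps_closed[OF \<kappa>(1)] add_maps_closed[OF \<mu>(1)]
    add_maps_add[OF \<kappa>(1)] add_maps_add[OF \<mu>(1)] minus_add)
 have W: "additive_subgroup W G"
 proof (rule G.additive_subgroupI)
  show "W <= carrier G" unfolding W_def using add_maps_closed[OF wm] by blast
  show "\<zero>{|G|} : W"
   unfolding W_def add_maps_zero[OF TJg.abelian_group_axioms G wm, symmetric] by blast
 next
  fix x y assume "x : W" "y : W"
  then obtain z z' where z: "z .: ?TJ" "z' .: ?TJ" "x = (\<kappa> z, \<ominus>{|C|} \<mu> z)" "y = (\<kappa> z', \<ominus>{|C|} \<mu> z')"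
   unfolding W_def by blast
  then show "x \<oplus>{|G|} y : W"
   unfolding W_def z(3,4) add_maps_add[OF wm z(1,2), symmetric] using TJg.a_closed[OF z(1,2)] by blast
 next
  fix x assume "x : W"
  then obtain z where z: "z .: ?TJ" "x = (\<kappa> z, \<ominus>{|C|} \<mu> z)"
   unfolding W_def by blast
  then show "\<ominus>{|G|} x : W"
   unfolding W_def z(2) add_maps_uminus[OF TJg.abelian_group_axioms G wm z(1), symmetric]
   using TJg.a_inv_closed[OF z(1)] by blast
 qed
 let ?Q = "quot_group G W"
 have Q: "abelian_group ?Q" by (rule abelian_quot_group[OF G W])
 note pr = quot_proj_add_maps[OF G W]
 have "ALL y:L'. EX x a. x : L & a .: A & y = x \<oplus>{|P|} p <|{|P|} a" unfolding L' by blast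
 \<comment> \<open>A decomposition y = x + pa is not unique. By \<open>key\<close> the class of the
   pair (x (x) c, ac) modulo W does not depend on the choice, because the coefficients of two
   choices differ by an element of J.\<close>
 then obtain xx aa where xa: "!!y. y : L' ==> xx y : L" "!!y. y : L' ==> aa y .: A"
  "!!y. y : L' ==> y = xx y \<oplus>{|P|} p <|{|P|} aa y" by metis
 define b where "b y c = quot_proj G W (tensor A PL C (xx y) c, aa y |>{|C|} c)" for y c
 have key: "b (x \<oplus>{|P|} p <|{|P|} a) c = quot_proj G W (tensor A PL C x c, a |>{|C|} c)"
  if x: "x : L" and a: "a .: A" and c: "c .: C" for x a c
 proof -
  define y where "y = x \<oplus>{|P|} p <|{|P|} a"
  have y: "y : L'" unfolding L' y_def using x a by blast
  define d where "d = a \<ominus>{|A|} aa y"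
  have d: "d .: A" using a xa(2)[OF y] by (simp add: d_def)
  have xp: "x .: P" "xx y .: P" "p <|{|P|} a .: P" "p <|{|P|} aa y .: P"
   using x xa(1,2)[OF y] Lc(1) p a by (auto simp: P.ract_closed)
  have pd: "p <|{|P|} d = xx y \<ominus>{|P|} x"
  proof -
   have e: "xx y \<oplus>{|P|} p <|{|P|} aa y = x \<oplus>{|P|} p <|{|P|} a" using xa(3)[OF y] y_def by simp
   have "p <|{|P|} d = p <|{|P|} a \<ominus>{|P|} p <|{|P|} aa y"
    unfolding d_def
    using add_maps_minus[OF B.abelian_group_axioms P.ab P.ract_right_add_maps[OF p] a xa(2)[OF y]] .
   also have "... = (x \<oplus>{|P|} p <|{|P|} a) \<ominus>{|P|} x \<ominus>{|P|} p <|{|P|} aa y"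
    using xp by (simp add: P.minus_eq P.a_ac P.r_neg1 P.r_neg2 P.r_neg P.l_neg)
   also have "... = xx y \<ominus>{|P|} x"
    unfolding e[symmetric] using xp by (simp add: P.minus_eq P.a_ac P.r_neg1 P.r_neg2 P.r_neg P.l_neg)
   finally show ?thesis .
  qed
  have "xx y \<ominus>{|P|} x : L" using submod_minus[OF P.ab L xa(1)[OF y] x] .
  then have dJ: "d : J" using pd d by (simp add: J_def)
  have ed: "aa y \<oplus>{|A|} d = a" "x \<oplus>{|P|} p <|{|P|} d = xx y"
   unfolding pd unfolding d_def
   using a xa(2)[OF y] xp by (simp_all add: B.add_diff_cancel P.add_diff_cancel)
  have "quot_proj G W (\<kappa> (tensor A RJ C d c), \<ominus>{|C|} \<mu> (tensor A RJ C d c)) = \<zero>{|?Q|}"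
  proof -
   have "(\<kappa> (tensor A RJ C d c), \<ominus>{|C|} \<mu> (tensor A RJ C d c)) : W"
    unfolding W_def using TJ.tensor_closed[of d c] dJ c PLs(7) by blast
   moreover from this have "(\<kappa> (tensor A RJ C d c), \<ominus>{|C|} \<mu> (tensor A RJ C d c)) .: G"
    using additive_subgroup.a_subset[OF W] by blast
   ultimately show ?thesis using quot_proj_zero_iff[OF G W] by blast
  qed
  then have z: "quot_proj G W (tensor A PL C (p <|{|P|} d) c, \<ominus>{|C|} (d |>{|C|} c)) = \<zero>{|?Q|}"
   by (simp add: \<kappa>(2)[OF dJ c] \<mu>(2)[OF dJ c])
  have pdL: "p <|{|P|} d : L" using dJ by (simp add: J_def)
  have cl: "tensor A PL C x c .: ?T" "tensor A PL C (p <|{|P|} d) c .: ?T"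
   using x pdL c by (simp_all add: TL.tensor_closed PLs)
  have cl2: "a |>{|C|} c .: C" "d |>{|C|} c .: C" "aa y |>{|C|} c .: C"
   using a d c xa(2)[OF y] by (simp_all add: lact_closed)
  have "(tensor A PL C (xx y) c, aa y |>{|C|} c)
    = (tensor A PL C x c, a |>{|C|} c) \<oplus>{|G|} (tensor A PL C (p <|{|P|} d) c, \<ominus>{|C|} (d |>{|C|} c))"
  proof -
   have "tensor A PL C (xx y) c = tensor A PL C x c \<oplus>{|?T|} tensor A PL C (p <|{|P|} d) c"
    unfolding ed(2)[symmetric] using TL.tensor_add_left[of x "p <|{|P|} d" c] x pdL c by (simp add: PLs)
   moreover have "a |>{|C|} c = aa y |>{|C|} c \<oplus>{|C|} d |>{|C|} c"
    unfolding ed(1)[symmetric] using lact_add_left[OF xa(2)[OF y] d c] by simp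
   ultimately show ?thesis using cl2 by (simp add: G_def a_assoc r_neg)
  qed
  then have "b y c = quot_proj G W (tensor A PL C x c, a |>{|C|} c) \<oplus>{|?Q|} \<zero>{|?Q|}"
   unfolding b_def z[symmetric] using cl cl2 by (subst add_maps_add[OF pr, symmetric]) (simp_all add: G_def)
  also have "... = quot_proj G W (tensor A PL C x c, a |>{|C|} c)"
   using add_maps_closed[OF pr] cl cl2 abelian_group.axioms(1)[OF Q]
   by (simp add: abelian_monoid.r_zero G_def)
  finally show ?thesis by (simp add: y_def)
 qed
 have bal: "balanced A PL' C ?Q b"
 proof (rule balancedI, unfold PLs, goal_cases)
  case (1 y c)
  then show ?case
   unfolding b_def using xa(1,2)[of y]
   by (intro add_maps_closed[OF pr]) (simp add: G_def TL.tensor_closed PLs lact_closed)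
 next
  case (2 y y' c)
  note y = xa[OF 2(1)] and y' = xa[OF 2(2)]
  have yp: "xx y .: P" "xx y' .: P" using y(1) y'(1) Lc(1) by auto
  have "y \<oplus>{|P|} y' = (xx y \<oplus>{|P|} xx y') \<oplus>{|P|} p <|{|P|} (aa y \<oplus>{|A|} aa y')"
   using arg_cong2[OF y(3) y'(3), of "(\<oplus>{|P|})"] y(2) y'(2) p yp
   by (simp only: sum4 P.ract_closed P.ract_add_right)
  then have "b (y \<oplus>{|P|} y') c
    = quot_proj G W (tensor A PL C (xx y \<oplus>{|P|} xx y') c, (aa y \<oplus>{|A|} aa y') |>{|C|} c)"
   using key[of "xx y \<oplus>{|P|} xx y'" "aa y \<oplus>{|A|} aa y'" c] y y' 2(3) Lc by simp
  also have "... = quot_proj G W ((tensor A PL C (xx y) c, aa y |>{|C|} c) \<oplus>{|G|} (tensor A PL C (xx y') c, aa y' |>{|C|} c))"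
   using TL.tensor_add_left[of "xx y" "xx y'" c] y y' 2(3) by (simp add: PLs G_def lact_add_left)
  also have "... = b y c \<oplus>{|?Q|} b y' c"
   unfolding b_def using y y' 2(3)
   by (subst add_maps_add[OF pr]) (simp_all add: G_def TL.tensor_closed PLs lact_closed)
  finally show ?case .
 next
  case (3 y c c')
  note y = xa[OF 3(1)]
  have "(tensor A PL C (xx y) (c \<oplus>{|C|} c'), aa y |>{|C|} (c \<oplus>{|C|} c'))
   = (tensor A PL C (xx y) c, aa y |>{|C|} c) \<oplus>{|G|} (tensor A PL C (xx y) c', aa y |>{|C|} c')"
   using TL.tensor_add_right[of "xx y" c c'] y 3 by (simp add: PLs G_def lact_add_right)
  then show ?case
   unfolding b_def using y 3
   by (subst add_maps_add[OF pr, symmetric]) (simp_all add: G_def TL.tensor_closed PLs lact_closed)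
 next
  case (4 y r c)
  note y = xa[OF 4(1)]
  have yp: "xx y .: P" using y(1) Lc(1) by auto
  have "y <|{|P|} r = xx y <|{|P|} r \<oplus>{|P|} p <|{|P|} (aa y \<otimes>{|A|} r)"
   using arg_cong[OF y(3), of "%z. z <|{|P|} r"] y(2) p yp 4
   by (simp only: P.ract_closed P.ract_add_left P.ract_mult)
  then have "b (y <|{|P|} r) c = quot_proj G W (tensor A PL C (xx y <|{|P|} r) c, (aa y \<otimes>{|A|} r) |>{|C|} c)"
   using key[of "xx y <|{|P|} r" "aa y \<otimes>{|A|} r" c] y 4 Lc by simp
  also have "... = b y (r |>{|C|} c)"
   unfolding b_def using TL.tensor_balanced[of "xx y" r c] y 4 by (simp add: PLs lact_mult)
  finally show ?case .
 qed
 note lift = TL'.tensor_lift_add_maps[OF Q bal] TL'.tensor_lift_tensor[OF Q bal]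
 have inc: "id : rmod_hom A PL PL'" unfolding PL_def PL'_def by (rule rmod_hom_incl[OF LL'])
 note incm = tmap_add_maps[OF TL.is_pair TL'.is_pair inc lmod_hom_id]
 have in0: "(%t. (t, \<zero>{|C|})) : add_maps ?T G" by (rule add_mapsI) (simp_all add: G_def)
 show "t = \<zero>{|TG A (P(|carrier := L|)) C|}"
  if "t .: (TG A (P(|carrier := L|)) C)"
   "tmap A (P(|carrier := L'|)) C id id t = \<zero>{|TG A (P(|carrier := L'|)) C|}"
 proof -
  have t: "t .: ?T" and t0: "tmap A PL' C id id t = \<zero>{|TG A PL' C|}"
   using that by (simp_all add: PL_def PL'_def)
  have "quot_proj G W (t, \<zero>{|C|}) = tensor_lift ?Q (case_prod b) (tmap A PL' C id id t)"
  proof (rule TL.tensor_ext[OF add_maps_comp[OF in0 pr] add_maps_comp[OF incm(1) lift(1)] Q t])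
   fix x c assume "x .: PL" "c .: C"
   moreover from this have "x : L'" "x = x \<oplus>{|P|} p <|{|P|} \<zero>{|A|}" using LL' Lc(1) p
    by (auto simp: PLs P.ract_zero_right)
   ultimately show "quot_proj G W (tensor A PL C x c, \<zero>{|C|})
    = tensor_lift ?Q (case_prod b) (tmap A PL' C id id (tensor A PL C x c))"
    using key[of x "\<zero>{|A|}" c] by (simp add: incm(2) lift(2) PLs lact_zero_left)
  qed
  also have "... = \<zero>{|?Q|}"
   unfolding t0 by (rule add_maps_zero[OF TL'.ab_tensor Q lift(1)])
  finally have "(t, \<zero>{|C|}) : W" using quot_proj_zero_iff[OF G W] t by (simp add: G_def)
  then obtain z where z: "z .: ?TJ" "t = \<kappa> z" "\<ominus>{|C|} \<mu> z = \<zero>{|C|}" unfolding W_def by auto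
  have "\<mu> z = \<zero>{|C|}" using z(1,3) add_maps_closed[OF \<mu>(1)] a_inv_zero minus_minus by metis
  then have "z = \<zero>{|?TJ|}" using iflat J z(1) unfolding ideal_flat_def \<mu>_def RJ_def by blast
  then have "t = \<zero>{|?T|}"
   using z(2) add_maps_zero[OF TJg.abelian_group_axioms T.abelian_group_axioms \<kappa>(1)] by simp
  then show ?thesis by (simp add: PL_def)
 qed
qed

end

lemma (in abelian_group) diff_zero_iff:
 assumes "x .: G" "y .: G" shows "x \<ominus> y = \<zero> \<longleftrightarrow> x = y"
proof
 assume "x \<ominus> y = \<zero>"
 then show "x = y" using add_diff_cancel[OF assms(2,1)] assms by simp
qed (use assms in "simp add: minus_eq r_neg")

lemma (in abelian_group) diff_eq_diff:
 assumes c: "x .: G" "u .: G" "y .: G" "v .: G" and e: "x \<oplus> u = y \<oplus> v"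
 shows "y \<ominus> x = u \<ominus> v"
proof -
 have "y = (y \<oplus> v) \<ominus> v" using c by (simp add: minus_eq a_assoc r_neg)
 also have "... = (u \<ominus> v) \<oplus> x" unfolding e[symmetric] using c by (simp add: minus_eq a_assoc a_comm a_lcomm)
 finally have "y \<ominus> x = (u \<ominus> v) \<oplus> x \<ominus> x" by simp
 then show ?thesis using c by (simp add: minus_eq a_assoc r_neg)
qed

text \<open>At the level of formal sums an inclusion changes nothing. This links the kernels of the
  two free groups in \<open>sub_injective\<close>.\<close>

lemma tensor_map_coset:
 assumes "tensor_pair R M N" "tensor_pair R M' N" "id : rmod_hom R M M'"
  and s: "Poly_Mapping.keys s <= carrier M \<times> carrier N"
 shows "tmap R M' N id id (tensor_kernel R M N #>{|free_Abelian_group (carrier M \<times> carrier N)|} s)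
  = tensor_kernel R M' N #>{|free_Abelian_group (carrier M' \<times> carrier N)|} s"
proof -
 interpret P: tensor_pair R M N by fact
 interpret Q: tensor_pair R M' N by fact
 note tm = tmap_add_maps[OF assms(1-3) lmod_hom_id]
 have sub: "carrier M \<times> carrier N <= carrier M' \<times> carrier N"
  using rmod_hom_closed[OF assms(3)] by auto
 interpret FP: comm_group P.FG by (rule abelian_free_Abelian_group)
 interpret FQ: comm_group Q.FG by (rule abelian_free_Abelian_group)
 interpret QT: abelian_group "TG R M' N" by (rule Q.ab_tensor)
 interpret PT: abelian_group "TG R M N" by (rule P.ab_tensor)
 show ?thesis
  using s
 proof (induction s rule: free_Abelian_group_induct[consumes 1, case_names 1 2 3])
  case 1
  have "P.KK #>{|P.FG|} 0 = \<zero>{|TG R M N|}"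
   using FP.coset_mult_one[OF subgroup.subset[OF P.kernel_subgroup]] by (simp add: P.tensor_group_eq)
  moreover have "Q.KK #>{|Q.FG|} 0 = \<zero>{|TG R M' N|}"
   using FQ.coset_mult_one[OF subgroup.subset[OF Q.kernel_subgroup]] by (simp add: Q.tensor_group_eq)
  ultimately show ?case
   using add_maps_zero[OF P.ab_tensor Q.ab_tensor tm(1)] by (simp add: id_def)
 next
  case (2 a b)
  have k: "Poly_Mapping.keys (a - b) <= carrier M \<times> carrier N"
   using order_trans[OF keys_diff[of a b]] 2 by simp
  have c: "P.KK #>{|P.FG|} (a - b) .: (TG R M N)"
   "P.KK #>{|P.FG|} b .: (TG R M N)"
   using k 2(2) by (simp_all add: P.carrier_tensor_group)
  have cq: "Q.KK #>{|Q.FG|} (a - b) .: (TG R M' N)"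
   "Q.KK #>{|Q.FG|} b .: (TG R M' N)"
   using order_trans[OF k sub] order_trans[OF 2(2) sub] by (simp_all add: Q.carrier_tensor_group)
  have "(P.KK #>{|P.FG|} (a - b)) \<oplus>{|TG R M N|} (P.KK #>{|P.FG|} b) = P.KK #>{|P.FG|} a"
   using 2 k by (simp add: P.tensor_group_coset_add)
  then have "tmap R M' N id id (P.KK #>{|P.FG|} (a - b)) \<oplus>{|TG R M' N|} (Q.KK #>{|Q.FG|} b)
    = Q.KK #>{|Q.FG|} a"
   using add_maps_add[OF tm(1) c] 2(3,4) by (simp add: id_def)
  also have "... = (Q.KK #>{|Q.FG|} (a - b)) \<oplus>{|TG R M' N|} (Q.KK #>{|Q.FG|} b)"
   using order_trans[OF k sub] order_trans[OF 2(2) sub] by (simp add: Q.tensor_group_coset_add)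
  finally show ?case using QT.add.right_cancel[of "Q.KK #>{|Q.FG|} b"] cq add_maps_closed[OF tm(1) c(1)] by (simp add: id_def)
 next
  case (3 p)
  then show ?case using tm(2)[of "fst p" "snd p"] by (auto simp: tensor_def id_def)
 qed
qed

text \<open>An element of the kernel is generated by finitely many relations, and each of them
  involves at most two elements of P. Hence it already lies in the kernel over every L that contains
  these finitely many elements.\<close>

lemma kernel_finite_support:
 assumes "tensor_pair A P C" "s : tensor_kernel A P C"
 shows "EX Y. finite Y & Y <= carrier P \<and>
  (ALL L. Y <= L & tensor_pair A (P(|carrier := L|)) C --> s : tensor_kernel A (P(|carrier := L|)) C)"
proof -
 interpret P: tensor_pair A P C by fact
 have rel: "EX Y. finite Y & Y <= carrier P \<and>
  (ALL L. Y <= L --> h : tensor_relations A (P(|carrier := L|)) C)"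
  if "h : tensor_relations A P C" for h
  using that unfolding tensor_relations_def
 proof (elim UnE CollectE exE conjE, goal_cases)
  case (1 x x' y)
  then show ?case by (intro exI[of _ "{x, x'}"]) auto
 next
  case (2 x y y')
  then show ?case by (intro exI[of _ "{x}"]) auto
 next
  case (3 x r y)
  then show ?case by (intro exI[of _ "{x}"]) auto
 qed
 show ?thesis
  using assms(2) unfolding tensor_kernel_def
 proof (induction rule: generate.induct)
  case one
  show ?case using generate.one[of "free_Abelian_group (carrier (P(|carrier := L|)) \<times> carrier C)" for L]
   by (intro exI[of _ "{}"]) simp
 next
  case (incl h)
  from rel[OF incl] obtain Y where Y: "finite Y" "Y <= carrier P"
   "!!L. Y <= L ==> h : tensor_relations A (P(|carrier := L|)) C" by (elim exE conjE) simp
  then show ?case by (intro exI[of _ Y]) (simp add: generate.incl)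
 next
  case (inv h)
  from rel[OF inv] obtain Y where Y: "finite Y" "Y <= carrier P"
   "!!L. Y <= L ==> h : tensor_relations A (P(|carrier := L|)) C" by (elim exE conjE) simp
  have e: "inv{|P.FG|} h = - h" using P.relations_keys[OF inv] by simp
  have "- h : generate (free_Abelian_group (carrier (P(|carrier := L|)) \<times> carrier C)) (tensor_relations A (P(|carrier := L|)) C)"
   if L: "Y <= L" "tensor_pair A (P(|carrier := L|)) C" for L
   using generate.inv[OF Y(3)[OF L(1)], of "free_Abelian_group (carrier (P(|carrier := L|)) \<times> carrier C)"]
    tensor_pair.relations_keys[OF L(2) Y(3)[OF L(1)]] by simp
  then show ?case using Y(1,2) unfolding e by (intro exI[of _ Y]) simp
 next
  case (eng h1 h2)
  from eng.IH(1) obtain Y1 where Y1: "finite Y1" "Y1 <= carrier P"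
   "ALL L. Y1 <= L & tensor_pair A (P(|carrier := L|)) C --> h1 : generate (free_Abelian_group (carrier (P(|carrier := L|)) \<times> carrier C)) (tensor_relations A (P(|carrier := L|)) C)"
   by (elim exE conjE)
  from eng.IH(2) obtain Y2 where Y2: "finite Y2" "Y2 <= carrier P"
   "ALL L. Y2 <= L & tensor_pair A (P(|carrier := L|)) C --> h2 : generate (free_Abelian_group (carrier (P(|carrier := L|)) \<times> carrier C)) (tensor_relations A (P(|carrier := L|)) C)"
   by (elim exE conjE)
  show ?case
  proof (intro exI[of _ "Y1 \<union> Y2"] conjI allI impI)
   fix L assume L: "Y1 \<union> Y2 <= L & tensor_pair A (P(|carrier := L|)) C"
   show "h1 \<otimes>{|P.FG|} h2 : generate (free_Abelian_group (carrier (P(|carrier := L|)) \<times> carrier C)) (tensor_relations A (P(|carrier := L|)) C)"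
    using generate.eng[OF Y1(3)[rule_format, of L] Y2(3)[rule_format, of L]] L by simp
  qed (use Y1 Y2 in "simp_all")
 qed
qed

context flat_bimodule begin

lemma tp: "right_module A P ==> tensor_pair A P C"
 by (rule tensor_pairI[OF _ bimodule_axioms])

lemma tp_sub: "[|right_module A P; submod A P L|] ==> tensor_pair A (P(|carrier := L|)) C"
 by (rule tp[OF right_module.right_module_sub])

text \<open>The elements of Y are adjoined one after the other; each step is injective by
  \<open>one_step_injective\<close>, hence so is the composite.\<close>

lemma finite_steps_injective:
 fixes P :: "('a, 'm, 's) rmod_scheme"
 assumes P: "right_module A P" and L: "submod A P L" and Y: "finite Y" "Y <= carrier P"
 shows "EX L'. submod A P L' & L <= L' & Y <= L' \<and>
  (ALL t:carrier (TG A (P(|carrier := L|)) C).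
   tmap A (P(|carrier := L'|)) C id id t = \<zero>{|TG A (P(|carrier := L'|)) C|}
   --> t = \<zero>{|TG A (P(|carrier := L|)) C|})"
proof -
 define inj0 where "inj0 L' \<longleftrightarrow> (ALL t:carrier (TG A (P(|carrier := L|)) C).
   tmap A (P(|carrier := L'|)) C id id t = \<zero>{|TG A (P(|carrier := L'|)) C|}
   --> t = \<zero>{|TG A (P(|carrier := L|)) C|})" for L'
 have base: "inj0 L"
  unfolding inj0_def using tensor_map_ident[OF tp_sub[OF P L], of _ id id] by simp
 have step: "EX L2. submod A P L2 & L <= L2 & insert p Y <= L2 & inj0 L2"
  if p: "p .: P" and L1: "submod A P L1" "L <= L1" "Y <= L1" and inj1: "inj0 L1" for p Y L1
 proof -
 have i1: "!!t. [|t .: (TG A (P(|carrier := L|)) C);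
   tmap A (P(|carrier := L1|)) C id id t = \<zero>{|TG A (P(|carrier := L1|)) C|}|]
   ==> t = \<zero>{|TG A (P(|carrier := L|)) C|}" using inj1 by (simp add: inj0_def)
 define L2 where "L2 = {x \<oplus>{|P|} p <|{|P|} a | x a. x : L1 & a .: A}"
 note st = one_step_injective[OF P L1(1) p L2_def]
 note tps = tp_sub[OF P L] tp_sub[OF P L1(1)] tp_sub[OF P st(1)]
 note i01 = rmod_hom_incl(1)[OF L1(2), of A P]
 have "t = \<zero>{|TG A (P(|carrier := L|)) C|}"
  if t: "t .: (TG A (P(|carrier := L|)) C)"
   and t0: "tmap A (P(|carrier := L2|)) C id id t = \<zero>{|TG A (P(|carrier := L2|)) C|}" for t
 proof (rule i1[OF t], rule st(4))
  show "tmap A (P(|carrier := L1|)) C id id t .: (TG A (P(|carrier := L1|)) C)"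
   by (rule add_maps_closed[OF tmap_add_maps(1)[OF tps(1,2) i01 lmod_hom_id] t])
  have "tmap A (P(|carrier := L2|)) C id id (tmap A (P(|carrier := L1|)) C id id t)
    = tmap A (P(|carrier := L2|)) C id id t"
   by (rule tensor_map_comp[OF tps i01 lmod_hom_id rmod_hom_incl(1)[OF st(2)] lmod_hom_id
    rmod_hom_incl(1)[OF order_trans[OF L1(2) st(2)]] lmod_hom_id _ _ t]) simp_all
  then show "tmap A (P(|carrier := L2|)) C id id (tmap A (P(|carrier := L1|)) C id id t)
    = \<zero>{|TG A (P(|carrier := L2|)) C|}" using t0 by simp
 qed
 then show ?thesis using st(1,2,3) L1 by (intro exI[of _ L2]) (auto simp: inj0_def)
 qed
 have "EX L'. submod A P L' & L <= L' & Y <= L' & inj0 L'"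
  using Y
 proof (induction Y rule: finite_induct)
  case empty
  show ?case using L base by blast
 next
  case (insert p Y)
  from insert.IH insert.prems obtain L1 where "submod A P L1" "L <= L1" "Y <= L1" "inj0 L1" by auto
  then show ?case using step[of p L1 Y] insert.prems by simp
 qed
 then show ?thesis by (simp only: inj0_def)
qed

text \<open>If t vanishes in P (x) C, a formal sum representing it lies in the kernel for P, hence
  in the kernel for some L' that is reached from L in finitely many steps. Injectivity of these
  steps gives t = 0.\<close>

lemma sub_injective:
 fixes P :: "('a, 'm, 's) rmod_scheme"
 assumes P: "right_module A P" and L: "submod A P L"
  and t: "t .: (TG A (P(|carrier := L|)) C)"
  and t0: "tmap A P C id id t = \<zero>{|TG A P C|}"
 shows "t = \<zero>{|TG A (P(|carrier := L|)) C|}"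
proof -
 interpret PP: tensor_pair A P C by (rule tp[OF P])
 interpret LL: tensor_pair A "P(|carrier := L|)" C by (rule tp_sub[OF P L])
 have LP: "L <= carrier P" by (rule submod_subset[OF L])
 obtain s where s: "Poly_Mapping.keys s <= L \<times> carrier C" "t = LL.KK #>{|LL.FG|} s"
  using t by (auto simp: LL.carrier_tensor_group)
 have sP: "Poly_Mapping.keys s <= carrier P \<times> carrier C" using s(1) LP by blast
 have "tmap A P C id id t = PP.KK #>{|PP.FG|} s"
  unfolding s(2) using s(1)
  by (intro tensor_map_coset[OF LL.is_pair PP.is_pair rmod_hom_incl(2)[OF LP LP]]) simp
 then have "PP.KK #>{|PP.FG|} s = PP.KK" using t0 by (simp add: PP.tensor_group_eq)
 then have "s : PP.KK"
  using group.coset_join1[OF group_free_Abelian_group _ _ PP.kernel_subgroup, of s] sP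
   subgroup.subset[OF PP.kernel_subgroup] by simp
 from kernel_finite_support[OF PP.is_pair this]
 obtain Y where Y: "finite Y" "Y <= carrier P"
  "!!L'. [|Y <= L'; tensor_pair A (P(|carrier := L'|)) C|] ==> s : tensor_kernel A (P(|carrier := L'|)) C" by blast
 from finite_steps_injective[OF P L Y(1,2)]
 obtain L' where L': "submod A P L'" "L <= L'" "Y <= L'"
  and i: "tmap A (P(|carrier := L'|)) C id id t = \<zero>{|TG A (P(|carrier := L'|)) C|}
   ==> t = \<zero>{|TG A (P(|carrier := L|)) C|}" using t by blast
 interpret L': tensor_pair A "P(|carrier := L'|)" C by (rule tp_sub[OF P L'(1)])
 show ?thesis
 proof (rule i)
  have sk: "s : L'.KK" by (rule Y(3)[OF L'(3) L'.is_pair])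
  have "tmap A (P(|carrier := L'|)) C id id t = L'.KK #>{|L'.FG|} s"
   unfolding s(2) using s(1)
   by (intro tensor_map_coset[OF LL.is_pair L'.is_pair rmod_hom_incl(1)[OF L'(2)]]) simp
  also have "... = L'.KK"
   using group.coset_join2[OF group_free_Abelian_group _ L'.kernel_subgroup sk] L'.kernel_keys[OF sk] by simp
  also have "... = \<zero>{|TG A (P(|carrier := L'|)) C|}" by (simp add: L'.tensor_group_eq)
  finally show "tmap A (P(|carrier := L'|)) C id id t = \<zero>{|TG A (P(|carrier := L'|)) C|}" .
 qed
qed

text \<open>Exactness in the form in which it is used later. By \<open>sub_injective\<close> the
  hypothesis may be read in L (x) C with L = f(M) + Q. There the rule that sends f x + q to x is
  well defined modulo the preimage of Q and induces a map to M (x) C modulo the wanted span. This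
  map sends (f (x) C) t to the class of t, and it kills Q (x) C.\<close>

lemma tspan_preimage:
 fixes M :: "('a, 'm, 's) rmod_scheme" and P :: "('a, 'n, 't) rmod_scheme"
 assumes M: "right_module A M" and P: "right_module A P" and f: "f : rmod_hom A M P"
  and Q: "submod A P Q" and t: "t .: (TG A M C)"
  and tQ: "tmap A P C f id t : tspan A P C Q"
 shows "t : tspan A M C {x : carrier M. f x : Q}"
proof -
 interpret M: right_module A M by fact
 interpret P: right_module A P by fact
 interpret TM: tensor_pair A M C by (rule tp[OF M])
 interpret TP: tensor_pair A P C by (rule tp[OF P])
 note fc = rmod_hom_closed[OF f] and fa = rmod_hom_add[OF f] and fr = rmod_hom_ract[OF f]
 note Qc = submod_closed[OF Q]
 define f' where "f' = {x : carrier M. f x : Q}"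
 have f': "submod A M f'"
  by (rule M.submodI') (use add_maps_zero[OF M.ab P.ab rmod_hom_add_maps[OF f]] Qc in
    \<open>auto simp: f'_def fa fr M.ract_closed\<close>)
 define L where "L = {f x \<oplus>{|P|} q | x q. x .: M & q : Q}"
 have sum4: "(x \<oplus>{|P|} u) \<oplus>{|P|} (y \<oplus>{|P|} v) = (x \<oplus>{|P|} y) \<oplus>{|P|} (u \<oplus>{|P|} v)"
  if "x .: P" "y .: P" "u .: P" "v .: P" for x y u v
  using that by (simp add: P.a_ac)
 have fz: "f \<zero>{|M|} = \<zero>{|P|}" by (rule add_maps_zero[OF M.ab P.ab rmod_hom_add_maps[OF f]])
 have L: "submod A P L"
 proof (rule P.submodI')
  show "L <= carrier P" using Qc(1) fc by (auto simp: L_def)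
  show "\<zero>{|P|} : L" unfolding L_def using Qc(2) fz by (auto intro!: exI[of _ "\<zero>{|M|}"] exI[of _ "\<zero>{|P|}"])
 next
  fix y y' assume "y : L" "y' : L"
  then obtain x q x' q' where "y = f x \<oplus>{|P|} q" "y' = f x' \<oplus>{|P|} q'" "x .: M" "x' .: M" "q : Q" "q' : Q"
   unfolding L_def by blast
  then show "y \<oplus>{|P|} y' : L" unfolding L_def using Qc
   by (auto intro!: exI[of _ "x \<oplus>{|M|} x'"] exI[of _ "q \<oplus>{|P|} q'"] simp: fa fc sum4)
 next
  fix y a assume "y : L" "a .: A"
  then obtain x q where "y = f x \<oplus>{|P|} q" "x .: M" "q : Q" unfolding L_def by blast
  then show "y <|{|P|} a : L" unfolding L_def using Qc \<open>a : carrier A\<close>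
   by (auto intro!: exI[of _ "x <|{|M|} a"] exI[of _ "q <|{|P|} a"] simp: fr fc P.ract_add_left M.ract_closed)
 qed
 have fL: "f x : L" if "x .: M" for x
 proof -
  have "f x = f x \<oplus>{|P|} \<zero>{|P|}" using fc[OF that] by simp
  then show ?thesis unfolding L_def using Qc(2) that by blast
 qed
 have QL: "q : L" if "q : Q" for q
 proof -
  have "q = f \<zero>{|M|} \<oplus>{|P|} q" using Qc(1)[OF that] fz by simp
  then show ?thesis unfolding L_def using that by blast
 qed
 define PL where "PL = P(|carrier := L|)"
 have PLs: "carrier PL = L" "ract PL = ract P" "add PL = add P" "\<zero>{|PL|} = \<zero>{|P|}" by (simp_all add: PL_def)
 interpret PL: right_module A PL unfolding PL_def by (rule P.right_module_sub[OF L])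
 interpret TL: tensor_pair A PL C by (rule tp[OF PL.is_rmod])
 have inc: "id : rmod_hom A PL P" unfolding PL_def by (rule rmod_hom_incl(2)) (rule submod_subset[OF L])+
 have fPL: "f : rmod_hom A M PL" using fL fa fr by (auto simp: rmod_hom_def PLs)
 note incm = tmap_add_maps[OF TL.is_pair TP.is_pair inc lmod_hom_id]
 note fm = tmap_add_maps[OF TM.is_pair TL.is_pair fPL lmod_hom_id]
 let ?TL = "TG A PL C" and ?TP = "TG A P C" and ?TM = "TG A M C"
 interpret TLg: abelian_group ?TL by (rule TL.ab_tensor)
 interpret TPg: abelian_group ?TP by (rule TP.ab_tensor)
 have QLs: "Q <= carrier PL" using QL PLs by blast
 \<comment> \<open>An element spanned by Q in P (x) C has a counterpart spanned by Q in L (x) C,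
   where it can be compared with the image of t.\<close>
 have "EX u:tspan A PL C Q. tmap A P C id id u = v" if "v : tspan A P C Q" for v
  using that
 proof (induction rule: tspan.induct)
  case zero
  then show ?case
   using tspan.zero[of A PL C Q] add_maps_zero[OF TL.ab_tensor TP.ab_tensor incm(1)] by blast
 next
  case (pure x y)
  then show ?case
   using incm(2)[of x y] subsetD[OF QLs, of x] tspan.pure[of x Q y C A PL]
   by (intro bexI[of _ "tensor A PL C x y"]) (simp_all add: id_def)
 next
  case (add v w)
  then obtain a b where ab: "a : tspan A PL C Q" "b : tspan A PL C Q"
   "tmap A P C id id a = v" "tmap A P C id id b = w" by blast
  then show ?case
   using add_maps_add[OF incm(1), of a b] TL.tspan_closed[OF _ QLs] tspan.add[OF ab(1,2)]
   by (intro bexI[of _ "a \<oplus>{|?TL|} b"]) (simp_all add: id_def)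
 qed
 then obtain u where u: "u : tspan A PL C Q" "tmap A P C id id u = tmap A P C f id t"
  using tQ by blast
 have uc: "u .: ?TL" by (rule TL.tspan_closed[OF u(1) QLs])
 define tL where "tL = tmap A PL C f id t"
 have tLc: "tL .: ?TL" unfolding tL_def by (rule add_maps_closed[OF fm(1) t])
 have "tmap A P C id id tL = tmap A P C f id t"
  unfolding tL_def
  by (rule tensor_map_comp[OF TM.is_pair TL.is_pair TP.is_pair
    fPL lmod_hom_id inc lmod_hom_id f lmod_hom_id _ _ t]) simp_all
 then have "tmap A P C id id (tL \<ominus>{|?TL|} u) = \<zero>{|?TP|}"
  using add_maps_minus[OF TL.ab_tensor TP.ab_tensor incm(1) tLc uc] u(2)
   add_maps_closed[OF incm(1) uc] by (simp add: abelian_group.diff_zero_iff[OF TP.ab_tensor])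
 then have "tL \<ominus>{|?TL|} u = \<zero>{|?TL|}"
  using sub_injective[OF P L, of "tL \<ominus>{|?TL|} u"] tLc uc TLg.minus_closed unfolding PL_def by blast
 then have tu: "tL = u" using tLc uc by (simp add: abelian_group.diff_zero_iff[OF TL.ab_tensor])
 define S where "S = tspan A M C f'"
 have S: "additive_subgroup S ?TM" unfolding S_def by (rule TM.tspan_subgroup_submod[OF f'])
 let ?G = "quot_group ?TM S"
 have G: "abelian_group ?G" by (rule abelian_quot_group[OF TM.ab_tensor S])
 note pr = quot_proj_add_maps[OF TM.ab_tensor S]
  and pr0 = quot_proj_zero_iff[OF TM.ab_tensor S]
 interpret TMg: abelian_group ?TM by (rule TM.ab_tensor)
 interpret Gg: abelian_group ?G by (rule G)
 have "ALL y:L. EX x q. x .: M & q : Q & y = f x \<oplus>{|P|} q" unfolding L_def by blast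
 then obtain xx qq where xq: "!!y. y : L ==> xx y .: M" "!!y. y : L ==> qq y : Q"
  "!!y. y : L ==> y = f (xx y) \<oplus>{|P|} qq y" by metis
 \<comment> \<open>The value at y = f x + q is the class of x (x) c for a chosen x;
   \<open>key\<close> shows that the choice does not matter.\<close>
 define b where "b y c = quot_proj ?TM S (tensor A M C (xx y) c)" for y c
 have key: "b y c = quot_proj ?TM S (tensor A M C x c)"
  if x: "x .: M" and q: "q : Q" and c: "c .: C" and y: "y = f x \<oplus>{|P|} q" for x q c y
 proof -
  have yL: "y : L" unfolding L_def y using x q by blast
  note Y = xq[OF yL]
  have cc: "f x .: P" "q .: P" "f (xx y) .: P" "qq y .: P"
   using x q Y(1,2) fc Qc(1) by auto
  have e: "f x \<oplus>{|P|} q = f (xx y) \<oplus>{|P|} qq y" using Y(3) y by simp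
  have "f (xx y \<ominus>{|M|} x) = f (xx y) \<ominus>{|P|} f x"
   by (rule add_maps_minus[OF M.ab P.ab rmod_hom_add_maps[OF f] Y(1) x])
  also have "... = q \<ominus>{|P|} qq y"
   by (rule P.diff_eq_diff[OF cc e])
  finally have "xx y \<ominus>{|M|} x : f'"
   unfolding f'_def using submod_minus[OF P.ab Q q Y(2)] Y(1) x by simp
  then have "tensor A M C (xx y \<ominus>{|M|} x) c : S" unfolding S_def by (rule tspan.pure[OF _ c])
  then have "tensor A M C (xx y) c \<ominus>{|?TM|} tensor A M C x c : S"
   using add_maps_minus[OF M.ab TM.ab_tensor TM.tensor_left_add_maps[OF c] Y(1) x] by simp
  moreover have tc: "tensor A M C (xx y) c .: ?TM" "tensor A M C x c .: ?TM"
   using Y(1) x c by (simp_all add: TM.tensor_closed)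
  ultimately have "quot_proj ?TM S (tensor A M C (xx y) c) \<ominus>{|?G|} quot_proj ?TM S (tensor A M C x c) = \<zero>{|?G|}"
   using add_maps_minus[OF TM.ab_tensor G pr tc] pr0[OF TMg.minus_closed[OF tc]] by simp
  then show ?thesis
   unfolding b_def using add_maps_closed[OF pr] tc by (simp add: abelian_group.diff_zero_iff[OF G])
 qed
 have bal: "balanced A PL C ?G b"
 proof (rule balancedI, unfold PLs, goal_cases)
  case (1 y c)
  then show ?case
   unfolding b_def using xq(1)[of y] by (intro add_maps_closed[OF pr]) (simp add: TM.tensor_closed)
 next
  case (2 y y' c)
  note y = xq[OF 2(1)] and y' = xq[OF 2(2)]
  have "y \<oplus>{|P|} y' = f (xx y \<oplus>{|M|} xx y') \<oplus>{|P|} (qq y \<oplus>{|P|} qq y')"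
   using arg_cong2[OF y(3) y'(3), of "(\<oplus>{|P|})"] y(1,2) y'(1,2) by (simp only: sum4 fa fc Qc(1))
  then have "b (y \<oplus>{|P|} y') c = quot_proj ?TM S (tensor A M C (xx y \<oplus>{|M|} xx y') c)"
   using y y' 2(3) Qc(3) by (intro key) simp_all
  also have "... = b y c \<oplus>{|?G|} b y' c"
   unfolding b_def using y(1) y'(1) 2(3)
   by (subst add_maps_add[OF pr, symmetric]) (simp_all add: TM.tensor_closed TM.tensor_add_left)
  finally show ?case .
 next
  case (3 y c c')
  then show ?case
   unfolding b_def using xq(1)[of y]
   by (subst add_maps_add[OF pr, symmetric]) (simp_all add: TM.tensor_closed TM.tensor_add_right)
 next
  case (4 y r c)
  note y = xq[OF 4(1)]
  have "y <|{|P|} r = f (xx y <|{|M|} r) \<oplus>{|P|} qq y <|{|P|} r"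
   using arg_cong[OF y(3), of "%z. z <|{|P|} r"] y(1,2) 4
   by (simp only: P.ract_add_left fr fc Qc(1))
  then have "b (y <|{|P|} r) c = quot_proj ?TM S (tensor A M C (xx y <|{|M|} r) c)"
   using y 4 Qc(4) by (intro key) (simp_all add: M.ract_closed)
  also have "... = b y (r |>{|C|} c)"
   unfolding b_def using TM.tensor_balanced[of "xx y" r c] y(1) 4 by simp
  finally show ?case .
 qed
 note lift = TL.tensor_lift_add_maps[OF G bal] TL.tensor_lift_tensor[OF G bal]
 let ?\<Psi> = "tensor_lift ?G (case_prod b)"
 have "quot_proj ?TM S t = ?\<Psi> (tmap A PL C f id t)"
 proof (rule TM.tensor_ext[OF pr add_maps_comp[OF fm(1) lift(1)] G t])
  fix x c assume "x .: M" "c .: C"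
  then show "quot_proj ?TM S (tensor A M C x c) = ?\<Psi> (tmap A PL C f id (tensor A M C x c))"
   using key[of x "\<zero>{|P|}" c "f x"] Qc(2) fc by (simp add: fm(2) lift(2) PLs fL)
 qed
 also have "... = ?\<Psi> u" using tu tL_def by simp
 also have "... = \<zero>{|?G|}"
 proof -
  have "?\<Psi> u : {\<zero>{|?G|}}"
  proof (rule TL.tspan_image[OF u(1) QLs lift(1) G])
   show "additive_subgroup {\<zero>{|?G|}} ?G"
    by (rule Gg.additive_subgroupI) (simp_all add: Gg.a_inv_zero)
   fix q c assume q: "q : Q" and c: "c .: C"
   have "b q c = quot_proj ?TM S (tensor A M C \<zero>{|M|} c)"
    by (rule key[of "\<zero>{|M|}" q]) (use q c Qc(1) fz in auto)
   also have "... = \<zero>{|?G|}"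
    using add_maps_zero[OF M.ab TM.ab_tensor TM.tensor_left_add_maps[OF c]]
    add_maps_zero[OF TM.ab_tensor G pr] by simp
   finally show "?\<Psi> (tensor A PL C q c) : {\<zero>{|?G|}}" using q c QLs by (simp add: lift(2) subset_iff)
  qed
  then show ?thesis by simp
 qed
 finally have "t : S" using pr0[OF t] by simp
 then show ?thesis by (simp add: S_def f'_def)
qed

lemma tensor_map_injective:
 assumes "right_module A M" "right_module A P" "f : rmod_hom A M P" "inj_on f (carrier M)"
 shows "inj_on (tmap A P C f id) (carrier (TG A M C))"
proof (rule inj_onI)
 fix s t assume s: "s .: (TG A M C)" and t: "t .: (TG A M C)"
  and st: "tmap A P C f id s = tmap A P C f id t"
 interpret M: right_module A M by fact
 interpret P: right_module A P by fact
 interpret TM: tensor_pair A M C by (rule tp[OF assms(1)])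
 interpret TP: tensor_pair A P C by (rule tp[OF assms(2)])
 interpret TMg: abelian_group "TG A M C" by (rule TM.ab_tensor)
 interpret TPg: abelian_group "TG A P C" by (rule TP.ab_tensor)
 note fm = tmap_add_maps[OF TM.is_pair TP.is_pair assms(3) lmod_hom_id]
 have "tmap A P C f id (s \<ominus>{|TG A M C|} t) = \<zero>{|TG A P C|}"
  using add_maps_minus[OF TM.ab_tensor TP.ab_tensor fm(1) s t] st
   add_maps_closed[OF fm(1) t] by (simp add: abelian_group.diff_zero_iff[OF TP.ab_tensor])
 then have "tmap A P C f id (s \<ominus>{|TG A M C|} t) : tspan A P C {\<zero>{|P|}}"
  by (simp add: tspan.zero)
 from tspan_preimage[OF assms(1-3) P.submod_zero TMg.minus_closed[OF s t] this]
 have "s \<ominus>{|TG A M C|} t : tspan A M C {x : carrier M. f x : {\<zero>{|P|}}}" .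
 moreover have "{x : carrier M. f x : {\<zero>{|P|}}} <= {\<zero>{|M|}}"
  using add_maps_zero[OF M.ab P.ab rmod_hom_add_maps[OF assms(3)]] inj_onD[OF assms(4)] by auto
 ultimately have "s \<ominus>{|TG A M C|} t : tspan A M C {\<zero>{|M|}}" by (rule tspan_mono)
 from TM.tspan_triv[OF this] show "s = t"
  using abelian_group.diff_zero_iff[OF TM.ab_tensor s t] by simp
qed

end

text \<open>A right ideal and A itself are copied into the test type, where the hypothesis applies
  to the inclusion. In A (x) C an element z of J (x) C becomes 1 (x) (contraction of z), so a
  vanishing contraction makes z vanish there, and then in J (x) C.\<close>

lemma left_flat_imp_ideal_flat:
 fixes A :: "('a, 'p) ring_scheme"
 assumes C: "bimodule A A C" and flat: "left_flat TYPE((nat => 'a) set) A C"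
 shows "ideal_flat A C"
 unfolding ideal_flat_def
proof (intro allI impI ballI)
 fix J z
 define R where "R = regular_rmod A"
 define RJ where "RJ = R(|carrier := J|)"
 assume J: "submod A (regular_rmod A) J" and z: "z .: (TG A (regular_rmod A(|carrier := J|)) C)"
  and z0: "tensor_lift C (%(a, c). a |>{|C|} c) z = \<zero>{|C|}"
 interpret C: bimodule A A C by fact
 interpret R: right_module A R unfolding R_def by (rule right_module_regular) (rule C.B.ring_axioms)
 have JR: "submod A R J" using J by (simp add: R_def)
 interpret RJ: right_module A RJ unfolding RJ_def by (rule R.right_module_sub[OF JR])
 have Rs: "carrier R = carrier A" "\<zero>{|R|} = \<zero>{|A|}" "add R = add A" "ract R = (\<otimes>{|A|})"
  "carrier RJ = J" "\<zero>{|RJ|} = \<zero>{|A|}" "add RJ = add A" "ract RJ = (\<otimes>{|A|})"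
  by (simp_all add: R_def RJ_def)
 \<comment> \<open>The copy of a is the singleton of the constant function with value a;
   \<open>dec\<close> reads a off at the argument 0.\<close>
 define enc :: "'a => (nat => 'a) set" where "enc a = {%_. a}" for a
 define dec :: "(nat => 'a) set => 'a" where "dec X = the_elem X 0" for X
 have [simp]: "dec (enc a) = a" for a by (simp add: enc_def dec_def)
 define E :: "'a set => ('a, (nat => 'a) set) rmod" where
  "E U = (|carrier = enc ` U, mult = undefined, one = undefined, zero = enc \<zero>{|A|},
    add = (%X Y. enc (dec X \<oplus>{|A|} dec Y)), ract = (%X a. enc (dec X \<otimes>{|A|} a))|)" for U
 have Es [simp]: "carrier (E U) = enc ` U" "\<zero>{|E U|} = enc \<zero>{|A|}"
  "X \<oplus>{|E U|} Y = enc (dec X \<oplus>{|A|} dec Y)" "X <|{|E U|} a = enc (dec X \<otimes>{|A|} a)" for U X Y a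
  by (simp_all add: E_def)
 have rE: "right_module A (E U)" if U: "submod A R U" for U
 proof -
  note c = submod_closed[OF U, unfolded Rs]
  interpret abelian_group "E U"
  proof (rule abelian_groupI, goal_cases)
   case (6 X)
   then obtain a where "X = enc a" "a : U" by auto
   then show ?case using submod_uminus[OF R.ab U, of a] c(1)
    add_maps_uminus[OF R.ab R.ab rmod_hom_add_maps[OF rmod_hom_id], of a]
    R.l_neg[of a] by (auto intro!: bexI[of _ "\<ominus>{|R|} a"] simp: Rs)
  qed (use c in "auto simp: C.B.a_ac")
  show ?thesis
   by unfold_locales (use c in "auto simp: C.B.l_distr C.B.r_distr C.B.m_assoc")
 qed
 have CR: "submod A R (carrier A)" using R.submod_carrier by (simp add: Rs)
 interpret M: right_module A "E J" by (rule rE[OF JR])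
 interpret M': right_module A "E (carrier A)" by (rule rE[OF CR])
 note tps = tensor_pairI[OF _ C]
 interpret TJ: tensor_pair A RJ C by (rule tps[OF RJ.is_rmod])
 interpret TR: tensor_pair A R C by (rule tps[OF R.is_rmod])
 interpret TM: tensor_pair A "E J" C by (rule tps[OF M.is_rmod])
 interpret TM': tensor_pair A "E (carrier A)" C by (rule tps[OF M'.is_rmod])
 have Jc: "J <= carrier A" using submod_subset[OF JR] by (simp add: Rs)
 have h: "enc : rmod_hom A RJ (E J)" "enc : rmod_hom A R (E (carrier A))" "dec : rmod_hom A (E J) RJ"
  "id : rmod_hom A (E J) (E (carrier A))" "id : rmod_hom A RJ R" "enc : rmod_hom A RJ (E (carrier A))"
  using Jc by (auto simp: rmod_hom_def Rs)
 have "id : lmod_hom A C C" by (rule lmod_hom_id)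
 note m1 = tmap_add_maps[OF TJ.is_pair TM.is_pair h(1) lmod_hom_id]
 note m2 = tmap_add_maps[OF TM.is_pair TM'.is_pair h(4) lmod_hom_id]
 note m3 = tmap_add_maps[OF TJ.is_pair TR.is_pair h(5) lmod_hom_id]
 note m4 = tmap_add_maps[OF TR.is_pair TM'.is_pair h(2) lmod_hom_id]
 note m5 = tmap_add_maps[OF TM.is_pair TJ.is_pair h(3) lmod_hom_id]
 have zc: "z .: (TG A RJ C)" using z by (simp add: RJ_def R_def)
 let ?z' = "tmap A (E J) C enc id z"
 have z'c: "?z' .: (TG A (E J) C)" by (rule add_maps_closed[OF m1(1) zc])
 have inj: "inj_on (tmap A (E (carrier A)) C id id) (carrier (TG A (E J) C))"
  using flat M.is_rmod M'.is_rmod h(4)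
  unfolding left_flat_def by auto
 note cm = C.contract_add_maps[OF JR[unfolded R_def], folded R_def, folded RJ_def]
 have "tmap A R C id id z = tensor A R C \<one>{|A|} (tensor_lift C (%(a, c). a |>{|C|} c) z)"
 proof (rule TJ.tensor_ext[OF m3(1) add_maps_comp[OF cm(1) TR.tensor_right_add_maps] TR.ab_tensor zc])
  show "\<one>{|A|} .: R" by (simp add: Rs)
  fix a c assume a: "a .: RJ" and c: "c .: C"
  then have "a .: A" "a : J" using Jc by (auto simp: Rs)
  then show "tmap A R C id id (tensor A RJ C a c)
    = tensor A R C \<one>{|A|} (tensor_lift C (%(a, c). a |>{|C|} c) (tensor A RJ C a c))"
   using TR.tensor_balanced[of "\<one>{|A|}" a c] c a by (simp add: m3(2) cm(2) Rs)
 qed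
 also have "... = \<zero>{|TG A R C|}"
  using add_maps_zero[OF C.ab TR.ab_tensor TR.tensor_right_add_maps, of "\<one>{|A|}"] z0 by (simp add: Rs)
 finally have zR: "tmap A R C id id z = \<zero>{|TG A R C|}" .
 have "tmap A (E (carrier A)) C id id ?z' = tmap A (E (carrier A)) C enc id z"
  by (rule tensor_map_comp[OF TJ.is_pair TM.is_pair TM'.is_pair
    h(1) lmod_hom_id h(4) lmod_hom_id h(6) lmod_hom_id _ _ zc]) simp_all
 also have "... = tmap A (E (carrier A)) C enc id (tmap A R C id id z)"
  by (rule tensor_map_comp[OF TJ.is_pair TR.is_pair TM'.is_pair
    h(5) lmod_hom_id h(2) lmod_hom_id h(6) lmod_hom_id _ _ zc, symmetric]) simp_all
 also have "... = \<zero>{|TG A (E (carrier A)) C|}"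
  unfolding zR by (rule add_maps_zero[OF TR.ab_tensor TM'.ab_tensor m4(1)])
 finally have "?z' = \<zero>{|TG A (E J) C|}"
  using inj_onD[OF inj, of ?z' "\<zero>{|TG A (E J) C|}"] z'c
   add_maps_zero[OF TM.ab_tensor TM'.ab_tensor m2(1)]
   abelian_monoid.zero_closed[OF abelian_group.axioms(1)[OF TM.ab_tensor]] by simp
 moreover have "tmap A RJ C dec id ?z' = tmap A RJ C id id z"
  by (rule tensor_map_comp[OF TJ.is_pair TM.is_pair TJ.is_pair
    h(1) lmod_hom_id h(3) lmod_hom_id rmod_hom_id lmod_hom_id _ _ zc]) simp_all
 moreover have "tmap A RJ C id id z = z" by (rule tensor_map_ident[OF TJ.is_pair zc]) simp_all
 ultimately have "z = \<zero>{|TG A RJ C|}"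
  using add_maps_zero[OF TM.ab_tensor TJ.ab_tensor m5(1)] by simp
 then show "z = \<zero>{|TG A (regular_rmod A(|carrier := J|)) C|}" by (simp add: RJ_def R_def)
qed

section \<open>Coactions, slices, matrix coefficients and cofree comodules\<close>

definition precomod ::
  "('a, 'p) ring_scheme => ('a, 'c, 'q) coring_scheme => ('a, 'c, 'm, 's) comod_scheme => bool" where
 "precomod A C M \<longleftrightarrow> right_module A M & coact M : add_maps M (TG A M C)"

text \<open>These are the sets that become carriers of subcomodules once C is flat
  (\<open>stable_subcomodule\<close>); no coaction on W itself is mentioned.\<close>

definition stable ::
  "('a, 'p) ring_scheme => ('a, 'c, 'q) coring_scheme => ('a, 'c, 'm, 's) comod_scheme => 'm set => bool" where
 "stable A C M W \<longleftrightarrow> submod A M W & (ALL x:W. coact M x : tspan A M C W)"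

lemma right_comodule_precomod: "right_comodule A C M ==> precomod A C M"
 unfolding precomod_def right_comodule_def right_comodule_axioms_def rmod_hom_iff by simp

lemma precomod_module: "precomod A C M ==> right_module A M"
 by (simp add: precomod_def)

lemma precomod_coact:
 "precomod A C M ==> x .: M ==> coact M x .: (TG A M C)"
 unfolding precomod_def by (elim conjE) (rule add_maps_closed)

lemma comod_hom_rmod: "f : comod_hom A C M N ==> f : rmod_hom A M N"
 by (simp add: comod_hom_def)

lemma comod_hom_coact:
 "f : comod_hom A C M N ==> x .: M ==> tmap A N C f id (coact M x) = coact N (f x)"
 by (simp add: comod_hom_def)

lemma comod_homI:
 assumes "f : rmod_hom A M N"
  "!!x. x .: M ==> tmap A N C f id (coact M x) = coact N (f x)"
 shows "f : comod_hom A C M N"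
 using assms by (simp add: comod_hom_def)

text \<open>The map id (x) l from M (x) C to M (x) A = M, for a left linear l. Applied to a coaction
  it is the action of the left dual of C on M.\<close>

definition slice :: "('a, 'm, 's) rmod_scheme => ('c => 'a) => ('m \<times> 'c \<Rightarrow>\<^sub>0 int) set => 'm" where
 "slice M l = tensor_lift M (%(x, c). x <|{|M|} l c)"

definition left_forms ::
  "('a, 'p) ring_scheme => ('a, 'a, 'c, 'q) bimod_scheme => ('c => 'a) set" where
 "left_forms A C = {l : add_maps C A. ALL a:carrier A. ALL c:carrier C. l (a |>{|C|} c) = a \<otimes>{|A|} l c}"

text \<open>The map \<psi> (x) id from M (x) C to A (x) C = C. Composed with a coaction it produces
  matrix coefficients.\<close>

definition contr ::
  "('a, 'a, 'c, 'q) bimod_scheme => ('m => 'a) => ('m \<times> 'c \<Rightarrow>\<^sub>0 int) set => 'c" where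
 "contr C \<psi> = tensor_lift C (%(x, c). \<psi> x |>{|C|} c)"

context
 fixes A :: "('a, 'p) ring_scheme" and C :: "('a, 'a, 'c, 'q) bimod_scheme"
  and M :: "('a, 'm, 's) rmod_scheme"
 assumes C: "bimodule A A C" and M: "right_module A M"
begin

interpretation C: bimodule A A C by (rule C)
interpretation M: right_module A M by (rule M)
interpretation TM: tensor_pair A M C by (rule tensor_pairI[OF M C])

lemma slice_add_maps:
 assumes l: "l : left_forms A C"
 shows "slice M l : add_maps (TG A M C) M"
  and "[|x .: M; c .: C|] ==> slice M l (tensor A M C x c) = x <|{|M|} l c"
proof -
 have l1: "l : add_maps C A" and l2: "!!a c. [|a .: A; c .: C|] ==> l (a |>{|C|} c) = a \<otimes>{|A|} l c"
  using l by (simp_all add: left_forms_def)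
 have b: "balanced A M C M (%x c. x <|{|M|} l c)"
  by (rule balancedI) (simp_all add: add_maps_closed[OF l1] add_maps_add[OF l1] l2 M.ract_closed
    M.ract_add_left M.ract_add_right M.ract_mult)
 show "slice M l : add_maps (TG A M C) M"
  unfolding slice_def by (rule TM.tensor_lift_add_maps[OF M.ab b])
 show "[|x .: M; c .: C|] ==> slice M l (tensor A M C x c) = x <|{|M|} l c"
  unfolding slice_def by (rule TM.tensor_lift_tensor[OF M.ab b])
qed

lemma slice_tspan:
 assumes "l : left_forms A C" "submod A M W" "t : tspan A M C W"
 shows "slice M l t : W"
proof (rule TM.tspan_image[OF assms(3) submod_subset[OF assms(2)] slice_add_maps(1)[OF assms(1)] M.ab
   submod_subgroup[OF assms(2)]])
 fix x c assume "x : W" "c .: C"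
 then show "slice M l (tensor A M C x c) : W"
  using submod_closed[OF assms(2)] slice_add_maps(2)[OF assms(1)] assms(1) add_maps_closed[of l C A c]
  by (simp add: left_forms_def)
qed

lemma contr_add_maps:
 assumes psi: "\<psi> : rmod_hom A M (regular_rmod A)"
 shows "contr C \<psi> : add_maps (TG A M C) C"
  and "[|x .: M; c .: C|] ==> contr C \<psi> (tensor A M C x c) = \<psi> x |>{|C|} c"
  and "contr C \<psi> : rmod_hom A (TR A M C) C"
proof -
 note p = rmod_hom_closed[OF psi, simplified] rmod_hom_add[OF psi, simplified] rmod_hom_ract[OF psi, simplified]
 have b: "balanced A M C C (%x c. \<psi> x |>{|C|} c)"
  by (rule balancedI) (simp_all add: p C.lact_closed C.lact_add_left C.lact_add_right C.lact_mult)
 show 1: "contr C \<psi> : add_maps (TG A M C) C"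
  unfolding contr_def by (rule TM.tensor_lift_add_maps[OF C.ab b])
 show 2: "contr C \<psi> (tensor A M C x c) = \<psi> x |>{|C|} c" if "x .: M" "c .: C" for x c
  unfolding contr_def by (rule TM.tensor_lift_tensor[OF C.ab b that])
 have "contr C \<psi> (t <|{|TR A M C|} a) = contr C \<psi> t <|{|C|} a"
  if "t .: (TG A M C)" and a: "a .: A" for t a
  by (rule TM.tensor_ext[OF add_maps_comp[OF tensor_ract(1)[OF TM.is_pair C a] 1]
    add_maps_comp[OF 1 C.ract_add_maps[OF a]] C.ab that(1)])
   (simp_all add: tensor_ract(2)[OF TM.is_pair C a] 2 C.ract_closed a C.lact_ract p)
 then show "contr C \<psi> : rmod_hom A (TR A M C) C" using 1 by (simp add: rmod_hom_iff)
qed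

end

lemma slice_natural:
 assumes C: "bimodule A A C" and M: "right_module A M" and N: "right_module A N"
  and f: "f : rmod_hom A M N" and l: "l : left_forms A C" and t: "t .: (TG A M C)"
 shows "slice N l (tmap A N C f id t) = f (slice M l t)"
proof -
 interpret TM: tensor_pair A M C by (rule tensor_pairI[OF M C])
 interpret TN: tensor_pair A N C by (rule tensor_pairI[OF N C])
 note fm = tmap_add_maps[OF TM.is_pair TN.is_pair f lmod_hom_id]
 note sM = slice_add_maps[OF C M l] and sN = slice_add_maps[OF C N l]
 have lc: "l c .: A" if "c .: C" for c
  using that l add_maps_closed[of l C A] by (simp add: left_forms_def)
 show ?thesis
  by (rule TM.tensor_ext[OF add_maps_comp[OF fm(1) sN(1)] add_maps_comp[OF sM(1) rmod_hom_add_maps[OF f]]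
    right_module_ab[OF N] t])
   (simp_all add: fm(2) sM(2) sN(2) rmod_hom_closed[OF f] rmod_hom_ract[OF f] lc)
qed

lemma regular_comod_simps [simp]:
 "carrier (regc C) = carrier C" "\<zero>{|regc C|} = \<zero>{|C|}"
 "(\<oplus>{|regc C|}) = (\<oplus>{|C|})" "ract (regc C) = ract C" "coact (regc C) = comult C"
 by (simp_all add: regular_comod_def)

lemma tensor_regular_comod [simp]:
 "TG R (regc C) N = TG R C N" "tensor R (regc C) N = tensor R C N"
 "TR R (regc C) N = TR R C N" "tmap R (regc C) N = tmap R C N"
 by (rule tensor_cong_left; simp)+

lemma tensor_assoc_regular_comod [simp]:
 "tensor_assoc R (regc C) N P = tensor_assoc R C N P"
 by (rule tensor_assoc_cong_left; simp)

lemma homs_regular_comod [simp]: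
 "rmod_hom A M (regc C) = rmod_hom A M C" "rmod_hom A (regc C) M = rmod_hom A C M"
 by (simp_all add: rmod_hom_def)

text \<open>The cofree comodule on M: the comultiplication acts on the second factor of M (x)
  C.\<close>

definition tensor_comod ::
  "('a, 'p) ring_scheme => ('a, 'c, 'q) coring_scheme => ('a, 'm, 's) rmod_scheme
   => ('a, 'c, ('m \<times> 'c \<Rightarrow>\<^sub>0 int) set) comod" where
 "tensor_comod A C M =
  (let T = TR A M C in
   (|carrier = carrier T, mult = undefined, one = undefined, zero = \<zero>{|T|}, add = (\<oplus>{|T|}),
    ract = ract T,
    coact = (%t. tensor_unassoc A M C C (tmap A M (TB A C C) id (comult C) t))|))"

lemma tensor_comod_simps [simp]:
 "carrier (tensor_comod A C M) = carrier (TG A M C)"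
 "\<zero>{|tensor_comod A C M|} = \<zero>{|TG A M C|}"
 "(\<oplus>{|tensor_comod A C M|}) = (\<oplus>{|TG A M C|})"
 "ract (tensor_comod A C M) = ract (TR A M C)"
 "coact (tensor_comod A C M) t = tensor_unassoc A M C C (tmap A M (TB A C C) id (comult C) t)"
 by (simp_all add: tensor_comod_def Let_def)

lemma tensor_tensor_comod [simp]:
 "TG R (tensor_comod A C M) N = TG R (TR A M C) N"
 "tensor R (tensor_comod A C M) N = tensor R (TR A M C) N"
 "TR R (tensor_comod A C M) N = TR R (TR A M C) N"
 "tmap R (tensor_comod A C M) N = tmap R (TR A M C) N"
 by (rule tensor_cong_left; simp)+

lemma homs_tensor_comod [simp]:
 "rmod_hom A N (tensor_comod A C M) = rmod_hom A N (TR A M C)"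
 "rmod_hom A (tensor_comod A C M) N = rmod_hom A (TR A M C) N"
 by (simp_all add: rmod_hom_def)

context coring begin

lemma bim: "bimodule A A C" by (rule bimodule_axioms)

lemma tpM: "right_module A M ==> tensor_pair A M C" by (rule tensor_pairI[OF _ bim])

lemma comult_rmod_hom: "comult C : rmod_hom A C (TR A C C)"
 using comult_hom by (simp add: bimod_hom_iff rmod_hom_def)

lemma comult_lmod_hom: "comult C : lmod_hom A C (TB A C C)"
 using comult_hom by (simp add: bimod_hom_iff)

lemma counit_left_form: "counit C : left_forms A C"
 using rmod_hom_add_maps[OF counit_right_linear] counit_left_linear
 by (simp add: left_forms_def add_maps_def)

lemma triple: "right_module A M ==> tensor_triple A M C C"
 by (simp add: tensor_triple_def bim)

lemma regular_comodule: "right_comodule A C (regc C)"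
proof -
 interpret R: abelian_group "regc C"
  by (rule abelian_group_transfer[OF ab]) simp_all
 have rm: "right_module A (regc C)"
  by unfold_locales (simp_all add: ract_closed ract_add_left ract_add_right ract_mult ract_one)
 show ?thesis
 proof (unfold_locales, simp_all add: ract_closed ract_add_left ract_add_right ract_mult ract_one
   comult_rmod_hom coassociative)
  fix x assume "x .: C"
  then have "slice C (counit C) (comult C x) = x" unfolding slice_def by (rule counit_right)
  \<comment> \<open>\<open>tensor_lift\<close> depends on the target record, and \<open>C\<close>
    and \<open>regc C\<close> are different records with the same addition; the two slices are
    compared on pure tensors.\<close>
  moreover have "slice (regc C) (counit C) (comult C x) = slice C (counit C) (comult C x)"
  proof (rule tensor_pair.tensor_ext[OF tpM[OF is_rmod] _ _ ab])
   show "comult C x .: (TG A C C)"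
    using rmod_hom_closed[OF comult_rmod_hom \<open>x : carrier C\<close>] by simp
   show "slice C (counit C) : add_maps (TG A C C) C"
    by (rule slice_add_maps(1)[OF bim is_rmod counit_left_form])
   show "slice (regc C) (counit C) : add_maps (TG A C C) C"
    using slice_add_maps(1)[OF bim rm counit_left_form] by (simp add: add_maps_def)
   show "slice (regc C) (counit C) (tensor A C C y c) = slice C (counit C) (tensor A C C y c)"
    if "y .: C" "c .: C" for y c
    using slice_add_maps(2)[OF bim rm counit_left_form, of y c]
    slice_add_maps(2)[OF bim is_rmod counit_left_form, of y c] that by simp
  qed
  ultimately show "tensor_lift (regc C) (%(y, c). y <| counit C c) (comult C x) = x"
   by (simp add: slice_def)
 qed
qed

lemma comodule_coact_closed:
 "right_comodule A C M ==> x .: M ==> coact M x .: (TG A M C)"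
 using right_comodule_precomod add_maps_closed unfolding precomod_def by metis

lemma comodule_counit:
 "right_comodule A C M ==> x .: M ==> slice M (counit C) (coact M x) = x"
 by (simp add: slice_def right_comodule.coact_counital)

text \<open>The cofree comodule is the reason for \<open>precomod\<close>: stability and colinear
  maps make sense for a merely additive coaction, so M (x) C can be used without a proof of the
  comodule axioms for it.\<close>

lemma precomod_tensor_comod:
 assumes M: "right_module A M" shows "precomod A C (tensor_comod A C M)"
proof -
 interpret X: tensor_triple A M C C by (rule triple[OF M])
 interpret T: right_module A "TR A M C" by (rule X.rMN)
 interpret T': abelian_group "tensor_comod A C M"
  by (rule abelian_group_transfer[OF T.ab]) simp_all
 have "right_module A (tensor_comod A C M)"
  by unfold_locales (use T.ract_closed T.ract_add_left T.ract_add_right T.ract_mult T.ract_one in simp_all)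
 moreover have "(%t. tensor_unassoc A M C C (tmap A M (TB A C C) id (comult C) t))
   : add_maps (TG A M C) (TG A (TR A M C) C)"
  by (rule add_maps_comp[OF tmap_add_maps(1)[OF X.tpMN X.tp2 rmod_hom_id comult_lmod_hom]
    X.tensor_unassoc_add_maps])
 moreover have "add_maps (tensor_comod A C M) G = add_maps (TG A M C) G" for G :: "'g ring"
  by (simp add: add_maps_def)
 ultimately show ?thesis unfolding precomod_def add_maps_def by (simp add: Pi_iff)
qed

text \<open>This is coassociativity, read through \<open>tensor_unassoc\<close>.\<close>

lemma coact_comod_hom:
 assumes M: "right_comodule A C M" shows "coact M : comod_hom A C M (tensor_comod A C M)"
proof (rule comod_homI)
 interpret M: right_comodule A C M by fact
 interpret X: tensor_triple A M C C by (rule triple[OF M.is_rmod])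
 show "coact M : rmod_hom A M (tensor_comod A C M)" using M.coact_hom by simp
 fix x assume x: "x .: M"
 note c = comodule_coact_closed[OF M x]
 have "tmap A (TR A M C) C (coact M) id (coact M x) .: X.T1"
  by (rule add_maps_closed[OF tmap_add_maps(1)[OF X.tpMN X.tp1 M.coact_hom lmod_hom_id] c])
 then show "tmap A (tensor_comod A C M) C (coact M) id (coact M x) = coact (tensor_comod A C M) (coact M x)"
  using X.unassoc_assoc M.coact_coassociative[OF x] by (metis tensor_comod_simps(5) tensor_tensor_comod(4))
qed

lemma unassoc_natural_right:
 assumes M: "right_module A M" and T: "right_module A T" and u: "u .: M" and k: "k : rmod_hom A T C"
  and s: "s .: (TG A T C)"
 shows "tmap A (TR A M C) C (%t. tensor A M C u (k t)) id s
  = tensor_unassoc A M C C (tensor A M (TB A C C) u (tmap A C C k id s))"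
  and "(%t. tensor A M C u (k t)) : rmod_hom A T (TR A M C)"
proof -
 interpret X: tensor_triple A M C C by (rule triple[OF M])
 interpret TM: tensor_pair A M C by (rule tpM[OF M])
 interpret TT: tensor_pair A T C by (rule tpM[OF T])
 interpret X2: tensor_pair A M "TB A C C" by (rule X.tp2)
 note kc = rmod_hom_closed[OF k] rmod_hom_add[OF k] rmod_hom_ract[OF k]
 show g: "(%t. tensor A M C u (k t)) : rmod_hom A T (TR A M C)"
  unfolding rmod_hom_iff using u
  by (auto simp: kc TM.tensor_closed TM.tensor_add_right tensor_ract(2)[OF X.tpMN bim] intro!: add_mapsI)
 note m1 = tmap_add_maps[OF TT.is_pair X.tp1 g lmod_hom_id]
  and m2 = tmap_add_maps[OF TT.is_pair X.tpNP k lmod_hom_id]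
 have r: "(%y. tensor A M (TB A C C) u y) : add_maps (TG A C C) X.T2"
  using X2.tensor_right_add_maps[OF u] by simp
 show "tmap A (TR A M C) C (%t. tensor A M C u (k t)) id s
  = tensor_unassoc A M C C (tensor A M (TB A C C) u (tmap A C C k id s))"
  by (rule TT.tensor_ext[OF m1(1) add_maps_comp[OF add_maps_comp[OF m2(1) r] X.tensor_unassoc_add_maps] X.ab1 s])
   (simp_all add: m1(2) m2(2) X.tensor_unassoc_tensor u kc)
qed

text \<open>Since pure tensors generate M (x) C, these maps show that M (x) C is a sum of images of
  simple comodules as soon as C is one; see \<open>coact_lifts\<close>.\<close>

lemma tensor_comod_hom:
 assumes M: "right_module A M" and T: "precomod A C T" and u: "u .: M"
  and k: "k : comod_hom A C T (regc C)"
 shows "(%t. tensor A M C u (k t)) : comod_hom A C T (tensor_comod A C M)"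
proof (rule comod_homI)
 note T' = precomod_module[OF T] and c = precomod_coact[OF T]
 have k': "k : rmod_hom A T C" using comod_hom_rmod[OF k] by simp
 interpret X: tensor_triple A M C C by (rule triple[OF M])
 note n = unassoc_natural_right[OF M T' u k']
 show "(%t. tensor A M C u (k t)) : rmod_hom A T (tensor_comod A C M)"
  using n(2)[OF abelian_monoid.zero_closed[OF abelian_group.axioms(1)[OF tensor_pair.ab_tensor[OF tpM[OF T']]]]]
  by simp
 fix t assume t: "t .: T"
 have "tmap A C C k id (coact T t) = comult C (k t)" using comod_hom_coact[OF k t] by simp
 then show "tmap A (tensor_comod A C M) C (%t. tensor A M C u (k t)) id (coact T t)
   = coact (tensor_comod A C M) (tensor A M C u (k t))"
  using n(1)[OF c[OF t]] tmap_add_maps(2)[OF X.tpMN X.tp2 rmod_hom_id comult_lmod_hom u, of "k t"]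
   rmod_hom_closed[OF k' t] by simp
qed

text \<open>Colinearity rests on left linearity of the comultiplication: both sides send x (x) c to
  \<psi>(x) acting on the comultiplication of c.\<close>

lemma contr_comod_hom:
 assumes M: "right_module A M" and psi: "\<psi> : rmod_hom A M (regular_rmod A)"
 shows "contr C \<psi> : comod_hom A C (tensor_comod A C M) (regc C)"
proof (rule comod_homI)
 interpret X: tensor_triple A M C C by (rule triple[OF M])
 interpret TM: tensor_pair A M C by (rule tpM[OF M])
 interpret CC: tensor_pair A C C by (rule X.tpNP)
 interpret X2: tensor_pair A M "TB A C C" by (rule X.tp2)
 note ct = contr_add_maps[OF bim M psi]
 show "contr C \<psi> : rmod_hom A (tensor_comod A C M) (regc C)" using ct(3) by simp
 note m1 = tmap_add_maps[OF X.tp1 X.tpNP ct(3) lmod_hom_id]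
 note m2 = tmap_add_maps[OF X.tpMN X.tp2 rmod_hom_id comult_lmod_hom]
 have pc: "!!x. x .: M ==> \<psi> x .: A" using rmod_hom_closed[OF psi] by simp
 have inner: "tmap A C C (contr C \<psi>) id (tensor_unassoc A M C C (tensor A M (TB A C C) x s))
   = \<psi> x |>{|TB A C C|} s" if x: "x .: M" and s: "s .: (TG A C C)" for x s
 proof -
  have r: "(%y. tensor A M (TB A C C) x y) : add_maps (TG A C C) X.T2"
   using X2.tensor_right_add_maps[OF x] by simp
  show ?thesis
   by (rule CC.tensor_ext[OF add_maps_comp[OF add_maps_comp[OF r X.tensor_unassoc_add_maps] m1(1)]
    tensor_lact(1)[OF bim bim pc[OF x]] CC.ab_tensor s])
    (simp_all add: x X.tensor_unassoc_tensor m1(2) TM.tensor_closed ct(2) tensor_lact(2)[OF bim bim pc[OF x]])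
 qed
 fix t assume "t .: (tensor_comod A C M)"
 then have t: "t .: (TG A M C)" by simp
 have "tmap A C C (contr C \<psi>) id (tensor_unassoc A M C C (tmap A M (TB A C C) id (comult C) t))
   = comult C (contr C \<psi> t)"
 proof (rule TM.tensor_ext[OF add_maps_comp[OF add_maps_comp[OF m2(1) X.tensor_unassoc_add_maps] m1(1)]
    add_maps_comp[OF ct(1) ] CC.ab_tensor t])
  show "comult C : add_maps C (TG A C C)" using rmod_hom_add_maps[OF comult_rmod_hom] by simp
  fix x c assume x: "x .: M" and c: "c .: C"
  have dc: "comult C c .: (TG A C C)" using rmod_hom_closed[OF comult_rmod_hom c] by simp
  show "tmap A C C (contr C \<psi>) id (tensor_unassoc A M C C (tmap A M (TB A C C) id (comult C) (tensor A M C x c)))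
   = comult C (contr C \<psi> (tensor A M C x c))"
   using lmod_hom_lact[OF comult_lmod_hom pc[OF x] c] by (simp add: m2(2) x c inner dc ct(2))
 qed
 then show "tmap A (regc C) C (contr C \<psi>) id (coact (tensor_comod A C M) t)
   = coact (regc C) (contr C \<psi> t)" by simp
qed

lemma comod_hom_comp:
 assumes M: "precomod A C M" and N: "right_module A N" and P: "right_module A P"
  and f: "f : comod_hom A C M N" and g: "g : comod_hom A C N P"
 shows "(%x. g (f x)) : comod_hom A C M P"
proof (rule comod_homI)
 note fr = comod_hom_rmod[OF f] and gr = comod_hom_rmod[OF g]
 show gf: "(%x. g (f x)) : rmod_hom A M P" by (rule rmod_hom_comp[OF fr gr])
 fix x assume x: "x .: M"
 have c: "coact M x .: (TG A M C)" by (rule precomod_coact[OF M x])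
 have "tmap A P C (%x. g (f x)) id (coact M x) = tmap A P C g id (tmap A N C f id (coact M x))"
  by (rule tensor_map_comp[OF tpM[OF precomod_module[OF M]] tpM[OF N] tpM[OF P] fr lmod_hom_id gr lmod_hom_id
    gf lmod_hom_id _ _ c, symmetric]) simp_all
 also have "... = coact P (g (f x))"
  using comod_hom_coact[OF f x] comod_hom_coact[OF g rmod_hom_closed[OF fr x]] by simp
 finally show "tmap A P C (%x. g (f x)) id (coact M x) = coact P (g (f x))" .
qed

lemma comod_hom_id:
 assumes "precomod A C M" shows "id : comod_hom A C M M"
proof (rule comod_homI[OF rmod_hom_id])
 fix x assume "x .: M"
 from tensor_map_ident[OF tpM[OF precomod_module[OF assms]] precomod_coact[OF assms this], of id id]
 show "tmap A M C id id (coact M x) = coact M (id x)" by simp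
qed

lemma comod_hom_cong:
 assumes M: "precomod A C M" and N: "right_module A N" and f: "f : comod_hom A C M N"
  and e: "!!x. x .: M ==> f x = g x"
 shows "g : comod_hom A C M N"
proof (rule comod_homI)
 interpret M: right_module A M by (rule precomod_module[OF M])
 note fr = comod_hom_rmod[OF f]
 show gr: "g : rmod_hom A M N"
  using fr e M.ract_closed M.a_closed unfolding rmod_hom_def by (auto simp: Pi_iff)
 fix x assume x: "x .: M"
 have c: "coact M x .: (TG A M C)" by (rule precomod_coact[OF M x])
 note tps = tpM[OF M.is_rmod] tpM[OF N]
 note m1 = tmap_add_maps[OF tps gr lmod_hom_id] and m2 = tmap_add_maps[OF tps fr lmod_hom_id]
 have "tmap A N C g id (coact M x) = tmap A N C f id (coact M x)"
  by (rule tensor_pair.tensor_ext[OF tps(1) m1(1) m2(1) tensor_pair.ab_tensor[OF tps(2)] c])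
   (simp add: m1(2) m2(2) e)
 then show "tmap A N C g id (coact M x) = coact N (g x)" using comod_hom_coact[OF f x] e[OF x] by simp
qed

lemma comod_hom_minus:
 assumes M: "precomod A C M" and N: "precomod A C N"
  and f: "f : comod_hom A C M N" and g: "g : comod_hom A C M N"
 shows "(%x. f x \<ominus>{|N|} g x) : comod_hom A C M N"
proof (rule comod_homI)
 interpret M: right_module A M by (rule precomod_module[OF M])
 interpret N: right_module A N by (rule precomod_module[OF N])
 note fr = comod_hom_rmod[OF f] and gr = comod_hom_rmod[OF g]
 note tps = tpM[OF M.is_rmod] tpM[OF N.is_rmod]
 have um: "(%x. f x \<ominus>{|N|} g x) : add_maps M N"
  unfolding N.minus_eq
  by (rule add_maps_plus[OF N.ab rmod_hom_add_maps[OF fr] add_maps_uminus_map[OF N.ab rmod_hom_add_maps[OF gr]]])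
 show hr: "(%x. f x \<ominus>{|N|} g x) : rmod_hom A M N"
  unfolding rmod_hom_iff using um
  by (auto simp: rmod_hom_ract[OF fr] rmod_hom_ract[OF gr] N.minus_eq N.ract_add_left N.ract_uminus_left
    rmod_hom_closed[OF fr] rmod_hom_closed[OF gr])
 fix x assume x: "x .: M"
 have c: "coact M x .: (TG A M C)" by (rule precomod_coact[OF M x])
 note m1 = tmap_add_maps[OF tps fr lmod_hom_id] and m2 = tmap_add_maps[OF tps gr lmod_hom_id]
  and m3 = tmap_add_maps[OF tps hr lmod_hom_id]
 note TN = tensor_pair.ab_tensor[OF tps(2)]
 interpret TNg: abelian_group "TG A N C" by (rule TN)
 have "tmap A N C (%x. f x \<ominus>{|N|} g x) id t
   = tmap A N C f id t \<oplus>{|TG A N C|} \<ominus>{|TG A N C|} tmap A N C g id t"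
  if t: "t .: (TG A M C)" for t
 proof (rule tensor_pair.tensor_ext[OF tps(1) m3(1) add_maps_plus[OF TN m1(1) add_maps_uminus_map[OF TN m2(1)]] TN t])
  fix y d assume yd: "y .: M" "d .: C"
  show "tmap A N C (%x. f x \<ominus>{|N|} g x) id (tensor A M C y d)
   = tmap A N C f id (tensor A M C y d) \<oplus>{|TG A N C|} \<ominus>{|TG A N C|} tmap A N C g id (tensor A M C y d)"
   using add_maps_minus[OF N.ab TN tensor_pair.tensor_left_add_maps[OF tps(2) yd(2)], of "f y" "g y"]
   by (simp add: m1(2)[OF yd] m2(2)[OF yd] m3(2)[OF yd] rmod_hom_closed[OF fr yd(1)] rmod_hom_closed[OF gr yd(1)] TNg.minus_eq)
 qed
 from this[OF c] show "tmap A N C (%x. f x \<ominus>{|N|} g x) id (coact M x) = coact N (f x \<ominus>{|N|} g x)"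
  using comod_hom_coact[OF f x] comod_hom_coact[OF g x] rmod_hom_closed[OF fr x] rmod_hom_closed[OF gr x]
   add_maps_minus[OF N.ab TN, of "coact N" "f x" "g x"] N
  by (simp add: TNg.minus_eq precomod_def)
qed

lemma comod_hom_zero:
 assumes M: "precomod A C M" and N: "precomod A C N"
 shows "(%x. \<zero>{|N|}) : comod_hom A C M N"
proof (rule comod_homI)
 interpret M: right_module A M by (rule precomod_module[OF M])
 interpret N: right_module A N by (rule precomod_module[OF N])
 show zr: "(%x. \<zero>{|N|}) : rmod_hom A M N" by (simp add: rmod_hom_def N.ract_zero_left)
 fix x assume x: "x .: M"
 have c: "coact M x .: (TG A M C)" by (rule precomod_coact[OF M x])
 note tps = tpM[OF M.is_rmod] tpM[OF N.is_rmod]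
 note TN = tensor_pair.ab_tensor[OF tps(2)]
 note m = tmap_add_maps[OF tps zr lmod_hom_id]
 have "tmap A N C (%x. \<zero>{|N|}) id (coact M x) = \<zero>{|TG A N C|}"
  by (rule tensor_pair.tensor_ext[OF tps(1) m(1) add_maps_zero_map[OF TN] TN c])
   (simp add: m(2) add_maps_zero[OF N.ab TN tensor_pair.tensor_left_add_maps[OF tps(2)]])
 then show "tmap A N C (%x. \<zero>{|N|}) id (coact M x) = coact N \<zero>{|N|}"
  using add_maps_zero[OF N.ab TN, of "coact N"] N by (simp add: precomod_def)
qed

lemma comod_hom_inverse:
 assumes M: "precomod A C M" and N: "precomod A C N"
  and f: "f : comod_hom A C M N" and b: "bij_betw f (carrier M) (carrier N)"
 shows "inv_into (carrier M) f : comod_hom A C N M" "bij_betw (inv_into (carrier M) f) (carrier N) (carrier M)"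
proof -
 interpret M: right_module A M by (rule precomod_module[OF M])
 interpret N: right_module A N by (rule precomod_module[OF N])
 let ?g = "inv_into (carrier M) f"
 note fr = comod_hom_rmod[OF f]
 show bg: "bij_betw ?g (carrier N) (carrier M)" by (rule bij_betw_inv_into[OF b])
 have gc: "?g y .: M" and fg: "f (?g y) = y" if "y .: N" for y
  using bij_betw_apply[OF bg that] bij_betw_inv_into_right[OF b that] by simp_all
 have gf: "?g (f x) = x" if "x .: M" for x by (rule bij_betw_inv_into_left[OF b that])
 have gr: "?g : rmod_hom A N M"
  unfolding rmod_hom_def
 proof (intro CollectI conjI ballI)
  show "?g : carrier N \<rightarrow> carrier M" using gc by blast
  fix y assume y: "y .: N"
  { fix z assume z: "z .: N"
   have "f (?g y \<oplus>{|M|} ?g z) = y \<oplus>{|N|} z" using rmod_hom_add[OF fr gc[OF y] gc[OF z]] fg y z by simp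
   then show "?g (y \<oplus>{|N|} z) = ?g y \<oplus>{|M|} ?g z" using gf[of "?g y \<oplus>{|M|} ?g z"] gc y z by simp }
  { fix a assume a: "a .: A"
   have "f (?g y <|{|M|} a) = y <|{|N|} a" using rmod_hom_ract[OF fr gc[OF y] a] fg y by simp
   then show "?g (y <|{|N|} a) = ?g y <|{|M|} a" using gf[of "?g y <|{|M|} a"] gc y a by (simp add: M.ract_closed) }
 qed
 show "?g : comod_hom A C N M"
 proof (rule comod_homI[OF gr])
  fix y assume y: "y .: N"
  have c: "coact M (?g y) .: (TG A M C)"
   by (rule precomod_coact[OF M gc[OF y]])
  note tps = tpM[OF M.is_rmod] tpM[OF N.is_rmod]
  have "tmap A M C ?g id (coact N y) = tmap A M C ?g id (tmap A N C f id (coact M (?g y)))"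
   using comod_hom_coact[OF f gc[OF y]] fg[OF y] by simp
  also have "... = tmap A M C id id (coact M (?g y))"
   by (rule tensor_map_comp[OF tps tps(1) fr lmod_hom_id gr lmod_hom_id rmod_hom_id lmod_hom_id _ _ c])
    (simp_all add: gf)
  also have "... = coact M (?g y)" by (rule tensor_map_ident[OF tps(1) c]) simp_all
  finally show "tmap A M C ?g id (coact N y) = coact M (?g y)" .
 qed
qed

text \<open>One half of the bijection between linear forms on M and colinear maps M -> C;
  composition with the counit leads back. The other composite is \<open>hat_counit\<close>.\<close>

lemma hat_comod_hom:
 assumes M: "right_comodule A C M" and psi: "\<psi> : rmod_hom A M (regular_rmod A)"
 shows "(%x. contr C \<psi> (coact M x)) : comod_hom A C M (regc C)"
  and "x .: M ==> counit C (contr C \<psi> (coact M x)) = \<psi> x"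
proof -
 interpret M: right_comodule A C M by fact
 note pm = precomod_tensor_comod[OF M.is_rmod]
 show "(%x. contr C \<psi> (coact M x)) : comod_hom A C M (regc C)"
  by (rule comod_hom_comp[OF right_comodule_precomod[OF M] precomod_module[OF pm]
    precomod_module[OF right_comodule_precomod[OF regular_comodule]]
    coact_comod_hom[OF M] contr_comod_hom[OF M.is_rmod psi]])
 note ct = contr_add_maps[OF bim M.is_rmod psi]
  and sl = slice_add_maps[OF bim M.is_rmod counit_left_form]
 have e: "counit C : add_maps C A" using rmod_hom_add_maps[OF counit_right_linear] by (simp add: add_maps_def)
 have pa: "\<psi> : add_maps M A" using rmod_hom_add_maps[OF psi] by (simp add: add_maps_def)
 have "counit C (contr C \<psi> t) = \<psi> (slice M (counit C) t)" if t: "t .: (TG A M C)" for t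
  by (rule tensor_pair.tensor_ext[OF tpM[OF M.is_rmod] add_maps_comp[OF ct(1) e]
    add_maps_comp[OF sl(1) pa] B.abelian_group_axioms t])
   (simp add: ct(2) sl(2) counit_left_linear add_maps_closed[OF pa] rmod_hom_ract[OF psi] add_maps_closed[OF e])
 then show "x .: M ==> counit C (contr C \<psi> (coact M x)) = \<psi> x"
  using comodule_coact_closed[OF M] comodule_counit[OF M] by simp
qed

lemma counit_comp_form:
 assumes "k : rmod_hom A M C" shows "(%x. counit C (k x)) : rmod_hom A M (regular_rmod A)"
 by (rule rmod_hom_comp[OF assms counit_right_linear])

text \<open>Colinearity of k turns the left side into the left counit axiom at k x.\<close>

lemma hat_counit:
 assumes M: "right_comodule A C M" and k: "k : comod_hom A C M (regc C)" and x: "x .: M"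
 shows "contr C (%x. counit C (k x)) (coact M x) = k x"
proof -
 interpret M: right_comodule A C M by fact
 have kr: "k : rmod_hom A M C" using comod_hom_rmod[OF k] by simp
 note f = counit_comp_form[OF kr]
 note tps = tpM[OF M.is_rmod] tpM[OF is_rmod]
 note ct = contr_add_maps[OF bim M.is_rmod f]
  and cc = contr_add_maps[OF bim is_rmod counit_right_linear]
  and m = tmap_add_maps[OF tps kr lmod_hom_id]
 have "contr C (%x. counit C (k x)) t = contr C (counit C) (tmap A C C k id t)"
  if t: "t .: (TG A M C)" for t
  by (rule tensor_pair.tensor_ext[OF tps(1) ct(1) add_maps_comp[OF m(1) cc(1)] ab t])
   (simp add: ct(2) m(2) cc(2) rmod_hom_closed[OF kr])
 from this[OF comodule_coact_closed[OF M x]]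
 have "contr C (%x. counit C (k x)) (coact M x) = contr C (counit C) (comult C (k x))"
  using comod_hom_coact[OF k x] by simp
 also have "... = k x" unfolding contr_def by (rule counit_left[OF rmod_hom_closed[OF kr x]])
 finally show ?thesis .
qed

end

section \<open>Stable subsets, Schur's lemma and lifting over a flat coring\<close>

locale flat_coring = coring A C for A :: "('a, 'p) ring_scheme" and C :: "('a, 'c, 'q) coring_scheme" (structure) +
 assumes iflat: "ideal_flat A C"

sublocale flat_coring \<subseteq> flat_bimodule A C
 by unfold_locales (rule iflat)

lemma stableI:
 assumes "submod A M W" "!!x. x : W ==> coact M x : tspan A M C W" shows "stable A C M W"
 using assms by (simp add: stable_def)

lemma stable_submod: "stable A C M W ==> submod A M W"
 by (simp add: stable_def)

lemma stable_coact: "stable A C M W ==> x : W ==> coact M x : tspan A M C W"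
 by (simp add: stable_def)

text \<open>The coaction is a chosen preimage in W (x) C of the coaction in M (x) C. A preimage
  exists for stable W, and flatness makes it unique, which is why the choice satisfies the comodule
  axioms.\<close>

definition sub_comod :: "('a, 'p) ring_scheme => ('a, 'c, 'q) coring_scheme => ('a, 'c, 'm) comod
  => 'm set => ('a, 'c, 'm) comod" where
 "sub_comod A C M W = M(|carrier := W, coact := (%x. SOME u.
   u .: (TG A (M(|carrier := W|)) C) & tmap A M C id id u = coact M x)|)"

lemma sub_comod_simps [simp]:
 "carrier (sub_comod A C M W) = W" "\<zero>{|sub_comod A C M W|} = \<zero>{|M|}"
 "(\<oplus>{|sub_comod A C M W|}) = (\<oplus>{|M|})" "ract (sub_comod A C M W) = ract M"
 by (simp_all add: sub_comod_def)

text \<open>The sum of the images of finitely many maps, each paired with its source. It is a list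
  because lifting removes one map at a time; in all applications \<open>c\<close> is
  \<open>carrier\<close>.\<close>

primrec img :: "('m, 'q) ring_scheme => ('a \<times> ('t => 'm)) list => ('a => 't set) => 'm set" where
 "img P [] c = {\<zero>{|P|}}"
| "img P (Tg # L) c = {snd Tg t \<oplus>{|P|} q | t q. t : c (fst Tg) & q : img P L c}"

text \<open>This encodes f = g_1 s_1 + ... + g_n s_n with colinear maps s_j into the sources. Every
  remainder \<open>f'\<close> is also required to be colinear, so that arguments by recursion on the
  list can continue with it.\<close>

primrec lifts :: "('a, 'p) ring_scheme => ('a, 'c, 'q) coring_scheme => ('a, 'c, 'n, 's) comod_scheme
  => ('a, 'c, 'm, 'u) comod_scheme => (('a, 'c, 't) comod \<times> ('t => 'm)) list => ('n => 'm) => bool" where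
 "lifts A C N P [] f \<longleftrightarrow> (ALL x:carrier N. f x = \<zero>{|P|})"
| "lifts A C N P (Tg # L) f \<longleftrightarrow> (EX s:comod_hom A C N (fst Tg). EX f':comod_hom A C N P.
   lifts A C N P L f' & (ALL x:carrier N. f x = snd Tg (s x) \<oplus>{|P|} f' x))"

lemma (in coring) stable_image:
 assumes "precomod A C M" "precomod A C N" "f : comod_hom A C M N" "stable A C M W"
 shows "stable A C N (f ` W)"
proof -
 interpret M: right_module A M by (rule precomod_module[OF assms(1)])
 interpret N: right_module A N by (rule precomod_module[OF assms(2)])
 note fr = comod_hom_rmod[OF assms(3)] and W = stable_submod[OF assms(4)]
 note Wc = submod_closed[OF W]
 show ?thesis
 proof (rule stableI)
  show "submod A N (f ` W)"
  proof (rule N.submodI')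
   show "f ` W <= carrier N" using Wc(1) rmod_hom_closed[OF fr] by blast
   show "\<zero>{|N|} : f ` W" using add_maps_zero[OF M.ab N.ab rmod_hom_add_maps[OF fr]] Wc(2) by force
   fix x y assume "x : f ` W" "y : f ` W"
   then obtain x' y' where "x = f x'" "y = f y'" "x' : W" "y' : W" by blast
   then have "x \<oplus>{|N|} y = f (x' \<oplus>{|M|} y')" "x' \<oplus>{|M|} y' : W" using rmod_hom_add[OF fr] Wc by simp_all
   then show "x \<oplus>{|N|} y : f ` W" by blast
  next
   fix x a assume "x : f ` W" "a .: A"
   then obtain x' where "x = f x'" "x' : W" by blast
   then have "x <|{|N|} a = f (x' <|{|M|} a)" "x' <|{|M|} a : W"
    using rmod_hom_ract[OF fr] Wc \<open>a : carrier A\<close> by simp_all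
   then show "x <|{|N|} a : f ` W" by blast
  qed
  fix y assume "y : f ` W"
  then obtain x where x: "x : W" "y = f x" by blast
  have "tmap A N C f id (coact M x) : tspan A N C (f ` W)"
   by (rule tspan_tensor_map[OF tpM[OF M.is_rmod] tpM[OF N.is_rmod] fr lmod_hom_id
    stable_coact[OF assms(4) x(1)] submod_subset[OF W]]) simp
  then show "coact N y : tspan A N C (f ` W)" using comod_hom_coact[OF assms(3) Wc(1)[OF x(1)]] x(2) by simp
 qed
qed

lemma (in coring) stable_full:
 assumes "precomod A C M" shows "stable A C M (carrier M)"
 by (rule stableI[OF right_module.submod_carrier[OF precomod_module[OF assms]]])
  (rule tensor_pair.tspan_full[OF tpM[OF precomod_module[OF assms]] precomod_coact[OF assms]])

lemma (in coring) stable_zero: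
 assumes "precomod A C M" shows "stable A C M {\<zero>{|M|}}"
proof (rule stableI[OF right_module.submod_zero[OF precomod_module[OF assms]]])
 fix x assume "x : {\<zero>{|M|}}"
 then have "coact M x = \<zero>{|TG A M C|}"
  using add_maps_zero[OF right_module_ab[OF precomod_module[OF assms]]
    tensor_pair.ab_tensor[OF tpM[OF precomod_module[OF assms]]], of "coact M"] assms
  by (simp add: precomod_def)
 then show "coact M x : tspan A M C {\<zero>{|M|}}" by (simp add: tspan.zero)
qed

lemma (in coring) stable_sum:
 assumes M: "precomod A C M" and W: "stable A C M W" and V: "stable A C M V"
 shows "stable A C M {x \<oplus>{|M|} y | x y. x : W & y : V}" (is "stable A C M ?S")
proof -
 interpret M: right_module A M by (rule precomod_module[OF M])
 note Wc = submod_closed[OF stable_submod[OF W]] and Vc = submod_closed[OF stable_submod[OF V]]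
 have sum4: "(x \<oplus>{|M|} u) \<oplus>{|M|} (y \<oplus>{|M|} v) = (x \<oplus>{|M|} y) \<oplus>{|M|} (u \<oplus>{|M|} v)"
  if "x .: M" "y .: M" "u .: M" "v .: M" for x y u v
  using that by (simp add: M.a_ac)
 have WS: "W <= ?S" and VS: "V <= ?S"
 proof -
  have "x = x \<oplus>{|M|} \<zero>{|M|}" if "x : W" for x using Wc(1)[OF that] by simp
  then show "W <= ?S" using Vc(2) by blast
  have "x = \<zero>{|M|} \<oplus>{|M|} x" if "x : V" for x using Vc(1)[OF that] by simp
  then show "V <= ?S" using Wc(2) by blast
 qed
 show ?thesis
 proof (rule stableI)
  show "submod A M ?S"
  proof (rule M.submodI')
   show "?S <= carrier M" using Wc(1) Vc(1) by auto
   show "\<zero>{|M|} : ?S" using WS Wc(2) by blast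
   fix s t assume "s : ?S" "t : ?S"
   then obtain x y x' y' where e: "s = x \<oplus>{|M|} y" "t = x' \<oplus>{|M|} y'" "x : W" "x' : W" "y : V" "y' : V" by blast
   then have "s \<oplus>{|M|} t = (x \<oplus>{|M|} x') \<oplus>{|M|} (y \<oplus>{|M|} y')" using sum4 Wc(1) Vc(1) by simp
   then show "s \<oplus>{|M|} t : ?S" using e Wc(3) Vc(3) by blast
  next
   fix s a assume "s : ?S" and a: "a .: A"
   then obtain x y where e: "s = x \<oplus>{|M|} y" "x : W" "y : V" by blast
   then have "s <|{|M|} a = x <|{|M|} a \<oplus>{|M|} y <|{|M|} a" using Wc(1) Vc(1) a by (simp add: M.ract_add_left)
   then show "s <|{|M|} a : ?S" using e a Wc(4) Vc(4) by blast
  qed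
  fix s assume "s : ?S"
  then obtain x y where e: "s = x \<oplus>{|M|} y" "x : W" "y : V" by blast
  have "coact M s = coact M x \<oplus>{|TG A M C|} coact M y"
   using M e Wc(1) Vc(1) add_maps_add[of "coact M" M "TG A M C" x y] by (simp add: precomod_def)
  then show "coact M s : tspan A M C ?S"
   using tspan.add[OF tspan_mono[OF stable_coact[OF W e(2)] WS] tspan_mono[OF stable_coact[OF V e(3)] VS]] by simp
 qed
qed

lemma (in coring) img_stable:
 assumes P: "precomod A C P"
  and "!!Tg. Tg : set L ==> precomod A C (fst Tg) & snd Tg : comod_hom A C (fst Tg) P"
 shows "stable A C P (img P L carrier)"
 using assms(2)
proof (induction L)
 case Nil
 then show ?case using stable_zero[OF P] by simp
next
 case (Cons Tg L)
 have 1: "stable A C P (snd Tg ` carrier (fst Tg))"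
  using Cons.prems[of Tg] by (intro stable_image[OF _ P _ stable_full]) auto
 have 2: "stable A C P (img P L carrier)" using Cons by simp
 have "img P (Tg # L) carrier = {x \<oplus>{|P|} y | x y. x : snd Tg ` carrier (fst Tg) & y : img P L carrier}"
  by auto
 then show ?case using stable_sum[OF P 1 2] by simp
qed

lemma img_closed:
 assumes "abelian_group P" "!!Tg t. Tg : set L ==> t : c (fst Tg) ==> snd Tg t .: P"
 shows "img P L c <= carrier P"
proof -
 interpret P: abelian_group P by fact
 show ?thesis
  using assms(2)
 proof (induction L)
  case (Cons Tg L)
  have "img P L c <= carrier P" by (rule Cons.IH) (use Cons.prems in simp)
  then show ?case using Cons.prems[of Tg] by auto
 qed simp
qed

lemma img_append:
 assumes P: "abelian_group P" and L: "img P L c <= carrier P" "img P L' c <= carrier P"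
  and g: "!!Tg t. Tg : set L ==> t : c (fst Tg) ==> snd Tg t .: P"
  and x: "x : img P L c" and y: "y : img P L' c"
 shows "x \<oplus>{|P|} y : img P (L @ L') c"
proof -
 interpret P: abelian_group P by fact
 have yP: "y .: P" using L y by blast
 have sub: "img P L c <= carrier P" if "!!Tg t. Tg : set L ==> t : c (fst Tg) ==> snd Tg t .: P" for L
  using img_closed[OF assms(1) that] .
 show ?thesis
  using x g
 proof (induction L arbitrary: x)
  case (Cons Tg L)
  then obtain t q where e: "x = snd Tg t \<oplus>{|P|} q" "t : c (fst Tg)" "q : img P L c" by auto
  have "q .: P" using sub[of L] Cons.prems(2) e(3) by auto
  then have "x \<oplus>{|P|} y = snd Tg t \<oplus>{|P|} (q \<oplus>{|P|} y)" using e yP Cons.prems(2) by (simp add: P.a_assoc)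
  moreover have "q \<oplus>{|P|} y : img P (L @ L') c" by (rule Cons.IH[OF e(3)]) (use Cons.prems(2) in simp)
  ultimately show ?case using e(2) by auto
 qed (use yP y in simp)
qed

context flat_coring begin

lemma stable_preimage:
 assumes "precomod A C M" "precomod A C N" "f : comod_hom A C M N" "stable A C N Q"
 shows "stable A C M {x : carrier M. f x : Q}"
proof -
 interpret M: right_module A M by (rule precomod_module[OF assms(1)])
 interpret N: right_module A N by (rule precomod_module[OF assms(2)])
 note fr = comod_hom_rmod[OF assms(3)]
 note Qc = submod_closed[OF stable_submod[OF assms(4)]]
 have fz: "f \<zero>{|M|} = \<zero>{|N|}" by (rule add_maps_zero[OF M.ab N.ab rmod_hom_add_maps[OF fr]])
 show ?thesis
 proof (rule stableI)
  show "submod A M {x : carrier M. f x : Q}"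
   by (rule M.submodI') (auto simp: fz Qc rmod_hom_add[OF fr] rmod_hom_ract[OF fr] M.ract_closed)
  fix x assume "x : {x : carrier M. f x : Q}"
  then have x: "x .: M" "f x : Q" by auto
  show "coact M x : tspan A M C {x : carrier M. f x : Q}"
   by (rule tspan_preimage[OF M.is_rmod N.is_rmod fr stable_submod[OF assms(4)]
    precomod_coact[OF assms(1) x(1)]])
    (simp add: comod_hom_coact[OF assms(3) x(1)] stable_coact[OF assms(4) x(2)])
 qed
qed

text \<open>Linearity, coassociativity and counitality hold after applying j, because they hold in
  P. By flatness j (x) C and (j (x) C) (x) C are injective like j, so they hold in M.\<close>

lemma comodule_transport:
 assumes M: "right_module A M" and P: "right_comodule A C P" and j: "j : rmod_hom A M P" "inj_on j (carrier M)"
  and c: "!!x. x .: M ==> coact M x .: (TG A M C)"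
  and e: "!!x. x .: M ==> tmap A P C j id (coact M x) = coact P (j x)"
 shows "right_comodule A C M"
proof -
 interpret M: right_module A M by fact
 interpret P: right_comodule A C P by fact
 have Pm: "right_module A P" by (rule P.is_rmod)
 interpret X: tensor_triple A M C C by (rule triple[OF M])
 interpret Y: tensor_triple A P C C by (rule triple[OF Pm])
 note jm = tmap_add_maps[OF X.tpMN Y.tpMN j(1) lmod_hom_id]
 note jr = tensor_map_rmod_hom[OF X.tpMN Y.tpMN bim bim j(1), of id]
 have idb: "id : bimod_hom A A C C" by (simp add: bimod_hom_iff rmod_hom_id lmod_hom_id)
 note jr = tensor_map_rmod_hom[OF X.tpMN Y.tpMN bim bim j(1) idb]
 note inj1 = tensor_map_injective[OF M Pm j]
 note rM = X.rMN and rP = Y.rMN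
 have inj2: "inj_on (tmap A (TR A P C) C (tmap A P C j id) id) (carrier X.T1)"
  by (rule tensor_map_injective[OF rM rP jr]) (use inj1 in simp)
 have jc: "j x .: P" if "x .: M" for x by (rule rmod_hom_closed[OF j(1) that])
 have lin: "coact M : rmod_hom A M (TR A M C)"
  unfolding rmod_hom_def
 proof (intro CollectI conjI ballI)
  show "coact M : carrier M \<rightarrow> carrier (TR A M C)" using c by simp
  fix x assume x: "x .: M"
  { fix y assume y: "y .: M"
   show "coact M (x \<oplus>{|M|} y) = coact M x \<oplus>{|TR A M C|} coact M y"
   proof (rule inj_onD[OF inj1])
    show "coact M x \<oplus>{|TR A M C|} coact M y .: (TG A M C)"
    using abelian_monoid.a_closed[OF abelian_group.axioms(1)[OF tensor_pair.ab_tensor[OF X.tpMN]]] c x y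
    by simp
    show "tmap A P C j id (coact M (x \<oplus>{|M|} y)) = tmap A P C j id (coact M x \<oplus>{|TR A M C|} coact M y)"
    using add_maps_add[OF jm(1) c[OF x] c[OF y]] e x y rmod_hom_add[OF j(1) x y]
    rmod_hom_add[OF P.coact_hom jc[OF x] jc[OF y]] by simp
   qed (use c x y in simp) }
  { fix a assume a: "a .: A"
   show "coact M (x <|{|M|} a) = coact M x <|{|TR A M C|} a"
   proof (rule inj_onD[OF inj1])
    show "coact M x <|{|TR A M C|} a .: (TG A M C)"
    using right_module.ract_closed[OF rM, of "coact M x" a] c x a by simp
    show "tmap A P C j id (coact M (x <|{|M|} a)) = tmap A P C j id (coact M x <|{|TR A M C|} a)"
    using rmod_hom_ract[OF jr, of "coact M x" a] e x a M.ract_closed rmod_hom_ract[OF j(1) x a]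
    rmod_hom_ract[OF P.coact_hom jc[OF x] a] c by simp
   qed (use c x a M.ract_closed in simp) }
 qed
 note cm = tmap_add_maps[OF X.tpMN X.tp1 lin lmod_hom_id]
  and cP = tmap_add_maps[OF Y.tpMN Y.tp1 P.coact_hom lmod_hom_id]
  and jjm = tmap_add_maps[OF X.tp1 Y.tp1 jr lmod_hom_id]
  and j2m = tmap_add_maps[OF X.tp2 Y.tp2 j(1) lmod_hom_id]
  and dM = tmap_add_maps[OF X.tpMN X.tp2 rmod_hom_id comult_lmod_hom]
  and dP = tmap_add_maps[OF Y.tpMN Y.tp2 rmod_hom_id comult_lmod_hom]
 have nat: "tensor_assoc A P C C (tmap A (TR A P C) C (tmap A P C j id) id t)
   = tmap A P (TB A C C) j id (tensor_assoc A M C C t)" if "t .: X.T1" for t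
  by (rule X.T1_ext[OF add_maps_comp[OF jjm(1) Y.tensor_assoc_add_maps]
    add_maps_comp[OF X.tensor_assoc_add_maps j2m(1)] Y.ab2 that])
   (simp_all add: jjm(2) j2m(2) tensor_pair.tensor_closed[OF X.tpMN] tensor_pair.tensor_closed[OF X.tpNP]
    jm(2) X.tensor_assoc_tensor Y.tensor_assoc_tensor jc)
 have e1: "tmap A P (TB A C C) j id (tmap A M (TB A C C) id (comult C) t)
   = tmap A P (TB A C C) id (comult C) (tmap A P C j id t)"
  if "t .: (TG A M C)" for t
  by (rule tensor_pair.tensor_ext[OF X.tpMN add_maps_comp[OF dM(1) j2m(1)] add_maps_comp[OF jm(1) dP(1)] Y.ab2 that])
   (use rmod_hom_closed[OF comult_rmod_hom] in "simp_all add: dM(2) j2m(2) jm(2) dP(2) jc")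
 have e2: "tmap A (TR A P C) C (tmap A P C j id) id (tmap A (TR A M C) C (coact M) id t)
   = tmap A (TR A P C) C (coact P) id (tmap A P C j id t)"
  if "t .: (TG A M C)" for t
  by (rule tensor_pair.tensor_ext[OF X.tpMN add_maps_comp[OF cm(1) jjm(1)] add_maps_comp[OF jm(1) cP(1)] Y.ab1 that])
   (simp_all add: cm(2) jjm(2) jm(2) cP(2) jc c e)
 show ?thesis
 proof (unfold_locales)
  show "coact M : rmod_hom A M (TR A M C)" by (rule lin)
  fix x assume x: "x .: M"
  define l where "l = tmap A (TR A M C) C (coact M) id (coact M x)"
  define R where "R = tmap A M (TB A C C) id (comult C) (coact M x)"
  define r where "r = tensor_unassoc A M C C R"
  have l: "l .: X.T1" unfolding l_def by (rule add_maps_closed[OF cm(1) c[OF x]])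
  have R: "R .: X.T2" unfolding R_def by (rule add_maps_closed[OF dM(1) c[OF x]])
  have r: "r .: X.T1" unfolding r_def by (rule add_maps_closed[OF X.tensor_unassoc_add_maps R])
  let ?J = "tmap A (TR A P C) C (tmap A P C j id) id"
  have "tensor_assoc A P C C (?J l) = tensor_assoc A P C C (?J r)"
  proof -
   have "tensor_assoc A P C C (?J l) = tensor_assoc A P C C (tmap A (TR A P C) C (coact P) id (coact P (j x)))"
    unfolding l_def e2[OF c[OF x]] e[OF x] ..
   also have "... = tmap A P (TB A C C) id (comult C) (coact P (j x))"
    by (rule P.coact_coassociative[OF jc[OF x]])
   also have "... = tmap A P (TB A C C) j id R"
    unfolding R_def e1[OF c[OF x]] e[OF x] ..
   also have "... = tmap A P (TB A C C) j id (tensor_assoc A M C C r)"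
    unfolding r_def X.assoc_unassoc[OF R] ..
   also have "... = tensor_assoc A P C C (?J r)" by (rule nat[OF r, symmetric])
   finally show ?thesis .
  qed
  \<comment> \<open>\<open>tensor_assoc\<close> has the inverse \<open>tensor_unassoc\<close>, so
    the equality holds before reassociating.\<close>
  then have "?J l = ?J r"
   using Y.unassoc_assoc[OF add_maps_closed[OF jjm(1) l]] Y.unassoc_assoc[OF add_maps_closed[OF jjm(1) r]] by metis
  then have "l = r" by (rule inj_onD[OF inj2 _ l r])
  then show "tensor_assoc A M C C (tmap A (TR A M C) C (coact M) id (coact M x))
    = tmap A M (TB A C C) id (comult C) (coact M x)"
   using X.assoc_unassoc[OF R] by (simp add: l_def r_def R_def)
  have "j (slice M (counit C) (coact M x)) = j x"
   using slice_natural[OF bim M Pm j(1) counit_left_form c[OF x]] e[OF x]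
    comodule_counit[OF P.right_comodule_axioms jc[OF x]] by simp
  then have "slice M (counit C) (coact M x) = x"
   using inj_onD[OF j(2)] add_maps_closed[OF slice_add_maps(1)[OF bim M counit_left_form] c[OF x]] x by blast
  then show "tensor_lift M (%(y, c). y <|{|M|} counit C c) (coact M x) = x" by (simp add: slice_def)
 qed
qed

lemma stable_subcomodule:
 fixes M :: "('a, 'c, 'm) comod"
 assumes M: "right_comodule A C M" and W: "stable A C M W"
 shows "subcomodule A C (sub_comod A C M W) M"
proof -
 interpret M: right_comodule A C M by fact
 note Wm = stable_submod[OF W] and Wc = submod_closed[OF stable_submod[OF W]]
 let ?W = "M(|carrier := W|)" and ?N = "sub_comod A C M W"
 interpret W: right_module A ?W by (rule M.right_module_sub[OF Wm])
 interpret Ng: abelian_group ?N by (rule abelian_group_transfer[OF W.ab]) simp_all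
 interpret N: right_module A ?N
  by unfold_locales (use W.ract_closed W.ract_add_left W.ract_add_right W.ract_mult W.ract_one in simp_all)
 have idW: "id : rmod_hom A ?W M" by (rule rmod_hom_incl(2)) (rule submod_subset[OF Wm])+
 have idN: "id : rmod_hom A ?N M" using Wc(1) by (simp add: rmod_hom_def)
 note tps = tpM[OF W.is_rmod] tpM[OF M.is_rmod]
 have TN: "TG A ?N C = TG A ?W C" by (rule tensor_cong_left) simp_all
 note im = tmap_add_maps[OF tps idW lmod_hom_id]
 have ex: "EX u. u .: (TG A ?W C) & tmap A M C id id u = v"
  if "v : tspan A M C W" for v
  using that
 proof (induction rule: tspan.induct)
  case zero
  show ?case
   using add_maps_zero[OF tensor_pair.ab_tensor[OF tps(1)] tensor_pair.ab_tensor[OF tps(2)] im(1)]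
    abelian_monoid.zero_closed[OF abelian_group.axioms(1)[OF tensor_pair.ab_tensor[OF tps(1)]]] by blast
 next
  case (pure x y)
  then show ?case using im(2)[of x y] tensor_pair.tensor_closed[OF tps(1), of x y]
   by (intro exI[of _ "tensor A ?W C x y"]) (simp add: id_def)
 next
  case (add s t)
  from add.IH obtain u v where uv: "u .: (TG A ?W C)" "tmap A M C id id u = s"
   "v .: (TG A ?W C)" "tmap A M C id id v = t" by (auto simp: id_def)
  then show ?case
   using add_maps_add[OF im(1) uv(1,3)]
    abelian_monoid.a_closed[OF abelian_group.axioms(1)[OF tensor_pair.ab_tensor[OF tps(1)]] uv(1,3)]
   by (intro exI[of _ "u \<oplus>{|TG A ?W C|} v"]) (simp add: id_def)
 qed
 have co: "coact ?N x .: (TG A ?W C) & tmap A M C id id (coact ?N x) = coact M x"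
  if x: "x : W" for x
  unfolding sub_comod_def using someI_ex[OF ex[OF stable_coact[OF W x]]] by simp
 have "right_comodule A C ?N"
  by (rule comodule_transport[OF N.is_rmod M.right_comodule_axioms idN])
   (use co in "simp_all add: TN")
 moreover have "id : comod_hom A C ?N M" by (rule comod_homI[OF idN]) (use co in simp)
 ultimately show ?thesis unfolding subcomodule_def using Wc(1) by auto
qed

lemma subcomodule_stable:
 assumes M: "right_comodule A C M" and N: "subcomodule A C N M" shows "stable A C M (carrier N)"
proof -
 interpret M: right_comodule A C M by fact
 interpret N: right_comodule A C N using N by (simp add: subcomodule_def)
 have h: "id : comod_hom A C N M" using N by (simp add: subcomodule_def)
 from stable_image[OF right_comodule_precomod[OF N.right_comodule_axioms] right_comodule_precomod[OF M] h
   stable_full[OF right_comodule_precomod[OF N.right_comodule_axioms]]]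
 show ?thesis by simp
qed

text \<open>Stable subsets are exactly the carriers of subcomodules, so simplicity can be tested
  without choosing coactions on subsets.\<close>

lemma simple_iff:
 "simple_comodule A C M \<longleftrightarrow> right_comodule A C M & carrier M ~= {\<zero>{|M|}} \<and>
  (ALL W. stable A C M W --> W = {\<zero>{|M|}} \<or> W = carrier M)"
proof -
 have "(ALL N. subcomodule A C N M --> carrier N = {\<zero>{|M|}} \<or> carrier N = carrier M) \<longleftrightarrow>
  (ALL W. stable A C M W --> W = {\<zero>{|M|}} \<or> W = carrier M)" if "right_comodule A C M"
  using stable_subcomodule[OF that] subcomodule_stable[OF that] by (metis sub_comod_simps(1))
 then show ?thesis unfolding simple_comodule_def by auto
qed

lemma simple_comodule_right: "simple_comodule A C M ==> right_comodule A C M"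
 by (simp add: simple_comodule_def)

lemma simple_precomod: "simple_comodule A C M ==> precomod A C M"
 by (rule right_comodule_precomod[OF simple_comodule_right])

lemma simple_stable: "simple_comodule A C M ==> stable A C M W ==> x : W ==> x ~= \<zero>{|M|} ==> W = carrier M"
 by (auto simp: simple_iff)

text \<open>The kernel is the preimage of the stable set {0}, hence stable by flatness.\<close>

lemma comod_hom_simple_inj:
 assumes M: "simple_comodule A C M" and N: "precomod A C N" and f: "f : comod_hom A C M N"
  and x: "x .: M" "f x ~= \<zero>{|N|}"
 shows "inj_on f (carrier M)"
proof -
 interpret M: right_module A M by (rule precomod_module[OF simple_precomod[OF M]])
 interpret N: right_module A N by (rule precomod_module[OF N])
 note fa = rmod_hom_add_maps[OF comod_hom_rmod[OF f]]
 have "stable A C M {x : carrier M. f x : {\<zero>{|N|}}}"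
  by (rule stable_preimage[OF simple_precomod[OF M] N f stable_zero[OF N]])
 then have k: "{x : carrier M. f x : {\<zero>{|N|}}} = {\<zero>{|M|}}" using M x unfolding simple_iff by blast
 show ?thesis
 proof (rule inj_onI)
  fix y z assume yz: "y .: M" "z .: M" "f y = f z"
  have "f (y \<ominus>{|M|} z) = \<zero>{|N|}"
   using add_maps_minus[OF M.ab N.ab fa yz(1,2)] yz add_maps_closed[OF fa] N.diff_zero_iff by simp
  then have "y \<ominus>{|M|} z = \<zero>{|M|}" using k yz(1,2) M.minus_closed by blast
  then show "y = z" using M.diff_zero_iff yz by simp
 qed
qed

lemma schur:
 assumes M: "simple_comodule A C M" and N: "simple_comodule A C N" and f: "f : comod_hom A C M N"
  and x: "x .: M" "f x ~= \<zero>{|N|}"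
 shows "f : comod_iso A C M N"
proof -
 have "stable A C N (f ` carrier M)"
  by (rule stable_image[OF simple_precomod[OF M] simple_precomod[OF N] f stable_full[OF simple_precomod[OF M]]])
 then have "f ` carrier M = carrier N" using simple_stable[OF N] x by blast
 then show ?thesis
  using comod_hom_simple_inj[OF M simple_precomod[OF N] f x] f by (simp add: comod_iso_def bij_betw_def)
qed

text \<open>Induction over the list. Let g be its first map, with source T, and let Q be the sum of
  the other images. The set W of all t with g t in Q is stable, hence zero or all of T. If it is T,
  then g contributes nothing. If it is zero, the sum of g(T) and Q is direct and g is injective, and
  s x is taken to be the component of f x in T.\<close>

lemma lifting:
 fixes L :: "(('a, 'c, 't) comod \<times> ('t => 'm)) list"
 assumes N: "precomod A C N" and P: "precomod A C P"
  and "!!Tg. Tg : set L ==> simple_comodule A C (fst Tg) & snd Tg : comod_hom A C (fst Tg) P"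
  and "f : comod_hom A C N P" and "!!x. x .: N ==> f x : img P L carrier"
 shows "lifts A C N P L f"
 using assms(3-5)
proof (induction L arbitrary: f)
 case (Cons Tg L)
 obtain T g where Tg: "Tg = (T, g)" by (cases Tg)
 have T: "simple_comodule A C T" and g: "g : comod_hom A C T P" using Cons.prems(1)[of Tg] Tg by auto
 have f: "f : comod_hom A C N P" by (rule Cons.prems(2))
 note Tp = simple_precomod[OF T]
 interpret T: right_module A T by (rule precomod_module[OF Tp])
 interpret N: right_module A N by (rule precomod_module[OF N])
 interpret P: right_module A P by (rule precomod_module[OF P])
 note gr = comod_hom_rmod[OF g] and fr = comod_hom_rmod[OF f]
 define Q where "Q = img P L carrier"
 have Q: "stable A C P Q" unfolding Q_def
  by (rule img_stable[OF P]) (use Cons.prems(1) simple_precomod in auto)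
 note Qm = stable_submod[OF Q] and Qc = submod_closed[OF stable_submod[OF Q]]
 define W where "W = {t : carrier T. g t : Q}"
 have W: "stable A C T W" unfolding W_def by (rule stable_preimage[OF Tp P g Q])
 have dec: "EX t q. t .: T & q : Q & f x = g t \<oplus>{|P|} q" if "x .: N" for x
  using Cons.prems(3)[OF that] by (auto simp: Tg Q_def)
 have IH: "lifts A C N P L f'" if "f' : comod_hom A C N P" "!!x. x .: N ==> f' x : Q" for f'
  by (rule Cons.IH) (use Cons.prems(1) that in "auto simp: Q_def")
 show ?case
 proof (cases "W = carrier T")
  case True
  have fQ: "f x : Q" if x: "x .: N" for x
  proof -
   obtain t q where "t .: T" "q : Q" "f x = g t \<oplus>{|P|} q" using dec[OF x] by blast
   then show ?thesis using True Qc(3) unfolding W_def by auto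
  qed
  have "f x = g \<zero>{|T|} \<oplus>{|P|} f x" if "x .: N" for x
   using add_maps_zero[OF T.ab P.ab rmod_hom_add_maps[OF gr]] rmod_hom_closed[OF fr that] by simp
  then show ?thesis
   using IH[OF f fQ] f
   unfolding lifts.simps Tg fst_conv snd_conv
   by (intro bexI[OF _ comod_hom_zero[OF N Tp]] bexI[OF _ f]) blast
 next
  case False
  then have W0: "W = {\<zero>{|T|}}" using T W unfolding simple_iff by blast
  have uniq: "t = t'" if "t .: T" "t' .: T" "q : Q" "q' : Q" "g t \<oplus>{|P|} q = g t' \<oplus>{|P|} q'" for t t' q q'
  proof -
   have "g t' \<ominus>{|P|} g t = q \<ominus>{|P|} q'"
    by (rule P.diff_eq_diff) (use that Qc(1) rmod_hom_closed[OF gr] in auto)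
   then have "g (t' \<ominus>{|T|} t) : Q"
    using add_maps_minus[OF T.ab P.ab rmod_hom_add_maps[OF gr] that(2,1)] submod_minus[OF P.ab Qm that(3,4)] by simp
   then have "t' \<ominus>{|T|} t : W" using that unfolding W_def by simp
   then show ?thesis using W0 T.diff_zero_iff[OF that(2,1)] by simp
  qed
  have "ALL x:carrier N. EX t. t .: T & (EX q:Q. f x = g t \<oplus>{|P|} q)" using dec by blast
  then obtain s where s: "!!x. x .: N ==> s x .: T" "!!x. x .: N ==> EX q:Q. f x = g (s x) \<oplus>{|P|} q"
   by metis
  have sI: "s x = t" if "x .: N" "t .: T" "q : Q" "f x = g t \<oplus>{|P|} q" for x t q
   using uniq s that by metis
  define f' where "f' x = f x \<ominus>{|P|} g (s x)" for x
  have f'Q: "f' x : Q" and ff': "f x = g (s x) \<oplus>{|P|} f' x" if x: "x .: N" for x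
  proof -
   obtain q where q: "q : Q" "f x = g (s x) \<oplus>{|P|} q" using s(2)[OF x] by blast
   have gs: "g (s x) .: P" by (rule rmod_hom_closed[OF gr s(1)[OF x]])
   show "f x = g (s x) \<oplus>{|P|} f' x"
    unfolding f'_def using P.add_diff_cancel[OF gs rmod_hom_closed[OF fr x]] by simp
   have "f' x = q" unfolding f'_def q(2) using gs Qc(1)[OF q(1)] by (simp add: P.minus_eq P.a_comm[of "g (s x)"] P.a_assoc P.r_neg)
   then show "f' x : Q" using q(1) by simp
  qed
  have sum4: "(x \<oplus>{|P|} u) \<oplus>{|P|} (y \<oplus>{|P|} v) = (x \<oplus>{|P|} y) \<oplus>{|P|} (u \<oplus>{|P|} v)"
   if "x .: P" "y .: P" "u .: P" "v .: P" for x y u v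
   using that by (simp add: P.a_ac)
  have sr: "s : rmod_hom A N T"
   unfolding rmod_hom_def
  proof (intro CollectI conjI ballI)
   show "s : carrier N \<rightarrow> carrier T" using s(1) by blast
   fix x assume x: "x .: N"
   have gsx: "g (s x) .: P" "f' x .: P" using rmod_hom_closed[OF gr s(1)[OF x]] f'Q[OF x] Qc(1) by auto
   { fix y assume y: "y .: N"
    have gsy: "g (s y) .: P" "f' y .: P" using rmod_hom_closed[OF gr s(1)[OF y]] f'Q[OF y] Qc(1) by auto
    have "f (x \<oplus>{|N|} y) = (g (s x) \<oplus>{|P|} f' x) \<oplus>{|P|} (g (s y) \<oplus>{|P|} f' y)"
    using rmod_hom_add[OF fr x y] ff'[OF x] ff'[OF y] by simp
    also have "... = g (s x \<oplus>{|T|} s y) \<oplus>{|P|} (f' x \<oplus>{|P|} f' y)"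
    using rmod_hom_add[OF gr s(1)[OF x] s(1)[OF y]] sum4 gsx gsy by simp
    finally show "s (x \<oplus>{|N|} y) = s x \<oplus>{|T|} s y"
    using x y s(1) Qc(3) f'Q by (intro sI) auto }
   { fix a assume a: "a .: A"
    have "f (x <|{|N|} a) = (g (s x) \<oplus>{|P|} f' x) <|{|P|} a"
    using rmod_hom_ract[OF fr x a] ff'[OF x] by simp
    also have "... = g (s x <|{|T|} a) \<oplus>{|P|} f' x <|{|P|} a"
    using rmod_hom_ract[OF gr s(1)[OF x] a] P.ract_add_left gsx a by simp
    finally show "s (x <|{|N|} a) = s x <|{|T|} a"
    using x a s(1) Qc(4) f'Q by (intro sI) (auto simp: T.ract_closed N.ract_closed) }
  qed
  have gsr: "(%x. g (s x)) : rmod_hom A N P" by (rule rmod_hom_comp[OF sr gr])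
  have f'r: "f' : rmod_hom A N P"
  proof -
   have "(%x. f x \<ominus>{|P|} g (s x)) : add_maps N P"
    unfolding P.minus_eq
    by (rule add_maps_plus[OF P.ab rmod_hom_add_maps[OF fr] add_maps_uminus_map[OF P.ab rmod_hom_add_maps[OF gsr]]])
   then show ?thesis
    unfolding rmod_hom_iff f'_def
    by (auto simp: rmod_hom_ract[OF fr] rmod_hom_ract[OF gsr] P.minus_eq P.ract_add_left P.ract_uminus_left
    rmod_hom_closed[OF fr] rmod_hom_closed[OF gsr])
  qed
  note tN = tpM[OF N.is_rmod] and tT = tpM[OF T.is_rmod] and tP = tpM[OF P.is_rmod]
  note aN = tensor_pair.ab_tensor[OF tN] and aT = tensor_pair.ab_tensor[OF tT]
   and aP = tensor_pair.ab_tensor[OF tP]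
  interpret aT: abelian_group "TG A T C" by (rule aT)
  interpret aP: abelian_group "TG A P C" by (rule aP)
  note sm = tmap_add_maps[OF tN tT sr lmod_hom_id] and gm = tmap_add_maps[OF tT tP gr lmod_hom_id]
   and fm = tmap_add_maps[OF tN tP fr lmod_hom_id] and f'm = tmap_add_maps[OF tN tP f'r lmod_hom_id]
  have split: "tmap A P C f id t = tmap A P C g id (tmap A T C s id t) \<oplus>{|TG A P C|} tmap A P C f' id t"
   if "t .: (TG A N C)" for t
   by (rule tensor_pair.tensor_ext[OF tN fm(1) add_maps_plus[OF aP add_maps_comp[OF sm(1) gm(1)] f'm(1)] aP that])
    (simp add: fm(2) sm(2) gm(2) f'm(2) s(1) ff' tensor_pair.tensor_add_left[OF tP, symmetric]
    rmod_hom_closed[OF gsr] rmod_hom_closed[OF f'r])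
  \<comment> \<open>The defect \<open>?d\<close> of colinearity of s is sent by g (x) C into Q (x)
    C, since f and g are colinear and Q is stable. By exactness the defect lies in the span of W,
    which is zero.\<close>
  have sc: "s : comod_hom A C N T"
  proof (rule comod_homI[OF sr])
   fix x assume x: "x .: N"
   note cx = precomod_coact[OF N x] and cs = precomod_coact[OF Tp s(1)[OF x]]
   let ?d = "tmap A T C s id (coact N x) \<ominus>{|TG A T C|} coact T (s x)"
   have sc: "tmap A T C s id (coact N x) .: (TG A T C)" by (rule add_maps_closed[OF sm(1) cx])
   have d: "?d .: (TG A T C)" by (rule aT.minus_closed[OF sc cs])
   let ?u = "tmap A P C g id (tmap A T C s id (coact N x))" and ?v = "tmap A P C g id (coact T (s x))"
   let ?p = "tmap A P C f' id (coact N x)"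
   have f'P: "f' x .: P" by (rule rmod_hom_closed[OF f'r x])
   have gsP: "g (s x) .: P" by (rule rmod_hom_closed[OF gsr x])
   have "?u \<oplus>{|TG A P C|} ?p = coact P (f x)" using split[OF cx] comod_hom_coact[OF f x] by simp
   also have "... = coact P (g (s x)) \<oplus>{|TG A P C|} coact P (f' x)"
    
    unfolding ff'[OF x] using P unfolding precomod_def by (elim conjE) (rule add_maps_add[OF _ gsP f'P])
   also have "coact P (g (s x)) = ?v" using comod_hom_coact[OF g s(1)[OF x]] by simp
   finally have "?v \<oplus>{|TG A P C|} coact P (f' x) = ?u \<oplus>{|TG A P C|} ?p" by (simp add: id_def)
   from aP.diff_eq_diff[OF _ _ _ _ this]
   have "?u \<ominus>{|TG A P C|} ?v = coact P (f' x) \<ominus>{|TG A P C|} ?p"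
    using add_maps_closed[OF gm(1) sc] add_maps_closed[OF gm(1) cs] precomod_coact[OF P f'P]
    add_maps_closed[OF f'm(1) cx] by simp
   moreover have "tmap A P C g id ?d = ?u \<ominus>{|TG A P C|} ?v"
    by (rule add_maps_minus[OF aT aP gm(1) sc cs])
   moreover have "?p : tspan A P C Q"
    by (rule tspan_tensor_map[OF tN tP f'r lmod_hom_id tensor_pair.tspan_full[OF tN cx]]) (use f'Q in auto)
   moreover have "coact P (f' x) : tspan A P C Q" by (rule stable_coact[OF Q f'Q[OF x]])
   ultimately have "tmap A P C g id ?d : tspan A P C Q"
    using additive_subgroup_minus[OF aP tensor_pair.tspan_subgroup_submod[OF tP Qm]] by simp
   from tspan_preimage[OF T.is_rmod P.is_rmod gr Qm d this]
   have "?d : tspan A T C {\<zero>{|T|}}" using W0 unfolding W_def by simp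
   then have "?d = \<zero>{|TG A T C|}" by (rule tensor_pair.tspan_triv[OF tT])
   then show "tmap A T C s id (coact N x) = coact T (s x)" using aT.diff_zero_iff[OF sc cs] by simp
  qed
  have gsc: "(%x. g (s x)) : comod_hom A C N P"
   by (rule comod_hom_comp[OF N T.is_rmod P.is_rmod sc g])
  have f'c: "f' : comod_hom A C N P" unfolding f'_def by (rule comod_hom_minus[OF N P f gsc])
  show ?thesis using sc f'c IH[OF f'c f'Q] ff' by (auto simp: Tg)
 qed
qed simp

text \<open>N (x) C is generated by tensors u (x) k t with t in a simple comodule, so the coaction
  of one nonzero x lies in the sum of finitely many simple images. The set of all y whose coaction
  lies in this sum is stable and contains x, hence is all of N. So one finite list works for the
  whole coaction, and \<open>lifting\<close> applies.\<close>

lemma coact_lifts: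
 fixes N :: "('a, 'c, 'n) comod" and \<K> :: "(('a, 'c, 't) comod \<times> ('t => 'c)) set"
 assumes N: "simple_comodule A C N"
  and K: "!!T k. (T, k) : \<K> ==> simple_comodule A C T & k : comod_hom A C T (regc C)"
  and gen: "!!c. c .: C ==> EX L. set L <= \<K> & c : img C L carrier"
 obtains L where "!!T g. (T, g) : set L ==> EX k u. (T, k) : \<K> & u .: N & g = (%t. tensor A N C u (k t))"
  and "lifts A C N (tensor_comod A C N) L (coact N)"
proof -
 have Nr: "right_comodule A C N" by (rule simple_comodule_right[OF N])
 note Np = right_comodule_precomod[OF Nr]
 interpret N: right_comodule A C N by (rule Nr)
 interpret TN: tensor_pair A N C by (rule tpM[OF N.is_rmod])
 interpret TNg: abelian_group "TG A N C" by (rule TN.ab_tensor)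
 let ?P = "tensor_comod A C N"
 have P: "precomod A C ?P" by (rule precomod_tensor_comod[OF N.is_rmod])
 define good where "good L \<longleftrightarrow> (ALL Tg:set L. EX k u. (fst Tg, k) : \<K> & u .: N & snd Tg = (%t. tensor A N C u (k t)))"
  for L :: "(('a, 'c, 't) comod \<times> ('t => _)) list"
 have gh: "simple_comodule A C (fst Tg) & snd Tg : comod_hom A C (fst Tg) ?P" if "good L" "Tg : set L" for L Tg
 proof -
  obtain k u where ku: "(fst Tg, k) : \<K>" "u .: N" "snd Tg = (%t. tensor A N C u (k t))"
   using \<open>good L\<close> \<open>Tg : set L\<close> unfolding good_def by blast
  then show ?thesis using K[OF ku(1)] tensor_comod_hom[OF N.is_rmod simple_precomod ku(2)] by auto
 qed
 have gst: "stable A C ?P (img ?P L carrier)" if "good L" for L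
  by (rule img_stable[OF P]) (use gh[OF that] simple_precomod in blast)
 have gc: "img ?P L carrier <= carrier ?P" if "good L" for L
  by (rule submod_subset[OF stable_submod[OF gst[OF that]]])
 have "EX L. good L & t : img ?P L carrier" if "t .: (TG A N C)" for t
  using that
 proof (induction rule: TN.tensor_induct)
  case zero
  then show ?case by (intro exI[of _ "[]"]) (simp add: good_def)
 next
  case (tensor u c)
  obtain L0 where L0: "set L0 <= \<K>" "c : img C L0 carrier" using gen[OF tensor(2)] by blast
  define L where "L = map (%Tk. (fst Tk, %t. tensor A N C u (snd Tk t))) L0"
  have Kc: "snd Tk t .: C" if "Tk : \<K>" "t .: (fst Tk)" for Tk t
   using K[of "fst Tk" "snd Tk"] that rmod_hom_closed[OF comod_hom_rmod, of "snd Tk" A C "fst Tk" "regc C" t] by simp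
  have ic: "img C L0 carrier <= carrier C" if "set L0 <= \<K>" for L0 :: "(('a, 'c, 't) comod \<times> ('t => 'c)) list"
   by (rule img_closed[OF ab]) (use that Kc in blast)
  have "tensor A N C u c : img ?P (map (%Tk. (fst Tk, %t. tensor A N C u (snd Tk t))) L0) carrier"
   using L0
  proof (induction L0 arbitrary: c)
   case Nil
   then show ?case using add_maps_zero[OF ab TN.ab_tensor TN.tensor_right_add_maps[OF tensor(1)]] by simp
  next
   case (Cons Tk L0)
   then obtain t q where e: "c = snd Tk t \<oplus> q" "t .: (fst Tk)" "q : img C L0 carrier" by auto
   have "snd Tk t .: C" "q .: C" using Kc[of Tk t] Cons.prems(1) e ic[of L0] by auto
   then have "tensor A N C u c = tensor A N C u (snd Tk t) \<oplus>{|TG A N C|} tensor A N C u q"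
    using TN.tensor_add_right[OF tensor(1)] e(1) by simp
   moreover have "tensor A N C u q : img ?P (map (%Tk. (fst Tk, %t. tensor A N C u (snd Tk t))) L0) carrier"
    by (rule Cons.IH) (use Cons.prems(1) e(3) in auto)
   ultimately show ?case using e(2) by auto
  qed
  moreover have "good L"
   unfolding good_def
  proof
   fix Tg assume "Tg : set L"
   then obtain Tk where "Tk : set L0" "Tg = (fst Tk, %t. tensor A N C u (snd Tk t))" unfolding L_def by auto
   then show "EX k u. (fst Tg, k) : \<K> & u .: N & snd Tg = (%t. tensor A N C u (k t))"
    using L0(1) tensor(1) by (intro exI[of _ "snd Tk"] exI[of _ u]) auto
  qed
  ultimately show ?case unfolding L_def by blast
 next
  case (add s t)
  from add.IH obtain L L' where L: "good L" "s : img ?P L carrier" "good L'" "t : img ?P L' carrier" by blast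
  have "s \<oplus>{|?P|} t : img ?P (L @ L') carrier"
   by (rule img_append[OF right_module_ab[OF precomod_module[OF P]] gc[OF L(1)] gc[OF L(3)] _ L(2,4)])
    (rule rmod_hom_closed[OF comod_hom_rmod[OF conjunct2[OF gh[OF L(1)]]]])
  moreover have "good (L @ L')" using L(1,3) unfolding good_def by auto
  ultimately show ?case by (intro exI[of _ "L @ L'"]) simp
 qed
 note gen_tensor = this
 have "carrier N ~= {\<zero>{|N|}}" using N by (simp add: simple_comodule_def)
 then obtain x where x: "x .: N" "x ~= \<zero>{|N|}" using N.zero_closed by blast
 obtain L where L: "good L" "coact N x : img ?P L carrier"
  using gen_tensor[OF comodule_coact_closed[OF Nr x(1)]] by blast
 have "stable A C N {y : carrier N. coact N y : img ?P L carrier}"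
  by (rule stable_preimage[OF Np P coact_comod_hom[OF Nr] gst[OF L(1)]])
 then have all: "{y : carrier N. coact N y : img ?P L carrier} = carrier N"
  by (rule simple_stable[OF N _ _ x(2)]) (simp add: x(1) L(2))
 show ?thesis
 proof (rule that[of L])
  show "EX k u. (T, k) : \<K> & u .: N & g = (%t. tensor A N C u (k t))" if "(T, g) : set L" for T g
   using L(1) that unfolding good_def by force
  show "lifts A C N ?P L (coact N)"
  proof (rule lifting[OF Np P gh[OF L(1)] coact_comod_hom[OF Nr]])
   fix y assume "y .: N"
   then have "y : {y : carrier N. coact N y : img ?P L carrier}" by (simp only: all)
   then show "coact N y : img ?P L carrier" by simp
  qed
 qed
qed

text \<open>If all maps s_j of the decomposition vanished at x, so would f.\<close>

lemma lifts_nonzero: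
 assumes "lifts A C N P L f" "x .: N" "f x ~= \<zero>{|P|}" "abelian_group P"
  and "!!Tg. Tg : set L ==> abelian_group (fst Tg) & snd Tg : add_maps (fst Tg) P"
 shows "EX Tg:set L. EX s:comod_hom A C N (fst Tg). s x ~= \<zero>{|fst Tg|}"
 using assms(1,3,5)
proof (induction L arbitrary: f)
 case Nil
 then show ?case using assms(2) by simp
next
 case (Cons Tg L)
 interpret P: abelian_group P by fact
 from Cons.prems(1) obtain s f' where s: "s : comod_hom A C N (fst Tg)" "lifts A C N P L f'"
  "f x = snd Tg (s x) \<oplus>{|P|} f' x" using assms(2) by auto
 show ?case
 proof (cases "s x = \<zero>{|fst Tg|}")
  case True
  have "abelian_group (fst Tg)" "snd Tg : add_maps (fst Tg) P" using Cons.prems(3)[of Tg] by simp_all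
  then have "snd Tg (s x) = \<zero>{|P|}" unfolding True by (rule add_maps_zero[OF _ assms(4)])
  then have "f' x ~= \<zero>{|P|}" using s(3) Cons.prems(2) by auto
  from Cons.IH[OF s(2) this] show ?thesis using Cons.prems(3) by simp
 next
  case False
  then show ?thesis using s(1) by (intro bexI[of _ Tg]) auto
 qed
qed

end

section \<open>Direct sums\<close>

definition dsum :: "'i set => ('i => ('c, 'q) ring_scheme) => ('i => 'c) ring" where
 "dsum I G = add_ring (sum_group I (%i. add_monoid (G i)))"

text \<open>The formula has the shape of the comultiplication and the counit in
  \<open>dsum_coring\<close>, which thereby become instances of it
  (\<open>dsum_coring_simps\<close>).\<close>

definition dsum_lift ::
  "'i set => ('i => ('c, 'q) ring_scheme) => ('g, 'h) ring_scheme => ('i => 'c => 'g) => ('i => 'c) => 'g" where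
 "dsum_lift I G H g f = (\<Oplus>{|H|} i\<in>{i\<in>I. f i ~= \<zero>{|G i|}}. g i (f i))"

locale dsum_family =
 fixes I :: "'i set" and G :: "'i => ('c, 'q) ring_scheme"
 assumes abG: "i : I ==> abelian_group (G i)"
begin

lemma carrier_dsum:
 "carrier (dsum I G) = {f : \<Pi>\<^sub>E i\<in>I. carrier (G i). finite {i\<in>I. f i ~= \<zero>{|G i|}}}"
 unfolding dsum_def add_ring_simps
 by (subst carrier_sum_group) (simp_all add: abelian_group.a_group[OF abG])

lemma dsum_ops [simp]:
 "\<zero>{|dsum I G|} = (\<lambda>i\<in>I. \<zero>{|G i|})" "x \<oplus>{|dsum I G|} y = (\<lambda>i\<in>I. x i \<oplus>{|G i|} y i)"
 by (simp_all add: dsum_def)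

lemma abelian_dsum: "abelian_group (dsum I G)"
 unfolding dsum_def
proof (rule abelian_group_add_ring, rule group.group_comm_groupI)
 let ?S = "sum_group I (%i. add_monoid (G i))"
 show "group ?S" by (rule sum_group) (simp add: abelian_group.a_group[OF abG])
 fix x y assume "x .: ?S" "y .: ?S"
 then have xy: "x i .: (G i)" "y i .: (G i)" if "i : I" for i
  using carrier_dsum that by (auto simp: dsum_def PiE_iff)
 have "x i \<oplus>{|G i|} y i = y i \<oplus>{|G i|} x i" if "i : I" for i
  using abelian_monoid.a_comm[OF abelian_group.axioms(1)[OF abG[OF that]] xy[OF that]] .
 then show "x \<otimes>{|?S|} y = y \<otimes>{|?S|} x" by (auto intro: restrict_ext)
qed

lemma dsum_incl_closed:
 assumes "i : I" "x .: (G i)" shows "dsum_incl I G i x .: (dsum I G)"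
proof -
 have "{j : I. dsum_incl I G i x j ~= \<zero>{|G j|}} <= {i}" by (auto simp: dsum_incl_def)
 then have "finite {j : I. dsum_incl I G i x j ~= \<zero>{|G j|}}" by (rule finite_subset) simp
 then show ?thesis
  using assms(2) abelian_monoid.zero_closed[OF abelian_group.axioms(1)[OF abG]]
  by (auto simp: carrier_dsum dsum_incl_def)
qed

lemma dsum_incl_add_maps: "i : I ==> dsum_incl I G i : add_maps (G i) (dsum I G)"
proof (rule add_mapsI)
 show "i : I ==> x .: (G i) ==> dsum_incl I G i x .: (dsum I G)" for x
  by (rule dsum_incl_closed)
 show "i : I ==> x .: (G i) ==> y .: (G i) ==>
  dsum_incl I G i (x \<oplus>{|G i|} y) = dsum_incl I G i x \<oplus>{|dsum I G|} dsum_incl I G i y" for x y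
  by (auto simp: dsum_incl_def abelian_monoid.l_zero[OF abelian_group.axioms(1)[OF abG]]
   abelian_monoid.zero_closed[OF abelian_group.axioms(1)[OF abG]] intro: restrict_ext)
qed

lemma dsum_induct [consumes 1, case_names zero incl add]:
 assumes f: "f .: (dsum I G)" and zero: "P \<zero>{|dsum I G|}"
  and incl: "!!i x. [|i : I; x .: (G i)|] ==> P (dsum_incl I G i x)"
  and add: "!!f g. [|f .: (dsum I G); g .: (dsum I G); P f; P g|] ==> P (f \<oplus>{|dsum I G|} g)"
 shows "P f"
proof -
 \<comment> \<open>Induction on a finite set that contains the support; each step splits off one
   coordinate.\<close>
 have "P f" if "finite J" "f .: (dsum I G)" "{i\<in>I. f i ~= \<zero>{|G i|}} <= J" for J f
  using that
 proof (induction J arbitrary: f rule: finite_induct)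
  case empty
  then have "f = \<zero>{|dsum I G|}" by (auto simp: carrier_dsum PiE_iff extensional_def)
  then show ?case using zero by (simp add: restrict_def)
 next
  case (insert i J)
  show ?case
  proof (cases "i : I")
   case False
   then show ?thesis using insert.IH[OF insert.prems(1)] insert.prems(2) by blast
  next
   case True
   define f' where "f' = (\<lambda>j\<in>I. if j = i then \<zero>{|G j|} else f j)"
   have fi: "f i .: (G i)" using insert.prems(1) True by (auto simp: carrier_dsum)
   have "{j\<in>I. f' j ~= \<zero>{|G j|}} <= {j\<in>I. f j ~= \<zero>{|G j|}}" by (auto simp: f'_def)
   then have "finite {j\<in>I. f' j ~= \<zero>{|G j|}}"
    by (rule finite_subset) (use insert.prems(1) in "simp add: carrier_dsum")
   then have f'c: "f' .: (dsum I G)"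
    using insert.prems(1) abelian_monoid.zero_closed[OF abelian_group.axioms(1)[OF abG]]
    by (auto simp: carrier_dsum f'_def)
   have "P f'" by (rule insert.IH[OF f'c]) (use insert.prems(2) in "auto simp: f'_def")
   moreover have "f = dsum_incl I G i (f i) \<oplus>{|dsum I G|} f'"
   proof (rule ext)
    fix j
    have "f j .: (G j)" if "j : I" using insert.prems(1) that by (auto simp: carrier_dsum)
    moreover have "f j = undefined" if "j \<notin> I" using insert.prems(1) that by (auto simp: carrier_dsum PiE_iff extensional_def)
    ultimately show "f j = (dsum_incl I G i (f i) \<oplus>{|dsum I G|} f') j"
    using abelian_monoid.l_zero[OF abelian_group.axioms(1)[OF abG]] abelian_monoid.r_zero[OF abelian_group.axioms(1)[OF abG]]
    by (auto simp: dsum_incl_def f'_def)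
   qed
   ultimately show ?thesis using add[OF dsum_incl_closed[OF True fi] f'c incl[OF True fi]] by simp
  qed
 qed
 then show ?thesis using f carrier_dsum by blast
qed

lemma dsum_ext:
 assumes "f : add_maps (dsum I G) H" "g : add_maps (dsum I G) H" "abelian_group H" "x .: (dsum I G)"
  and "!!i y. [|i : I; y .: (G i)|] ==> f (dsum_incl I G i y) = g (dsum_incl I G i y)"
 shows "f x = g x"
 using assms(4)
proof (induction rule: dsum_induct)
 case zero
 then show ?case using add_maps_zero[OF abelian_dsum assms(3,1)] add_maps_zero[OF abelian_dsum assms(3,2)]
  by (simp del: dsum_ops)
next
 case (add s t)
 then show ?case by (simp add: add_maps_add[OF assms(1)] add_maps_add[OF assms(2)] del: dsum_ops)
qed (use assms(5) in simp)

context
 fixes H :: "('g, 'h) ring_scheme" and g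
 assumes H: "abelian_group H" and g: "!!i. i : I ==> g i : add_maps (G i) H"
begin

interpretation H: abelian_group H by (rule H)

lemma dsum_lift_superset:
 assumes f: "f .: (dsum I G)" and J: "finite J" "{i\<in>I. f i ~= \<zero>{|G i|}} <= J" "J <= I"
 shows "dsum_lift I G H g f = (\<Oplus>{|H|} i\<in>J. g i (f i))"
 unfolding dsum_lift_def
proof (rule H.add.finprod_mono_neutral_cong_left[OF J(1,2)])
 fix i assume "i : J - {i : I. f i ~= \<zero>{|G i|}}"
 then have i: "i : I" "f i = \<zero>{|G i|}" using J(3) by auto
 show "g i (f i) = \<zero>{|H|}" unfolding i(2) by (rule add_maps_zero[OF abG[OF i(1)] H g[OF i(1)]])
next
 show "(%i. g i (f i)) : J \<rightarrow> carrier H"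
  using J(3) f add_maps_closed[OF g] by (auto simp: carrier_dsum)
qed simp

lemma dsum_lift_add_maps: "dsum_lift I G H g : add_maps (dsum I G) H"
proof (rule add_mapsI)
 fix f assume f: "f .: (dsum I G)"
 then have "(%i. g i (f i)) : {i\<in>I. f i ~= \<zero>{|G i|}} \<rightarrow> carrier H"
  using add_maps_closed[OF g] by (auto simp: carrier_dsum)
 then show "dsum_lift I G H g f .: H" unfolding dsum_lift_def by (rule H.finsum_closed)
 fix f' assume f': "f' .: (dsum I G)"
 let ?J = "{i\<in>I. f i ~= \<zero>{|G i|}} \<union> {i\<in>I. f' i ~= \<zero>{|G i|}}"
 have J: "finite ?J" "?J <= I" using f f' by (auto simp: carrier_dsum)
 have s: "f \<oplus>{|dsum I G|} f' .: (dsum I G)"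
  using abelian_monoid.a_closed[OF abelian_group.axioms(1)[OF abelian_dsum] f f'] .
 have c: "g i (f i) .: H" "g i (f' i) .: H" "f i .: (G i)" "f' i .: (G i)" if "i : I" for i
  using f f' that add_maps_closed[OF g[OF that]] by (auto simp: carrier_dsum)
 have z: "\<zero>{|G i|} \<oplus>{|G i|} \<zero>{|G i|} = \<zero>{|G i|}" if "i : I" for i
  using abelian_monoid.l_zero[OF abelian_group.axioms(1)[OF abG[OF that]]]
   abelian_monoid.zero_closed[OF abelian_group.axioms(1)[OF abG[OF that]]] by simp
 have "dsum_lift I G H g (f \<oplus>{|dsum I G|} f') = (\<Oplus>{|H|} i\<in>?J. g i ((f \<oplus>{|dsum I G|} f') i))"
  by (rule dsum_lift_superset[OF s J(1) _ J(2)]) (auto simp: z)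
 also have "... = (\<Oplus>{|H|} i\<in>?J. g i (f i) \<oplus>{|H|} g i (f' i))"
  by (rule H.finsum_cong') (use J(2) c add_maps_add[OF g] in auto)
 also have "... = (\<Oplus>{|H|} i\<in>?J. g i (f i)) \<oplus>{|H|} (\<Oplus>{|H|} i\<in>?J. g i (f' i))"
  by (rule H.finsum_addf) (use J(2) c in auto)
 also have "... = dsum_lift I G H g f \<oplus>{|H|} dsum_lift I G H g f'"
  using dsum_lift_superset[OF f J(1) _ J(2)] dsum_lift_superset[OF f' J(1) _ J(2)] by simp
 finally show "dsum_lift I G H g (f \<oplus>{|dsum I G|} f') = dsum_lift I G H g f \<oplus>{|H|} dsum_lift I G H g f'" .
qed

lemma dsum_lift_incl:
 assumes i: "i : I" and x: "x .: (G i)" shows "dsum_lift I G H g (dsum_incl I G i x) = g i x"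
proof -
 have "dsum_lift I G H g (dsum_incl I G i x) = (\<Oplus>{|H|} j\<in>{i}. g j (dsum_incl I G i x j))"
  by (rule dsum_lift_superset[OF dsum_incl_closed[OF i x]]) (use i in "auto simp: dsum_incl_def")
 then show ?thesis using i add_maps_closed[OF g[OF i] x] by (simp add: dsum_incl_def)
qed

end

end

section \<open>Independent families of subgroups\<close>

inductive_set ssum :: "('g, 'q) ring_scheme => ('x => 'g set) => 'x set => 'g set" for G F B where
 zero: "\<zero>{|G|} : ssum G F B"
| add: "[|i : B; x : F i; y : ssum G F B|] ==> x \<oplus>{|G|} y : ssum G F B"

definition independent_family :: "('g, 'q) ring_scheme => ('x => 'g set) => 'x set => bool" where
 "independent_family G F B \<longleftrightarrow> (ALL i:B. F i \<inter> ssum G F (B - {i}) <= {\<zero>{|G|}})"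

lemma ssum_mono: assumes "y : ssum G F B" "B <= B'" shows "y : ssum G F B'"
 using assms(1) by (induction rule: ssum.induct) (use assms(2) in "auto intro: ssum.intros")

lemma ssum_finite:
 assumes "y : ssum G F B" shows "EX J. finite J & J <= B & y : ssum G F J"
 using assms
proof (induction rule: ssum.induct)
 case zero
 show ?case by (intro exI[of _ "{}"]) (simp add: ssum.zero)
next
 case (add i x y)
 then obtain J where J: "finite J" "J <= B" "y : ssum G F J" by blast
 have "x \<oplus>{|G|} y : ssum G F (insert i J)"
  by (rule ssum.add[OF _ add(2) ssum_mono[OF J(3)]]) auto
 then show ?case using J add(1) by (intro exI[of _ "insert i J"]) simp
qed

lemma subset_chain_sub: "subset.chain \<A> \<C> ==> \<C> <= \<A>"
 by (simp add: subset.chain_def)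

context
 fixes G :: "('g, 'q) ring_scheme" and F :: "'x => 'g set" and X :: "'x set"
 assumes abG: "abelian_group G" and F: "!!x. x : X ==> additive_subgroup (F x) G"
begin

interpretation G: abelian_group G by (rule abG)

lemma ssum_closed:
 assumes "B <= X" "y : ssum G F B" shows "y .: G"
 using assms(2)
proof (induction rule: ssum.induct)
 case (add i x y)
 then have "x .: G" using additive_subgroup.a_subset[OF F] assms(1) by blast
 then show ?case using add by simp
qed simp

lemma ssum_subgroup: "B <= X ==> additive_subgroup (ssum G F B) G"
proof (rule G.additive_subgroupI)
 assume B: "B <= X"
 have Fc: "x .: G" if "i : B" "x : F i" for i x using additive_subgroup.a_subset[OF F] B that by blast
 show "ssum G F B <= carrier G" using ssum_closed[OF B] by blast
 show "\<zero>{|G|} : ssum G F B" by (rule ssum.zero)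
 show "x \<oplus>{|G|} y : ssum G F B" if "x : ssum G F B" "y : ssum G F B" for x y
  using that(1)
 proof (induction rule: ssum.induct)
  case zero
  then show ?case using that(2) ssum_closed[OF B] by simp
 next
  case (add i u v)
  have "u \<oplus>{|G|} v \<oplus>{|G|} y = u \<oplus>{|G|} (v \<oplus>{|G|} y)"
   using Fc[OF add(1,2)] ssum_closed[OF B add(3)] ssum_closed[OF B that(2)] by (rule G.a_assoc)
  then show ?case using ssum.add[OF add(1,2,4)] by simp
 qed
 show "\<ominus>{|G|} x : ssum G F B" if "x : ssum G F B" for x
  using that
 proof (induction rule: ssum.induct)
  case zero
  show ?case by (simp only: G.a_inv_zero ssum.zero)
 next
  case (add i u v)
  have "\<ominus>{|G|} (u \<oplus>{|G|} v) = \<ominus>{|G|} u \<oplus>{|G|} \<ominus>{|G|} v"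
   using Fc[OF add(1,2)] ssum_closed[OF B add(3)] by (rule G.minus_add)
  then show ?case
   using ssum.add[OF add(1) additive_subgroup_uminus[OF abG F add(2)] add(4)] add(1) B by auto
 qed
qed

lemma ssum_incl: assumes "B <= X" "i : B" shows "F i <= ssum G F B"
proof
 fix x assume x: "x : F i"
 have "x .: G" using additive_subgroup.a_subset[OF F] assms x by blast
 moreover have "x \<oplus>{|G|} \<zero>{|G|} : ssum G F B" by (rule ssum.add[of i B x F, OF assms(2) x ssum.zero])
 ultimately show "x : ssum G F B" by simp
qed

text \<open>The dichotomy is all that is used of simplicity, so the lemma serves for the lines over
  a division ring (existence of a basis) as well as for simple subcomodules (complete
  decomposition). By Zorn's lemma there is a maximal independent subfamily; a member outside its sum
  would meet that sum trivially and could be added.\<close>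

lemma exists_independent_spanning:
 assumes dich: "!!i B. [|i : X; B <= X|] ==> F i \<inter> ssum G F B <= {\<zero>{|G|}} \<or> F i <= ssum G F B"
 obtains B where "B <= X" "independent_family G F B" "!!i. i : X ==> F i <= ssum G F B"
proof -
 let ?A = "{B. B <= X & independent_family G F B}"
 have "EX M:?A. ALL B:?A. M <= B --> B = M"
 proof (rule subset_Zorn')
  fix \<C> assume ch: "subset.chain ?A \<C>"
  have sub: "\<Union>\<C> <= X" using subset_chain_sub[OF ch] by (intro Union_least) auto
  \<comment> \<open>An element of the sum over the union of a chain uses finitely many indices, and
    these lie in a single member of the chain.\<close>
  have "F i \<inter> ssum G F (\<Union>\<C> - {i}) <= {\<zero>{|G|}}" if i: "i : \<Union>\<C>" for i
  proof
   fix x assume x: "x : F i \<inter> ssum G F (\<Union>\<C> - {i})"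
   then have "x : ssum G F (\<Union>\<C> - {i})" by (rule IntD2)
   from ssum_finite[OF this] obtain J where J: "finite J" "J <= \<Union>\<C> - {i}" "x : ssum G F J" by (elim exE conjE)
   have "finite (insert i J)" using J(1) by simp
   moreover have "insert i J <= \<Union>\<C>" using J(2) i by (simp add: subset_Diff_insert)
   moreover have "\<C> ~= {}" using i by (metis UnionE empty_iff)
   ultimately have fin: "finite (insert i J)" "insert i J <= \<Union>\<C>" "\<C> ~= {}" .
   from finite_subset_Union_chain[OF fin ch] obtain B where B: "B : \<C>" "insert i J <= B" .
   have "J <= B - {i}" using B(2) J(2) by (simp add: subset_Diff_insert)
   then have "x : ssum G F (B - {i})" by (rule ssum_mono[OF J(3)])
   moreover have "independent_family G F B" using subsetD[OF subset_chain_sub[OF ch] B(1)] by simp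
   ultimately show "x : {\<zero>{|G|}}" using IntD1[OF x] B(2) unfolding independent_family_def by auto
  qed
  then show "\<Union>\<C> : ?A" using sub by (simp add: independent_family_def)
 qed
 then obtain M where M0: "M : ?A" "ALL B:?A. M <= B --> B = M" by (elim bexE)
 then have M: "M <= X" "independent_family G F M" by simp_all
 have max: "B = M" if "B <= X" "independent_family G F B" "M <= B" for B
  using M0(2)[rule_format, of B] that by simp
 show ?thesis
 proof (rule that[OF M])
  fix i assume i: "i : X"
  show "F i <= ssum G F M"
  proof (rule ccontr)
   assume no: "\<not> F i <= ssum G F M"
   then have triv: "F i \<inter> ssum G F M <= {\<zero>{|G|}}" using dich[OF i M(1)] by blast
   have iM: "i \<notin> M" using no ssum_incl[OF M(1)] by blast
   have "F j \<inter> ssum G F (insert i M - {j}) <= {\<zero>{|G|}}" if j: "j : insert i M" for j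
   proof (cases "j = i")
    case True
    then show ?thesis using triv iM by simp
   next
    case False
    then have jM: "j : M" using j by simp
    \<comment> \<open>Elements of the enlarged sum split into a part y in F i and a part z in the
      sum of the members other than j. If the total lies in F j, then y lies in F i and in the sum
      over M, hence is 0, and independence of M finishes.\<close>
    have key: "EX y:F i. EX z:ssum G F (M - {j}). x = y \<oplus>{|G|} z" if "x : ssum G F (insert i M - {j})" for x
    using that
    proof (induction rule: ssum.induct)
    case zero
    show ?case
    using additive_subgroup.zero_closed[OF F[OF i]] ssum.zero[of G F "M - {j}"]
    by (intro bexI[of _ "\<zero>{|G|}"]) simp_all
    next
    case (add k u v)
    then obtain y z where yz: "y : F i" "z : ssum G F (M - {j})" "v = y \<oplus>{|G|} z" by blast
    have c: "y .: G" "z .: G" "u .: G"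
    using additive_subgroup.a_subset[OF F] i yz ssum_closed[of "M - {j}" z] M(1) add(1,2) by blast+
    show ?case
    proof (cases "k = i")
    case True
    have "u \<oplus>{|G|} v = (u \<oplus>{|G|} y) \<oplus>{|G|} z" using c yz(3) by (simp add: G.a_assoc)
    moreover have "u \<oplus>{|G|} y : F i" using additive_subgroup.a_closed[OF F[OF i]] add(2) yz(1) True by simp
    ultimately show ?thesis using yz(2) by blast
    next
    case False
    then have "k : M - {j}" using add(1) by blast
    then have "u \<oplus>{|G|} z : ssum G F (M - {j})" by (rule ssum.add[OF _ add(2) yz(2)])
    moreover have "u \<oplus>{|G|} v = y \<oplus>{|G|} (u \<oplus>{|G|} z)" using c yz(3) by (simp add: G.a_lcomm)
    ultimately show ?thesis using yz(1) by blast
    qed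
    qed
    show ?thesis
    proof
    fix x assume x: "x : F j \<inter> ssum G F (insert i M - {j})"
    then obtain y z where yz: "y : F i" "z : ssum G F (M - {j})" "x = y \<oplus>{|G|} z" using key by blast
    note sg = ssum_subgroup[OF M(1)]
    have c: "y .: G" "z .: G"
    using additive_subgroup.a_subset[OF F[OF i]] yz ssum_closed[of "M - {j}" z] M(1) by blast+
    have "x : ssum G F M" using ssum_incl[OF M(1) jM] x by blast
    moreover have "z : ssum G F M" by (rule ssum_mono[OF yz(2)]) blast
    ultimately have "x \<ominus>{|G|} z : ssum G F M" by (rule additive_subgroup_minus[OF abG sg])
    moreover have "x \<ominus>{|G|} z = y" using yz(3) c by (simp add: G.minus_eq G.a_assoc G.r_neg)
    ultimately have "y = \<zero>{|G|}" using triv yz(1) by blast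
    then have "x = z" using yz(3) c by simp
    then show "x : {\<zero>{|G|}}" using x yz(2) jM M(2) unfolding independent_family_def by blast
    qed
   qed
   then have "independent_family G F (insert i M)" by (simp add: independent_family_def)
   then show False using max[of "insert i M"] i M(1) iM by blast
  qed
 qed
qed

text \<open>The \<open>N i\<close> are the subgroups F i as groups of their own, in the form that
  \<open>dsum\<close> expects. Injectivity: a nonzero coordinate of a family that sums to 0 would be
  a sum of members with other indices.\<close>

lemma independent_dsum_bij:
 assumes B: "B <= X" "independent_family G F B"
  and N: "!!i. i : B ==> abelian_group (N i)" "!!i. i : B ==> carrier (N i) = F i" "!!i. i : B ==> \<zero>{|N i|} = \<zero>{|G|}"
   "!!i x y. i : B ==> x : F i ==> y : F i ==> x \<oplus>{|N i|} y = x \<oplus>{|G|} y"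
 shows "bij_betw (dsum_lift B N G (%_ x. x)) (carrier (dsum B N)) (ssum G F B)"
proof -
 interpret D: dsum_family B N by (rule dsum_family.intro) (rule N(1))
 have Fc: "F i <= carrier G" if "i : B" for i using additive_subgroup.a_subset[OF F] B(1) that by blast
 have g: "(%x. x) : add_maps (N i) G" if "i : B" for i
  by (rule add_mapsI) (use N(2)[OF that] N(4)[OF that] subsetD[OF Fc[OF that]] in simp_all)
 let ?S = "dsum_lift B N G (%_ x. x)"
 have Sm: "?S : add_maps (dsum B N) G" by (rule D.dsum_lift_add_maps[OF abG g])
 note Si = D.dsum_lift_incl[OF abG g]
 have sum_in: "finsum G f J : ssum G F B'" if "finite J" "J <= B'" "B' <= B" "!!i. i : J ==> f i : F i" for f J B'
 proof (rule additive_subgroup_finsum[OF abG ssum_subgroup])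
  show "B' <= X" using that B by blast
  show "f : J \<rightarrow> ssum G F B'" using that ssum_incl[OF \<open>B' <= X\<close>] by blast
 qed
 have fF: "f i : F i" if "f .: (dsum B N)" "i : B" for f i
  using that N(2) by (auto simp: D.carrier_dsum)
 have inj: "inj_on ?S (carrier (dsum B N))"
 proof (rule inj_onI)
  fix f f' assume f: "f .: (dsum B N)" "f' .: (dsum B N)" and e: "?S f = ?S f'"
  interpret DG: abelian_group "dsum B N" by (rule D.abelian_dsum)
  define d where "d = f \<ominus>{|dsum B N|} f'"
  have d: "d .: (dsum B N)" unfolding d_def by (rule DG.minus_closed[OF f])
  have Sd: "?S d = \<zero>{|G|}"
   unfolding d_def using add_maps_minus[OF D.abelian_dsum abG Sm f] e G.diff_zero_iff add_maps_closed[OF Sm f(2)] by simp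
  let ?J = "{i : B. d i ~= \<zero>{|N i|}}"
  have fin: "finite ?J" using d by (simp add: D.carrier_dsum)
  have "?J = {}"
  proof (rule ccontr)
   assume "?J ~= {}"
   then obtain i where i: "i : ?J" by blast
   have dc: "(%j. d j) : ?J - {i} \<rightarrow> carrier G" "d i .: G" using fF[OF d] Fc i by auto
   have "?S d = finsum G d (insert i (?J - {i}))" using i by (simp add: dsum_lift_def insert_absorb)
   also have "... = d i \<oplus>{|G|} finsum G d (?J - {i})"
    by (rule G.finsum_insert) (use fin dc in auto)
   finally have s: "d i \<oplus>{|G|} finsum G d (?J - {i}) = \<zero>{|G|}" using Sd by simp
   have r: "finsum G d (?J - {i}) : ssum G F (B - {i})"
    by (rule sum_in) (use fin fF[OF d] in auto)
   then have rc: "finsum G d (?J - {i}) .: G" using ssum_closed[of "B - {i}"] B(1) by blast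
   have di: "d i = \<ominus>{|G|} finsum G d (?J - {i})" using s rc dc(2) by (rule G.minus_equality[symmetric])
   have BX: "B - {i} <= X" using B(1) by blast
   have "d i : ssum G F (B - {i})"
    by (subst di) (rule additive_subgroup_uminus[OF abG ssum_subgroup[OF BX] r])
   moreover have iB: "i : B" using i by simp
   ultimately have "d i = \<zero>{|G|}"
    using fF[OF d iB] bspec[OF B(2)[unfolded independent_family_def] iB] by auto
   then show False using i N(3)[OF iB] by simp
  qed
  then have "d = \<zero>{|dsum B N|}" using d unfolding D.carrier_dsum
   by (intro ext) (auto simp: PiE_iff extensional_def)
  then show "f = f'" unfolding d_def using DG.diff_zero_iff[OF f] by simp
 qed
 have "?S ` carrier (dsum B N) = ssum G F B"
 proof
  show "?S ` carrier (dsum B N) <= ssum G F B"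
  proof
   fix y assume "y : ?S ` carrier (dsum B N)"
   then obtain f where f: "f .: (dsum B N)" "y = ?S f" by blast
   show "y : ssum G F B"
    unfolding f(2) dsum_lift_def by (rule sum_in) (use f(1) fF[OF f(1)] in "auto simp: D.carrier_dsum")
  qed
  show "ssum G F B <= ?S ` carrier (dsum B N)"
  proof
   fix y assume "y : ssum G F B"
   then show "y : ?S ` carrier (dsum B N)"
   proof (induction rule: ssum.induct)
    case zero
    show ?case
    by (rule image_eqI[of _ ?S, OF add_maps_zero[OF D.abelian_dsum abG Sm, symmetric]
    abelian_monoid.zero_closed[OF abelian_group.axioms(1)[OF D.abelian_dsum]]])
   next
    case (add i x y)
    from add.IH obtain f where f: "f .: (dsum B N)" "y = ?S f" by (elim imageE)
    have x: "x .: (N i)" using N(2) add by simp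
    have "?S (dsum_incl B N i x \<oplus>{|dsum B N|} f) = x \<oplus>{|G|} y"
    using add_maps_add[OF Sm D.dsum_incl_closed[OF add(1) x] f(1)] Si[OF _ add(1) x] f(2) by simp
    from image_eqI[of _ ?S, OF this[symmetric]
    abelian_monoid.a_closed[OF abelian_group.axioms(1)[OF D.abelian_dsum] D.dsum_incl_closed[OF add(1) x] f(1)]]
    show ?case .
   qed
  qed
 qed
 then show ?thesis using inj by (simp add: bij_betw_def)
qed

end

section \<open>Endomorphisms, linear forms and dual bases\<close>

lemma End_ring_simps:
 "carrier (End_ring A M) = rmod_hom A M M \<inter> extensional (carrier M)"
 "\<zero>{|End_ring A M|} = (\<lambda>x\<in>carrier M. \<zero>{|M|})" "\<one>{|End_ring A M|} = (\<lambda>x\<in>carrier M. x)"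
 "f \<oplus>{|End_ring A M|} g = (\<lambda>x\<in>carrier M. f x \<oplus>{|M|} g x)"
 "f \<otimes>{|End_ring A M|} g = compose (carrier M) f g"
 by (simp_all add: End_ring_def)

lemma dual_bimod_simps:
 "carrier (dual_bimod A M) = rmod_hom A M (regular_rmod A) \<inter> extensional (carrier M)"
 "\<zero>{|dual_bimod A M|} = (\<lambda>x\<in>carrier M. \<zero>{|A|})"
 "f \<oplus>{|dual_bimod A M|} g = (\<lambda>x\<in>carrier M. f x \<oplus>{|A|} g x)"
 "f <|{|dual_bimod A M|} d = (\<lambda>x\<in>carrier M. f (d x))"
 "a |>{|dual_bimod A M|} f = (\<lambda>x\<in>carrier M. a \<otimes>{|A|} f x)"
 by (simp_all add: dual_bimod_def)

lemma eval_bimod_simps [simp]: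
 "carrier (eval_bimod M) = carrier M" "\<zero>{|eval_bimod M|} = \<zero>{|M|}" "(\<oplus>{|eval_bimod M|}) = (\<oplus>{|M|})"
 "ract (eval_bimod M) = ract M" "d |>{|eval_bimod M|} x = d x"
 by (simp_all add: eval_bimod_def)

lemma restrict_ext_iff: "restrict f X = restrict g X \<longleftrightarrow> (ALL x:X. f x = g x)"
 by (metis restrict_apply' restrict_ext)

context right_module begin

lemma rmod_hom_restrict: "f : rmod_hom A M N ==> restrict f (carrier M) : rmod_hom A M N \<inter> extensional (carrier M)"
 by (auto simp: rmod_hom_def ract_closed)

lemma ext_eqI:
 "[|f : extensional (carrier M); g : extensional (carrier M); !!x. x .: M ==> f x = g x|] ==> f = g"
 by (rule extensionalityI)

lemma End_abelian: "abelian_group (End_ring A M)"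
proof (rule abelian_groupI, unfold End_ring_simps)
 fix f g assume f: "f : rmod_hom A M M \<inter> extensional (carrier M)" and g: "g : rmod_hom A M M \<inter> extensional (carrier M)"
 have "(%x. f x \<oplus> g x) : rmod_hom A M M"
  using f g add_maps_plus[OF ab, of f M g] by (auto simp: rmod_hom_iff ract_add_left add_maps_closed)
 then show "(\<lambda>x\<in>carrier M. f x \<oplus> g x) : rmod_hom A M M \<inter> extensional (carrier M)" by (rule rmod_hom_restrict)
 show "(\<lambda>x\<in>carrier M. f x \<oplus> g x) = (\<lambda>x\<in>carrier M. g x \<oplus> f x)"
  using f g by (auto simp: restrict_ext_iff a_comm rmod_hom_closed)
 fix h assume "h : rmod_hom A M M \<inter> extensional (carrier M)"
 then show "(\<lambda>x\<in>carrier M. (\<lambda>x\<in>carrier M. f x \<oplus> g x) x \<oplus> h x) = (\<lambda>x\<in>carrier M. f x \<oplus> (\<lambda>x\<in>carrier M. g x \<oplus> h x) x)"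
  using f g by (auto simp: restrict_ext_iff a_assoc rmod_hom_closed)
next
 show "(\<lambda>x\<in>carrier M. \<zero>) : rmod_hom A M M \<inter> extensional (carrier M)"
  by (rule rmod_hom_restrict) (simp add: rmod_hom_def ract_zero_left)
next
 fix f assume f: "f : rmod_hom A M M \<inter> extensional (carrier M)"
 then show "(\<lambda>x\<in>carrier M. (\<lambda>x\<in>carrier M. \<zero>) x \<oplus> f x) = f"
  by (intro ext_eqI) (auto simp: rmod_hom_closed)
 have "(%x. \<ominus> f x) : rmod_hom A M M"
  using f add_maps_uminus_map[OF ab, of f M] by (auto simp: rmod_hom_iff ract_uminus_left add_maps_closed)
 then show "EX y:rmod_hom A M M \<inter> extensional (carrier M). (\<lambda>x\<in>carrier M. y x \<oplus> f x) = (\<lambda>x\<in>carrier M. \<zero>)"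
  using f by (intro bexI[OF _ rmod_hom_restrict]) (auto simp: restrict_ext_iff l_neg rmod_hom_closed)
qed

lemma End_ring_ring: "ring (End_ring A M)"
proof (rule ringI[OF End_abelian])
 have comp: "compose (carrier M) f g : rmod_hom A M M \<inter> extensional (carrier M)"
  if "f : rmod_hom A M M" "g : rmod_hom A M M" for f g
  unfolding compose_def by (rule rmod_hom_restrict[OF rmod_hom_comp[OF that(2,1)]])
 show "Group.monoid (End_ring A M)"
 proof (rule monoidI, unfold End_ring_simps)
  show "(\<lambda>x\<in>carrier M. x) : rmod_hom A M M \<inter> extensional (carrier M)"
   by (rule rmod_hom_restrict) (simp add: rmod_hom_def)
  fix f g assume f: "f : rmod_hom A M M \<inter> extensional (carrier M)" and g: "g : rmod_hom A M M \<inter> extensional (carrier M)"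
  then show "compose (carrier M) f g : rmod_hom A M M \<inter> extensional (carrier M)" using comp by auto
  show "compose (carrier M) (\<lambda>x\<in>carrier M. x) f = f"
   using f by (intro ext_eqI) (auto simp: compose_def rmod_hom_closed)
  show "compose (carrier M) f (\<lambda>x\<in>carrier M. x) = f"
   using f by (intro ext_eqI) (auto simp: compose_def)
  fix h assume "h : rmod_hom A M M \<inter> extensional (carrier M)"
  then show "compose (carrier M) (compose (carrier M) f g) h = compose (carrier M) f (compose (carrier M) g h)"
   by (auto simp: compose_def restrict_ext_iff rmod_hom_closed)
 qed
next
 fix f g h assume "f .: (End_ring A M)" "g .: (End_ring A M)" "h .: (End_ring A M)"
 then have "f : rmod_hom A M M" "g : rmod_hom A M M" "h : rmod_hom A M M" by (simp_all add: End_ring_simps)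
 note c = this this[THEN rmod_hom_closed]
 show "(f \<oplus>{|End_ring A M|} g) \<otimes>{|End_ring A M|} h = f \<otimes>{|End_ring A M|} h \<oplus>{|End_ring A M|} g \<otimes>{|End_ring A M|} h"
  using c by (simp add: End_ring_simps compose_def restrict_ext_iff)
 show "h \<otimes>{|End_ring A M|} (f \<oplus>{|End_ring A M|} g) = h \<otimes>{|End_ring A M|} f \<oplus>{|End_ring A M|} h \<otimes>{|End_ring A M|} g"
  using c by (simp add: End_ring_simps compose_def restrict_ext_iff rmod_hom_add[of h])
qed

lemma End_uminus:
 assumes "f .: (End_ring A M)" shows "\<ominus>{|End_ring A M|} f = (\<lambda>x\<in>carrier M. \<ominus> f x)"
proof -
 interpret E: abelian_group "End_ring A M" by (rule End_abelian)
 have f: "f : rmod_hom A M M" using assms by (simp add: End_ring_simps)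
 have "(%x. \<ominus> f x) : rmod_hom A M M"
  using f add_maps_uminus_map[OF ab, of f M] by (auto simp: rmod_hom_iff ract_uminus_left add_maps_closed)
 then have "(\<lambda>x\<in>carrier M. \<ominus> f x) .: (End_ring A M)"
  using rmod_hom_restrict by (simp add: End_ring_simps)
 moreover have "(\<lambda>x\<in>carrier M. \<ominus> f x) \<oplus>{|End_ring A M|} f = \<zero>{|End_ring A M|}"
  using f by (simp add: End_ring_simps restrict_ext_iff l_neg rmod_hom_closed)
 ultimately show ?thesis using assms by (simp add: E.minus_equality)
qed

lemma dual_abelian: "abelian_group (dual_bimod A M)"
proof (rule abelian_groupI, unfold dual_bimod_simps)
 have ar: "add_maps M (regular_rmod A) = add_maps M A" by (simp add: add_maps_def)
 note cl = rmod_hom_closed[where N = "regular_rmod A", simplified]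
 fix f g assume f: "f : rmod_hom A M (regular_rmod A) \<inter> extensional (carrier M)" and g: "g : rmod_hom A M (regular_rmod A) \<inter> extensional (carrier M)"
 have "(%x. f x \<oplus>{|A|} g x) : rmod_hom A M (regular_rmod A)"
  using f g add_maps_plus[OF A.abelian_group_axioms, of f M g]
  by (auto simp: rmod_hom_iff A.l_distr add_maps_closed ar)
 then show "(\<lambda>x\<in>carrier M. f x \<oplus>{|A|} g x) : rmod_hom A M (regular_rmod A) \<inter> extensional (carrier M)" by (rule rmod_hom_restrict)
 show "(\<lambda>x\<in>carrier M. f x \<oplus>{|A|} g x) = (\<lambda>x\<in>carrier M. g x \<oplus>{|A|} f x)"
  using f g by (auto simp: restrict_ext_iff A.a_comm cl)
 fix h assume "h : rmod_hom A M (regular_rmod A) \<inter> extensional (carrier M)"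
 then show "(\<lambda>x\<in>carrier M. (\<lambda>x\<in>carrier M. f x \<oplus>{|A|} g x) x \<oplus>{|A|} h x) = (\<lambda>x\<in>carrier M. f x \<oplus>{|A|} (\<lambda>x\<in>carrier M. g x \<oplus>{|A|} h x) x)"
  using f g by (auto simp: restrict_ext_iff A.a_assoc cl)
next
 show "(\<lambda>x\<in>carrier M. \<zero>{|A|}) : rmod_hom A M (regular_rmod A) \<inter> extensional (carrier M)"
  by (rule rmod_hom_restrict) (simp add: rmod_hom_def)
next
 note cl = rmod_hom_closed[where N = "regular_rmod A", simplified]
 have ar: "add_maps M (regular_rmod A) = add_maps M A" by (simp add: add_maps_def)
 fix f assume f: "f : rmod_hom A M (regular_rmod A) \<inter> extensional (carrier M)"
 then show "(\<lambda>x\<in>carrier M. (\<lambda>x\<in>carrier M. \<zero>{|A|}) x \<oplus>{|A|} f x) = f"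
  by (intro ext_eqI) (auto simp: cl)
 have "(%x. \<ominus>{|A|} f x) : rmod_hom A M (regular_rmod A)"
  using f add_maps_uminus_map[OF A.abelian_group_axioms, of f M]
  by (auto simp: rmod_hom_iff A.l_minus add_maps_closed ar)
 then show "EX y:rmod_hom A M (regular_rmod A) \<inter> extensional (carrier M). (\<lambda>x\<in>carrier M. y x \<oplus>{|A|} f x) = (\<lambda>x\<in>carrier M. \<zero>{|A|})"
  using f by (intro bexI[OF _ rmod_hom_restrict]) (auto simp: restrict_ext_iff A.l_neg cl)
qed

lemma dual_bimodule:
 assumes "subring D (End_ring A M)"
 shows "bimodule A (End_ring A M(|carrier := D|)) (dual_bimod A M)"
proof -
 interpret E: ring "End_ring A M" by (rule End_ring_ring)
 interpret R: ring "End_ring A M(|carrier := D|)" by (rule E.subring_is_ring[OF assms])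
 interpret S: abelian_group "dual_bimod A M" by (rule dual_abelian)
 have D: "d : rmod_hom A M M" if "d : D" for d using subringE(1)[OF assms] that by (auto simp: End_ring_simps)
 note dc = D[THEN rmod_hom_closed]
 note cl = rmod_hom_closed[where N = "regular_rmod A", simplified]
  rmod_hom_add[where N = "regular_rmod A", simplified] rmod_hom_ract[where N = "regular_rmod A", simplified]
 have r1: "(\<lambda>x\<in>carrier M. f (d x)) : rmod_hom A M (regular_rmod A)"
  if "f : rmod_hom A M (regular_rmod A)" "d : D" for f d
  using rmod_hom_restrict[OF rmod_hom_comp[OF D[OF that(2)] that(1)]] by blast
 have l1: "(\<lambda>x\<in>carrier M. a \<otimes>{|A|} f x) : rmod_hom A M (regular_rmod A)"
  if "a .: A" "f : rmod_hom A M (regular_rmod A)" for a f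
 proof -
  have "(%x. a \<otimes>{|A|} f x) : rmod_hom A M (regular_rmod A)"
   using that by (auto simp: rmod_hom_def A.r_distr A.m_assoc Pi_iff)
  from rmod_hom_restrict[OF this] show ?thesis by blast
 qed
 have o1: "(\<lambda>x\<in>carrier M. f (if x : carrier M then x else undefined)) = f"
   "(\<lambda>x\<in>carrier M. \<one>{|A|} \<otimes>{|A|} f x) = f"
  if "f : rmod_hom A M (regular_rmod A)" "f : extensional (carrier M)" for f
  using that by (auto intro!: ext_eqI simp: cl)
 show ?thesis
  by unfold_locales
   (auto simp: dual_bimod_simps r1 l1 o1 restrict_ext_iff cl dc End_ring_simps A.l_distr A.r_distr A.m_assoc
    compose_def)
qed

lemma eval_bimodule:
 assumes "subring D (End_ring A M)"
 shows "bimodule (End_ring A M(|carrier := D|)) A (eval_bimod M)"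
proof -
 interpret E: ring "End_ring A M" by (rule End_ring_ring)
 interpret R: ring "End_ring A M(|carrier := D|)" by (rule E.subring_is_ring[OF assms])
 interpret S: abelian_group "eval_bimod M" by (rule abelian_group_transfer[OF ab]) simp_all
 have D: "d : rmod_hom A M M" if "d : D" for d using subringE(1)[OF assms] that by (auto simp: End_ring_simps)
 show ?thesis
  by unfold_locales
   (auto simp: ract_closed ract_add_left ract_add_right ract_mult ract_one rmod_hom_closed[OF D] rmod_hom_add[OF D]
    rmod_hom_ract[OF D] End_ring_simps compose_def)
qed

end

text \<open>A dual basis is an indexed family in which vectors may repeat, whereas
  \<open>finitely_generated\<close> and \<open>free_rmod\<close> work with sets of vectors; sums are
  regrouped accordingly.\<close>

lemma finsum_fibres:
 assumes G: "abelian_group G" and "finite F" "finite J" "e ` J <= F" "g : J \<rightarrow> carrier G"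
 shows "finsum G g J = (\<Oplus>{|G|} f\<in>F. finsum G g {j\<in>J. e j = f})"
 using assms(2-5)
proof (induction F arbitrary: J rule: finite_induct)
 case empty
 interpret G: abelian_group G by fact
 from empty show ?case by simp
next
 case (insert f F)
 interpret G: abelian_group G by fact
 let ?K = "{j\<in>J. e j = f}" and ?L = "{j\<in>J. e j ~= f}"
 have J: "J = ?K \<union> ?L" "?K \<inter> ?L = {}" "finite ?K" "finite ?L" using insert.prems(1) by auto
 have gc: "g : ?K \<rightarrow> carrier G" "g : ?L \<rightarrow> carrier G" using insert.prems(3) by auto
 have c: "(%f. finsum G g {j\<in>J. e j = f}) : F \<rightarrow> carrier G" "finsum G g ?K .: G"
  using insert.prems(3) by (auto intro!: G.finsum_closed)
 have "finsum G g J = finsum G g ?K \<oplus>{|G|} finsum G g ?L"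
  using G.finsum_Un_disjoint[OF J(3,4,2) gc] J(1) by simp
 also have "finsum G g ?L = (\<Oplus>{|G|} f'\<in>F. finsum G g {j\<in>?L. e j = f'})"
  by (rule insert.IH) (use insert.prems in auto)
 also have "... = (\<Oplus>{|G|} f'\<in>F. finsum G g {j\<in>J. e j = f'})"
 proof (rule G.finsum_cong'[OF refl c(1)])
  fix f' assume "f' : F"
  then have "{j\<in>?L. e j = f'} = {j\<in>J. e j = f'}" using insert.hyps(2) by auto
  then show "finsum G g {j\<in>?L. e j = f'} = finsum G g {j\<in>J. e j = f'}" by simp
 qed
 finally show ?case using G.finsum_insert[OF insert.hyps(1,2) c] by simp
qed

context right_module begin

lemma dual_basis_finitely_generated:
 assumes b: "dual_basis A M (n, es, e)" shows "finitely_generated A M"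
 unfolding finitely_generated_def
proof (intro exI[of _ "e ` {..<n}"] conjI ballI)
 have e: "!!i. i < n ==> e i .: M" and es: "!!i. i < n ==> es i : rmod_hom A M (regular_rmod A)"
  and s: "!!x. x .: M ==> x = (\<Oplus> i\<in>{..<n}. e i <| es i x)"
  using b by (auto simp: dual_basis_def dual_bimod_simps Pi_iff)
 show "e ` {..<n} <= carrier M" using e by auto
 fix x assume x: "x .: M"
 have ex: "es i x .: A" if "i < n" for i using rmod_hom_closed[OF es[OF that] x] by simp
 let ?a = "%f. \<Oplus>{|A|} i\<in>{i\<in>{..<n}. e i = f}. es i x"
 have "x = (\<Oplus> i\<in>{..<n}. e i <| es i x)" by (rule s[OF x])
 also have "... = (\<Oplus> f\<in>e ` {..<n}. \<Oplus> i\<in>{i\<in>{..<n}. e i = f}. e i <| es i x)"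
  by (rule finsum_fibres[OF ab]) (auto simp: ract_closed e ex)
 also have "... = (\<Oplus> f\<in>e ` {..<n}. f <| ?a f)"
 proof (rule finsum_cong'[OF refl])
  show "(%f. f <| ?a f) : e ` {..<n} \<rightarrow> carrier M"
   using e ex by (auto intro!: ract_closed A.finsum_closed)
  fix f assume "f : e ` {..<n}"
  then have f: "f .: M" using e by auto
  have "f <| ?a f = (\<Oplus> i\<in>{i\<in>{..<n}. e i = f}. f <| es i x)"
   by (rule add_maps_finsum[OF A.abelian_group_axioms ab ract_right_add_maps[OF f]]) (use ex in auto)
  also have "... = (\<Oplus> i\<in>{i\<in>{..<n}. e i = f}. e i <| es i x)"
   by (rule finsum_cong') (use ex e in "auto simp: ract_closed")
  finally show "(\<Oplus> i\<in>{i\<in>{..<n}. e i = f}. e i <| es i x) = f <| ?a f" by simp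
 qed
 finally show "EX a:e ` {..<n} \<rightarrow> carrier A. x = (\<Oplus> e\<in>e ` {..<n}. e <| a e)"
  using ex by (intro bexI[of _ ?a]) (auto intro!: A.finsum_closed)
qed simp

lemma free_rmod_simps:
 "carrier (free_rmod A X) = carrier (dsum X (%_. A))" "\<zero>{|free_rmod A X|} = \<zero>{|dsum X (%_. A)|}"
 "(\<oplus>{|free_rmod A X|}) = (\<oplus>{|dsum X (%_. A)|})" "f <|{|free_rmod A X|} a = (\<lambda>x\<in>X. f x \<otimes>{|A|} a)"
 by (simp_all add: free_rmod_def dsum_def Let_def)

lemma dsum_family_const: "dsum_family X (%_. A)"
 by (rule dsum_family.intro) (rule A.abelian_group_axioms)

lemma dual_basis_projective:
 assumes b: "dual_basis A M (n, es, e)" shows "projective A M"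
proof -
 have e: "!!i. i < n ==> e i .: M" and es: "!!i. i < n ==> es i : rmod_hom A M (regular_rmod A)"
  and s: "!!x. x .: M ==> x = (\<Oplus> i\<in>{..<n}. e i <| es i x)"
  using b by (auto simp: dual_basis_def dual_bimod_simps Pi_iff)
 let ?X = "e ` {..<n}"
 interpret D: dsum_family ?X "%_. A" by (rule dsum_family_const)
 have ex: "es i x .: A" if "i < n" "x .: M" for i x using rmod_hom_closed[OF es[OF that(1)] that(2)] by simp
 define a where "a x f = (\<Oplus>{|A|} i\<in>{i\<in>{..<n}. e i = f}. es i x)" for x f
 have ac: "a x f .: A" if "x .: M" for x f
  unfolding a_def using ex that by (auto intro!: A.finsum_closed)
 define \<sigma> where "\<sigma> x = (\<lambda>f\<in>?X. a x f)" for x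
 define p where "p = dsum_lift ?X (%_. A) M (%f c. f <| c)"
 have Xc: "f .: M" if "f : ?X" for f using e that by auto
 have um: "(%c. f <| c) : add_maps A M" if "f : ?X" for f by (rule ract_right_add_maps[OF Xc[OF that]])
 note pm = D.dsum_lift_add_maps[where g = "%f c. f <| c", OF ab um, folded p_def]
 have \<sigma>c: "\<sigma> x .: (dsum ?X (%_. A))" if "x .: M" for x
  using ac[OF that] by (auto simp: D.carrier_dsum \<sigma>_def)
 have "\<sigma> : rmod_hom A M (free_rmod A ?X)"
  unfolding rmod_hom_def
 proof (intro CollectI conjI ballI)
  show "\<sigma> : carrier M \<rightarrow> carrier (free_rmod A ?X)" using \<sigma>c by (simp add: free_rmod_simps)
  fix x assume x: "x .: M"
  have exJ: "(%i. es i z) : {i\<in>{..<n}. e i = f} \<rightarrow> carrier A" if "z .: M" for z f using ex that by auto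
  { fix y assume y: "y .: M"
   have "a (x \<oplus> y) f = a x f \<oplus>{|A|} a y f" for f
   proof -
    have "a (x \<oplus> y) f = (\<Oplus>{|A|} i\<in>{i\<in>{..<n}. e i = f}. es i x \<oplus>{|A|} es i y)"
    unfolding a_def by (rule A.finsum_cong') (use rmod_hom_add[OF es] x y ex in auto)
    then show ?thesis unfolding a_def using A.finsum_addf[OF exJ[OF x] exJ[OF y]] by simp
   qed
   then show "\<sigma> (x \<oplus> y) = \<sigma> x \<oplus>{|free_rmod A ?X|} \<sigma> y"
    by (simp add: free_rmod_simps \<sigma>_def restrict_ext_iff) }
  { fix c assume c: "c .: A"
   have "a (x <| c) f = a x f \<otimes>{|A|} c" for f
   proof -
    have "a (x <| c) f = (\<Oplus>{|A|} i\<in>{i\<in>{..<n}. e i = f}. es i x \<otimes>{|A|} c)"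
    unfolding a_def by (rule A.finsum_cong') (use rmod_hom_ract[OF es] x c ex in auto)
    then show ?thesis unfolding a_def using A.finsum_ldistr[OF _ c exJ[OF x]] by simp
   qed
   then show "\<sigma> (x <| c) = \<sigma> x <|{|free_rmod A ?X|} c"
    by (simp add: free_rmod_simps \<sigma>_def restrict_ext_iff) }
 qed
 moreover have "p : rmod_hom A (free_rmod A ?X) M"
  unfolding rmod_hom_iff
 proof (intro conjI ballI)
  show "p : add_maps (free_rmod A ?X) M" using pm by (simp add: add_maps_def free_rmod_simps)
  fix f c assume f: "f .: (free_rmod A ?X)" and c: "c .: A"
  have fc: "f x .: A" if "x : ?X" for x using f that by (auto simp: free_rmod_simps D.carrier_dsum)
  have f': "f .: (dsum ?X (%_. A))" using f by (simp add: free_rmod_simps)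
  have fr: "(\<lambda>x\<in>?X. f x \<otimes>{|A|} c) .: (dsum ?X (%_. A))"
   using fc c by (auto simp: D.carrier_dsum)
  have su: "p h = (\<Oplus> x\<in>?X. x <| h x)" if "h .: (dsum ?X (%_. A))" for h
   unfolding p_def by (rule D.dsum_lift_superset[where g = "%f c. f <| c", OF ab um that]) auto
  have "p (f <|{|free_rmod A ?X|} c) = (\<Oplus> x\<in>?X. (x <| f x) <| c)"
   unfolding free_rmod_simps su[OF fr]
   by (rule finsum_cong') (use fc c Xc in "auto simp: ract_mult ract_closed")
  also have "... = p f <| c"
   unfolding su[OF f'] by (rule add_maps_finsum[OF ab ab ract_add_maps[OF c], symmetric])
    (use fc Xc in "auto simp: ract_closed")
  finally show "p (f <|{|free_rmod A ?X|} c) = p f <| c" .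
 qed
 moreover have "p (\<sigma> x) = x" if x: "x .: M" for x
 proof -
  have "p (\<sigma> x) = (\<Oplus> f\<in>?X. f <| \<sigma> x f)"
   unfolding p_def by (rule D.dsum_lift_superset[where g = "%f c. f <| c", OF ab um \<sigma>c[OF x]]) auto
  also have "... = (\<Oplus> f\<in>?X. \<Oplus> i\<in>{i\<in>{..<n}. e i = f}. e i <| es i x)"
  proof (rule finsum_cong'[OF refl])
   show "(%f. \<Oplus> i\<in>{i\<in>{..<n}. e i = f}. e i <| es i x) : ?X \<rightarrow> carrier M"
    using e ex x by (auto intro!: finsum_closed simp: ract_closed)
   fix f assume fX: "f : ?X"
   note f = Xc[OF fX]
   have "f <| a x f = (\<Oplus> i\<in>{i\<in>{..<n}. e i = f}. f <| es i x)"
    unfolding a_def by (rule add_maps_finsum[OF A.abelian_group_axioms ab ract_right_add_maps[OF f]]) (use ex x in auto)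
   also have "... = (\<Oplus> i\<in>{i\<in>{..<n}. e i = f}. e i <| es i x)"
    by (rule finsum_cong') (use ex e x in "auto simp: ract_closed")
   finally show "f <| \<sigma> x f = (\<Oplus> i\<in>{i\<in>{..<n}. e i = f}. e i <| es i x)" using fX by (simp add: \<sigma>_def)
  qed
  also have "... = (\<Oplus> i\<in>{..<n}. e i <| es i x)"
   by (rule finsum_fibres[OF ab, symmetric]) (auto simp: ract_closed e ex x)
  also have "... = x" by (rule s[OF x, symmetric])
  finally show ?thesis .
 qed
 ultimately show ?thesis unfolding projective_def by (intro exI[of _ ?X] exI[of _ \<sigma>] exI[of _ p]) simp
qed

text \<open>The coordinates of the section s are the forms, and the images under p of the basis
  elements of the free module are the vectors. Finitely many coordinates suffice because finitely
  many generators do.\<close>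

lemma fg_projective_dual_basis:
 assumes fg: "finitely_generated A M" and pr: "projective A M"
 shows "EX b. dual_basis A M b"
proof -
 obtain X :: "'m set" and s p where s: "s : rmod_hom A M (free_rmod A X)" and p: "p : rmod_hom A (free_rmod A X) M"
  and ps: "!!x. x .: M ==> p (s x) = x" using pr unfolding projective_def by blast
 obtain F where F: "finite F" "F <= carrier M"
  and gen: "!!x. x .: M ==> EX a:F \<rightarrow> carrier A. x = (\<Oplus> e\<in>F. e <| a e)"
  using fg unfolding finitely_generated_def by blast
 interpret D: dsum_family X "%_. A" by (rule dsum_family_const)
 have sc: "s x .: (dsum X (%_. A))" if "x .: M" for x
  using rmod_hom_closed[OF s that] by (simp add: free_rmod_simps)
 have sx: "s x y .: A" if "x .: M" "y : X" for x y using sc[OF that(1)] that(2) by (auto simp: D.carrier_dsum)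
 have sadd: "s (x \<oplus> x') y = s x y \<oplus>{|A|} s x' y" if "x .: M" "x' .: M" "y : X" for x x' y
  using rmod_hom_add[OF s that(1,2)] that(3) by (simp add: free_rmod_simps)
 have sract: "s (x <| a) y = s x y \<otimes>{|A|} a" if "x .: M" "a .: A" "y : X" for x a y
  using rmod_hom_ract[OF s that(1,2)] that(3) by (simp add: free_rmod_simps)
 \<comment> \<open>The coordinates that are nonzero on some generator. The submodule
   \<open>W\<close> of all x with no further coordinates contains the generators, hence is
   everything.\<close>
 define X0 where "X0 = (\<Union>f\<in>F. {y\<in>X. s f y ~= \<zero>{|A|}})"
 have X0: "finite X0" "X0 <= X" using F sc by (auto simp: X0_def D.carrier_dsum)
 define W where "W = {x\<in>carrier M. ALL y:X - X0. s x y = \<zero>{|A|}}"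
 have "submod A M W"
 proof (rule submodI')
  show "\<zero> : W"
  proof -
   have "s \<zero> y = \<zero>{|A|}" if "y : X" for y
   proof -
    have "s \<zero> y \<oplus>{|A|} s \<zero> y = s \<zero> y" using sadd[of \<zero> \<zero> y] that by simp
    then show ?thesis using sx[of \<zero> y] that by (metis A.add.l_cancel_one zero_closed)
   qed
   then show ?thesis by (simp add: W_def)
  qed
 qed (auto simp: W_def sadd sract ract_closed)
 then have Wg: "additive_subgroup W M" and Wr: "!!x a. x : W ==> a .: A ==> x <| a : W" by (auto simp: submod_def)
 have FW: "f : W" if "f : F" for f using that F by (auto simp: W_def X0_def)
 have all: "x : W" if x: "x .: M" for x
 proof -
  obtain a where a: "a : F \<rightarrow> carrier A" "x = (\<Oplus> e\<in>F. e <| a e)" using gen[OF x] by blast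
  show ?thesis unfolding a(2) by (rule additive_subgroup_finsum[OF ab Wg]) (use a(1) FW Wr in auto)
 qed
 let ?\<delta> = "%y. dsum_incl X (%_. A) y \<one>{|A|}"
 have dc: "?\<delta> y .: (dsum X (%_. A))" if "y : X" for y by (rule D.dsum_incl_closed[OF that]) simp
 define u where "u y = p (?\<delta> y)" for y
 have uc: "u y .: M" if "y : X" for y
  unfolding u_def using rmod_hom_closed[OF p] dc[OF that] by (simp add: free_rmod_simps)
 have pm: "p : add_maps (dsum X (%_. A)) M"
  using rmod_hom_add_maps[OF p] by (simp add: add_maps_def free_rmod_simps)
 have um: "(%a. u y <| a) : add_maps A M" if "y : X" for y by (rule ract_right_add_maps[OF uc[OF that]])
 note lift = D.dsum_lift_add_maps[where g = "%y a. u y <| a", OF ab um]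
  D.dsum_lift_incl[where g = "%y a. u y <| a", OF ab um]
  D.dsum_lift_superset[where g = "%y a. u y <| a", OF ab um]
 have pu: "p f = dsum_lift X (%_. A) M (%y a. u y <| a) f" if "f .: (dsum X (%_. A))" for f
 proof (rule D.dsum_ext[OF pm lift(1) ab that])
  fix y a assume y: "y : X" and a: "a .: A"
  have "dsum_incl X (%_. A) y a = ?\<delta> y <|{|free_rmod A X|} a"
   using a by (auto simp: free_rmod_simps dsum_incl_def restrict_ext_iff)
  then have "p (dsum_incl X (%_. A) y a) = u y <| a"
   unfolding u_def using rmod_hom_ract[OF p, of "?\<delta> y" a] dc[OF y] a by (simp add: free_rmod_simps)
  then show "p (dsum_incl X (%_. A) y a) = dsum_lift X (%_. A) M (%y a. u y <| a) (dsum_incl X (%_. A) y a)"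
   using lift(2)[OF _ y, of a] a by simp
 qed
 have xsum: "x = (\<Oplus> y\<in>X0. u y <| s x y)" if x: "x .: M" for x
 proof -
  have "x = dsum_lift X (%_. A) M (%y a. u y <| a) (s x)" using ps[OF x] pu[OF sc[OF x]] by simp
  also have "... = (\<Oplus> y\<in>X0. u y <| s x y)"
   by (rule lift(3)[OF _ sc[OF x] X0(1) _ X0(2)]) (use all[OF x] in "auto simp: W_def")
  finally show ?thesis .
 qed
 obtain h where h: "bij_betw h {..<card X0} X0" using ex_bij_betw_nat_finite[OF X0(1)] by (auto simp: atLeast0LessThan)
 have hX: "h i : X" if "i < card X0" for i using bij_betw_apply[OF h] X0(2) that by blast
 have "dual_basis A M (card X0, %i. \<lambda>x\<in>carrier M. s x (h i), %i. u (h i))"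
  unfolding dual_basis_def prod.case
 proof (intro conjI ballI)
  show "(%i. \<lambda>x\<in>carrier M. s x (h i)) : {..<card X0} \<rightarrow> carrier (dual_bimod A M)"
  proof
   fix i assume "i : {..<card X0}"
   then have i: "h i : X" using hX by simp
   have "(%x. s x (h i)) : rmod_hom A M (regular_rmod A)"
    using i by (auto simp: rmod_hom_def sx sadd sract)
   then show "(\<lambda>x\<in>carrier M. s x (h i)) .: (dual_bimod A M)"
    using rmod_hom_restrict by (simp add: dual_bimod_simps)
  qed
  show "(%i. u (h i)) : {..<card X0} \<rightarrow> carrier M" using uc hX by auto
  fix x assume x: "x .: M"
  have "x = (\<Oplus> y\<in>h ` {..<card X0}. u y <| s x y)" using xsum[OF x] bij_betw_imp_surj_on[OF h] by simp
  also have "... = (\<Oplus> i\<in>{..<card X0}. u (h i) <| s x (h i))"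
   by (rule finsum_reindex) (use bij_betw_imp_inj_on[OF h] hX uc sx x in "auto simp: ract_closed")
  also have "... = (\<Oplus> i\<in>{..<card X0}. u (h i) <| (\<lambda>x\<in>carrier M. s x (h i)) x)"
   using x by simp
  finally show "x = (\<Oplus> i\<in>{..<card X0}. u (h i) <| (\<lambda>x\<in>carrier M. s x (h i)) x)" .
 qed
 then show ?thesis by blast
qed

end

lemma bimodule_transfer:
 assumes "bimodule B A M" "carrier N = carrier M" "\<zero>{|N|} = \<zero>{|M|}" "(\<oplus>{|N|}) = (\<oplus>{|M|})"
  "ract N = ract M" "lact N = lact M"
 shows "bimodule B A N"
proof -
 interpret M: bimodule B A M by fact
 interpret N: abelian_group N by (rule abelian_group_transfer[OF M.ab]) (use assms in simp_all)
 show ?thesis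
  by unfold_locales (use assms in "simp_all add: M.ract_closed M.ract_add_left M.ract_add_right M.ract_mult M.ract_one
   M.lact_closed M.lact_add_right M.lact_add_left M.lact_mult M.lact_one M.lact_ract")
qed

context right_module begin

lemma dual_basis_facts:
 assumes "dual_basis A M (n, es, e)"
 shows "!!i. i < n ==> e i .: M" "!!i. i < n ==> es i .: (dual_bimod A M)"
  "!!i. i < n ==> es i : rmod_hom A M (regular_rmod A)"
  "!!x. x .: M ==> x = (\<Oplus> i\<in>{..<n}. e i <| es i x)"
  "!!i x. i < n ==> x .: M ==> es i x .: A"
proof -
 show "!!i. i < n ==> e i .: M" "!!i. i < n ==> es i .: (dual_bimod A M)"
  "!!x. x .: M ==> x = (\<Oplus> i\<in>{..<n}. e i <| es i x)"
  using assms by (auto simp: dual_basis_def Pi_iff)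
 then show r: "!!i. i < n ==> es i : rmod_hom A M (regular_rmod A)" by (auto simp: dual_bimod_simps)
 show "!!i x. i < n ==> x .: M ==> es i x .: A" using rmod_hom_closed[OF r] by simp
qed

text \<open>On a pure tensor x (x) y this is the dual basis formula for x, with the scalars moved
  across the tensor sign.\<close>

lemma dual_basis_tensor_expand:
 assumes b: "dual_basis A M (n, es, e)" and N: "bimodule A A N" and w: "w .: (TG A M N)"
 shows "w = (\<Oplus>{|TG A M N|} k\<in>{..<n}. tensor A M N (e k) (contr N (es k) w))"
proof -
 note f = dual_basis_facts[OF b]
 interpret N: bimodule A A N by fact
 interpret T: tensor_pair A M N by (rule tensor_pairI[OF is_rmod N])
 interpret Tg: abelian_group "TG A M N" by (rule T.ab_tensor)
 note ct = contr_add_maps[OF N is_rmod f(3)]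
 have am: "(%w. tensor A M N (e k) (contr N (es k) w)) : add_maps (TG A M N) (TG A M N)" if "k < n" for k
  by (rule add_maps_comp[OF ct(1)[OF that] T.tensor_right_add_maps[OF f(1)[OF that]]])
 have S: "(%w. \<Oplus>{|TG A M N|} k\<in>{..<n}. tensor A M N (e k) (contr N (es k) w)) : add_maps (TG A M N) (TG A M N)"
  by (rule add_maps_sum[OF T.ab_tensor T.ab_tensor]) (use am in simp)
 have I: "(%w. w) : add_maps (TG A M N) (TG A M N)" by (rule add_mapsI) simp_all
 show ?thesis
 proof (rule T.tensor_ext[OF I S Tg.abelian_group_axioms w])
  fix x y assume x: "x .: M" and y: "y .: N"
  have "tensor A M N x y = tensor A M N (\<Oplus> k\<in>{..<n}. e k <| es k x) y" using f(4)[OF x] by simp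
  also have "... = (\<Oplus>{|TG A M N|} k\<in>{..<n}. tensor A M N (e k <| es k x) y)"
   by (rule add_maps_finsum[OF ab T.ab_tensor T.tensor_left_add_maps[OF y]])
    (use f x in "auto simp: ract_closed")
  also have "... = (\<Oplus>{|TG A M N|} k\<in>{..<n}. tensor A M N (e k) (contr N (es k) (tensor A M N x y)))"
   by (rule Tg.finsum_cong') (use f x y ct(2) T.tensor_balanced in "auto simp: T.tensor_closed N.lact_closed")
  finally show "tensor A M N x y = (\<Oplus>{|TG A M N|} k\<in>{..<n}. tensor A M N (e k) (contr N (es k) (tensor A M N x y)))" .
 qed
qed

lemma dual_expand:
 assumes b: "dual_basis A M (n, es, e)" and \<psi>: "\<psi> .: (dual_bimod A M)"
 shows "\<psi> = (\<Oplus>{|dual_bimod A M|} k\<in>{..<n}. \<psi> (e k) |>{|dual_bimod A M|} es k)"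
proof -
 note f = dual_basis_facts[OF b]
 interpret Dg: abelian_group "dual_bimod A M" by (rule dual_abelian)
 have p: "\<psi> : rmod_hom A M (regular_rmod A)" using \<psi> by (simp add: dual_bimod_simps)
 have pc: "\<psi> x .: A" if "x .: M" for x using rmod_hom_closed[OF p that] by simp
 have E: "bimodule A (End_ring A M(|carrier := carrier (End_ring A M)|)) (dual_bimod A M)"
  by (rule dual_bimodule) (rule ring.carrier_is_subring[OF End_ring_ring])
 have lc: "\<psi> (e k) |>{|dual_bimod A M|} es k .: (dual_bimod A M)" if "k < n" for k
  by (rule bimodule.lact_closed[OF E pc[OF f(1)[OF that]] f(2)[OF that]])
 show ?thesis
 proof (rule ext_eqI)
  show "\<psi> : extensional (carrier M)" using \<psi> by (simp add: dual_bimod_simps)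
  have "(\<Oplus>{|dual_bimod A M|} k\<in>{..<n}. \<psi> (e k) |>{|dual_bimod A M|} es k) .: (dual_bimod A M)"
   using lc by (intro Dg.finsum_closed) auto
  then show "(\<Oplus>{|dual_bimod A M|} k\<in>{..<n}. \<psi> (e k) |>{|dual_bimod A M|} es k) : extensional (carrier M)"
   by (simp add: dual_bimod_simps)
  fix x assume x: "x .: M"
  have ev: "(%\<phi>. \<phi> x) : add_maps (dual_bimod A M) A"
   by (rule add_mapsI) (use x rmod_hom_closed[of _ A M "regular_rmod A"] in "auto simp: dual_bimod_simps")
  have pa: "\<psi> : add_maps M A" using rmod_hom_add_maps[OF p] by (simp add: add_maps_def)
  have "(\<Oplus>{|dual_bimod A M|} k\<in>{..<n}. \<psi> (e k) |>{|dual_bimod A M|} es k) x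
    = (\<Oplus>{|A|} k\<in>{..<n}. (\<psi> (e k) |>{|dual_bimod A M|} es k) x)"
   by (rule add_maps_finsum[OF dual_abelian A.abelian_group_axioms ev]) (use lc in auto)
  also have "... = (\<Oplus>{|A|} k\<in>{..<n}. \<psi> (e k <| es k x))"
   by (rule A.finsum_cong') (use x f pc rmod_hom_ract[OF p] in "auto simp: dual_bimod_simps ract_closed")
  also have "... = \<psi> (\<Oplus> k\<in>{..<n}. e k <| es k x)"
   by (rule add_maps_finsum[OF ab A.abelian_group_axioms pa, symmetric]) (use x f in "auto simp: ract_closed")
  also have "... = \<psi> x" using f(4)[OF x] by simp
  finally show "\<psi> x = (\<Oplus>{|dual_bimod A M|} k\<in>{..<n}. \<psi> (e k) |>{|dual_bimod A M|} es k) x" by simp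
 qed
qed

end

text \<open>The comatrix coring and its comodule are defined by the same choice of a dual basis;
  these three constants name the components of that choice.\<close>

definition db_size :: "('a, 'p) ring_scheme => ('a, 'm, 'q) rmod_scheme => nat" where
 "db_size A M = fst (SOME b. dual_basis A M b)"
definition db_form :: "('a, 'p) ring_scheme => ('a, 'm, 'q) rmod_scheme => nat => 'm => 'a" where
 "db_form A M = fst (snd (SOME b. dual_basis A M b))"
definition db_vec :: "('a, 'p) ring_scheme => ('a, 'm, 'q) rmod_scheme => nat => 'm" where
 "db_vec A M = snd (snd (SOME b. dual_basis A M b))"

lemma some_dual_basis: "EX b. dual_basis A M b ==> dual_basis A M (db_size A M, db_form A M, db_vec A M)"
 unfolding db_size_def db_form_def db_vec_def by (simp add: someI_ex)

lemma comatrix_coring_simps: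
 "carrier (comatrix_coring A M D) = carrier (comatrix_bimod A M D)"
 "\<zero>{|comatrix_coring A M D|} = \<zero>{|comatrix_bimod A M D|}"
 "(\<oplus>{|comatrix_coring A M D|}) = (\<oplus>{|comatrix_bimod A M D|})"
 "ract (comatrix_coring A M D) = ract (comatrix_bimod A M D)"
 "lact (comatrix_coring A M D) = lact (comatrix_bimod A M D)"
 "comult (comatrix_coring A M D) = tensor_lift (TG A (comatrix_bimod A M D) (comatrix_bimod A M D))
   (%(\<phi>, x). \<Oplus>{|TG A (comatrix_bimod A M D) (comatrix_bimod A M D)|} i\<in>{..<db_size A M}.
    tensor A (comatrix_bimod A M D) (comatrix_bimod A M D)
    (comatrix_tensor A M D \<phi> (db_vec A M i)) (comatrix_tensor A M D (db_form A M i) x))"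
 "counit (comatrix_coring A M D) = tensor_lift A (%(\<phi>, x). \<phi> x)"
 by (simp_all add: comatrix_coring_def Let_def db_size_def db_form_def db_vec_def split_def)

lemma comatrix_comod_simps:
 "carrier (comatrix_comod A M D) = carrier M" "\<zero>{|comatrix_comod A M D|} = \<zero>{|M|}"
 "(\<oplus>{|comatrix_comod A M D|}) = (\<oplus>{|M|})" "ract (comatrix_comod A M D) = ract M"
 "coact (comatrix_comod A M D) x = (\<Oplus>{|TG A M (comatrix_bimod A M D)|} i\<in>{..<db_size A M}.
    tensor A M (comatrix_bimod A M D) (db_vec A M i) (comatrix_tensor A M D (db_form A M i) x))"
 by (simp_all add: comatrix_comod_def Let_def db_size_def db_form_def db_vec_def split_def)

text \<open>A dual basis takes the place of finite generation and projectivity: it is what a simple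
  comodule yields directly and what the formulas are written in.\<close>

locale comatrix = right_module A M for A :: "('a, 'p) ring_scheme" and M :: "('a, 'm, 'q) rmod_scheme" (structure) +
 fixes D :: "('m => 'm) set"
 assumes D: "subring D (End_ring A M)" and db_ex: "EX b. dual_basis A M b"
begin

abbreviation "R \<equiv> End_ring A M(|carrier := D|)"
abbreviation "dl \<equiv> dual_bimod A M"
abbreviation "T \<equiv> comatrix_bimod A M D"
abbreviation "tt \<equiv> comatrix_tensor A M D"
abbreviation "nn \<equiv> db_size A M"
abbreviation "es \<equiv> db_form A M"
abbreviation "ev \<equiv> db_vec A M"

lemmas db = some_dual_basis[OF db_ex]
lemmas dbf = dual_basis_facts[OF db]

lemma bdl: "bimodule A R dl" by (rule dual_bimodule[OF D])
lemma bev: "bimodule R A (eval_bimod M)" by (rule eval_bimodule[OF D])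
lemma tpT: "tensor_pair R dl (eval_bimod M)" by (rule tensor_pairI[OF bimodule_right[OF bdl] bev])
lemma bT: "bimodule A A T" unfolding comatrix_bimod_def by (rule bimodule_tensor_bimod[OF bdl bev])

lemma carrier_T: "carrier T = carrier (TG R dl (eval_bimod M))" by (simp add: comatrix_bimod_def)
lemma add_T: "(\<oplus>{|T|}) = (\<oplus>{|TG R dl (eval_bimod M)|})" by (simp add: comatrix_bimod_def)
lemma add_maps_T: "add_maps T G = add_maps (TG R dl (eval_bimod M)) G" "add_maps G T = add_maps G (TG R dl (eval_bimod M))"
 by (simp_all add: comatrix_bimod_def)

interpretation TP: tensor_pair R dl "eval_bimod M" by (rule tpT)
interpretation T: bimodule A A T by (rule bT)

lemma D_hom: "d : D ==> d : rmod_hom A M M" using subringE(1)[OF D] by (auto simp: End_ring_simps)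
lemma D_ext: "d : D ==> d : extensional (carrier M)" using subringE(1)[OF D] by (auto simp: End_ring_simps)

lemma dl_hom: "\<phi> .: dl ==> \<phi> : rmod_hom A M (regular_rmod A)" by (simp add: dual_bimod_simps)
lemma dl_closed: "\<phi> .: dl ==> x .: M ==> \<phi> x .: A"
 using rmod_hom_closed[OF dl_hom] by simp

lemma tt_closed: "[|\<phi> .: dl; x .: M|] ==> tt \<phi> x .: T"
 unfolding carrier_T comatrix_tensor_def using TP.tensor_closed[of \<phi> x] by simp

lemma tt_right_add_maps: "\<phi> .: dl ==> (%x. tt \<phi> x) : add_maps M T"
 unfolding add_maps_T comatrix_tensor_def using TP.tensor_right_add_maps[of \<phi>] by (simp add: add_maps_def)

lemma tt_left_add_maps: "x .: M ==> (%\<phi>. tt \<phi> x) : add_maps dl T"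
 unfolding add_maps_T comatrix_tensor_def using TP.tensor_left_add_maps[of x] by simp

lemma tt_balanced: "[|\<phi> .: dl; d : D; x .: M|] ==> tt (\<phi> <|{|dl|} d) x = tt \<phi> (d x)"
 unfolding comatrix_tensor_def using TP.tensor_balanced[of \<phi> d x] by simp

lemma tt_ract: "[|\<phi> .: dl; x .: M; a .: A|] ==> tt \<phi> x <|{|T|} a = tt \<phi> (x <| a)"
 unfolding comatrix_tensor_def comatrix_bimod_def using tensor_ract(2)[OF tpT bev, of a \<phi> x] by simp

lemma tt_lact: "[|\<phi> .: dl; x .: M; a .: A|] ==> a |>{|T|} tt \<phi> x = tt (a |>{|dl|} \<phi>) x"
 unfolding comatrix_tensor_def comatrix_bimod_def using tensor_lact(2)[OF bdl bev, of a \<phi> x] by simp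

lemma tt_hom: "\<phi> .: dl ==> (%x. tt \<phi> x) : rmod_hom A M T"
 by (simp add: rmod_hom_iff tt_right_add_maps tt_ract)

lemma T_induct [consumes 1, case_names zero tensor add]:
 assumes "t .: T" "P \<zero>{|T|}" "!!\<phi> x. [|\<phi> .: dl; x .: M|] ==> P (tt \<phi> x)"
  "!!s t. [|s .: T; t .: T; P s; P t|] ==> P (s \<oplus>{|T|} t)"
 shows "P t"
 using assms unfolding carrier_T add_T comatrix_tensor_def
 by (intro TP.tensor_induct[of t P]) (simp_all add: comatrix_bimod_def)

lemma tpTT: "tensor_pair A T T" by (rule tensor_pairI[OF T.is_rmod bT])
lemma tpMT: "tensor_pair A M T" by (rule tensor_pairI[OF is_rmod bT])

interpretation TT: tensor_pair A T T by (rule tpTT)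
interpretation MT: tensor_pair A M T by (rule tpMT)

definition "can x = (\<Oplus>{|TG A M T|} k\<in>{..<nn}. tensor A M T (ev k) (tt (es k) x))"

text \<open>The sum of all \<open>ev k\<close> (x) \<open>es k\<close> commutes with D: an
  endomorphism may be applied to the vectors or to the forms. Both sides are compared through their
  contractions by the forms \<open>es l\<close>, which determine an element of the tensor product by
  the dual basis. This is why the comultiplication is balanced over D, and later why D acts by
  colinear maps.\<close>

lemma can_D:
 assumes d: "d : D" and x: "x .: M"
 shows "(\<Oplus>{|TG A M T|} k\<in>{..<nn}. tensor A M T (d (ev k)) (tt (es k) x)) = can (d x)" (is "?w = _")
proof -
 interpret MTg: abelian_group "TG A M T" by (rule MT.ab_tensor)
 note dh = rmod_hom_closed[OF D_hom[OF d]]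
 have wc: "?w .: (TG A M T)"
  by (rule MTg.finsum_closed) (use dbf dh x in "auto simp: MT.tensor_closed tt_closed")
 have c: "contr T (es l) ?w = tt (es l) (d x)" if l: "l < nn" for l
 proof -
  note ct = contr_add_maps[OF bT is_rmod dbf(3)[OF l]]
  have pd: "es l <|{|dl|} d .: dl"
   using right_module.ract_closed[OF bimodule_right[OF bdl] dbf(2)[OF l], of d] d by simp
  have pe: "(es l <|{|dl|} d) (ev k) = es l (d (ev k))" if "k < nn" for k using dbf(1)[OF that] by (simp add: dual_bimod_simps)
  have ac: "es l (d (ev k)) .: A" if "k < nn" for k by (rule dl_closed[OF dbf(2)[OF l] dh[OF dbf(1)[OF that]]])
  have lc: "es l (d (ev k)) |>{|dl|} es k .: dl" if "k < nn" for k
   by (rule bimodule.lact_closed[OF bdl ac[OF that] dbf(2)[OF that]])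
  have "contr T (es l) ?w = (\<Oplus>{|T|} k\<in>{..<nn}. contr T (es l) (tensor A M T (d (ev k)) (tt (es k) x)))"
   by (rule add_maps_finsum[OF MT.ab_tensor T.ab ct(1)]) (use dbf dh x in "auto simp: MT.tensor_closed tt_closed")
  also have "... = (\<Oplus>{|T|} k\<in>{..<nn}. tt (es l (d (ev k)) |>{|dl|} es k) x)"
   by (rule T.finsum_cong') (use dbf dh x ac lc in "auto simp: ct(2) tt_closed tt_lact")
  also have "... = tt (\<Oplus>{|dl|} k\<in>{..<nn}. es l (d (ev k)) |>{|dl|} es k) x"
   by (rule add_maps_finsum[OF dual_abelian T.ab tt_left_add_maps[OF x], symmetric]) (use lc in auto)
  also have "(\<Oplus>{|dl|} k\<in>{..<nn}. es l (d (ev k)) |>{|dl|} es k) = es l <|{|dl|} d"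
  proof -
   have "(\<Oplus>{|dl|} k\<in>{..<nn}. es l (d (ev k)) |>{|dl|} es k) = (\<Oplus>{|dl|} k\<in>{..<nn}. (es l <|{|dl|} d) (ev k) |>{|dl|} es k)"
    by (rule abelian_monoid.finsum_cong'[OF abelian_group.axioms(1)[OF dual_abelian]]) (use pe lc in auto)
   then show ?thesis using dual_expand[OF db pd] by simp
  qed
  also have "tt (es l <|{|dl|} d) x = tt (es l) (d x)" by (rule tt_balanced[OF dbf(2)[OF l] d x])
  finally show ?thesis .
 qed
 have "?w = (\<Oplus>{|TG A M T|} k\<in>{..<nn}. tensor A M T (ev k) (contr T (es k) ?w))"
  by (rule dual_basis_tensor_expand[OF db bT wc])
 also have "... = can (d x)"
  unfolding can_def by (rule MTg.finsum_cong') (use c dbf dh x in "auto simp: MT.tensor_closed tt_closed")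
 finally show ?thesis .
qed

definition "cm \<phi> x = (\<Oplus>{|TG A T T|} k\<in>{..<nn}. tensor A T T (tt \<phi> (ev k)) (tt (es k) x))"

lemma cm_alt:
 assumes p: "\<phi> .: dl" and w: "!!k. k < nn ==> w k .: M" and x: "x .: M"
 shows "(\<Oplus>{|TG A T T|} k\<in>{..<nn}. tensor A T T (tt \<phi> (w k)) (tt (es k) x))
  = tmap A T T (%x. tt \<phi> x) id (\<Oplus>{|TG A M T|} k\<in>{..<nn}. tensor A M T (w k) (tt (es k) x))"
proof -
 note m = tmap_add_maps[OF tpMT tpTT tt_hom[OF p] lmod_hom_id]
 interpret TTg: abelian_group "TG A T T" by (rule TT.ab_tensor)
 have "tmap A T T (%x. tt \<phi> x) id (\<Oplus>{|TG A M T|} k\<in>{..<nn}. tensor A M T (w k) (tt (es k) x))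
  = (\<Oplus>{|TG A T T|} k\<in>{..<nn}. tmap A T T (%x. tt \<phi> x) id (tensor A M T (w k) (tt (es k) x)))"
  by (rule add_maps_finsum[OF MT.ab_tensor TT.ab_tensor m(1)])
   (use w x dbf in "auto simp: MT.tensor_closed tt_closed")
 also have "... = (\<Oplus>{|TG A T T|} k\<in>{..<nn}. tensor A T T (tt \<phi> (w k)) (tt (es k) x))"
  by (rule TTg.finsum_cong') (use w x dbf p in "auto simp: TT.tensor_closed tt_closed m(2)")
 finally show ?thesis by simp
qed

lemma cm_eq: "[|\<phi> .: dl; x .: M|] ==> cm \<phi> x = tmap A T T (%x. tt \<phi> x) id (can x)"
 unfolding cm_def can_def by (rule cm_alt) (use dbf in auto)

lemma cm_balanced: "balanced R dl (eval_bimod M) (TG A T T) cm"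
proof -
 interpret TTg: abelian_group "TG A T T" by (rule TT.ab_tensor)
 have tc: "tensor A T T (tt \<phi> (ev k)) (tt (es k) x) .: (TG A T T)"
  if "\<phi> .: dl" "x .: M" "k < nn" for \<phi> x k
  using that dbf by (simp add: TT.tensor_closed tt_closed)
 have cl: "cm \<phi> x .: (TG A T T)" if p: "\<phi> .: dl" and x: "x .: M" for \<phi> x
  unfolding cm_def using tc[OF p x] by (intro TTg.finsum_closed) auto
 have al: "cm (\<phi> \<oplus>{|dl|} \<psi>) x = cm \<phi> x \<oplus>{|TG A T T|} cm \<psi> x"
  if p: "\<phi> .: dl" and x: "x .: M" and q: "\<psi> .: dl" for \<phi> x \<psi>
 proof -
  have "cm (\<phi> \<oplus>{|dl|} \<psi>) x = (\<Oplus>{|TG A T T|} k\<in>{..<nn}. tensor A T T (tt \<phi> (ev k)) (tt (es k) x)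
    \<oplus>{|TG A T T|} tensor A T T (tt \<psi> (ev k)) (tt (es k) x))"
   unfolding cm_def
   by (rule TTg.finsum_cong')
    (use tc[OF p x] tc[OF q x] dbf p q x add_maps_add[OF tt_left_add_maps] in "auto simp: TT.tensor_add_left tt_closed")
  also have "... = cm \<phi> x \<oplus>{|TG A T T|} cm \<psi> x"
   unfolding cm_def by (rule TTg.finsum_addf) (use tc[OF p x] tc[OF q x] in auto)
  finally show ?thesis .
 qed
 have ar: "cm \<phi> (x \<oplus> y) = cm \<phi> x \<oplus>{|TG A T T|} cm \<phi> y"
  if p: "\<phi> .: dl" and x: "x .: M" and y: "y .: M" for \<phi> x y
 proof -
  have "cm \<phi> (x \<oplus> y) = (\<Oplus>{|TG A T T|} k\<in>{..<nn}. tensor A T T (tt \<phi> (ev k)) (tt (es k) x)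
    \<oplus>{|TG A T T|} tensor A T T (tt \<phi> (ev k)) (tt (es k) y))"
   unfolding cm_def
   by (rule TTg.finsum_cong')
    (use tc[OF p x] tc[OF p y] dbf p y x add_maps_add[OF tt_right_add_maps] in "auto simp: TT.tensor_add_right tt_closed")
  also have "... = cm \<phi> x \<oplus>{|TG A T T|} cm \<phi> y"
   unfolding cm_def by (rule TTg.finsum_addf) (use tc[OF p x] tc[OF p y] in auto)
  finally show ?thesis .
 qed
 have bal: "cm (\<phi> <|{|dl|} d) x = cm \<phi> (d x)"
  if p: "\<phi> .: dl" and x: "x .: M" and d: "d : D" for \<phi> x d
 proof -
  note dh = rmod_hom_closed[OF D_hom[OF d]]
  have "cm (\<phi> <|{|dl|} d) x = (\<Oplus>{|TG A T T|} k\<in>{..<nn}. tensor A T T (tt \<phi> (d (ev k))) (tt (es k) x))"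
   unfolding cm_def by (rule TTg.finsum_cong') (use p d x dbf dh in "auto simp: tt_balanced TT.tensor_closed tt_closed")
  also have "... = tmap A T T (%x. tt \<phi> x) id (can (d x))"
   unfolding can_D[OF d x, symmetric] by (rule cm_alt[OF p _ x]) (use dh dbf in auto)
  also have "... = cm \<phi> (d x)" by (rule cm_eq[OF p dh[OF x], symmetric])
  finally show ?thesis .
 qed
 show ?thesis by (rule balancedI) (use cl al ar bal in simp_all)
qed

lemma comult_comatrix:
 "comult (comatrix_coring A M D) : add_maps T (TG A T T)"
 "[|\<phi> .: dl; x .: M|] ==> comult (comatrix_coring A M D) (tt \<phi> x) = cm \<phi> x"
proof -
 have e: "comult (comatrix_coring A M D) = tensor_lift (TG A T T) (case_prod cm)"
  unfolding comatrix_coring_simps cm_def by simp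
 show "comult (comatrix_coring A M D) : add_maps T (TG A T T)"
  unfolding e add_maps_T by (rule TP.tensor_lift_add_maps[OF TT.ab_tensor cm_balanced])
 show "[|\<phi> .: dl; x .: M|] ==> comult (comatrix_coring A M D) (tt \<phi> x) = cm \<phi> x"
  unfolding e comatrix_tensor_def using TP.tensor_lift_tensor[OF TT.ab_tensor cm_balanced, of \<phi> x] by simp
qed

lemma counit_comatrix:
 "counit (comatrix_coring A M D) : add_maps T A"
 "[|\<phi> .: dl; x .: M|] ==> counit (comatrix_coring A M D) (tt \<phi> x) = \<phi> x"
proof -
 have b: "balanced R dl (eval_bimod M) A (%\<phi> x. \<phi> x)"
  by (rule balancedI) (use dl_closed rmod_hom_add[OF dl_hom] in "simp_all add: dual_bimod_simps")
 show "counit (comatrix_coring A M D) : add_maps T A"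
  unfolding comatrix_coring_simps add_maps_T by (rule TP.tensor_lift_add_maps[OF A.abelian_group_axioms b])
 show "[|\<phi> .: dl; x .: M|] ==> counit (comatrix_coring A M D) (tt \<phi> x) = \<phi> x"
  unfolding comatrix_coring_simps comatrix_tensor_def
  using TP.tensor_lift_tensor[OF A.abelian_group_axioms b, of \<phi> x] by simp
qed

lemma bCC: "bimodule A A (comatrix_coring A M D)"
 by (rule bimodule_transfer[OF bT]) (simp_all add: comatrix_coring_simps)

end

section \<open>Direct sums of comatrix corings\<close>

lemma dsum_bimod_simps:
 "carrier (dsum_bimod I G) = carrier (dsum I G)" "\<zero>{|dsum_bimod I G|} = \<zero>{|dsum I G|}"
 "(\<oplus>{|dsum_bimod I G|}) = (\<oplus>{|dsum I G|})"
 "f <|{|dsum_bimod I G|} a = (\<lambda>i\<in>I. f i <|{|G i|} a)" "a |>{|dsum_bimod I G|} f = (\<lambda>i\<in>I. a |>{|G i|} f i)"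
 by (simp_all add: dsum_bimod_def dsum_def Let_def)

lemma bimodule_dsum:
 fixes A :: "('a, 'p) ring_scheme"
 assumes A: "ring A" and G: "!!i. i : I ==> bimodule A A (G i)" shows "bimodule A A (dsum_bimod I G)"
proof -
 interpret A: ring A by fact
 interpret D: dsum_family I G by (rule dsum_family.intro) (rule bimodule_ab[OF G])
 interpret S: abelian_group "dsum_bimod I G"
  by (rule abelian_group_transfer[OF D.abelian_dsum]) (simp_all add: dsum_bimod_simps)
 have c: "f i .: (G i)" if "f .: (dsum I G)" "i : I" for f i using that by (auto simp: D.carrier_dsum)
 have ex: "f : extensional I" if "f .: (dsum I G)" for f using that by (auto simp: D.carrier_dsum PiE_iff)
 have cl: "(\<lambda>i\<in>I. h i (f i)) .: (dsum I G)"
  if f: "f .: (dsum I G)" and h: "!!i. i : I ==> h i : add_maps (G i) (G i)" for f h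
 proof -
  have "{i\<in>I. (\<lambda>i\<in>I. h i (f i)) i ~= \<zero>{|G i|}} <= {i\<in>I. f i ~= \<zero>{|G i|}}"
   using add_maps_zero[OF D.abG D.abG h] by auto
  then have "finite {i\<in>I. (\<lambda>i\<in>I. h i (f i)) i ~= \<zero>{|G i|}}"
   by (rule finite_subset) (use f in "simp add: D.carrier_dsum")
  then show ?thesis using add_maps_closed[OF h c[OF f]] by (auto simp: D.carrier_dsum)
 qed
 note r = bimodule_right[OF G]
 show ?thesis
 proof (unfold_locales, unfold dsum_bimod_simps)
  fix f a assume "f .: (dsum I G)" "a .: A"
  then show "(\<lambda>i\<in>I. f i <|{|G i|} a) .: (dsum I G)"
   using cl[of f "%i x. x <|{|G i|} a"] right_module.ract_add_maps[OF r] by blast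
 next
  fix a f assume "a .: A" "f .: (dsum I G)"
  then show "(\<lambda>i\<in>I. a |>{|G i|} f i) .: (dsum I G)"
   using cl[of f "%i x. a |>{|G i|} x"] bimodule.lact_add_maps[OF G] by blast
 next
  fix f assume f: "f .: (dsum I G)"
  show "(\<lambda>i\<in>I. f i <|{|G i|} \<one>{|A|}) = f"
   by (rule extensionalityI[OF _ ex[OF f]]) (use c[OF f] right_module.ract_one[OF r] in auto)
  show "(\<lambda>i\<in>I. \<one>{|A|} |>{|G i|} f i) = f"
   by (rule extensionalityI[OF _ ex[OF f]]) (use c[OF f] bimodule.lact_one[OF G] in auto)
 qed (simp_all add: restrict_ext_iff c right_module.ract_add_left[OF r] right_module.ract_add_right[OF r]
   right_module.ract_mult[OF r] bimodule.lact_add_left[OF G] bimodule.lact_add_right[OF G] bimodule.lact_mult[OF G]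
   bimodule.lact_ract[OF G])
qed

lemma dsum_coring_simps:
 "carrier (dsum_coring A I G) = carrier (dsum_bimod I G)" "\<zero>{|dsum_coring A I G|} = \<zero>{|dsum_bimod I G|}"
 "(\<oplus>{|dsum_coring A I G|}) = (\<oplus>{|dsum_bimod I G|})" "ract (dsum_coring A I G) = ract (dsum_bimod I G)"
 "lact (dsum_coring A I G) = lact (dsum_bimod I G)"
 "comult (dsum_coring A I G) = dsum_lift I G (TG A (dsum_bimod I G) (dsum_bimod I G))
   (%i x. tmap A (dsum_bimod I G) (dsum_bimod I G) (dsum_incl I G i) (dsum_incl I G i) (comult (G i) x))"
 "counit (dsum_coring A I G) = dsum_lift I G A (%i. counit (G i))"
 by (simp_all add: dsum_coring_def Let_def dsum_lift_def fun_eq_iff)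

locale comatrix_family = ring A for A :: "('a, 'p) ring_scheme" +
 fixes I :: "'i set" and S :: "'i => ('a, 'm, 'q) rmod_scheme" and D :: "'i => ('m => 'm) set"
 assumes cmx: "i : I ==> comatrix A (S i) (D i)"
begin

abbreviation "CC i \<equiv> comatrix_coring A (S i) (D i)"
abbreviation "SS \<equiv> dsum_bimod I CC"
abbreviation "SC \<equiv> dsum_coring A I CC"
definition "gen i \<phi> x = dsum_incl I CC i (comatrix_tensor A (S i) (D i) \<phi> x)"

lemma bSS: "bimodule A A SS" by (rule bimodule_dsum[OF ring_axioms comatrix.bCC[OF cmx]])

lemma fam: "dsum_family I CC" by (rule dsum_family.intro) (rule bimodule_ab[OF comatrix.bCC[OF cmx]])

interpretation D: dsum_family I CC by (rule fam)

lemma CC_add_maps: "add_maps (CC i) G = add_maps (comatrix_bimod A (S i) (D i)) G" "add_maps G (CC i) = add_maps G (comatrix_bimod A (S i) (D i))"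
 by (simp_all add: add_maps_def comatrix_coring_simps)

lemma SS_add_maps: "add_maps SS G = add_maps (dsum I CC) G" "add_maps G SS = add_maps G (dsum I CC)"
 by (simp_all add: add_maps_def dsum_bimod_simps del: D.dsum_ops)

lemma incl_hom: assumes i: "i : I" shows "dsum_incl I CC i : bimod_hom A A (comatrix_bimod A (S i) (D i)) SS"
proof -
 interpret c: comatrix A "S i" "D i" by (rule cmx[OF i])
 have am: "dsum_incl I CC i : add_maps (comatrix_bimod A (S i) (D i)) SS"
  using D.dsum_incl_add_maps[OF i] by (simp add: SS_add_maps CC_add_maps del: D.dsum_ops)
 have z: "\<zero>{|CC j|} <|{|CC j|} a = \<zero>{|CC j|}" "a |>{|CC j|} \<zero>{|CC j|} = \<zero>{|CC j|}" if "j : I" "a .: A" for j a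
  using right_module.ract_zero_left[OF bimodule_right[OF comatrix.bCC[OF cmx[OF that(1)]]] that(2)]
   bimodule.lact_zero_right[OF comatrix.bCC[OF cmx[OF that(1)]] that(2)] .
 show ?thesis
  unfolding bimod_hom_iff rmod_hom_iff lmod_hom_def
  using am z by (auto simp: dsum_bimod_simps dsum_incl_def restrict_ext_iff comatrix_coring_simps)
qed

lemma tSS: "tensor_pair A SS SS" by (rule tensor_pairI[OF bimodule_right[OF bSS] bSS])

lemma comult_summand:
 assumes j: "j : I"
 shows "(%x. tmap A SS SS (dsum_incl I CC j) (dsum_incl I CC j) (comult (CC j) x)) : add_maps (CC j) (TG A SS SS)"
  and "tmap A SS SS (dsum_incl I CC j) (dsum_incl I CC j)
   : add_maps (TG A (comatrix_bimod A (S j) (D j)) (comatrix_bimod A (S j) (D j))) (TG A SS SS)"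
proof -
 show m: "tmap A SS SS (dsum_incl I CC j) (dsum_incl I CC j)
   : add_maps (TG A (comatrix_bimod A (S j) (D j)) (comatrix_bimod A (S j) (D j))) (TG A SS SS)"
  using tmap_add_maps(1)[OF comatrix.tpTT[OF cmx[OF j]] tSS] incl_hom[OF j] by (simp add: bimod_hom_iff)
 show "(%x. tmap A SS SS (dsum_incl I CC j) (dsum_incl I CC j) (comult (CC j) x)) : add_maps (CC j) (TG A SS SS)"
  unfolding CC_add_maps by (rule add_maps_comp[OF comatrix.comult_comatrix(1)[OF cmx[OF j]] m])
qed

lemma counit_summand: "j : I ==> counit (CC j) : add_maps (CC j) A"
 unfolding CC_add_maps by (rule comatrix.counit_comatrix(1)[OF cmx])

lemmas comult_lift = D.dsum_lift_add_maps[where g = "%j x. tmap A SS SS (dsum_incl I CC j) (dsum_incl I CC j) (comult (CC j) x)",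
   OF tensor_pair.ab_tensor[OF tSS] comult_summand(1)]
  D.dsum_lift_incl[where g = "%j x. tmap A SS SS (dsum_incl I CC j) (dsum_incl I CC j) (comult (CC j) x)",
   OF tensor_pair.ab_tensor[OF tSS] comult_summand(1)]
lemmas counit_lift = D.dsum_lift_add_maps[where g = "%j. counit (CC j)", OF abelian_group_axioms counit_summand]
  D.dsum_lift_incl[where g = "%j. counit (CC j)", OF abelian_group_axioms counit_summand]

lemma comult_add_maps: "comult SC : add_maps SS (TG A SS SS)"
 unfolding dsum_coring_simps SS_add_maps by (rule comult_lift(1))

lemma counit_add_maps: "counit SC : add_maps SS A"
 unfolding dsum_coring_simps SS_add_maps by (rule counit_lift(1))

context
 fixes i assumes i: "i : I"
begin

interpretation c: comatrix A "S i" "D i" by (rule cmx[OF i])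

lemma gen_closed: "[|\<phi> .: (dual_bimod A (S i)); x .: (S i)|] ==> gen i \<phi> x .: SS"
 unfolding gen_def using D.dsum_incl_closed[OF i, of "c.tt \<phi> x"] c.tt_closed[of \<phi> x]
 by (simp add: dsum_bimod_simps comatrix_coring_simps)

lemma gen_right_hom: "\<phi> .: (dual_bimod A (S i)) ==> gen i \<phi> : rmod_hom A (S i) SS"
 using rmod_hom_comp[OF c.tt_hom, of \<phi> "dsum_incl I CC i" SS] incl_hom[OF i]
 by (simp add: gen_def[abs_def] bimod_hom_iff)

lemma gen_left_add_maps: "x .: (S i) ==> (%\<phi>. gen i \<phi> x) : add_maps (dual_bimod A (S i)) SS"
 unfolding gen_def by (rule add_maps_comp[OF c.tt_left_add_maps]) (use incl_hom[OF i] in "simp_all add: bimod_hom_iff rmod_hom_iff")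

lemma gen_lact: "[|\<phi> .: (dual_bimod A (S i)); x .: (S i); a .: A|] ==>
  a |>{|SS|} gen i \<phi> x = gen i (a |>{|dual_bimod A (S i)|} \<phi>) x"
 unfolding gen_def c.tt_lact[symmetric]
 using lmod_hom_lact[of "dsum_incl I CC i" A c.T SS a "c.tt \<phi> x"] incl_hom[OF i] c.tt_closed[of \<phi> x]
 by (simp add: bimod_hom_iff)

lemma gen_balanced: "[|\<phi> .: (dual_bimod A (S i)); d : D i; x .: (S i)|] ==>
  gen i (\<phi> <|{|dual_bimod A (S i)|} d) x = gen i \<phi> (d x)"
 unfolding gen_def by (simp add: c.tt_balanced)

lemma comult_gen:
 assumes p: "\<phi> .: (dual_bimod A (S i))" and x: "x .: (S i)"
 shows "comult SC (gen i \<phi> x) = (\<Oplus>{|TG A SS SS|} k\<in>{..<db_size A (S i)}.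
  tensor A SS SS (gen i \<phi> (db_vec A (S i) k)) (gen i (db_form A (S i) k) x))"
proof -
 interpret TS: tensor_pair A SS SS by (rule tSS)
 interpret TSg: abelian_group "TG A SS SS" by (rule TS.ab_tensor)
 have mt: "tmap A SS SS (dsum_incl I CC i) (dsum_incl I CC i) (tensor A c.T c.T s t)
   = tensor A SS SS (dsum_incl I CC i s) (dsum_incl I CC i t)" if "s .: c.T" "t .: c.T" for s t
  using tmap_add_maps(2)[OF c.tpTT tSS _ _ that, of "dsum_incl I CC i" "dsum_incl I CC i"] incl_hom[OF i]
  by (simp add: bimod_hom_iff)
 have "comult SC (gen i \<phi> x) = tmap A SS SS (dsum_incl I CC i) (dsum_incl I CC i) (comult (CC i) (c.tt \<phi> x))"
  unfolding dsum_coring_simps gen_def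
  by (rule comult_lift(2)[OF _ i]) (use c.tt_closed[OF p x] in "simp_all add: comatrix_coring_simps")
 also have "... = tmap A SS SS (dsum_incl I CC i) (dsum_incl I CC i) (c.cm \<phi> x)" using c.comult_comatrix(2)[OF p x] by simp
 also have "... = (\<Oplus>{|TG A SS SS|} k\<in>{..<db_size A (S i)}. tmap A SS SS (dsum_incl I CC i) (dsum_incl I CC i)
   (tensor A c.T c.T (c.tt \<phi> (db_vec A (S i) k)) (c.tt (db_form A (S i) k) x)))"
  unfolding c.cm_def
  by (rule add_maps_finsum[OF tensor_pair.ab_tensor[OF c.tpTT] TS.ab_tensor comult_summand(2)[OF i]])
   (use p x c.dbf in "auto simp: tensor_pair.tensor_closed[OF c.tpTT] c.tt_closed")
 also have "... = (\<Oplus>{|TG A SS SS|} k\<in>{..<db_size A (S i)}.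
  tensor A SS SS (gen i \<phi> (db_vec A (S i) k)) (gen i (db_form A (S i) k) x))"
 proof (rule TSg.finsum_cong'[OF refl])
  show "(%k. tensor A SS SS (gen i \<phi> (db_vec A (S i) k)) (gen i (db_form A (S i) k) x)) : {..<db_size A (S i)} \<rightarrow> carrier (TG A SS SS)"
   using gen_closed p x c.dbf by (auto intro!: TS.tensor_closed)
  fix k assume "k : {..<db_size A (S i)}"
  then show "tmap A SS SS (dsum_incl I CC i) (dsum_incl I CC i)
   (tensor A c.T c.T (c.tt \<phi> (db_vec A (S i) k)) (c.tt (db_form A (S i) k) x))
   = tensor A SS SS (gen i \<phi> (db_vec A (S i) k)) (gen i (db_form A (S i) k) x)"
   using mt c.tt_closed p x c.dbf by (simp add: gen_def)
 qed
 finally show "comult SC (gen i \<phi> x) = (\<Oplus>{|TG A SS SS|} k\<in>{..<db_size A (S i)}.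
  tensor A SS SS (gen i \<phi> (db_vec A (S i) k)) (gen i (db_form A (S i) k) x))" .
qed

lemma counit_gen:
 assumes p: "\<phi> .: (dual_bimod A (S i))" and x: "x .: (S i)"
 shows "counit SC (gen i \<phi> x) = \<phi> x"
proof -
 have "counit SC (gen i \<phi> x) = counit (CC i) (c.tt \<phi> x)"
  unfolding dsum_coring_simps gen_def
  by (rule counit_lift(2)[OF _ i]) (use c.tt_closed[OF p x] in "simp_all add: comatrix_coring_simps")
 then show "counit SC (gen i \<phi> x) = \<phi> x" using c.counit_comatrix(2)[OF p x] by simp
qed

end

lemma SS_induct [consumes 1, case_names zero gen add]:
 assumes "f .: SS" "P \<zero>{|SS|}"
  "!!i \<phi> x. [|i : I; \<phi> .: (dual_bimod A (S i)); x .: (S i)|] ==> P (gen i \<phi> x)"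
  "!!f g. [|f .: SS; g .: SS; P f; P g|] ==> P (f \<oplus>{|SS|} g)"
 shows "P f"
proof -
 have "P (dsum_incl I CC i t)" if i: "i : I" and "t .: (comatrix_bimod A (S i) (D i))" for i t
 proof -
  interpret c: comatrix A "S i" "D i" by (rule cmx[OF i])
  have am: "dsum_incl I CC i : add_maps c.T SS" using incl_hom[OF i] by (simp add: bimod_hom_iff rmod_hom_iff)
  show ?thesis using that(2)
  proof (induction rule: c.T_induct)
   case zero
   have "dsum_incl I CC i \<zero>{|c.T|} = \<zero>{|SS|}" by (rule add_maps_zero[OF bimodule_ab[OF c.bT] bimodule_ab[OF bSS] am])
   then show ?case using assms(2) by simp
  next
   case (tensor \<phi> x)
   then show ?case using assms(3)[OF i] by (simp add: gen_def)
  next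
   case (add s t)
   then show ?case using assms(4)[OF add_maps_closed[OF am] add_maps_closed[OF am]] add_maps_add[OF am] by simp
  qed
 qed
 then have 1: "!!i t. [|i : I; t .: (CC i)|] ==> P (dsum_incl I CC i t)" by (simp add: comatrix_coring_simps)
 have "f .: (dsum I CC)" using assms(1) by (simp add: dsum_bimod_simps)
 then show ?thesis
  by (rule D.dsum_induct[of f P]) (use assms(2,4) 1 in "simp_all only: dsum_bimod_simps")
qed

lemma SS_ext:
 assumes "f : add_maps SS H" "g : add_maps SS H" "abelian_group H" "x .: SS"
  and "!!i \<phi> y. [|i : I; \<phi> .: (dual_bimod A (S i)); y .: (S i)|] ==> f (gen i \<phi> y) = g (gen i \<phi> y)"
 shows "f x = g x"
 using assms(4)
proof (induction rule: SS_induct)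
 case zero
 then show ?case using add_maps_zero[OF bimodule_ab[OF bSS] assms(3,1)] add_maps_zero[OF bimodule_ab[OF bSS] assms(3,2)] by simp
next
 case (add s t)
 then show ?case by (simp add: add_maps_add[OF assms(1)] add_maps_add[OF assms(2)])
qed (use assms(5) in simp)

end

section \<open>Simple comodules over a flat coring\<close>

context flat_coring begin

text \<open>Slicing with the counit turns a term u (x) k(s x) of the decomposition into u times
  \<open>counit C (k (s x))\<close>. So u is a vector of a dual basis, and counit o k o s is the
  form that belongs to it.\<close>

lemma lifts_dual_basis:
 fixes N :: "('a, 'c, 'n) comod"
 assumes N: "right_comodule A C N"
  and L: "!!Tg. Tg : set L ==> EX k u. right_module A (fst Tg) & k : rmod_hom A (fst Tg) C & u .: N \<and>
   snd Tg = (%t. tensor A N C u (k t))"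
  and f: "lifts A C N (tensor_comod A C N) L f"
 shows "EX n es e. es : {..<n} \<rightarrow> carrier (dual_bimod A N) & e : {..<n} \<rightarrow> carrier N \<and>
  (ALL x:carrier N. slice N (counit C) (f x) = (\<Oplus>{|N|} i\<in>{..<n::nat}. e i <|{|N|} es i x))"
proof -
 interpret N: right_comodule A C N by fact
 interpret T: tensor_pair A N C by (rule tpM[OF N.is_rmod])
 note sl = slice_add_maps[OF bim N.is_rmod counit_left_form]
 show ?thesis
  using L f
 proof (induction L arbitrary: f)
  case Nil
  have z: "slice N (counit C) \<zero>{|TG A N C|} = \<zero>{|N|}"
   by (rule add_maps_zero[OF T.ab_tensor N.ab sl(1)])
  show ?case by (rule exI[of _ 0]) (use Nil z in auto)
 next
  case (Cons Tg L)
  obtain k u where k: "right_module A (fst Tg)" "k : rmod_hom A (fst Tg) C" "u .: N"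
   "snd Tg = (%t. tensor A N C u (k t))" using Cons.prems(1)[of Tg] by auto
  obtain s f' where s: "s : comod_hom A C N (fst Tg)" and f': "f' : comod_hom A C N (tensor_comod A C N)"
   and l: "lifts A C N (tensor_comod A C N) L f'"
   and ff': "!!x. x .: N ==> f x = tensor A N C u (k (s x)) \<oplus>{|TG A N C|} f' x"
   using Cons.prems(2) k(4) by auto
  obtain n es e where es: "es : {..<n} \<rightarrow> carrier (dual_bimod A N)" and e: "e : {..<n} \<rightarrow> carrier N"
   and x: "!!x. x .: N ==> slice N (counit C) (f' x) = (\<Oplus>{|N|} i\<in>{..<n::nat}. e i <|{|N|} es i x)"
   using Cons.IH[OF Cons.prems(1) l] by auto
  have h: "(%x. counit C (k (s x))) : rmod_hom A N (regular_rmod A)"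
   by (rule rmod_hom_comp[OF comod_hom_rmod[OF s]]) (rule counit_comp_form[OF k(2)])
  let ?p = "restrict (%x. counit C (k (s x))) (carrier N)"
  have p: "?p .: (dual_bimod A N)"
  proof -
   have "?p : rmod_hom A N (regular_rmod A)"
    using h by (auto simp: rmod_hom_iff add_maps_def N.ract_closed)
   then show ?thesis by (simp add: dual_bimod_simps)
  qed
  have esx: "es i x .: A" if "i < n" "x .: N" for i x
   using rmod_hom_closed[of "es i" A N "regular_rmod A" x] es that by (auto simp: dual_bimod_simps Pi_iff)
  have "slice N (counit C) (f x) = (\<Oplus>{|N|} i\<in>{..<Suc n}. (e(n := u)) i <|{|N|} (es(n := ?p)) i x)" if xN: "x .: N" for x
  proof -
   have c: "k (s x) .: C" "f' x .: (TG A N C)" "counit C (k (s x)) .: A"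
    using rmod_hom_closed[OF k(2) rmod_hom_closed[OF comod_hom_rmod[OF s] xN]]
    rmod_hom_closed[OF comod_hom_rmod[OF f'] xN] rmod_hom_closed[OF h xN] by simp_all
   have "slice N (counit C) (f x) = u <|{|N|} counit C (k (s x)) \<oplus>{|N|} slice N (counit C) (f' x)"
    unfolding ff'[OF xN] using add_maps_add[OF sl(1) T.tensor_closed[OF k(3) c(1)] c(2)] sl(2)[OF k(3) c(1)] by simp
   also have "... = u <|{|N|} counit C (k (s x)) \<oplus>{|N|} (\<Oplus>{|N|} i\<in>{..<n}. (e(n := u)) i <|{|N|} (es(n := ?p)) i x)"
    unfolding x[OF xN]
    by (rule arg_cong[where f = "%z. _ \<oplus>{|N|} z"], rule N.finsum_cong')
    (use e esx xN in "auto simp: N.ract_closed Pi_iff")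
   also have "... = (\<Oplus>{|N|} i\<in>insert n {..<n}. (e(n := u)) i <|{|N|} (es(n := ?p)) i x)"
    by (subst N.finsum_insert) (use e esx xN k(3) c in "auto simp: N.ract_closed Pi_iff")
   finally show ?thesis by (simp add: lessThan_Suc)
  qed
  then show ?case
   using p es e k(3)
   by (intro exI[of _ "Suc n"] exI[of _ "es(n := ?p)"] exI[of _ "e(n := u)"]) (auto simp: Pi_iff less_Suc_eq)
 qed
qed

text \<open>The decomposition is applied to the coaction, whose slice with the counit is the
  identity.\<close>

lemma simple_dual_basis:
 fixes N :: "('a, 'c, 'n) comod" and \<K> :: "(('a, 'c, 't) comod \<times> ('t => 'c)) set"
 assumes N: "simple_comodule A C N"
  and K: "!!T k. (T, k) : \<K> ==> simple_comodule A C T & k : comod_hom A C T (regc C)"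
  and gen: "!!c. c .: C ==> EX L. set L <= \<K> & c : img C L carrier"
 shows "EX b. dual_basis A N b"
proof -
 interpret N: right_comodule A C N by (rule simple_comodule_right[OF N])
 obtain L where L: "!!T g. (T, g) : set L ==> EX k u. (T, k) : \<K> & u .: N & g = (%t. tensor A N C u (k t))"
  and l: "lifts A C N (tensor_comod A C N) L (coact N)"
  using coact_lifts[OF N K gen] by metis
 have "EX n es e. es : {..<n} \<rightarrow> carrier (dual_bimod A N) & e : {..<n} \<rightarrow> carrier N \<and>
  (ALL x:carrier N. slice N (counit C) (coact N x) = (\<Oplus>{|N|} i\<in>{..<n::nat}. e i <|{|N|} es i x))"
 proof (rule lifts_dual_basis[OF N.right_comodule_axioms _ l])
  fix Tg assume "Tg : set L"
  then obtain k u where ku: "(fst Tg, k) : \<K>" "u .: N" "snd Tg = (%t. tensor A N C u (k t))"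
   using L[of "fst Tg" "snd Tg"] by auto
  note T = K[OF ku(1), THEN conjunct1] and k = K[OF ku(1), THEN conjunct2]
  have "k : rmod_hom A (fst Tg) C" using comod_hom_rmod[OF k] by simp
  then show "EX k u. right_module A (fst Tg) & k : rmod_hom A (fst Tg) C & u .: N & snd Tg = (%t. tensor A N C u (k t))"
   using precomod_module[OF simple_precomod[OF T]] ku(2,3) by (intro exI[of _ k] exI[of _ u]) simp
 qed
 then obtain n es e where "es : {..<n::nat} \<rightarrow> carrier (dual_bimod A N)" "e : {..<n} \<rightarrow> carrier N"
  "!!x. x .: N ==> slice N (counit C) (coact N x) = (\<Oplus>{|N|} i\<in>{..<n}. e i <|{|N|} es i x)"
  by (elim exE conjE) blast
 moreover have "slice N (counit C) (coact N x) = x" if "x .: N" for x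
  using comodule_counit[OF N.right_comodule_axioms that] .
 ultimately have "dual_basis A N (n, es, e)" unfolding dual_basis_def by simp
 then show ?thesis by blast
qed

text \<open>Extensionality makes this a subset of the carrier of \<open>End_ring\<close>.\<close>

definition comod_End :: "('a, 'c, 'n, 's) comod_scheme => ('n => 'n) set" where
 "comod_End N = comod_hom A C N N \<inter> extensional (carrier N)"

lemma comod_End_restrict:
 assumes "precomod A C N" "f : comod_hom A C N N" "!!x. x .: N ==> g x = f x"
 shows "restrict g (carrier N) : comod_End N"
proof -
 have "restrict g (carrier N) : comod_hom A C N N"
  by (rule comod_hom_cong[OF assms(1) precomod_module[OF assms(1)] assms(2)]) (use assms(3) in simp)
 then show ?thesis by (simp add: comod_End_def)
qed

text \<open>Here the centralizing hypothesis enters: in the tensor product x (x) c \<eta>(k) = x (x)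
  \<eta>(k) c = x \<eta>(k) (x) c.\<close>

lemma comod_hom_scalar:
 assumes K: "ring_algebra K A \<eta>" and z: "centralizes K \<eta> C" and N: "right_comodule A C N" and k: "k .: K"
 shows "(%x. x <|{|N|} \<eta> k) : comod_hom A C N N"
proof (rule comod_homI)
 interpret K: ring_algebra K A \<eta> by fact
 interpret N: right_comodule A C N by fact
 interpret T: tensor_pair A N C by (rule tpM[OF N.is_rmod])
 have ek: "\<eta> k .: A" using K.scalar_hom k by (auto simp: ring_hom_def)
 show r: "(%x. x <|{|N|} \<eta> k) : rmod_hom A N N"
  unfolding rmod_hom_iff
  using N.ract_add_maps[OF ek] K.scalar_central[OF k] ek by (simp add: N.ract_mult[symmetric])
 have cC: "c <| \<eta> k = \<eta> k |> c" if "c .: C" for c using z k that by (simp add: centralizes_def)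
 fix x assume x: "x .: N"
 note m = tmap_add_maps[OF tpM[OF N.is_rmod] tpM[OF N.is_rmod] r lmod_hom_id]
 note cx = comodule_coact_closed[OF N.right_comodule_axioms x]
 have "tmap A N C (%x. x <|{|N|} \<eta> k) id (coact N x) = coact N x <|{|TR A N C|} \<eta> k"
 proof (rule T.tensor_ext[OF m(1) _ T.ab_tensor cx])
  show "(%t. t <|{|TR A N C|} \<eta> k) : add_maps (TG A N C) (TG A N C)"
   using right_module.ract_add_maps[OF right_module_tensor_rmod[OF tpM[OF N.is_rmod] bim] ek] by simp
  fix y c assume "y .: N" "c .: C"
  then show "tmap A N C (%x. x <|{|N|} \<eta> k) id (tensor A N C y c) = tensor A N C y c <|{|TR A N C|} \<eta> k"
   using m(2) tensor_ract(2)[OF tpM[OF N.is_rmod] bim ek] cC ek by (simp add: T.tensor_balanced)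
 qed
 then show "tmap A N C (%x. x <|{|N|} \<eta> k) id (coact N x) = coact N (x <|{|N|} \<eta> k)"
  using rmod_hom_ract[OF N.coact_hom x ek] by simp
qed

text \<open>Schur's lemma makes every nonzero colinear endomorphism invertible; zero is not a unit
  because a simple comodule is nonzero.\<close>

lemma comod_End_division:
 assumes K: "ring_algebra K A \<eta>" and z: "centralizes K \<eta> C" and N: "simple_comodule A C N"
 shows "division_subring K \<eta> A N (comod_End N)"
proof -
 interpret N: right_comodule A C N by (rule simple_comodule_right[OF N])
 note Np = simple_precomod[OF N]
 have ring: "ring (End_ring A N)" by (rule N.End_ring_ring)
 have sub: "comod_End N <= carrier (End_ring A N)"
  using comod_hom_rmod by (auto simp: comod_End_def End_ring_simps)
 have EE: "f : comod_hom A C N N" "f : extensional (carrier N)" if "f : comod_End N" for f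
  using that by (simp_all add: comod_End_def)
 have cl: "f x .: N" if "f : comod_End N" "x .: N" for f x
  using rmod_hom_closed[OF comod_hom_rmod[OF EE(1)[OF that(1)]] that(2)] .
 have um: "(%x. \<zero>{|N|} \<ominus>{|N|} f x) : comod_hom A C N N" if "f : comod_hom A C N N" for f
  by (rule comod_hom_minus[OF Np Np comod_hom_zero[OF Np Np] that])
 have SR: "subring (comod_End N) (End_ring A N)"
 proof (rule ring.subringI[OF ring sub])
  show "\<one>{|End_ring A N|} : comod_End N"
   unfolding End_ring_simps by (rule comod_End_restrict[OF Np comod_hom_id[OF Np]]) simp
 next
  fix f assume f: "f : comod_End N"
  then have "f .: (End_ring A N)" using sub by blast
  show "\<ominus>{|End_ring A N|} f : comod_End N"
   unfolding N.End_uminus[OF \<open>f : carrier (End_ring A N)\<close>]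
   by (rule comod_End_restrict[OF Np um[OF EE(1)[OF f]]]) (use cl[OF f] in "simp add: N.minus_eq")
 next
  fix f g assume f: "f : comod_End N" and g: "g : comod_End N"
  show "f \<otimes>{|End_ring A N|} g : comod_End N"
   unfolding End_ring_simps compose_def
   by (rule comod_End_restrict[OF Np comod_hom_comp[OF Np N.is_rmod N.is_rmod EE(1)[OF g] EE(1)[OF f]]]) simp
  show "f \<oplus>{|End_ring A N|} g : comod_End N"
   unfolding End_ring_simps
   by (rule comod_End_restrict[OF Np comod_hom_minus[OF Np Np EE(1)[OF f] um[OF EE(1)[OF g]]]])
    (use cl[OF f] cl[OF g] in "simp add: N.minus_eq")
 qed
 obtain x0 where x0: "x0 .: N" "x0 ~= \<zero>{|N|}"
  using N N.zero_closed unfolding simple_comodule_def by blast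
 have one_nz: "\<one>{|End_ring A N|} ~= \<zero>{|End_ring A N|}" using x0 by (auto simp: End_ring_simps dest: fun_cong[of _ _ x0])
 let ?E = "End_ring A N(|carrier := comod_End N|)"
 have U: "Units ?E = comod_End N - {\<zero>{|End_ring A N|}}"
 proof (intro equalityI subsetI)
  fix f assume "f : Units ?E"
  then obtain g where f: "f : comod_End N" and g: "g : comod_End N" "g \<otimes>{|End_ring A N|} f = \<one>{|End_ring A N|}"
   by (auto simp: Units_def)
  interpret E: ring "End_ring A N" by (rule ring)
  have "f ~= \<zero>{|End_ring A N|}"
  proof
   assume "f = \<zero>{|End_ring A N|}"
   then have "g \<otimes>{|End_ring A N|} f = \<zero>{|End_ring A N|}" using E.r_null[of g] g(1) sub by auto
   then show False using g(2) one_nz by simp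
  qed
  then show "f : comod_End N - {\<zero>{|End_ring A N|}}" using f by simp
 next
  fix f assume "f : comod_End N - {\<zero>{|End_ring A N|}}"
  then have f: "f : comod_End N" and nz: "f ~= \<zero>{|End_ring A N|}" by auto
  have "EX x:carrier N. f x ~= \<zero>{|N|}"
  proof (rule ccontr)
   assume "\<not> (EX x:carrier N. f x ~= \<zero>{|N|})"
   then have "f = \<zero>{|End_ring A N|}"
    unfolding End_ring_simps by (intro extensionalityI[OF EE(2)[OF f]]) auto
   then show False using nz by simp
  qed
  then obtain x where x: "x .: N" "f x ~= \<zero>{|N|}" by blast
  have b: "bij_betw f (carrier N) (carrier N)" using schur[OF N N EE(1)[OF f] x] by (simp add: comod_iso_def)
  let ?g = "restrict (inv_into (carrier N) f) (carrier N)"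
  have g: "?g : comod_End N"
   by (rule comod_End_restrict[OF Np comod_hom_inverse(1)[OF Np Np EE(1)[OF f] b]]) simp
  have gc: "inv_into (carrier N) f y .: N" "f (inv_into (carrier N) f y) = y" "inv_into (carrier N) f (f y) = y"
   if "y .: N" for y
   using b that by (auto simp: bij_betw_def inv_into_into f_inv_into_f)
  have "?g \<otimes>{|End_ring A N|} f = \<one>{|End_ring A N|}" "f \<otimes>{|End_ring A N|} ?g = \<one>{|End_ring A N|}"
   using gc cl[OF f] by (auto simp: End_ring_simps compose_def intro!: restrict_ext)
  then show "f : Units ?E" using f g by (auto simp: Units_def)
 qed
 show ?thesis
  unfolding division_subring_def
 proof (intro conjI ballI)
  fix k assume "k .: K"
  then show "(\<lambda>x\<in>carrier N. x <|{|N|} \<eta> k) : comod_End N"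
   by (intro comod_End_restrict[OF Np comod_hom_scalar[OF K z N.right_comodule_axioms]]) simp_all
 qed (use SR U in simp_all)
qed

end

section \<open>Matrix coefficients and the canonical map from the comatrix corings\<close>

lemma (in comatrix_family) SS_lift:
 assumes G: "abelian_group G"
  and b: "!!i. i : I ==> balanced (End_ring A (S i)(|carrier := D i|)) (dual_bimod A (S i)) (eval_bimod (S i)) G (b i)"
 shows "EX f. f : add_maps SS G \<and>
  (ALL i \<phi> x. i : I --> \<phi> .: (dual_bimod A (S i)) --> x .: (S i) --> f (gen i \<phi> x) = b i \<phi> x)"
proof -
 interpret D: dsum_family I CC by (rule fam)
 have g: "tensor_lift G (case_prod (b i)) : add_maps (CC i) G"
  and gt: "!!\<phi> x. [|\<phi> .: (dual_bimod A (S i)); x .: (S i)|] ==>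
   tensor_lift G (case_prod (b i)) (comatrix_tensor A (S i) (D i) \<phi> x) = b i \<phi> x" if i: "i : I" for i
 proof -
  interpret c: comatrix A "S i" "D i" by (rule cmx[OF i])
  interpret TP: tensor_pair "End_ring A (S i)(|carrier := D i|)" "dual_bimod A (S i)" "eval_bimod (S i)" by (rule c.tpT)
  show "tensor_lift G (case_prod (b i)) : add_maps (CC i) G"
   unfolding CC_add_maps c.add_maps_T using TP.tensor_lift_add_maps[OF G b[OF i]] by simp
  show "tensor_lift G (case_prod (b i)) (comatrix_tensor A (S i) (D i) \<phi> x) = b i \<phi> x"
   if "\<phi> .: (dual_bimod A (S i))" "x .: (S i)" for \<phi> x
   unfolding comatrix_tensor_def using TP.tensor_lift_tensor[OF G b[OF i], of \<phi> x] that by simp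
 qed
 note lift = D.dsum_lift_add_maps[where g = "%i. tensor_lift G (case_prod (b i))", OF G g]
  D.dsum_lift_incl[where g = "%i. tensor_lift G (case_prod (b i))", OF G g]
 show ?thesis
 proof (intro exI conjI allI impI)
  show "dsum_lift I CC G (%i. tensor_lift G (case_prod (b i))) : add_maps SS G"
   unfolding SS_add_maps by (rule lift(1))
  fix i \<phi> x assume i: "i : I" and x: "\<phi> .: (dual_bimod A (S i))" "x .: (S i)"
  interpret c: comatrix A "S i" "D i" by (rule cmx[OF i])
  have "dsum_lift I CC G (%i. tensor_lift G (case_prod (b i))) (gen i \<phi> x) = tensor_lift G (case_prod (b i)) (c.tt \<phi> x)"
   unfolding gen_def by (rule lift(2)[OF _ i]) (use c.tt_closed[OF x] in "simp_all add: comatrix_coring_simps")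
  then show "dsum_lift I CC G (%i. tensor_lift G (case_prod (b i))) (gen i \<phi> x) = b i \<phi> x" using gt[OF i x] by simp
 qed
qed

context coring begin

context
 fixes M :: "('a, 'm, 's) rmod_scheme"
 assumes M: "right_module A M"
begin

interpretation M: right_module A M by (rule M)
interpretation T: tensor_pair A M C by (rule tpM[OF M])

lemma form_of_dual: "\<phi> .: (dual_bimod A M) ==> \<phi> : rmod_hom A M (regular_rmod A)"
 by (simp add: dual_bimod_simps)

lemma form_values: "[|\<phi> .: (dual_bimod A M); x .: M|] ==> \<phi> x .: A"
 using rmod_hom_closed[OF form_of_dual] by simp

lemma contr_cong:
 assumes "\<phi> : rmod_hom A M (regular_rmod A)" "\<psi> : rmod_hom A M (regular_rmod A)"
  "!!x. x .: M ==> \<phi> x = \<psi> x" "t .: (TG A M C)"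
 shows "contr C \<phi> t = contr C \<psi> t"
 by (rule T.tensor_ext[OF contr_add_maps(1)[OF bim M assms(1)] contr_add_maps(1)[OF bim M assms(2)] ab assms(4)])
  (simp add: contr_add_maps(2)[OF bim M assms(1)] contr_add_maps(2)[OF bim M assms(2)] assms(3))

lemma contr_dual_add_maps:
 assumes t: "t .: (TG A M C)"
 shows "(%\<phi>. contr C \<phi> t) : add_maps (dual_bimod A M) C"
proof (rule add_mapsI)
 fix \<phi> assume p: "\<phi> .: (dual_bimod A M)"
 note cp = contr_add_maps[OF bim M form_of_dual[OF p]]
 show "contr C \<phi> t .: C" by (rule add_maps_closed[OF cp(1) t])
 fix \<psi> assume q: "\<psi> .: (dual_bimod A M)"
 note cq = contr_add_maps[OF bim M form_of_dual[OF q]]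
 have pq: "\<phi> \<oplus>{|dual_bimod A M|} \<psi> .: (dual_bimod A M)"
  by (rule abelian_monoid.a_closed[OF abelian_group.axioms(1)[OF M.dual_abelian] p q])
 note cs = contr_add_maps[OF bim M form_of_dual[OF pq]]
 have v: "(\<phi> \<oplus>{|dual_bimod A M|} \<psi>) x = \<phi> x \<oplus>{|A|} \<psi> x" if "x .: M" for x
  using that by (simp add: dual_bimod_simps)
 show "contr C (\<phi> \<oplus>{|dual_bimod A M|} \<psi>) t = contr C \<phi> t \<oplus> contr C \<psi> t"
  by (rule T.tensor_ext[OF cs(1) add_maps_plus[OF ab cp(1) cq(1)] ab t])
   (use form_values[OF p] form_values[OF q] in "simp add: cs(2) cp(2) cq(2) v lact_add_left")
qed

lemma contr_lact:
 assumes p: "\<phi> .: (dual_bimod A M)" and a: "a .: A" and t: "t .: (TG A M C)"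
 shows "contr C (a |>{|dual_bimod A M|} \<phi>) t = a |> contr C \<phi> t"
proof -
 note cp = contr_add_maps[OF bim M form_of_dual[OF p]]
 have E: "bimodule A (End_ring A M(|carrier := carrier (End_ring A M)|)) (dual_bimod A M)"
  by (rule M.dual_bimodule) (rule ring.carrier_is_subring[OF M.End_ring_ring])
 note q = bimodule.lact_closed[OF E a p]
 note cs = contr_add_maps[OF bim M form_of_dual[OF q]]
 have v: "(a |>{|dual_bimod A M|} \<phi>) x = a \<otimes>{|A|} \<phi> x" if "x .: M" for x
  using that by (simp add: dual_bimod_simps)
 show ?thesis
  by (rule T.tensor_ext[OF cs(1) add_maps_comp[OF cp(1) lact_add_maps[OF a]] ab t])
   (use form_values[OF p] a in "simp add: cs(2) cp(2) v lact_mult")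
qed

lemma contr_comp:
 assumes p: "\<phi> : rmod_hom A M (regular_rmod A)" and d: "d : rmod_hom A M M" and q: "\<psi> : rmod_hom A M (regular_rmod A)"
  and e: "!!x. x .: M ==> \<psi> x = \<phi> (d x)" and t: "t .: (TG A M C)"
 shows "contr C \<psi> t = contr C \<phi> (tmap A M C d id t)"
proof -
 note m = tmap_add_maps[OF tpM[OF M] tpM[OF M] d lmod_hom_id]
 note cp = contr_add_maps[OF bim M p] and cq = contr_add_maps[OF bim M q]
 show ?thesis
  by (rule T.tensor_ext[OF cq(1) add_maps_comp[OF m(1) cp(1)] ab t])
   (simp add: cq(2) cp(2) m(2) e rmod_hom_closed[OF d])
qed

end

text \<open>By colinearity of the matrix coefficient map, the comultiplication of its value at x is
  this map applied to the first factor of the coaction of x, which is then expanded by the dual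
  basis. The result mirrors \<open>comult_gen\<close>, so the canonical map respects
  comultiplication.\<close>

lemma comult_hat:
 assumes M: "right_comodule A C M" and b: "dual_basis A M (n, es, e)"
  and p: "\<phi> : rmod_hom A M (regular_rmod A)" and x: "x .: M"
 shows "comult C (contr C \<phi> (coact M x)) = (\<Oplus>{|TG A C C|} k\<in>{..<n}.
  tensor A C C (contr C \<phi> (coact M (e k))) (contr C (es k) (coact M x)))"
proof -
 interpret M: right_comodule A C M by fact
 note h = hat_comod_hom[OF M p]
 have hr: "(%x. contr C \<phi> (coact M x)) : rmod_hom A M C" using comod_hom_rmod[OF h(1)] by simp
 note Mm = M.is_rmod
 note f = M.dual_basis_facts[OF b]
 interpret T: tensor_pair A M C by (rule tpM[OF Mm])
 interpret TC: tensor_pair A C C by (rule tpM[OF is_rmod])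
 interpret TCg: abelian_group "TG A C C" by (rule TC.ab_tensor)
 note m = tmap_add_maps[OF tpM[OF Mm] tpM[OF is_rmod] hr lmod_hom_id]
 note cx = comodule_coact_closed[OF M x]
 have cc: "contr C (es k) (coact M x) .: C" if "k < n" for k
  by (rule add_maps_closed[OF contr_add_maps(1)[OF bim Mm f(3)[OF that]] cx])
 have "comult C (contr C \<phi> (coact M x)) = tmap A C C (%x. contr C \<phi> (coact M x)) id (coact M x)"
  using comod_hom_coact[OF h(1) x] by simp
 also have "... = tmap A C C (%x. contr C \<phi> (coact M x)) id
   (\<Oplus>{|TG A M C|} k\<in>{..<n}. tensor A M C (e k) (contr C (es k) (coact M x)))"
  using M.dual_basis_tensor_expand[OF b bim cx] by simp
 also have "... = (\<Oplus>{|TG A C C|} k\<in>{..<n}.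
   tmap A C C (%x. contr C \<phi> (coact M x)) id (tensor A M C (e k) (contr C (es k) (coact M x))))"
  by (rule add_maps_finsum[OF T.ab_tensor TC.ab_tensor m(1)]) (use f cc in "auto simp: T.tensor_closed")
 also have "... = (\<Oplus>{|TG A C C|} k\<in>{..<n}. tensor A C C (contr C \<phi> (coact M (e k))) (contr C (es k) (coact M x)))"
  by (rule TCg.finsum_cong') (use f cc m(2) rmod_hom_closed[OF hr] in "auto simp: TC.tensor_closed")
 finally show ?thesis .
qed

end

text \<open>By \<open>gens\<close> the coring is the sum of the images of colinear maps from the
  members. That distinct members are not isomorphic keeps every nonzero colinear map between members
  within one summand.\<close>

locale simple_family = flat_coring A C for A :: "('a, 'p) ring_scheme" and C :: "('a, 'c, 'q) coring_scheme" (structure) +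
 fixes I :: "'i set" and M :: "'i => ('a, 'c, 'm) comod"
 assumes simp: "i : I ==> simple_comodule A C (M i)"
  and noniso: "[|i : I; j : I; i ~= j|] ==> comod_iso A C (M i) (M j) = {}"
  and sr: "i : I ==> subring (comod_End (M i)) (End_ring A (M i))"
  and gens: "c .: C ==> EX L. set L <= {(M i, k) | i k. i : I & k : comod_hom A C (M i) (regc C)} \<and>
   c : img C L carrier"
begin

lemma family_dual_basis: assumes "i : I" shows "EX b. dual_basis A (M i) b"
 by (rule simple_dual_basis[OF simp[OF assms] _ gens]) (auto simp: simp)

lemma rc: "i : I ==> right_comodule A C (M i)" by (rule simple_comodule_right[OF simp])
lemma rm: "i : I ==> right_module A (M i)" by (rule precomod_module[OF simple_precomod[OF simp]])

lemma cfam: "comatrix_family A I M (%i. comod_End (M i))"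
 by (intro comatrix_family.intro B.ring_axioms comatrix_family_axioms.intro comatrix.intro comatrix_axioms.intro rm sr family_dual_basis)

interpretation F: comatrix_family A I M "%i. comod_End (M i)" by (rule cfam)

abbreviation "dl i \<equiv> dual_bimod A (M i)"
definition "mc i \<phi> x = contr C \<phi> (coact (M i) x)"

lemma mc_comod_hom: "[|i : I; \<phi> .: (dl i)|] ==> mc i \<phi> : comod_hom A C (M i) (regc C)"
 using hat_comod_hom(1)[OF rc form_of_dual[OF rm]] by (simp add: mc_def[abs_def])

lemma mc_rmod_hom: "[|i : I; \<phi> .: (dl i)|] ==> mc i \<phi> : rmod_hom A (M i) C"
 using comod_hom_rmod[OF mc_comod_hom] by simp

lemma mc_closed: "[|i : I; \<phi> .: (dl i); x .: (M i)|] ==> mc i \<phi> x .: C"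
 by (rule rmod_hom_closed[OF mc_rmod_hom])

text \<open>Colinearity of d lets it pass from the form to the vector.\<close>

lemma mc_balanced:
 assumes i: "i : I"
 shows "balanced (End_ring A (M i)(|carrier := comod_End (M i)|)) (dl i) (eval_bimod (M i)) C (mc i)"
proof -
 interpret c: comatrix A "M i" "comod_End (M i)" by (rule F.cmx[OF i])
 have "mc i (\<phi> <|{|dl i|} d) x = mc i \<phi> (d x)"
  if p: "\<phi> .: (dl i)" and d: "d : comod_End (M i)" and x: "x .: (M i)" for \<phi> d x
 proof -
  have dh: "d : comod_hom A C (M i) (M i)" using d by (simp add: comod_End_def)
  have q: "\<phi> <|{|dl i|} d .: (dl i)"
   using right_module.ract_closed[OF bimodule_right[OF c.bdl] p, of d] d by simp
  show ?thesis
   unfolding mc_def comod_hom_coact[OF dh x, symmetric]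
   by (rule contr_comp[OF rm[OF i] form_of_dual[OF rm[OF i] p] comod_hom_rmod[OF dh] form_of_dual[OF rm[OF i] q] _
    comodule_coact_closed[OF rc[OF i] x]]) (simp add: dual_bimod_simps)
 qed
 moreover have "mc i (\<phi> \<oplus>{|dl i|} \<psi>) x = mc i \<phi> x \<oplus> mc i \<psi> x"
  if "\<phi> .: (dl i)" "\<psi> .: (dl i)" "x .: (M i)" for \<phi> \<psi> x
  unfolding mc_def by (rule add_maps_add[OF contr_dual_add_maps[OF rm[OF i] comodule_coact_closed[OF rc[OF i] that(3)]] that(1,2)])
 ultimately show ?thesis
  by (intro balancedI) (simp_all add: mc_closed[OF i] rmod_hom_add[OF mc_rmod_hom[OF i]])
qed

definition "\<theta> = (SOME f. f : add_maps F.SS C \<and>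
 (ALL i \<phi> x. i : I --> \<phi> .: (dl i) --> x .: (M i) --> f (F.gen i \<phi> x) = mc i \<phi> x))"

lemma \<theta>: "\<theta> : add_maps F.SS C"
  "[|i : I; \<phi> .: (dl i); x .: (M i)|] ==> \<theta> (F.gen i \<phi> x) = mc i \<phi> x"
proof -
 have "EX f. f : add_maps F.SS C \<and>
  (ALL i \<phi> x. i : I --> \<phi> .: (dl i) --> x .: (M i) --> f (F.gen i \<phi> x) = mc i \<phi> x)"
  by (rule F.SS_lift[where b = mc, OF ab mc_balanced])
 from someI_ex[OF this, folded \<theta>_def]
 show "\<theta> : add_maps F.SS C" "[|i : I; \<phi> .: (dl i); x .: (M i)|] ==> \<theta> (F.gen i \<phi> x) = mc i \<phi> x"
  by simp_all
qed

lemma \<theta>_bimod_hom: "\<theta> : bimod_hom A A F.SS C"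
proof -
 have "\<theta> (f <|{|F.SS|} a) = \<theta> f <| a" if f: "f .: F.SS" and a: "a .: A" for f a
 proof (rule F.SS_ext[OF add_maps_comp[OF right_module.ract_add_maps[OF bimodule_right[OF F.bSS] a] \<theta>(1)]
    add_maps_comp[OF \<theta>(1) ract_add_maps[OF a]] ab f])
  fix i \<phi> x assume i: "i : I" and p: "\<phi> .: (dl i)" and x: "x .: (M i)"
  show "\<theta> (F.gen i \<phi> x <|{|F.SS|} a) = \<theta> (F.gen i \<phi> x) <| a"
   using rmod_hom_ract[OF F.gen_right_hom[OF i p] x a, symmetric] rmod_hom_ract[OF mc_rmod_hom[OF i p] x a]
    right_module.ract_closed[OF rm[OF i] x a] i p x by (simp add: \<theta>(2))
 qed
 moreover have "\<theta> (a |>{|F.SS|} f) = a |> \<theta> f" if f: "f .: F.SS" and a: "a .: A" for f a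
 proof (rule F.SS_ext[OF add_maps_comp[OF bimodule.lact_add_maps[OF F.bSS a] \<theta>(1)]
    add_maps_comp[OF \<theta>(1) lact_add_maps[OF a]] ab f])
  fix i \<phi> x assume i: "i : I" and p: "\<phi> .: (dl i)" and x: "x .: (M i)"
  interpret c: comatrix A "M i" "comod_End (M i)" by (rule F.cmx[OF i])
  show "\<theta> (a |>{|F.SS|} F.gen i \<phi> x) = a |> \<theta> (F.gen i \<phi> x)"
   using F.gen_lact[OF i p x a] contr_lact[OF rm[OF i] p a comodule_coact_closed[OF rc[OF i] x]]
    bimodule.lact_closed[OF c.bdl a p] i p x by (simp add: \<theta>(2) mc_def)
 qed
 ultimately show ?thesis using \<theta>(1) by (simp add: bimod_hom_iff rmod_hom_iff lmod_hom_def)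
qed

lemma \<theta>_comult:
 assumes f: "f .: F.SS"
 shows "comult C (\<theta> f) = tmap A C C \<theta> \<theta> (comult F.SC f)"
proof -
 note tS = F.tSS
 interpret TS: tensor_pair A F.SS F.SS by (rule tS)
 interpret TC: tensor_pair A C C by (rule tpM[OF is_rmod])
 interpret TCg: abelian_group "TG A C C" by (rule TC.ab_tensor)
 have th: "\<theta> : rmod_hom A F.SS C" "\<theta> : lmod_hom A F.SS C" using \<theta>_bimod_hom by (simp_all add: bimod_hom_iff)
 note m = tmap_add_maps[OF tS tpM[OF is_rmod] th]
 have ca: "comult C : add_maps C (TG A C C)" using rmod_hom_add_maps[OF comult_rmod_hom] by simp
 show ?thesis
  proof (rule F.SS_ext[OF add_maps_comp[OF \<theta>(1) ca] add_maps_comp[OF F.comult_add_maps m(1)] TC.ab_tensor f])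
   fix i \<phi> x assume i: "i : I" and p: "\<phi> .: (dl i)" and x: "x .: (M i)"
   interpret c: comatrix A "M i" "comod_End (M i)" by (rule F.cmx[OF i])
   have gc: "F.gen i \<phi> (c.ev k) .: F.SS" "F.gen i (c.es k) x .: F.SS" if "k < c.nn" for k
    using F.gen_closed[OF i] p x c.dbf that by simp_all
   have "tmap A C C \<theta> \<theta> (comult F.SC (F.gen i \<phi> x)) = (\<Oplus>{|TG A C C|} k\<in>{..<c.nn}.
    tmap A C C \<theta> \<theta> (tensor A F.SS F.SS (F.gen i \<phi> (c.ev k)) (F.gen i (c.es k) x)))"
    unfolding F.comult_gen(1)[OF i p x]
    by (rule add_maps_finsum[OF TS.ab_tensor TC.ab_tensor m(1)]) (use gc in "auto simp: TS.tensor_closed")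
   also have "... = (\<Oplus>{|TG A C C|} k\<in>{..<c.nn}. tensor A C C (mc i \<phi> (c.ev k)) (mc i (c.es k) x))"
    by (rule TCg.finsum_cong') (use gc m(2) i p x c.dbf mc_closed in "auto simp: TC.tensor_closed \<theta>(2)")
   also have "... = comult C (\<theta> (F.gen i \<phi> x))"
    unfolding \<theta>(2)[OF i p x] unfolding mc_def using comult_hat[OF rc[OF i] c.db form_of_dual[OF rm[OF i] p] x] by simp
   finally show "comult C (\<theta> (F.gen i \<phi> x)) = tmap A C C \<theta> \<theta> (comult F.SC (F.gen i \<phi> x))" by simp
  qed
qed

text \<open>Lists of triples (index, form, vector) represent elements of the direct sum as sums of
  pure tensors. The number of terms is the measure in the proof of injectivity, and
  \<open>coeffs\<close> lists the corresponding colinear maps into C.\<close>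

definition "ok L \<longleftrightarrow> (ALL t:set L. fst t : I & fst (snd t) .: (dl (fst t)) & snd (snd t) .: (M (fst t)))"
definition "gsum L = foldr (%t y. F.gen (fst t) (fst (snd t)) (snd (snd t)) \<oplus>{|F.SS|} y) L \<zero>{|F.SS|}"
definition "coeffs L = map (%t. (M (fst t), mc (fst t) (fst (snd t)))) L"

lemma ok_simps [simp]: "ok []" "ok ((i, \<phi>, x) # L) \<longleftrightarrow> i : I & \<phi> .: (dl i) & x .: (M i) & ok L"
  "ok (L @ L') \<longleftrightarrow> ok L & ok L'"
 by (auto simp: ok_def)

lemma gsum_simps [simp]: "gsum [] = \<zero>{|F.SS|}" "gsum ((i, \<phi>, x) # L) = F.gen i \<phi> x \<oplus>{|F.SS|} gsum L"
 by (simp_all add: gsum_def)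

lemma coeffs_simps [simp]: "coeffs [] = []" "coeffs ((i, \<phi>, x) # L) = (M i, mc i \<phi>) # coeffs L"
 by (simp_all add: coeffs_def)

lemma coeffs_props: "ok L ==> Tg : set (coeffs L) ==> simple_comodule A C (fst Tg) & snd Tg : comod_hom A C (fst Tg) (regc C)"
 using mc_comod_hom simp by (auto simp: ok_def coeffs_def)

lemma gsum_closed: "ok L ==> gsum L .: F.SS"
proof (induction L)
 case Nil
 interpret SS: abelian_group F.SS by (rule bimodule_ab[OF F.bSS])
 show ?case by simp
next
 case (Cons t L)
 interpret SS: abelian_group F.SS by (rule bimodule_ab[OF F.bSS])
 show ?case using Cons F.gen_closed by (cases t) (auto intro: SS.a_closed)
qed

lemma gsum_append: "ok L ==> ok L' ==> gsum (L @ L') = gsum L \<oplus>{|F.SS|} gsum L'"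
proof (induction L)
 case Nil
 interpret SS: abelian_group F.SS by (rule bimodule_ab[OF F.bSS])
 show ?case using gsum_closed[OF Nil(2)] by simp
next
 case (Cons t L)
 interpret SS: abelian_group F.SS by (rule bimodule_ab[OF F.bSS])
 show ?case using Cons F.gen_closed gsum_closed by (cases t) (auto simp: SS.a_assoc)
qed

lemma SS_gsum: "f .: F.SS ==> EX L. ok L & f = gsum L"
proof (induction rule: F.SS_induct)
 case zero
 show ?case by (rule exI[of _ "[]"]) simp
next
 case (gen i \<phi> x)
 interpret SS: abelian_group F.SS by (rule bimodule_ab[OF F.bSS])
 show ?case by (rule exI[of _ "[(i, \<phi>, x)]"]) (use gen F.gen_closed in simp)
next
 case (add f g)
 then obtain L L' where "ok L" "f = gsum L" "ok L'" "g = gsum L'" by (elim exE conjE)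
 then show ?case by (intro exI[of _ "L @ L'"]) (simp add: gsum_append)
qed

lemma \<theta>_gsum_img: "ok L ==> \<theta> (gsum L) : img C (coeffs L) carrier"
proof (induction L)
 case Nil
 show ?case using add_maps_zero[OF bimodule_ab[OF F.bSS] ab \<theta>(1)] by simp
next
 case (Cons t L)
 obtain i \<phi> x where t: "t = (i, \<phi>, x)" by (cases t)
 have "\<theta> (gsum (t # L)) = mc i \<phi> x \<oplus> \<theta> (gsum L)"
  using Cons.prems add_maps_add[OF \<theta>(1) F.gen_closed gsum_closed] by (simp add: t \<theta>(2))
 then show ?case using Cons by (auto simp: t)
qed

lemma gen_zero:
 assumes "i : I"
 shows "x .: (M i) ==> F.gen i \<zero>{|dl i|} x = \<zero>{|F.SS|}" "\<phi> .: (dl i) ==> F.gen i \<phi> \<zero>{|M i|} = \<zero>{|F.SS|}"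
 using add_maps_zero[OF right_module.dual_abelian[OF rm[OF assms]] bimodule_ab[OF F.bSS] F.gen_left_add_maps[OF assms]]
  add_maps_zero[OF right_module_ab[OF rm[OF assms]] bimodule_ab[OF F.bSS] rmod_hom_add_maps[OF F.gen_right_hom[OF assms]]]
 by simp_all

text \<open>By Schur's lemma a colinear s is either zero, and then both tensors vanish, or an
  isomorphism. In the latter case i = j, and s is an element of the division ring, which moves
  across the tensor sign.\<close>

lemma move_across:
 assumes i: "i : I" and j: "j : I" and s: "s : comod_hom A C (M i) (M j)" and p: "\<psi> .: (dl j)" and u: "u .: (M i)"
 shows "EX \<phi>:carrier (dl i). (ALL x:carrier (M i). \<phi> x = \<psi> (s x)) & F.gen i \<phi> u = F.gen j \<psi> (s u)"
proof (cases "EX x:carrier (M i). s x ~= \<zero>{|M j|}")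
 case True
 then have "j = i" using schur[OF simp[OF i] simp[OF j] s] noniso[OF i j] by blast
 interpret c: comatrix A "M i" "comod_End (M i)" by (rule F.cmx[OF i])
 have d: "restrict s (carrier (M i)) : comod_End (M i)"
  by (rule comod_End_restrict[OF simple_precomod[OF simp[OF i]]]) (use s \<open>j = i\<close> in simp_all)
 have p': "\<psi> .: (dl i)" using p \<open>j = i\<close> by simp
 have q: "\<psi> <|{|dl i|} restrict s (carrier (M i)) .: (dl i)"
  using right_module.ract_closed[OF bimodule_right[OF c.bdl] p', of "restrict s (carrier (M i))"] d by simp
 show ?thesis
  by (rule bexI[OF _ q]) (use F.gen_balanced[OF i p' d u] u \<open>j = i\<close> in "simp add: dual_bimod_simps")
next
 case False
 have z: "\<psi> \<zero>{|M j|} = \<zero>{|A|}"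
  using add_maps_zero[OF right_module_ab[OF rm[OF j]] right_module_ab[OF right_module_regular[OF B.ring_axioms]]
    rmod_hom_add_maps[OF form_of_dual[OF rm[OF j] p]]] by simp
 have q: "\<zero>{|dl i|} .: (dl i)"
  by (rule abelian_monoid.zero_closed[OF abelian_group.axioms(1)[OF right_module.dual_abelian[OF rm[OF i]]]])
 show ?thesis
  by (rule bexI[OF _ q]) (use False u z gen_zero(1)[OF i u] gen_zero(2)[OF j p] in "auto simp: dual_bimod_simps")
qed

text \<open>If f is the sum of the matrix coefficient maps of \<psi>_j composed with s_j, then the
  form counit o f is the sum of the \<psi>_j o s_j. By \<open>move_across\<close> its tensor with u
  is the sum of the \<psi>_j (x) s_j u. Each of these is added to the term of L with the same form,
  so the number of terms does not change.\<close>

lemma absorb: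
 assumes i: "i : I" and u: "u .: (M i)"
 shows "ok L ==> lifts A C (M i) (regc C) (coeffs L) f ==>
  EX L' \<phi>. length L' = length L & ok L' & \<phi> .: (dl i) & (ALL x:carrier (M i). \<phi> x = counit C (f x)) \<and>
   F.gen i \<phi> u \<oplus>{|F.SS|} gsum L = gsum L'"
proof (induction L arbitrary: f)
 case Nil
 interpret SS: abelian_group F.SS by (rule bimodule_ab[OF F.bSS])
 have q: "\<zero>{|dl i|} .: (dl i)"
  by (rule abelian_monoid.zero_closed[OF abelian_group.axioms(1)[OF right_module.dual_abelian[OF rm[OF i]]]])
 have e: "counit C \<zero> = \<zero>{|A|}"
  using add_maps_zero[OF ab right_module_ab[OF right_module_regular[OF B.ring_axioms]] rmod_hom_add_maps[OF counit_right_linear]] by simp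
 have v: "\<zero>{|dl i|} x = \<zero>{|A|}" if "x .: (M i)" for x using that by (simp add: dual_bimod_simps)
 show ?case
  by (rule exI[of _ "[]"], rule exI[of _ "\<zero>{|dl i|}"]) (use Nil(2) q e v gen_zero(1)[OF i u] in simp)
next
 case (Cons t L)
 interpret SS: abelian_group F.SS by (rule bimodule_ab[OF F.bSS])
 obtain j \<psi> v where t: "t = (j, \<psi>, v)" by (cases t)
 have j: "j : I" "\<psi> .: (dl j)" "v .: (M j)" "ok L" using Cons.prems(1) by (simp_all add: t)
 obtain s f' where s: "s : comod_hom A C (M i) (M j)" and f': "f' : comod_hom A C (M i) (regc C)"
  and l: "lifts A C (M i) (regc C) (coeffs L) f'"
  and ff': "!!x. x .: (M i) ==> f x = mc j \<psi> (s x) \<oplus> f' x"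
  using Cons.prems(2) by (auto simp: t)
 obtain L' \<phi>' where L': "length L' = length L" "ok L'" and p': "\<phi>' .: (dl i)"
  and v': "!!x. x .: (M i) ==> \<phi>' x = counit C (f' x)"
  and g': "F.gen i \<phi>' u \<oplus>{|F.SS|} gsum L = gsum L'"
  using Cons.IH[OF j(4) l] by (elim exE conjE) blast
 obtain \<phi>'' where p'': "\<phi>'' .: (dl i)" and v'': "!!x. x .: (M i) ==> \<phi>'' x = \<psi> (s x)"
  and g'': "F.gen i \<phi>'' u = F.gen j \<psi> (s u)"
  using move_across[OF i j(1) s j(2) u] by (elim bexE conjE) blast
 note sc = rmod_hom_closed[OF comod_hom_rmod[OF s]]
 let ?p = "\<phi>'' \<oplus>{|dl i|} \<phi>'"
 have p: "?p .: (dl i)"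
  by (rule abelian_monoid.a_closed[OF abelian_group.axioms(1)[OF right_module.dual_abelian[OF rm[OF i]]] p'' p'])
 have "?p x = counit C (f x)" if x: "x .: (M i)" for x
 proof -
  have c: "mc j \<psi> (s x) .: C" "f' x .: C"
   using mc_closed[OF j(1,2) sc[OF x]] rmod_hom_closed[OF comod_hom_rmod[OF f'] x] by simp_all
  have "counit C (f x) = counit C (mc j \<psi> (s x)) \<oplus>{|A|} counit C (f' x)"
   using rmod_hom_add[OF counit_right_linear c] ff'[OF x] by simp
  then show ?thesis
   using hat_comod_hom(2)[OF rc[OF j(1)] form_of_dual[OF rm[OF j(1)] j(2)] sc[OF x]] v'[OF x] v''[OF x] x
   by (simp add: mc_def dual_bimod_simps)
 qed
 moreover have "F.gen i ?p u \<oplus>{|F.SS|} gsum (t # L) = gsum ((j, \<psi>, v \<oplus>{|M j|} s u) # L')"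
 proof -
  note c = F.gen_closed[OF j(1,2) sc[OF u]] F.gen_closed[OF j(1,2,3)] F.gen_closed[OF i p' u] gsum_closed[OF j(4)]
  have "F.gen i ?p u \<oplus>{|F.SS|} gsum (t # L) =
    (F.gen j \<psi> (s u) \<oplus>{|F.SS|} F.gen i \<phi>' u) \<oplus>{|F.SS|} (F.gen j \<psi> v \<oplus>{|F.SS|} gsum L)"
   using add_maps_add[OF F.gen_left_add_maps[OF i u] p'' p'] by (simp add: t g'')
  also have "... = (F.gen j \<psi> v \<oplus>{|F.SS|} F.gen j \<psi> (s u)) \<oplus>{|F.SS|} (F.gen i \<phi>' u \<oplus>{|F.SS|} gsum L)"
   using c by (simp add: SS.add.m_ac)
  finally show ?thesis using rmod_hom_add[OF F.gen_right_hom[OF j(1,2)] j(3) sc[OF u]] g' by simp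
 qed
 ultimately show ?case
  using L' p j sc[OF u] abelian_monoid.a_closed[OF abelian_group.axioms(1)[OF right_module_ab[OF rm[OF j(1)]]] j(3) sc[OF u]]
  by (intro exI[of _ "(j, \<psi>, v \<oplus>{|M j|} s u) # L'"] exI[of _ ?p]) (simp add: t)
qed

lemma img_regular: "img (regc C) L c = img C L c"
 by (induction L) simp_all

text \<open>Induction on the number of terms. Let the first term be \<phi> (x) u with u nonzero. As
  the sum is mapped to 0, \<open>mc i \<phi> u\<close> lies in the stable sum of the images of the
  other coefficient maps, and by simplicity so does the whole image of \<open>mc i \<phi>\<close>.
  Then \<open>lifting\<close> and \<open>absorb\<close> rewrite the sum with one term less.\<close>

lemma \<theta>_gsum_zero: "ok L ==> \<theta> (gsum L) = \<zero> ==> gsum L = \<zero>{|F.SS|}"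
proof (induction "length L" arbitrary: L rule: less_induct)
 case less
 interpret SS: abelian_group F.SS by (rule bimodule_ab[OF F.bSS])
 note preg = right_comodule_precomod[OF regular_comodule]
 show ?case
 proof (cases L)
  case (Cons t L1)
  obtain i \<phi> u where t: "t = (i, \<phi>, u)" by (cases t)
  have i: "i : I" "\<phi> .: (dl i)" "u .: (M i)" "ok L1" using less.prems(1) by (simp_all add: Cons t)
  have e: "gsum L = F.gen i \<phi> u \<oplus>{|F.SS|} gsum L1" by (simp add: Cons t)
  show ?thesis
  proof (cases "u = \<zero>{|M i|}")
   case True
   then have "gsum L = gsum L1" using gen_zero(2)[OF i(1,2)] gsum_closed[OF i(4)] by (simp add: e)
   then show ?thesis using less.hyps[of L1] less.prems(2) i(4) Cons by simp
  next
   case False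
   note tc = add_maps_closed[OF \<theta>(1) gsum_closed[OF i(4)]] and mcc = mc_closed[OF i(1-3)]
   have st: "stable A C (regc C) (img C (coeffs L1) carrier)"
    unfolding img_regular[symmetric]
    by (rule img_stable[OF preg]) (use coeffs_props[OF i(4)] simple_precomod in blast)
   have "mc i \<phi> u \<oplus> \<theta> (gsum L1) = \<zero>"
    using less.prems(2) add_maps_add[OF \<theta>(1) F.gen_closed[OF i(1-3)] gsum_closed[OF i(4)]] \<theta>(2)[OF i(1-3)] by (simp add: e)
   moreover interpret R: abelian_group "regc C" by (rule right_module_ab[OF precomod_module[OF preg]])
   have "\<ominus>{|regc C|} \<theta> (gsum L1) : img C (coeffs L1) carrier"
    by (rule submod_uminus[OF R.abelian_group_axioms stable_submod[OF st] \<theta>_gsum_img[OF i(4)]])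
   ultimately have u: "u : {x : carrier (M i). mc i \<phi> x : img C (coeffs L1) carrier}"
    using i(3) R.minus_equality[of "mc i \<phi> u" "\<theta> (gsum L1)"] tc mcc by simp
   have "{x : carrier (M i). mc i \<phi> x : img C (coeffs L1) carrier} = carrier (M i)"
    by (rule simple_stable[OF simp[OF i(1)] stable_preimage[OF simple_precomod[OF simp[OF i(1)]] preg mc_comod_hom[OF i(1,2)] st] u False])
   then have l: "lifts A C (M i) (regc C) (coeffs L1) (mc i \<phi>)"
    by (intro lifting[OF simple_precomod[OF simp[OF i(1)]] preg coeffs_props[OF i(4)] mc_comod_hom[OF i(1,2)]])
    (auto simp: img_regular)
   obtain L' \<phi>' where L': "length L' = length L1" "ok L'" "\<phi>' .: (dl i)"
    "!!x. x .: (M i) ==> \<phi>' x = counit C (mc i \<phi> x)" "F.gen i \<phi>' u \<oplus>{|F.SS|} gsum L1 = gsum L'"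
    using absorb[OF i(1,3,4) l] by (elim exE conjE) blast
   \<comment> \<open>The counit recovers the form from its matrix coefficient map, so what has been
     absorbed is exactly the first term of the list.\<close>
   have "\<phi>' = \<phi>"
   proof (rule right_module.ext_eqI[OF rm[OF i(1)]])
    show "\<phi>' : extensional (carrier (M i))" "\<phi> : extensional (carrier (M i))" using L'(3) i(2) by (simp_all add: dual_bimod_simps)
    show "\<phi>' x = \<phi> x" if "x .: (M i)" for x
    using L'(4)[OF that] hat_comod_hom(2)[OF rc[OF i(1)] form_of_dual[OF rm[OF i(1)] i(2)] that] by (simp add: mc_def)
   qed
   then have "gsum L = gsum L'" using L'(5) e by simp
   then show ?thesis using less.hyps[of L'] less.prems(2) L' Cons by simp
  qed
 qed simp
qed

text \<open>By \<open>hat_counit\<close> every colinear k from a member of the family is a matrix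
  coefficient map, namely that of the form counit o k.\<close>

lemma \<theta>_surj: "c .: C ==> EX f:carrier F.SS. \<theta> f = c"
proof -
 assume "c .: C"
 then obtain L where "set L <= {(M i, k) | i k. i : I & k : comod_hom A C (M i) (regc C)}" "c : img C L carrier"
  using gens by blast
 then show ?thesis
 proof (induction L arbitrary: c)
  case Nil
  interpret SS: abelian_group F.SS by (rule bimodule_ab[OF F.bSS])
  show ?case by (rule bexI[OF _ SS.zero_closed]) (use Nil add_maps_zero[OF bimodule_ab[OF F.bSS] ab \<theta>(1)] in simp)
 next
  case (Cons Tg L)
  interpret SS: abelian_group F.SS by (rule bimodule_ab[OF F.bSS])
  obtain i k where i: "i : I" and k: "k : comod_hom A C (M i) (regc C)" and Tg: "Tg = (M i, k)"
   using Cons.prems(1) by auto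
  obtain t q where t: "t .: (M i)" "q : img C L carrier" "c = k t \<oplus> q" using Cons.prems(2) Tg by auto
  obtain f where f: "f .: F.SS" "\<theta> f = q" using Cons.IH[OF _ t(2)] Cons.prems(1) by auto
  have kr: "k : rmod_hom A (M i) C" using comod_hom_rmod[OF k] by simp
  note kf = counit_comp_form[OF kr]
  let ?p = "restrict (%x. counit C (k x)) (carrier (M i))"
  have p: "?p .: (dl i)"
   using right_module.ract_closed[OF rm[OF i]] kf abelian_monoid.a_closed[OF abelian_group.axioms(1)[OF right_module_ab[OF rm[OF i]]]]
   by (auto simp: rmod_hom_def dual_bimod_simps)
  have "mc i ?p t = contr C (%x. counit C (k x)) (coact (M i) t)"
   unfolding mc_def
   by (rule contr_cong[OF rm[OF i] form_of_dual[OF rm[OF i] p] kf _ comodule_coact_closed[OF rc[OF i] t(1)]]) simp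
  then have "\<theta> (F.gen i ?p t) = k t" using \<theta>(2)[OF i p t(1)] hat_counit[OF rc[OF i] k t(1)] by simp
  then have "\<theta> (F.gen i ?p t \<oplus>{|F.SS|} f) = c"
   using add_maps_add[OF \<theta>(1) F.gen_closed[OF i p t(1)] f(1)] f(2) t(3) by simp
  then show ?case using SS.a_closed[OF F.gen_closed[OF i p t(1)] f(1)] by blast
 qed
qed

theorem coring_iso_\<theta>: "\<theta> : coring_iso A F.SC C"
proof -
 interpret SS: abelian_group F.SS by (rule bimodule_ab[OF F.bSS])
 have "inj_on \<theta> (carrier F.SS)"
 proof (rule inj_onI)
  fix f g assume f: "f .: F.SS" and g: "g .: F.SS" and e: "\<theta> f = \<theta> g"
  obtain L where L: "ok L" "f \<ominus>{|F.SS|} g = gsum L" using SS_gsum[OF SS.minus_closed[OF f g]] by blast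
  have "\<theta> (f \<ominus>{|F.SS|} g) = \<zero>"
   using add_maps_minus[OF bimodule_ab[OF F.bSS] ab \<theta>(1) f g] e add_maps_closed[OF \<theta>(1) g] diff_zero_iff by simp
  then have "f \<ominus>{|F.SS|} g = \<zero>{|F.SS|}" using \<theta>_gsum_zero[OF L(1)] L(2) by simp
  then show "f = g" using SS.diff_zero_iff f g by simp
 qed
 moreover have "\<theta> ` carrier F.SS = carrier C"
  using \<theta>_surj add_maps_closed[OF \<theta>(1)] by blast
 moreover have "counit C (\<theta> f) = counit F.SC f" if f: "f .: F.SS" for f
 proof (rule F.SS_ext[OF add_maps_comp[OF \<theta>(1)] F.counit_add_maps B.abelian_group_axioms f])
  show "counit C : add_maps C A" using rmod_hom_add_maps[OF counit_right_linear] by (simp add: add_maps_def)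
  fix i \<phi> x assume i: "i : I" "\<phi> .: (dl i)" "x .: (M i)"
  show "counit C (\<theta> (F.gen i \<phi> x)) = counit F.SC (F.gen i \<phi> x)"
   using hat_comod_hom(2)[OF rc[OF i(1)] form_of_dual[OF rm[OF i(1)] i(2)] i(3)] F.counit_gen[OF i] \<theta>(2)[OF i] by (simp add: mc_def)
 qed
 moreover have "\<theta> : bimod_hom A A F.SC C"
  using \<theta>_bimod_hom by (simp add: bimod_hom_def rmod_hom_def dsum_coring_simps)
 ultimately show ?thesis
  unfolding coring_iso_def using \<theta>_comult by (auto simp: bij_betw_def dsum_coring_simps(1-5))
qed

end

section \<open>Decomposing a cosemisimple coring\<close>

context coring begin

lemma comod_iso_sym:
 assumes M: "precomod A C M" and N: "precomod A C N" and f: "f : comod_iso A C M N"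
 shows "inv_into (carrier M) f : comod_iso A C N M"
 using comod_hom_inverse[OF M N] f by (simp add: comod_iso_def)

lemma comod_iso_trans:
 assumes M: "precomod A C M" and N: "precomod A C N" and P: "precomod A C P"
  and f: "f : comod_iso A C M N" and g: "g : comod_iso A C N P"
 shows "(%x. g (f x)) : comod_iso A C M P"
proof -
 have "bij_betw (g \<circ> f) (carrier M) (carrier P)" using f g by (auto simp: comod_iso_def intro: bij_betw_trans)
 then show ?thesis
  using comod_hom_comp[OF M precomod_module[OF N] precomod_module[OF P]] f g by (simp add: comod_iso_def comp_def)
qed

end

context flat_coring begin

text \<open>The members of the given decomposition are indexed by their carriers, which yields the
  index type \<open>'c set\<close>, and one carrier is chosen in each isomorphism class. A member is
  reached from the chosen one of its class by an isomorphism followed by the inclusion, so the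
  chosen ones still generate C.\<close>

lemma semisimple_family:
 assumes ss: "semisimple_comodule A C (regc C)"
 obtains I :: "'c set set" and M :: "'c set => ('a, 'c, 'c) comod" where "!!i. i : I ==> simple_comodule A C (M i)"
  "!!i j. [|i : I; j : I; i ~= j|] ==> comod_iso A C (M i) (M j) = {}"
  "!!c. c .: C ==> EX L. set L <= {(M i, k) | i k. i : I & k : comod_hom A C (M i) (regc C)} \<and>
   c : img C L carrier"
proof -
 obtain \<S> where S: "!!N. N : \<S> ==> simple_comodule A C N" "!!N. N : \<S> ==> subcomodule A C N (regc C)"
  and bij: "bij_betw (%f. \<Oplus>{|regc C|} N\<in>{N\<in>\<S>. f N ~= \<zero>{|regc C|}}. f N)
    (carrier (sum_group \<S> add_monoid)) (carrier (regc C))"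
  using ss unfolding semisimple_comodule_def by blast
 define NN where "NN = inv_into \<S> (carrier :: ('a, 'c, 'c) comod => _)"
 have NN: "NN W : \<S>" "carrier (NN W) = W" if "W : carrier ` \<S>" for W
  using inv_into_into[OF that] f_inv_into_f[OF that] by (simp_all add: NN_def)
 note NNp = simple_precomod[OF S(1)[OF NN(1)]]
 define E where "E W V \<longleftrightarrow> comod_iso A C (NN W) (NN V) ~= {}" for W V
 have refl: "E W W" if "W : carrier ` \<S>" for W
 proof -
  have "id : comod_iso A C (NN W) (NN W)" using comod_hom_id[OF NNp[OF that]] by (simp add: comod_iso_def)
  then show ?thesis unfolding E_def by blast
 qed
 have sym: "E V W" if "W : carrier ` \<S>" "V : carrier ` \<S>" "E W V" for W V
  using comod_iso_sym[OF NNp[OF that(1)] NNp[OF that(2)]] that(3) unfolding E_def by blast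
 have trans: "E W U" if "W : carrier ` \<S>" "V : carrier ` \<S>" "U : carrier ` \<S>" "E W V" "E V U" for W V U
  using comod_iso_trans[OF NNp[OF that(1)] NNp[OF that(2)] NNp[OF that(3)]] that(4,5) unfolding E_def by blast
 define rep where "rep W = (SOME V. V : carrier ` \<S> & E W V)" for W
 have rep: "rep W : carrier ` \<S>" "E W (rep W)" if "W : carrier ` \<S>" for W
  using someI[of "%V. V : carrier ` \<S> & E W V" W] refl[OF that] that by (simp_all add: rep_def)
 have rep_eq: "rep W = rep V" if "W : carrier ` \<S>" "V : carrier ` \<S>" "E W V" for W V
 proof -
  have "(U : carrier ` \<S> & E W U) = (U : carrier ` \<S> & E V U)" for U
   using that trans sym by blast
  then show ?thesis by (simp add: rep_def)
 qed
 let ?I = "rep ` carrier ` \<S>"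
 define \<K> where "\<K> = {(NN i, k) | i k. i : ?I & k : comod_hom A C (NN i) (regc C)}"
 have IS: "i : carrier ` \<S>" if "i : ?I" for i using that rep by blast
 note preg = right_comodule_precomod[OF regular_comodule]
 note result = that[of ?I NN]
 show thesis
 proof (rule result)
  show "simple_comodule A C (NN i)" if "i : ?I" for i using S(1)[OF NN(1)[OF IS[OF that]]] .
  show "comod_iso A C (NN i) (NN j) = {}" if ne: "i : ?I" "j : ?I" "i ~= j" for i j
  proof (rule ccontr)
   assume "comod_iso A C (NN i) (NN j) ~= {}"
   then have ij: "E i j" by (simp add: E_def)
   from ne(1) obtain W where W: "i = rep W" "W : carrier ` \<S>" by (rule imageE)
   from ne(2) obtain V where V: "j = rep V" "V : carrier ` \<S>" by (rule imageE)
   have "rep W = rep i" "rep V = rep j"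
    unfolding W(1) V(1) using rep_eq[OF W(2) rep[OF W(2)]] rep_eq[OF V(2) rep[OF V(2)]] .
   moreover have "rep i = rep j" using rep_eq[OF IS[OF ne(1)] IS[OF ne(2)] ij] .
   ultimately show False using ne(3) W(1) V(1) by simp
  qed
  have Kc: "snd Tg t .: C" if Tg: "Tg : \<K>" and t: "t .: (fst Tg)" for Tg t
  proof -
   from Tg[unfolded \<K>_def] obtain i k where e: "Tg = (NN i, k)" and k: "k : comod_hom A C (NN i) (regc C)"
    by (elim CollectE exE conjE)
   show ?thesis using rmod_hom_closed[OF comod_hom_rmod[OF k], of t] t by (simp add: e)
  qed
  have closed: "img C L carrier <= carrier C" if L: "set L <= \<K>" for L
   by (rule img_closed[OF ab]) (rule Kc[OF subsetD[OF L]])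
  have single: "EX L. set L <= \<K> & x : img C L carrier" if N: "N : \<S>" and x: "x .: N" for N x
  proof -
   have W: "carrier N : carrier ` \<S>" using N by blast
   obtain g where g: "g : comod_iso A C (NN (rep (carrier N))) (NN (carrier N))"
    using sym[OF W rep(1)[OF W] rep(2)[OF W]] by (auto simp: E_def)
   have h: "id : comod_hom A C (NN (carrier N)) (regc C)"
    using S(2)[OF NN(1)[OF W]] by (simp add: subcomodule_def)
   have k: "(%x. id (g x)) : comod_hom A C (NN (rep (carrier N))) (regc C)"
    by (rule comod_hom_comp[OF NNp[OF rep(1)[OF W]] precomod_module[OF NNp[OF W]] precomod_module[OF preg] _ h])
    (use g in "simp add: comod_iso_def")
   have "g ` carrier (NN (rep (carrier N))) = carrier N"
    using g NN(2)[OF W] by (simp add: comod_iso_def bij_betw_def)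
   with x have "x : g ` carrier (NN (rep (carrier N)))" by simp
   then obtain t where t: "x = g t" "t .: (NN (rep (carrier N)))" by (rule imageE)
   have "carrier N <= carrier C" using S(2)[OF N] unfolding subcomodule_def by simp
   then have "x .: C" using x by (rule subsetD)
   then have "x = id (g t) \<oplus> \<zero>" by (simp add: t(1))
   then have "x : img C [(NN (rep (carrier N)), %x. id (g x))] carrier"
    unfolding img.simps using t(2) by (intro CollectI exI[of _ t] exI[of _ \<zero>]) simp
   moreover have "(NN (rep (carrier N)), %x. id (g x)) : \<K>"
    unfolding \<K>_def
    by (intro CollectI exI[of _ "rep (carrier N)"] exI[of _ "%x. id (g x)"] conjI HOL.refl imageI N k)
   ultimately show ?thesis by (intro exI[of _ "[(NN (rep (carrier N)), %x. id (g x))]"]) simp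
  qed
  fix c assume cC: "c .: C"
  have "c : (%f. \<Oplus>{|regc C|} N\<in>{N\<in>\<S>. f N ~= \<zero>{|regc C|}}. f N) ` carrier (sum_group \<S> add_monoid)"
   using bij_betw_imp_surj_on[OF bij] cC by simp
  then obtain f where c: "c = (\<Oplus>{|regc C|} N\<in>{N\<in>\<S>. f N ~= \<zero>{|regc C|}}. f N)"
   and f: "f .: (sum_group \<S> add_monoid)" by (rule imageE)
  interpret DS: dsum_family \<S> "%N. N"
   by (rule dsum_family.intro) (rule right_module_ab[OF precomod_module[OF simple_precomod[OF S(1)]]])
  have "f .: (dsum \<S> (%N. N))" using f by (simp add: dsum_def add_ring_simps)
  then have "f : (\<Pi>\<^sub>E N\<in>\<S>. carrier N)" unfolding DS.carrier_dsum by simp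
  then have fN: "f N .: N" if "N : \<S>" for N using that by (rule PiE_mem)
  interpret R: abelian_group "regc C" by (rule right_module_ab[OF precomod_module[OF preg]])
  have fC: "f N .: C" if "N : \<S>" for N
  proof -
   have "carrier N <= carrier (regc C)" using S(2)[OF that] unfolding subcomodule_def by blast
   then show ?thesis using subsetD[OF _ fN[OF that]] by simp
  qed
  have "EX L. set L <= \<K> & (\<Oplus>{|regc C|} N\<in>J. f N) : img C L carrier" if "J <= \<S>" for J
  proof (cases "finite J")
   case True
   then show ?thesis using that
   proof (induction J rule: finite_induct)
    case empty
    show ?case by (rule exI[of _ "[]"]) simp
   next
    case (insert N J)
    have J: "J <= \<S>" and NS: "N : \<S>" using insert.prems by simp_all
    from insert.IH[OF J] obtain L where L: "set L <= \<K>" "(\<Oplus>{|regc C|} N\<in>J. f N) : img C L carrier"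
    by (elim exE conjE)
    from single[OF NS fN[OF NS]] obtain L' where L': "set L' <= \<K>" "f N : img C L' carrier"
    by (elim exE conjE)
    have "f N \<oplus> (\<Oplus>{|regc C|} N\<in>J. f N) : img C (L' @ L) carrier"
    by (rule img_append[OF ab closed[OF L'(1)] closed[OF L(1)] Kc[OF subsetD[OF L'(1)]] L'(2) L(2)])
    moreover have "(\<Oplus>{|regc C|} N\<in>insert N J. f N) = f N \<oplus> (\<Oplus>{|regc C|} N\<in>J. f N)"
    by (subst R.finsum_insert) (use insert.hyps fC[OF NS] fC[OF subsetD[OF J]] in "simp_all add: Pi_iff")
    ultimately show ?case using L(1) L'(1) by (intro exI[of _ "L' @ L"]) simp
   qed
  next
   case False
   then have "(\<Oplus>{|regc C|} N\<in>J. f N) = \<zero>" using R.add.finprod_infinite[of J f] by simp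
   then show ?thesis by (intro exI[of _ "[]"]) simp
  qed
  from this[of "{N\<in>\<S>. f N ~= \<zero>{|regc C|}}"]
  show "EX L. set L <= {(NN i, k) | i k. i : ?I & k : comod_hom A C (NN i) (regc C)} & c : img C L carrier"
   unfolding c \<K>_def by simp
 qed
qed

end

text \<open>A comatrix decomposition consists of bare modules, while the simple comodules carry a
  coaction; forgetting it changes none of the constructions.\<close>

lemma truncate_simps:
 fixes M :: "('a, 'm, 'q) rmod_scheme"
 shows "dual_bimod A (rmod.truncate M) = dual_bimod A M" "eval_bimod (rmod.truncate M) = eval_bimod M"
  "End_ring A (rmod.truncate M) = End_ring A M" "rmod_hom A (rmod.truncate M) N = rmod_hom A M N"
  "rmod_hom A P (rmod.truncate M) = rmod_hom A P M" "finsum (rmod.truncate M) = finsum M"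
  "carrier (rmod.truncate M) = carrier M" "\<zero>{|rmod.truncate M|} = \<zero>{|M|}" "(\<oplus>{|rmod.truncate M|}) = (\<oplus>{|M|})"
  "ract (rmod.truncate M) = ract M"
 by (simp_all add: rmod.truncate_def dual_bimod_def eval_bimod_def End_ring_def rmod_hom_def finsum_def fun_eq_iff finprod_def)

lemma truncate_comatrix_coring: "comatrix_coring A (rmod.truncate M) D = comatrix_coring A M D"
proof -
 have "dual_basis A (rmod.truncate M) = dual_basis A M" by (simp add: dual_basis_def fun_eq_iff truncate_simps)
 then show ?thesis
  by (simp add: comatrix_coring_def comatrix_bimod_def comatrix_tensor_def truncate_simps)
qed

lemma right_module_transfer:
 assumes "right_module A M" "carrier N = carrier M" "\<zero>{|N|} = \<zero>{|M|}" "(\<oplus>{|N|}) = (\<oplus>{|M|})" "ract N = ract M"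
 shows "right_module A N"
proof -
 interpret M: right_module A M by fact
 interpret N: abelian_group N by (rule abelian_group_transfer[OF M.ab]) (use assms in simp_all)
 show ?thesis
  by unfold_locales (use assms in "simp_all add: M.ract_closed M.ract_add_left M.ract_add_right M.ract_mult M.ract_one")
qed

lemma right_module_truncate: "right_module A M ==> right_module A (rmod.truncate M)"
 by (rule right_module_transfer) (simp_all add: truncate_simps)

theorem cosemisimple_decomposition:
 fixes C :: "('a, 'c) coring"
 assumes K: "ring_algebra K A \<eta>" and z: "centralizes K \<eta> C" and c: "cosemisimple TYPE((nat => 'a) set) A C"
 shows "EX (I :: 'c set set) (S :: 'c set => ('a, 'c) rmod) D \<theta>. comatrix_decomposition K \<eta> A C I S D \<theta>"
proof -
 interpret coring A C using c by (simp add: cosemisimple_def)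
 interpret flat_coring A C
  by unfold_locales (rule left_flat_imp_ideal_flat[OF bim], use c in "simp add: cosemisimple_def")
 have ss: "semisimple_comodule A C (regc C)" using c by (simp add: cosemisimple_def)
 show ?thesis
 proof (rule semisimple_family[OF ss])
 fix I :: "'c set set" and M :: "'c set => ('a, 'c, 'c) comod"
 assume M: "!!i. i : I ==> simple_comodule A C (M i)"
  "!!i j. [|i : I; j : I; i ~= j|] ==> comod_iso A C (M i) (M j) = {}"
  "!!c. c .: C ==> EX L. set L <= {(M i, k) | i k. i : I & k : comod_hom A C (M i) (regc C)} \<and>
   c : img C L carrier"
 have dv: "division_subring K \<eta> A (M i) (comod_End (M i))" if "i : I" for i by (rule comod_End_division[OF K z M(1)[OF that]])
 interpret simple_family A C I M
 proof (rule simple_family.intro[OF flat_coring_axioms simple_family_axioms.intro])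
  show "subring (comod_End (M i)) (End_ring A (M i))" if "i : I" for i using dv[OF that] by (simp add: division_subring_def)
 qed (fact M)+
 have "comatrix_decomposition K \<eta> A C I (%i. rmod.truncate (M i)) (%i. comod_End (M i)) \<theta>"
  unfolding comatrix_decomposition_def truncate_comatrix_coring
 proof (intro conjI ballI)
  fix i assume i: "i : I"
  obtain n es e where b: "dual_basis A (M i) (n, es, e)" using family_dual_basis[OF i] by (metis prod_cases3)
  show "right_module A (rmod.truncate (M i))" by (rule right_module_truncate[OF rm[OF i]])
  show "finitely_generated A (rmod.truncate (M i))"
   using right_module.dual_basis_finitely_generated[OF rm[OF i] b] by (simp add: finitely_generated_def truncate_simps)
  show "projective A (rmod.truncate (M i))"
   using right_module.dual_basis_projective[OF rm[OF i] b] by (simp add: projective_def truncate_simps)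
  show "division_subring K \<eta> A (rmod.truncate (M i)) (comod_End (M i))"
   using dv[OF i] by (simp add: division_subring_def truncate_simps)
 qed (rule coring_iso_\<theta>)
 then show ?thesis by blast
 qed
qed

section \<open>Coordinates over a division subring\<close>

lemma abelian_group_subgroup:
 assumes G: "abelian_group G" and W: "additive_subgroup W G"
 shows "abelian_group (|carrier = W, mult = undefined, one = undefined, zero = \<zero>{|G|}, add = (\<oplus>{|G|})|)"
proof -
 interpret G: abelian_group G by fact
 have c: "x .: G" if "x : W" for x using additive_subgroup.a_subset[OF W] that by blast
 show ?thesis
 proof (rule abelian_groupI)
  fix x assume "x : carrier (|carrier = W, mult = undefined, one = undefined, zero = \<zero>{|G|}, add = (\<oplus>{|G|})|)"
  then have x: "x : W" by simp
  show "EX y:carrier (|carrier = W, mult = undefined, one = undefined, zero = \<zero>{|G|}, add = (\<oplus>{|G|})|).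
    y \<oplus>{|(|carrier = W, mult = undefined, one = undefined, zero = \<zero>{|G|}, add = (\<oplus>{|G|})|)|} x
   = \<zero>{|(|carrier = W, mult = undefined, one = undefined, zero = \<zero>{|G|}, add = (\<oplus>{|G|})|)|}"
   using additive_subgroup_uminus[OF G W x] c[OF x] by (auto intro!: bexI[of _ "\<ominus>{|G|} x"] simp: G.l_neg)
 qed (use c additive_subgroup.a_closed[OF W] additive_subgroup.zero_closed[OF W] in "simp_all add: G.a_ac")
qed

context right_module begin

context
 fixes D
 assumes D: "subring D (End_ring A M)" and U: "Units (End_ring A M(|carrier := D|)) = D - {\<zero>{|End_ring A M|}}"
begin

interpretation E: ring "End_ring A M" by (rule End_ring_ring)
interpretation Ev: bimodule "End_ring A M(|carrier := D|)" A "eval_bimod M" by (rule eval_bimodule[OF D])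

lemma D_rmod_hom: "d : D ==> d : rmod_hom A M M" using subringE(1)[OF D] by (auto simp: End_ring_simps)
lemma D_extensional: "d : D ==> d : extensional (carrier M)" using subringE(1)[OF D] by (auto simp: End_ring_simps)
lemma D_closed: "d : D ==> x .: M ==> d x .: M" by (rule rmod_hom_closed[OF D_rmod_hom])
lemma D_add: "d : D ==> x .: M ==> y .: M ==> d (x \<oplus> y) = d x \<oplus> d y" by (rule rmod_hom_add[OF D_rmod_hom])
lemma D_zero: "d : D ==> d \<zero> = \<zero>" by (rule add_maps_zero[OF ab ab rmod_hom_add_maps[OF D_rmod_hom]])

lemma D_sum: "d : D ==> d' : D ==> (\<lambda>x\<in>carrier M. d x \<oplus> d' x) : D"
 using subringE(7)[OF D, of d d'] by (simp add: End_ring_simps)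
lemma D_comp: "d : D ==> d' : D ==> compose (carrier M) d d' : D"
 using subringE(6)[OF D, of d d'] by (simp add: End_ring_simps)
lemma D_neg: "d : D ==> (\<lambda>x\<in>carrier M. \<ominus> d x) : D"
 using subringE(5)[OF D, of d] End_uminus[of d] subringE(1)[OF D] by auto
lemma D_0: "(\<lambda>x\<in>carrier M. \<zero>) : D" using subringE(2)[OF D] by (simp add: End_ring_simps)
lemma D_1: "(\<lambda>x\<in>carrier M. x) : D" using subringE(3)[OF D] by (simp add: End_ring_simps)

lemma D_inverse:
 assumes d: "d : D" and x: "x .: M" "d x ~= \<zero>"
 obtains e where "e : D" "!!y. y .: M ==> e (d y) = y" "!!y. y .: M ==> d (e y) = y"
proof -
 have "d ~= \<zero>{|End_ring A M|}" using x by (auto simp: End_ring_simps)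
 then have "d : Units (End_ring A M(|carrier := D|))" using d U by blast
 then obtain e where e: "e : D" "e \<otimes>{|End_ring A M|} d = \<one>{|End_ring A M|}" "d \<otimes>{|End_ring A M|} e = \<one>{|End_ring A M|}"
  by (auto simp: Units_def)
 show thesis
 proof (rule that[OF e(1)])
  fix y assume y: "y .: M"
  show "e (d y) = y" using fun_cong[OF e(2), of y] y by (simp add: End_ring_simps compose_def)
  show "d (e y) = y" using fun_cong[OF e(3), of y] y by (simp add: End_ring_simps compose_def)
 qed
qed

text \<open>A nonzero difference of d and d' would be invertible, yet it kills x. So an element of D
  is determined by its value at one nonzero vector, which makes coordinates unique.\<close>

lemma D_eq:
 assumes d: "d : D" and d': "d' : D" and x: "x .: M" "x ~= \<zero>" and e: "d x = d' x"
 shows "d = d'"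
proof (rule ext_eqI[OF D_extensional[OF d] D_extensional[OF d']], rule ccontr)
 fix y assume y: "y .: M" and ne: "d y ~= d' y"
 let ?d = "\<lambda>x\<in>carrier M. d x \<oplus> (\<lambda>x\<in>carrier M. \<ominus> d' x) x"
 have D': "?d : D" by (rule D_sum[OF d D_neg[OF d']])
 have "?d y ~= \<zero>" using ne y diff_zero_iff[of "d y" "d' y"] D_closed[OF d y] D_closed[OF d' y] by (simp add: minus_eq)
 then obtain u where u: "u : D" "!!y. y .: M ==> u (?d y) = y" using D_inverse[OF D' y] by blast
 have "?d x = \<zero>" using e x D_closed[OF d' x(1)] by (simp add: r_neg)
 then show False using u(2)[OF x(1)] D_zero[OF u(1)] x(2) by simp
qed

definition "line v = (%d. d v) ` D"

lemma line_subgroup: assumes v: "v .: M" shows "additive_subgroup (line v) M"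
proof (rule additive_subgroupI)
 show "line v <= carrier M" using D_closed v by (auto simp: line_def)
 show "\<zero> : line v" unfolding line_def by (rule image_eqI[OF _ D_0]) (use v in simp)
next
 fix x y assume "x : line v" "y : line v"
 then obtain d d' where d: "d : D" "x = d v" "d' : D" "y = d' v" by (auto simp: line_def)
 show "x \<oplus> y : line v" unfolding line_def by (rule image_eqI[OF _ D_sum[OF d(1,3)]]) (use v d in simp)
next
 fix x assume "x : line v"
 then obtain d where d: "d : D" "x = d v" by (auto simp: line_def)
 show "\<ominus> x : line v" unfolding line_def by (rule image_eqI[OF _ D_neg[OF d(1)]]) (use v d in simp)
qed

lemma line_smult: "d : D ==> v .: M ==> x : line v ==> d x : line v"
proof -
 assume d: "d : D" and v: "v .: M" and "x : line v"
 then obtain d' where d': "d' : D" "x = d' v" by (auto simp: line_def)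
 show "d x : line v" unfolding line_def by (rule image_eqI[OF _ D_comp[OF d d'(1)]]) (use v d' in "simp add: compose_def")
qed

lemma self_line: "v .: M ==> v : line v"
 unfolding line_def by (rule image_eqI[OF _ D_1]) simp

lemma ssum_line_smult:
 assumes "d : D" "B <= carrier M" "x : ssum M line B" shows "d x : ssum M line B"
 using assms(3)
proof (induction rule: ssum.induct)
 case zero
 show ?case using D_zero[OF assms(1)] ssum.zero[of M line B] by simp
next
 case (add i x y)
 have i: "i .: M" using add assms(2) by blast
 have x: "x .: M" using additive_subgroup.a_subset[OF line_subgroup[OF i]] add by blast
 have y: "y .: M"
  by (rule ssum_closed[where X = "carrier M", OF ab line_subgroup assms(2) add(3)])
 show ?case
  unfolding D_add[OF assms(1) x y]
  by (rule ssum.add[of i B "d x" line "d y" M, OF add(1) line_smult[OF assms(1) i add(2)] add.IH])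
qed

text \<open>Lines satisfy the dichotomy of \<open>exists_independent_spanning\<close>, because a
  nonzero vector d i of a line generates the line again, d being invertible. The result is a basis
  of M over D with coordinates in D. Additivity and linearity are stated at every vector u, since
  the functionals built from the coordinates evaluate them at arbitrary vectors.\<close>

lemma exists_coordinates:
 obtains B c where "B <= carrier M" "!!b x. b : B ==> x .: M ==> c b x : D"
  "!!b x y u. [|b : B; x .: M; y .: M; u .: M|] ==> c b (x \<oplus> y) u = c b x u \<oplus> c b y u"
  "!!b d x u. [|b : B; d : D; x .: M; u .: M|] ==> c b (d x) u = d (c b x u)"
  "!!x. x .: M ==> finite {b\<in>B. c b x b ~= \<zero>}"
  "!!x. x .: M ==> x = (\<Oplus> b\<in>{b\<in>B. c b x b ~= \<zero>}. c b x b)"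
proof -
 let ?X = "carrier M - {\<zero>}"
 have sg: "additive_subgroup (line v) M" if "v : ?X" for v using line_subgroup that by blast
 have dich: "line i \<inter> ssum M line B <= {\<zero>} \<or> line i <= ssum M line B" if i: "i : ?X" and B: "B <= ?X" for i B
 proof (rule disjCI)
  assume ns: "\<not> line i <= ssum M line B"
  have "d i = \<zero>" if d: "d : D" "d i : ssum M line B" for d
  proof (rule ccontr)
   assume "d i ~= \<zero>"
   then obtain e where e: "e : D" "!!y. y .: M ==> e (d y) = y" using D_inverse[OF d(1)] i by blast
   have Bc: "B <= carrier M" using B by blast
   have "i : ssum M line B" using ssum_line_smult[OF e(1) Bc d(2)] e(2) i by simp
   then have "line i <= ssum M line B" using ssum_line_smult[OF _ Bc] by (auto simp: line_def)
   then show False using ns by simp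
  qed
  then show "line i \<inter> ssum M line B <= {\<zero>}" by (auto simp: line_def)
 qed
 show thesis
 proof (rule exists_independent_spanning[OF ab sg dich])
 fix B assume B: "B <= ?X" "independent_family M line B" "!!i. i : ?X ==> line i <= ssum M line B"
 have Bc: "b .: M" "b ~= \<zero>" if "b : B" for b using B(1) that by auto
 define N where "N v = ((|carrier = line v, mult = undefined, one = undefined, zero = \<zero>, add = (\<oplus>)|) :: 'm ring)" for v
 have N: "abelian_group (N v)" if "v : B" for v
  unfolding N_def by (rule abelian_group_subgroup[OF ab line_subgroup[OF Bc(1)[OF that]]])
 have Ns: "carrier (N v) = line v" "\<zero>{|N v|} = \<zero>" "(\<oplus>{|N v|}) = (\<oplus>)" for v by (simp_all add: N_def)
 interpret S: dsum_family B N by (rule dsum_family.intro) (rule N)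
 let ?S = "dsum_lift B N M (%_ x. x)"
 have "bij_betw ?S (carrier (dsum B N)) (ssum M line B)"
  by (rule independent_dsum_bij[OF ab sg B(1,2) N]) (simp_all add: Ns)
 moreover have "ssum M line B = carrier M"
 proof (intro equalityI subsetI)
  show "x .: M" if "x : ssum M line B" for x by (rule ssum_closed[OF ab sg B(1) that])
  show "x : ssum M line B" if "x .: M" for x
   using B(3)[of x] self_line[OF that] that ssum.zero[of M line B] by (cases "x = \<zero>") auto
 qed
 ultimately have bij: "bij_betw ?S (carrier (dsum B N)) (carrier M)" by simp
 have lc: "line v <= carrier M" if "v : B" for v using additive_subgroup.a_subset[OF line_subgroup[OF Bc(1)[OF that]]] .
 have idm: "(%x. x) : add_maps (N v) M" if "v : B" for v
  by (rule add_mapsI) (use lc[OF that] in "auto simp: Ns")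
 have Sm: "?S : add_maps (dsum B N) M" by (rule S.dsum_lift_add_maps[where g = "%_ x. x", OF ab idm])
 define p where "p = inv_into (carrier (dsum B N)) ?S"
 have p: "p x .: (dsum B N)" "?S (p x) = x" if "x .: M" for x
  using that bij unfolding p_def bij_betw_def by (auto simp: inv_into_into f_inv_into_f)
 have uniq: "f = p x" if "f .: (dsum B N)" "?S f = x" "x .: M" for f x
  using inj_onD[OF bij_betw_imp_inj_on[OF bij] _ that(1) p(1)[OF that(3)]] that p(2) by simp
 have pl: "p x b : line b" if "x .: M" "b : B" for x b
  using p(1)[OF that(1)] that(2) by (auto simp: S.carrier_dsum Ns)
 have padd: "p (x \<oplus> y) b = p x b \<oplus> p y b" if "x .: M" "y .: M" "b : B" for x y b
 proof -
  have "p x \<oplus>{|dsum B N|} p y = p (x \<oplus> y)"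
   by (rule uniq) (use that p add_maps_add[OF Sm, of "p x" "p y"] abelian_monoid.a_closed[OF abelian_group.axioms(1)[OF S.abelian_dsum]]
    in "simp_all del: S.dsum_ops")
  then show ?thesis using that(3) by (metis (no_types, lifting) Ns(3) S.dsum_ops(2) restrict_apply')
 qed
 have pmul: "p (d x) b = d (p x b)" if d: "d : D" and x: "x .: M" and b: "b : B" for d x b
 proof -
  let ?f = "\<lambda>b\<in>B. d (p x b)"
  have sub: "{b\<in>B. ?f b ~= \<zero>{|N b|}} <= {b\<in>B. p x b ~= \<zero>{|N b|}}" using D_zero[OF d] by (auto simp: Ns)
  have fin: "finite {b\<in>B. p x b ~= \<zero>{|N b|}}" using p(1)[OF x] by (simp add: S.carrier_dsum)
  have f: "?f .: (dsum B N)"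
   unfolding S.carrier_dsum using finite_subset[OF sub fin] line_smult[OF d Bc(1)] pl[OF x] by (auto simp: Ns)
  have pc: "p x b .: M" if "b : B" for b using lc[OF that] pl[OF x that] by blast
  have "?S ?f = (\<Oplus> b\<in>{b\<in>B. p x b ~= \<zero>{|N b|}}. ?f b)"
   by (rule S.dsum_lift_superset[where g = "%_ x. x", OF ab idm f fin sub]) auto
  also have "... = (\<Oplus> b\<in>{b\<in>B. p x b ~= \<zero>{|N b|}}. d (p x b))"
   by (rule finsum_cong') (use D_closed[OF d pc] in auto)
  also have "... = d (?S (p x))"
   unfolding dsum_lift_def
   by (rule add_maps_finsum[OF ab ab rmod_hom_add_maps[OF D_rmod_hom[OF d]] fin, symmetric]) (use pc in auto)
  finally have "?S ?f = d x" using p(2)[OF x] by simp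
  then have "?f = p (d x)" using uniq[OF f _ D_closed[OF d x]] by simp
  then show ?thesis using b by (metis (no_types, lifting) restrict_apply')
 qed
 \<comment> \<open>The component \<open>p x b\<close> lies on the line of b; the coordinate is the
   unique element of D that carries b to it.\<close>
 define c where "c b x = (THE d. d : D & d b = p x b)" for b x
 have cu: "c b x = d" if "b : B" "x .: M" "d : D" "d b = p x b" for b x d
  unfolding c_def
 proof (rule the_equality)
  show "d : D & d b = p x b" using that by simp
  show "d' = d" if "d' : D & d' b = p x b" for d'
   by (rule D_eq[OF _ \<open>d : D\<close> Bc[OF \<open>b : B\<close>]]) (use that \<open>d b = p x b\<close> in simp_all)
 qed
 have c: "c b x : D" "c b x b = p x b" if b: "b : B" and x: "x .: M" for b x
 proof -
  obtain d where "d : D" "d b = p x b" using pl[OF x b] by (auto simp: line_def)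
  then show "c b x : D" "c b x b = p x b" using cu[OF b x] by auto
 qed
 show thesis
 proof (rule that[of B c])
  show "B <= carrier M" using Bc by blast
  show "c b x : D" if "b : B" "x .: M" for b x by (rule c(1)[OF that])
  show "c b (x \<oplus> y) u = c b x u \<oplus> c b y u" if b: "b : B" and x: "x .: M" and y: "y .: M" and u: "u .: M" for b x y u
  proof -
   have "c b (x \<oplus> y) = (\<lambda>u\<in>carrier M. c b x u \<oplus> c b y u)"
    by (rule cu[OF b a_closed[OF x y] D_sum[OF c(1)[OF b x] c(1)[OF b y]]])
    (use padd[OF x y b] c(2)[OF b x] c(2)[OF b y] Bc[OF b] in simp)
   then show ?thesis using u by simp
  qed
  show "c b (d x) u = d (c b x u)" if b: "b : B" and d: "d : D" and x: "x .: M" and u: "u .: M" for b d x u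
  proof -
   have "c b (d x) = compose (carrier M) d (c b x)"
    by (rule cu[OF b D_closed[OF d x] D_comp[OF d c(1)[OF b x]]])
    (use pmul[OF d x b] c(2)[OF b x] Bc[OF b] in "simp add: compose_def")
   then show ?thesis using u by (simp add: compose_def)
  qed
  fix x assume x: "x .: M"
  have e: "{b\<in>B. c b x b ~= \<zero>} = {b\<in>B. p x b ~= \<zero>{|N b|}}" using c(2)[OF _ x] by (auto simp: Ns)
  show "finite {b\<in>B. c b x b ~= \<zero>}" unfolding e using p(1)[OF x] by (simp add: S.carrier_dsum)
  have "x = (\<Oplus> b\<in>{b\<in>B. p x b ~= \<zero>{|N b|}}. p x b)" using p(2)[OF x] by (simp add: dsum_lift_def)
  also have "... = (\<Oplus> b\<in>{b\<in>B. c b x b ~= \<zero>}. c b x b)"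
   unfolding e by (rule finsum_cong') (use c(2)[OF _ x] subsetD[OF lc pl[OF x]] in auto)
  finally show "x = (\<Oplus> b\<in>{b\<in>B. c b x b ~= \<zero>}. c b x b)" .
 qed
 qed
qed

end

end

definition coordinates ::
  "('a, 'm, 'q) rmod_scheme => ('m => 'm) set => 'm set => ('m => 'm => 'm => 'm) => bool" where
 "coordinates M D B c \<longleftrightarrow> B <= carrier M \<and>
  (ALL b:B. ALL x:carrier M. c b x : D) \<and>
  (ALL b:B. ALL x:carrier M. ALL y:carrier M. ALL u:carrier M. c b (x \<oplus>{|M|} y) u = c b x u \<oplus>{|M|} c b y u) \<and>
  (ALL b:B. ALL d:D. ALL x:carrier M. ALL u:carrier M. c b (d x) u = d (c b x u)) \<and>
  (ALL x:carrier M. finite {b\<in>B. c b x b ~= \<zero>{|M|}} & x = (\<Oplus>{|M|} b\<in>{b\<in>B. c b x b ~= \<zero>{|M|}}. c b x b))"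

lemma (in right_module) coordinates_ex:
 assumes D: "subring D (End_ring A M)" and U: "Units (End_ring A M(|carrier := D|)) = D - {\<zero>{|End_ring A M|}}"
 shows "EX B c. coordinates M D B c"
proof (rule exists_coordinates[OF D U])
 fix B c
 assume "B <= carrier M" "!!b x. b : B ==> x .: M ==> c b x : D"
  "!!b x y u. [|b : B; x .: M; y .: M; u .: M|] ==> c b (x \<oplus> y) u = c b x u \<oplus> c b y u"
  "!!b d x u. [|b : B; d : D; x .: M; u .: M|] ==> c b (d x) u = d (c b x u)"
  "!!x. x .: M ==> finite {b\<in>B. c b x b ~= \<zero>}"
  "!!x. x .: M ==> x = (\<Oplus> b\<in>{b\<in>B. c b x b ~= \<zero>}. c b x b)"
 then have "coordinates M D B c" unfolding coordinates_def by (intro conjI ballI) assumption+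
 then show ?thesis by blast
qed

section \<open>Corings that are direct sums of comatrix corings\<close>

locale comatrix_decomposed = coring A C for A :: "('a, 'p) ring_scheme" and C :: "('a, 'c, 'q) coring_scheme" (structure) +
 fixes K :: "('k, 'r) ring_scheme" and \<eta> :: "'k => 'a" and I :: "'i set" and S :: "'i => ('a, 'm) rmod"
  and D :: "'i => ('m => 'm) set" and \<theta> :: "('i => (('m => 'a) \<times> 'm \<Rightarrow>\<^sub>0 int) set) => 'c"
 assumes dec: "comatrix_decomposition K \<eta> A C I S D \<theta>"
begin

lemma rm: "i : I ==> right_module A (S i)" using dec by (simp add: comatrix_decomposition_def)

lemma dv: "i : I ==> division_subring K \<eta> A (S i) (D i)" using dec by (simp add: comatrix_decomposition_def)

lemma sr: "i : I ==> subring (D i) (End_ring A (S i))" using dv by (simp add: division_subring_def)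

lemma un: "i : I ==> Units (End_ring A (S i)(|carrier := D i|)) = D i - {\<zero>{|End_ring A (S i)|}}"
 using dv by (simp add: division_subring_def)

lemma cmx: assumes "i : I" shows "comatrix A (S i) (D i)"
proof -
 have "EX b. dual_basis A (S i) b"
  using dec assms by (intro right_module.fg_projective_dual_basis[OF rm[OF assms]]) (simp_all add: comatrix_decomposition_def)
 then show ?thesis by (intro comatrix.intro rm sr comatrix_axioms.intro assms)
qed

lemma cfam: "comatrix_family A I S D"
 by (intro comatrix_family.intro B.ring_axioms comatrix_family_axioms.intro cmx)

interpretation F: comatrix_family A I S D by (rule cfam)

lemma \<theta>_iso: "\<theta> : coring_iso A F.SC C" using dec by (simp add: comatrix_decomposition_def)
lemma \<theta>_hom: "\<theta> : bimod_hom A A F.SS C"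
 using \<theta>_iso by (simp add: coring_iso_def bimod_hom_def rmod_hom_def dsum_coring_simps)
lemma \<theta>_bij: "bij_betw \<theta> (carrier F.SS) (carrier C)" using \<theta>_iso by (simp add: coring_iso_def dsum_coring_simps)
lemma \<theta>_add_maps: "\<theta> : add_maps F.SS C" using \<theta>_hom by (simp add: bimod_hom_iff rmod_hom_iff)

abbreviation "dl i \<equiv> dual_bimod A (S i)"
abbreviation "nn i \<equiv> db_size A (S i)"
abbreviation "es i \<equiv> db_form A (S i)"
abbreviation "ev i \<equiv> db_vec A (S i)"

definition "hh i \<phi> x = \<theta> (F.gen i \<phi> x)"

lemma C_induct [consumes 1, case_names zero gen add]:
 assumes "c .: C" "P \<zero>"
  "!!i \<phi> x. [|i : I; \<phi> .: (dl i); x .: (S i)|] ==> P (hh i \<phi> x)"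
  "!!c d. [|c .: C; d .: C; P c; P d|] ==> P (c \<oplus> d)"
 shows "P c"
proof -
 obtain f where f: "f .: F.SS" "c = \<theta> f" using \<theta>_bij assms(1) by (auto simp: bij_betw_def)
 have "P (\<theta> f)" using f(1)
 proof (induction rule: F.SS_induct)
  case zero
  then show ?case using assms(2) add_maps_zero[OF bimodule_ab[OF F.bSS] ab \<theta>_add_maps] by simp
 next
  case (gen i \<phi> x)
  then show ?case using assms(3) by (simp add: hh_def)
 next
  case (add f g)
  then show ?case using assms(4)[OF add_maps_closed[OF \<theta>_add_maps] add_maps_closed[OF \<theta>_add_maps]] add_maps_add[OF \<theta>_add_maps] by simp
 qed
 then show ?thesis using f(2) by simp
qed

lemma C_ext:
 assumes "f : add_maps C G" "g : add_maps C G" "abelian_group G" "c .: C"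
  and "!!i \<phi> x. [|i : I; \<phi> .: (dl i); x .: (S i)|] ==> f (hh i \<phi> x) = g (hh i \<phi> x)"
 shows "f c = g c"
 using assms(4)
proof (induction rule: C_induct)
 case zero
 then show ?case using add_maps_zero[OF ab assms(3,1)] add_maps_zero[OF ab assms(3,2)] by simp
next
 case (add s t)
 then show ?case by (simp add: add_maps_add[OF assms(1)] add_maps_add[OF assms(2)])
qed (use assms(5) in simp)

text \<open>The universal property of the sum of the comatrix corings, transported along the
  bijection \<theta>.\<close>

lemma C_lift:
 assumes G: "abelian_group G"
  and b: "!!i. i : I ==> balanced (End_ring A (S i)(|carrier := D i|)) (dl i) (eval_bimod (S i)) G (b i)"
 shows "EX f. f : add_maps C G \<and>
  (ALL i \<phi> x. i : I --> \<phi> .: (dl i) --> x .: (S i) --> f (hh i \<phi> x) = b i \<phi> x)"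
proof -
 interpret SS: abelian_group F.SS by (rule bimodule_ab[OF F.bSS])
 have "EX g. g : add_maps F.SS G \<and>
  (ALL i \<phi> x. i : I --> \<phi> .: (dl i) --> x .: (S i) --> g (F.gen i \<phi> x) = b i \<phi> x)"
  by (rule F.SS_lift[where b = b, OF G b])
 then obtain g where g: "g : add_maps F.SS G"
  "ALL i \<phi> x. i : I --> \<phi> .: (dl i) --> x .: (S i) --> g (F.gen i \<phi> x) = b i \<phi> x"
  by (elim exE conjE)
 define p where "p = inv_into (carrier F.SS) \<theta>"
 have p: "p c .: F.SS" "\<theta> (p c) = c" if "c .: C" for c
  using that \<theta>_bij unfolding p_def bij_betw_def by (auto simp: inv_into_into f_inv_into_f)
 have p\<theta>: "p (\<theta> f) = f" if "f .: F.SS" for f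
  using that \<theta>_bij unfolding p_def bij_betw_def by simp
 have "p : add_maps C F.SS"
 proof (rule add_mapsI)
  fix c d assume c: "c .: C" and d: "d .: C"
  have "p (\<theta> (p c \<oplus>{|F.SS|} p d)) = p c \<oplus>{|F.SS|} p d" using p c d by (intro p\<theta>) simp
  then show "p (c \<oplus> d) = p c \<oplus>{|F.SS|} p d" using add_maps_add[OF \<theta>_add_maps, of "p c" "p d"] p c d by simp
 qed (rule p(1))
 then have "(%c. g (p c)) : add_maps C G" using g(1) by (rule add_maps_comp)
 moreover have "g (p (hh i \<phi> x)) = b i \<phi> x" if "i : I" "\<phi> .: (dl i)" "x .: (S i)" for i \<phi> x
  using g(2) that p\<theta>[OF F.gen_closed[OF that]] by (simp add: hh_def)
 ultimately show ?thesis by (intro exI[of _ "%c. g (p c)"]) simp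
qed

lemma hh_right_hom: "[|i : I; \<phi> .: (dl i)|] ==> hh i \<phi> : rmod_hom A (S i) C"
 using rmod_hom_comp[OF F.gen_right_hom, of i \<phi> \<theta> C] \<theta>_hom by (simp add: hh_def[abs_def] bimod_hom_iff)

lemma hh_closed: "[|i : I; \<phi> .: (dl i); x .: (S i)|] ==> hh i \<phi> x .: C"
 by (rule rmod_hom_closed[OF hh_right_hom])

lemma hh_left_add_maps: "[|i : I; x .: (S i)|] ==> (%\<phi>. hh i \<phi> x) : add_maps (dl i) C"
 unfolding hh_def by (rule add_maps_comp[OF F.gen_left_add_maps \<theta>_add_maps])

lemma hh_lact: "[|i : I; \<phi> .: (dl i); x .: (S i); a .: A|] ==> a |> hh i \<phi> x = hh i (a |>{|dl i|} \<phi>) x"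
 unfolding hh_def F.gen_lact[symmetric] using \<theta>_hom F.gen_closed[of i \<phi> x] lmod_hom_lact[of \<theta> A F.SS C a "F.gen i \<phi> x"]
 by (simp add: bimod_hom_iff)

lemma hh_balanced: "[|i : I; \<phi> .: (dl i); d : D i; x .: (S i)|] ==> hh i (\<phi> <|{|dl i|} d) x = hh i \<phi> (d x)"
 unfolding hh_def by (simp add: F.gen_balanced)

lemma comult_hh:
 assumes i: "i : I" and p: "\<phi> .: (dl i)" and x: "x .: (S i)"
 shows "comult C (hh i \<phi> x) = (\<Oplus>{|TG A C C|} k\<in>{..<nn i}. tensor A C C (hh i \<phi> (ev i k)) (hh i (es i k) x))"
proof -
 interpret c: comatrix A "S i" "D i" by (rule cmx[OF i])
 interpret TS: tensor_pair A F.SS F.SS by (rule F.tSS)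
 interpret TC: tensor_pair A C C by (rule tpM[OF is_rmod])
 interpret TCg: abelian_group "TG A C C" by (rule TC.ab_tensor)
 have th: "\<theta> : rmod_hom A F.SS C" "\<theta> : lmod_hom A F.SS C" using \<theta>_hom by (simp_all add: bimod_hom_iff)
 note m = tmap_add_maps[OF F.tSS tpM[OF is_rmod] th]
 have gc: "F.gen i \<phi> (ev i k) .: F.SS" "F.gen i (es i k) x .: F.SS" if "k < nn i" for k
  using F.gen_closed[OF i] p x c.dbf that by simp_all
 have "comult C (hh i \<phi> x) = tmap A C C \<theta> \<theta> (comult F.SC (F.gen i \<phi> x))"
  using \<theta>_iso F.gen_closed[OF i p x] by (simp add: coring_iso_def hh_def dsum_coring_simps(1))
 also have "... = (\<Oplus>{|TG A C C|} k\<in>{..<nn i}.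
   tmap A C C \<theta> \<theta> (tensor A F.SS F.SS (F.gen i \<phi> (ev i k)) (F.gen i (es i k) x)))"
  unfolding F.comult_gen[OF i p x]
  by (rule add_maps_finsum[OF TS.ab_tensor TC.ab_tensor m(1)]) (use gc in "auto simp: TS.tensor_closed")
 also have "... = (\<Oplus>{|TG A C C|} k\<in>{..<nn i}. tensor A C C (hh i \<phi> (ev i k)) (hh i (es i k) x))"
  by (rule TCg.finsum_cong') (use gc m(2) i p x c.dbf hh_closed in "auto simp: TC.tensor_closed hh_def")
 finally show ?thesis .
qed

lemma counit_hh: "[|i : I; \<phi> .: (dl i); x .: (S i)|] ==> counit C (hh i \<phi> x) = \<phi> x"
 using \<theta>_iso F.gen_closed[of i \<phi> x] F.counit_gen[of i \<phi> x] by (simp add: coring_iso_def hh_def dsum_coring_simps(1))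

lemma dlv: "[|i : I; \<phi> .: (dl i); x .: (S i)|] ==> \<phi> x .: A"
 by (rule form_values[OF rm])

definition "Bs i = fst (SOME p. coordinates (S i) (D i) (fst p) (snd p))"
definition "cc i = snd (SOME p. coordinates (S i) (D i) (fst p) (snd p))"

lemma coord: assumes "i : I" shows "coordinates (S i) (D i) (Bs i) (cc i)"
proof -
 obtain B c where "coordinates (S i) (D i) B c"
  using right_module.coordinates_ex[OF rm[OF assms] sr[OF assms] un[OF assms]] by (elim exE)
 then have "EX p. coordinates (S i) (D i) (fst p) (snd p)" by (intro exI[of _ "(B, c)"]) simp
 from someI_ex[OF this] show ?thesis unfolding Bs_def cc_def .
qed

lemma coord_facts:
 assumes i: "i : I"
 shows "b : Bs i ==> b .: (S i)"
  "[|b : Bs i; x .: (S i)|] ==> cc i b x : D i"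
  "[|b : Bs i; x .: (S i); y .: (S i); u .: (S i)|] ==> cc i b (x \<oplus>{|S i|} y) u = cc i b x u \<oplus>{|S i|} cc i b y u"
  "[|b : Bs i; d : D i; x .: (S i); u .: (S i)|] ==> cc i b (d x) u = d (cc i b x u)"
  "x .: (S i) ==> finite {b\<in>Bs i. cc i b x b ~= \<zero>{|S i|}}"
  "x .: (S i) ==> x = (\<Oplus>{|S i|} b\<in>{b\<in>Bs i. cc i b x b ~= \<zero>{|S i|}}. cc i b x b)"
 using coord[OF i] unfolding coordinates_def by blast+

lemma D_hom: "i : I ==> d : D i ==> d : rmod_hom A (S i) (S i)"
 by (rule comatrix.D_hom[OF cmx])

lemma D_closed: "i : I ==> d : D i ==> x .: (S i) ==> d x .: (S i)"
 by (rule rmod_hom_closed[OF D_hom])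

lemma cc_closed: "[|i : I; b : Bs i; x .: (S i); u .: (S i)|] ==> cc i b x u .: (S i)"
 by (rule D_closed[OF _ coord_facts(2)])

text \<open>On the summand i this is \<phi> (x) x |-> \<phi>(c_b(x) v), with c_b the coordinate at
  b; on the others it is zero. It is balanced over D because c_b(d x) = d c_b(x). Taking the vectors
  \<open>ev i k\<close> for v gives the dual basis in \<open>part\<close>, and arbitrary v are used
  to reach all vectors of a summand.\<close>

definition "lam i b v = (SOME l. l : add_maps C A \<and>
 (ALL j \<phi> x. j : I --> \<phi> .: (dl j) --> x .: (S j) -->
  l (hh j \<phi> x) = (if j = i then \<phi> (cc i b x v) else \<zero>{|A|})))"

lemma lam:
 assumes i: "i : I" and b: "b : Bs i" and v: "v .: (S i)"
 shows "lam i b v : add_maps C A"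
  and "[|j : I; \<phi> .: (dl j); x .: (S j)|] ==> lam i b v (hh j \<phi> x) = (if j = i then \<phi> (cc i b x v) else \<zero>{|A|})"
proof -
 have "balanced (End_ring A (S j)(|carrier := D j|)) (dl j) (eval_bimod (S j)) A
   (%\<phi> x. if j = i then \<phi> (cc i b x v) else \<zero>{|A|})" if j: "j : I" for j
 proof (cases "j = i")
  case True
  show ?thesis
   by (rule balancedI)
    (use i b v dlv[OF i] cc_closed[OF i b] coord_facts(3,4)[OF i b] D_closed[OF i] rmod_hom_add[OF form_of_dual[OF rm[OF i]]]
    in "simp_all add: True dual_bimod_simps")
 next
  case False
  show ?thesis by (rule balancedI) (simp_all add: False)
 qed
 from someI_ex[OF C_lift[where b = "%j \<phi> x. if j = i then \<phi> (cc i b x v) else \<zero>{|A|}", OF B.abelian_group_axioms this], folded lam_def]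
 show "lam i b v : add_maps C A"
  and "[|j : I; \<phi> .: (dl j); x .: (S j)|] ==> lam i b v (hh j \<phi> x) = (if j = i then \<phi> (cc i b x v) else \<zero>{|A|})"
  by blast+
qed

lemma lam_left_form:
 assumes i: "i : I" and b: "b : Bs i" and v: "v .: (S i)"
 shows "lam i b v : left_forms A C"
proof -
 note l = lam[OF assms]
 have "lam i b v (a |> c) = a \<otimes>{|A|} lam i b v c" if a: "a .: A" and c: "c .: C" for a c
 proof (rule C_ext[OF add_maps_comp[OF lact_add_maps[OF a] l(1)] _ B.abelian_group_axioms c])
  show "(%c. a \<otimes>{|A|} lam i b v c) : add_maps C A"
   by (rule add_mapsI) (use a add_maps_closed[OF l(1)] add_maps_add[OF l(1)] in "simp_all add: B.r_distr")
  fix j \<phi> x assume j: "j : I" "\<phi> .: (dl j)" "x .: (S j)"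
  have q: "a |>{|dl j|} \<phi> .: (dl j)" by (rule bimodule.lact_closed[OF comatrix.bdl[OF cmx[OF j(1)]] a j(2)])
  show "lam i b v (a |> hh j \<phi> x) = a \<otimes>{|A|} lam i b v (hh j \<phi> x)"
   unfolding hh_lact[OF j a] l(2)[OF j(1) q j(3)] l(2)[OF j]
   using a j(3) cc_closed[OF i b _ v] by (cases "j = i") (simp_all add: dual_bimod_simps)
 qed
 then show ?thesis using l(1) by (simp add: left_forms_def)
qed

end

context comatrix_decomposed begin

interpretation F: comatrix_family A I S D by (rule cfam)

context
 fixes X :: "('a, 'x, 'y) rmod_scheme"
 assumes X: "right_module A X"
begin

interpretation X: right_module A X by (rule X)
interpretation T: tensor_pair A X C by (rule tpM[OF X])
interpretation Tg: abelian_group "TG A X C" by (rule T.ab_tensor)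

text \<open>The component of z at the basis vector b of the summand i. The functionals
  \<open>lam i b (ev i k)\<close> and the elements \<open>hh i (es i k) b\<close> act like a dual
  basis of C as a left module: summing over k produces \<phi> (x) c_b(w) b from \<phi> (x) w, and
  summing over b as well gives back \<phi> (x) w.\<close>

definition "part p z = (\<Oplus>{|TG A X C|} k\<in>{..<nn (fst p)}.
 tensor A X C (slice X (lam (fst p) (snd p) (ev (fst p) k)) z) (hh (fst p) (es (fst p) k) (snd p)))"

lemma part_summand:
 assumes i: "i : I" and b: "b : Bs i" and k: "k < nn i"
 shows "(%z. tensor A X C (slice X (lam i b (ev i k)) z) (hh i (es i k) b)) : add_maps (TG A X C) (TG A X C)"
proof -
 note f = comatrix.dbf[OF cmx[OF i]]
 show ?thesis
  by (rule add_maps_comp[OF slice_add_maps(1)[OF bim X lam_left_form[OF i b f(1)[OF k]]]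
    T.tensor_left_add_maps[OF hh_closed[OF i f(2)[OF k] coord_facts(1)[OF i b]]]])
qed

lemma part_add_maps: "p : Sigma I Bs ==> part p : add_maps (TG A X C) (TG A X C)"
 unfolding part_def[abs_def]
 by (rule add_maps_sum[OF T.ab_tensor T.ab_tensor]) (use part_summand in auto)

lemma part_hh:
 assumes i: "i : I" and b: "b : Bs i" and j: "j : I" and p: "\<phi> .: (dl j)" and w: "w .: (S j)" and x: "x .: X"
 shows "part (i, b) (tensor A X C x (hh j \<phi> w)) = (if j = i then tensor A X C x (hh i \<phi> (cc i b w b)) else \<zero>{|TG A X C|})"
proof -
 interpret c: comatrix A "S i" "D i" by (rule cmx[OF i])
 note hc = hh_closed[OF j p w]
 note bc = coord_facts(1)[OF i b]
 have sl: "slice X (lam i b (ev i k)) (tensor A X C x (hh j \<phi> w)) = x <|{|X|} (if j = i then \<phi> (cc i b w (ev i k)) else \<zero>{|A|})"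
  if k: "k < nn i" for k
  unfolding slice_add_maps(2)[OF bim X lam_left_form[OF i b c.dbf(1)[OF k]] x hc] lam(2)[OF i b c.dbf(1)[OF k] j p w] ..
 show ?thesis
 proof (cases "j = i")
  case False
  have "part (i, b) (tensor A X C x (hh j \<phi> w)) = (\<Oplus>{|TG A X C|} k\<in>{..<nn i}. \<zero>{|TG A X C|})"
   unfolding part_def fst_conv snd_conv
  proof (rule Tg.finsum_cong')
   fix k assume "k : {..<nn i}"
   then have k: "k < nn i" by simp
   show "tensor A X C (slice X (lam i b (ev i k)) (tensor A X C x (hh j \<phi> w))) (hh i (es i k) b) = \<zero>{|TG A X C|}"
    using False add_maps_zero[OF X.ab T.ab_tensor T.tensor_left_add_maps[OF hh_closed[OF i c.dbf(2)[OF k] bc]]]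
    by (simp add: sl[OF k] X.ract_zero_right[OF x])
  qed auto
  then show ?thesis using False by simp
 next
  case True
  have d: "cc i b w : D i" using coord_facts(2)[OF i b] w True by simp
  have p': "\<phi> .: (dl i)" and w': "w .: (S i)" using p w True by simp_all
  \<comment> \<open>Moving the coordinate into the form reduces the sum over k to the expansion of a
    single form in the dual basis.\<close>
  define \<psi> where "\<psi> = \<phi> <|{|dl i|} cc i b w"
  have q: "\<psi> .: (dl i)"
   using right_module.ract_closed[OF bimodule_right[OF c.bdl] p', of "cc i b w"] d by (simp add: \<psi>_def)
  have qe: "\<phi> (cc i b w (ev i k)) = \<psi> (ev i k)" if "k < nn i" for k using c.dbf(1)[OF that] by (simp add: \<psi>_def dual_bimod_simps)
  have qc: "\<psi> (ev i k) .: A" if "k < nn i" for k by (rule dlv[OF i q c.dbf(1)[OF that]])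
  have lc: "\<psi> (ev i k) |>{|dl i|} es i k .: (dl i)" if "k < nn i" for k
   by (rule bimodule.lact_closed[OF c.bdl qc[OF that] c.dbf(2)[OF that]])
  note ta = T.tensor_right_add_maps[OF x]
  have "part (i, b) (tensor A X C x (hh j \<phi> w)) = (\<Oplus>{|TG A X C|} k\<in>{..<nn i}. tensor A X C x (hh i (\<psi> (ev i k) |>{|dl i|} es i k) b))"
   unfolding part_def fst_conv snd_conv
  proof (rule Tg.finsum_cong'[OF refl])
   show "(%k. tensor A X C x (hh i (\<psi> (ev i k) |>{|dl i|} es i k) b)) : {..<nn i} \<rightarrow> carrier (TG A X C)"
    using T.tensor_closed[OF x hh_closed[OF i lc bc]] by auto
   fix k assume "k : {..<nn i}"
   then have k: "k < nn i" by simp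
   show "tensor A X C (slice X (lam i b (ev i k)) (tensor A X C x (hh j \<phi> w))) (hh i (es i k) b)
    = tensor A X C x (hh i (\<psi> (ev i k) |>{|dl i|} es i k) b)"
    unfolding sl[OF k] hh_lact[OF i c.dbf(2)[OF k] bc qc[OF k], symmetric]
    using T.tensor_balanced[OF x qc[OF k] hh_closed[OF i c.dbf(2)[OF k] bc]] True qe[OF k] by simp
  qed
  also have "... = tensor A X C x (\<Oplus> k\<in>{..<nn i}. hh i (\<psi> (ev i k) |>{|dl i|} es i k) b)"
   by (rule add_maps_finsum[OF ab T.ab_tensor ta, symmetric]) (use hh_closed[OF i lc bc] in auto)
  also have "(\<Oplus> k\<in>{..<nn i}. hh i (\<psi> (ev i k) |>{|dl i|} es i k) b) = hh i (\<Oplus>{|dl i|} k\<in>{..<nn i}. \<psi> (ev i k) |>{|dl i|} es i k) b"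
   by (rule add_maps_finsum[OF c.dual_abelian ab hh_left_add_maps[OF i bc], symmetric]) (use lc in auto)
  also have "... = hh i \<psi> b" using c.dual_expand[OF c.db q] by simp
  also have "hh i \<psi> b = hh i \<phi> (cc i b w b)" unfolding \<psi>_def by (rule hh_balanced[OF i p' d bc])
  finally show ?thesis using True by simp
 qed
qed

text \<open>The index set may be infinite, so the sum of the parts is taken over finite sets beyond
  one that depends on z. Quantifying over all larger finite sets makes the property additive in
  z.\<close>

definition "expands z \<longleftrightarrow> (EX L0. finite L0 & L0 <= Sigma I Bs \<and>
 (ALL L. finite L --> L0 <= L --> L <= Sigma I Bs --> z = (\<Oplus>{|TG A X C|} p\<in>L. part p z)))"

lemma expands_zero: "expands \<zero>{|TG A X C|}"
proof -
 have "(\<Oplus>{|TG A X C|} p\<in>L. part p \<zero>{|TG A X C|}) = \<zero>{|TG A X C|}" if "L <= Sigma I Bs" for L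
  by (rule Tg.add.finprod_one_eqI) (use add_maps_zero[OF T.ab_tensor T.ab_tensor part_add_maps] that in auto)
 then show ?thesis unfolding expands_def by (intro exI[of _ "{}"]) simp
qed

lemma expands_add:
 assumes z: "z .: (TG A X C)" and y: "y .: (TG A X C)" and ez: "expands z" and ey: "expands y"
 shows "expands (z \<oplus>{|TG A X C|} y)"
proof -
 obtain L0 where L0: "finite L0" "L0 <= Sigma I Bs"
  "!!L. finite L ==> L0 <= L ==> L <= Sigma I Bs ==> z = (\<Oplus>{|TG A X C|} p\<in>L. part p z)"
  using ez unfolding expands_def by blast
 obtain L1 where L1: "finite L1" "L1 <= Sigma I Bs"
  "!!L. finite L ==> L1 <= L ==> L <= Sigma I Bs ==> y = (\<Oplus>{|TG A X C|} p\<in>L. part p y)"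
  using ey unfolding expands_def by blast
 have "z \<oplus>{|TG A X C|} y = (\<Oplus>{|TG A X C|} p\<in>L. part p (z \<oplus>{|TG A X C|} y))"
  if "finite L" "L0 \<union> L1 <= L" "L <= Sigma I Bs" for L
 proof -
  note pc = add_maps_closed[OF part_add_maps[OF subsetD[OF that(3)]]]
   and pa = add_maps_add[OF part_add_maps[OF subsetD[OF that(3)]]]
  have "(\<Oplus>{|TG A X C|} p\<in>L. part p (z \<oplus>{|TG A X C|} y))
   = (\<Oplus>{|TG A X C|} p\<in>L. part p z \<oplus>{|TG A X C|} part p y)"
   by (rule Tg.finsum_cong') (use pc[OF _ z] pc[OF _ y] pa[OF _ z y] in auto)
  also have "... = (\<Oplus>{|TG A X C|} p\<in>L. part p z) \<oplus>{|TG A X C|} (\<Oplus>{|TG A X C|} p\<in>L. part p y)"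
   by (rule Tg.finsum_addf) (use pc[OF _ z] pc[OF _ y] in auto)
  finally show ?thesis using L0(3)[OF that(1) _ that(3)] L1(3)[OF that(1) _ that(3)] that(2) by simp
 qed
 then show ?thesis unfolding expands_def using L0(1,2) L1(1,2) by (intro exI[of _ "L0 \<union> L1"]) simp
qed

lemma expands_tensor_hh:
 assumes x: "x .: X" and j: "j : I" and p: "\<phi> .: (dl j)" and w: "w .: (S j)"
 shows "expands (tensor A X C x (hh j \<phi> w))"
proof -
 interpret Sj: right_module A "S j" by (rule rm[OF j])
 let ?F = "{b\<in>Bs j. cc j b w b ~= \<zero>{|S j|}}"
 let ?L0 = "(%b. (j, b)) ` ?F"
 note fin = coord_facts(5)[OF j w]
 have cb: "cc j b w b .: (S j)" if "b : Bs j" for b by (rule cc_closed[OF j that w coord_facts(1)[OF j that]])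
 note hr = hh_right_hom[OF j p]
 have thc: "tensor A X C x (hh j \<phi> (cc j b w b)) .: (TG A X C)" if "b : Bs j" for b
  by (rule T.tensor_closed[OF x hh_closed[OF j p cb[OF that]]])
 have z: "tensor A X C x (hh j \<phi> \<zero>{|S j|}) = \<zero>{|TG A X C|}"
  using add_maps_zero[OF Sj.ab ab rmod_hom_add_maps[OF hr]] add_maps_zero[OF ab T.ab_tensor T.tensor_right_add_maps[OF x]] by simp
 have eq: "tensor A X C x (hh j \<phi> w) = (\<Oplus>{|TG A X C|} p\<in>L. part p (tensor A X C x (hh j \<phi> w)))"
  if L: "finite L" "?L0 <= L" "L <= Sigma I Bs" for L
 proof -
  let ?P = "%p. part p (tensor A X C x (hh j \<phi> w))"
  have pc: "?P p .: (TG A X C)" if "p : Sigma I Bs" for p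
   by (rule add_maps_closed[OF part_add_maps[OF that] T.tensor_closed[OF x hh_closed[OF j p w]]])
  have "(\<Oplus>{|TG A X C|} p\<in>?L0. ?P p) = (\<Oplus>{|TG A X C|} p\<in>L. ?P p)"
  proof (rule Tg.add.finprod_mono_neutral_cong_left[OF L(1,2)])
   fix p assume p': "p : L - ?L0"
   obtain i b where ib1: "p = (i, b)" by (cases p)
   have "(i, b) : Sigma I Bs" using subsetD[OF L(3) DiffD1[OF p']] by (simp only: ib1)
   moreover have "p \<notin> ?L0" by (rule conjunct2[OF iffD1[OF Diff_iff p']])
   ultimately have ib: "p = (i, b)" "i : I" "b : Bs i" "(i, b) \<notin> ?L0" using ib1 by simp_all
   show "?P p = \<zero>{|TG A X C|}"
   proof (cases "j = i")
    case True
    have "cc i b w b = \<zero>{|S i|}"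
    proof (rule ccontr)
    assume "cc i b w b ~= \<zero>{|S i|}"
    then have "b : ?F" using ib(3) True by simp
    then have "(j, b) : ?L0" by (rule imageI)
    then show False using ib(4) True by simp
    qed
    then show ?thesis using part_hh[OF ib(2,3) j assms(3) w x] z True by (simp add: ib(1))
   qed (simp add: ib(1) part_hh[OF ib(2,3) j assms(3) w x])
  next
   show "?P : L \<rightarrow> carrier (TG A X C)" by (rule Pi_I) (rule pc[OF subsetD[OF L(3)]])
  qed simp
  moreover have "(\<Oplus>{|TG A X C|} p\<in>?L0. ?P p) = (\<Oplus>{|TG A X C|} b\<in>?F. ?P (j, b))"
   by (rule Tg.finsum_reindex) (use pc j in "auto simp: inj_on_def")
  moreover have "... = (\<Oplus>{|TG A X C|} b\<in>?F. tensor A X C x (hh j \<phi> (cc j b w b)))"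
   by (rule Tg.finsum_cong') (use part_hh[OF j _ j assms(3) w x] thc in auto)
  moreover have "... = tensor A X C x (hh j \<phi> (\<Oplus>{|S j|} b\<in>?F. cc j b w b))"
   by (rule add_maps_finsum[OF Sj.ab T.ab_tensor
    add_maps_comp[OF rmod_hom_add_maps[OF hr] T.tensor_right_add_maps[OF x]] fin, symmetric]) (use cb in auto)
  ultimately show ?thesis using coord_facts(6)[OF j w] by simp
 qed
 show ?thesis
  unfolding expands_def
 proof (intro exI[of _ ?L0] conjI allI impI)
  show "finite ?L0" using fin by simp
  show "?L0 <= Sigma I Bs" using j by auto
 qed (rule eq)
qed

lemma expands: "z .: (TG A X C) ==> expands z"
proof (induction rule: T.tensor_induct)
 case zero
 show ?case by (rule expands_zero)
next
 case (tensor x c)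
 show ?case using tensor(2)
 proof (induction rule: C_induct)
  case zero
  show ?case using expands_zero add_maps_zero[OF ab T.ab_tensor T.tensor_right_add_maps[OF tensor(1)]] by simp
 next
  case (gen i \<phi> w)
  show ?case by (rule expands_tensor_hh[OF tensor(1) gen])
 next
  case (add c d)
  show ?case
   unfolding T.tensor_add_right[OF tensor(1) add(1,2)]
   by (rule expands_add[OF T.tensor_closed[OF tensor(1) add(1)] T.tensor_closed[OF tensor(1) add(2)] add(3,4)])
 qed
next
 case (add s t)
 then show ?case by (rule expands_add)
qed

text \<open>All parts of z are built from slices of z, so they vanish, and z is a finite sum of its
  parts.\<close>

lemma slices_separate:
 assumes z: "z .: (TG A X C)" and s: "!!l. l : left_forms A C ==> slice X l z = \<zero>{|X|}"
 shows "z = \<zero>{|TG A X C|}"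
proof -
 from expands[OF z, unfolded expands_def]
 obtain L0 where L0': "finite L0" "L0 <= Sigma I Bs"
  "ALL L. finite L --> L0 <= L --> L <= Sigma I Bs --> z = (\<Oplus>{|TG A X C|} p\<in>L. part p z)"
  by (elim exE conjE)
 have L0: "L0 <= Sigma I Bs" "z = (\<Oplus>{|TG A X C|} p\<in>L0. part p z)"
  by (fact L0'(2), rule L0'(3)[rule_format, OF L0'(1) subset_refl L0'(2)])
 have pz: "part (i, b) z = \<zero>{|TG A X C|}" if i: "i : I" and b: "b : Bs i" for i b
  unfolding part_def fst_conv snd_conv
 proof (rule Tg.add.finprod_one_eqI)
  fix k assume "k : {..<nn i}"
  then have k: "k < nn i" by simp
  note f = comatrix.dbf[OF cmx[OF i]]
  show "tensor A X C (slice X (lam i b (ev i k)) z) (hh i (es i k) b) = \<zero>{|TG A X C|}"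
   unfolding s[OF lam_left_form[OF i b f(1)[OF k]]]
   by (rule add_maps_zero[OF X.ab T.ab_tensor T.tensor_left_add_maps[OF hh_closed[OF i f(2)[OF k] coord_facts(1)[OF i b]]]])
 qed
 have "(\<Oplus>{|TG A X C|} p\<in>L0. part p z) = \<zero>{|TG A X C|}"
 proof (rule Tg.add.finprod_one_eqI[OF _])
  fix p assume "p : L0"
  then have "p : Sigma I Bs" by (rule subsetD[OF L0(1)])
  then show "part p z = \<zero>{|TG A X C|}" using pz by (cases p) simp
 qed
 with L0(2) show ?thesis by (rule trans)
qed

end

text \<open>By naturality f sends the slices of z to those of (f (x) C) z. If the latter element is
  0 and f is injective, all slices of z vanish, hence z does. The type of the test modules plays no
  part in this argument.\<close>

lemma left_flat: "left_flat u A C"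
 unfolding left_flat_def
proof (intro allI impI, elim conjE)
 fix M :: "('a, 'u) rmod" and M' :: "('a, 'u) rmod" and f
 assume M: "right_module A M" and M': "right_module A M'" and f: "f : rmod_hom A M M'" and inj: "inj_on f (carrier M)"
 interpret M: right_module A M by fact
 interpret M': right_module A M' by fact
 interpret T: abelian_group "TG A M C" by (rule tensor_pair.ab_tensor[OF tpM[OF M]])
 interpret T': abelian_group "TG A M' C" by (rule tensor_pair.ab_tensor[OF tpM[OF M']])
 note m = tmap_add_maps(1)[OF tpM[OF M] tpM[OF M'] f lmod_hom_id]
 show "inj_on (tmap A M' C f id) (carrier (TG A M C))"
 proof (rule inj_onI)
  fix s t assume s: "s .: (TG A M C)" and t: "t .: (TG A M C)"
   and e: "tmap A M' C f id s = tmap A M' C f id t"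
  let ?z = "s \<ominus>{|TG A M C|} t"
  have zc: "?z .: (TG A M C)" by (rule T.minus_closed[OF s t])
  have z0: "tmap A M' C f id ?z = \<zero>{|TG A M' C|}"
   using add_maps_minus[OF T.abelian_group_axioms T'.abelian_group_axioms m s t] e add_maps_closed[OF m t] T'.diff_zero_iff by simp
  have "?z = \<zero>{|TG A M C|}"
  proof (rule slices_separate[OF M zc])
   fix l assume l: "l : left_forms A C"
   note sl = slice_add_maps(1)[OF bim M l] and sl' = slice_add_maps(1)[OF bim M' l]
   have "f (slice M l ?z) = slice M' l \<zero>{|TG A M' C|}"
    using slice_natural[OF bim M M' f l zc] z0 by simp
   also have "... = f \<zero>{|M|}"
    using add_maps_zero[OF T'.abelian_group_axioms M'.ab sl'] add_maps_zero[OF M.ab M'.ab rmod_hom_add_maps[OF f]] by simp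
   finally show "slice M l ?z = \<zero>{|M|}"
    by (rule inj_onD[OF inj _ add_maps_closed[OF sl zc] M.zero_closed])
  qed
  then show "s = t" using T.diff_zero_iff s t by simp
 qed
qed

lemma flat_coring: "flat_coring A C"
 by (rule flat_coring.intro[OF coring_axioms flat_coring_axioms.intro[OF left_flat_imp_ideal_flat[OF bim left_flat]]])

end

section \<open>The summands as simple comodules with prescribed endomorphisms\<close>

lemma finsum_swap:
 assumes G: "abelian_group G" and "finite P" "finite Q" and f: "!!i j. i : P ==> j : Q ==> f i j .: G"
 shows "(\<Oplus>{|G|} i\<in>P. \<Oplus>{|G|} j\<in>Q. f i j) = (\<Oplus>{|G|} j\<in>Q. \<Oplus>{|G|} i\<in>P. f i j)"
proof -
 interpret G: abelian_group G by fact
 show ?thesis using assms(2) f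
 proof (induction P rule: finite_induct)
  case empty
  show ?case by (simp add: G.finsum_zero)
 next
  case (insert a P)
  have c: "f i j .: G" if "i : insert a P" "j : Q" for i j using insert.prems that by blast
  have "(\<Oplus>{|G|} i\<in>insert a P. \<Oplus>{|G|} j\<in>Q. f i j) = (\<Oplus>{|G|} j\<in>Q. f a j) \<oplus>{|G|} (\<Oplus>{|G|} i\<in>P. \<Oplus>{|G|} j\<in>Q. f i j)"
   by (rule G.finsum_insert) (use insert.hyps c in "auto intro!: G.finsum_closed")
  also have "... = (\<Oplus>{|G|} j\<in>Q. f a j) \<oplus>{|G|} (\<Oplus>{|G|} j\<in>Q. \<Oplus>{|G|} i\<in>P. f i j)"
   using insert.IH c by simp
  also have "... = (\<Oplus>{|G|} j\<in>Q. f a j \<oplus>{|G|} (\<Oplus>{|G|} i\<in>P. f i j))"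
   by (rule G.finsum_addf[symmetric]) (use c in "auto intro!: G.finsum_closed")
  also have "... = (\<Oplus>{|G|} j\<in>Q. \<Oplus>{|G|} i\<in>insert a P. f i j)"
   by (rule G.finsum_cong') (use insert.hyps c in "auto intro!: G.finsum_closed simp: G.finsum_insert")
  finally show ?case .
 qed
qed

lemma tensor_map_comatrix_comod: "tmap R (comatrix_comod A M D) N = tmap R M N"
 by (rule tensor_cong_left(4)) (simp_all add: comatrix_comod_simps)

context comatrix_decomposed begin

interpretation F: comatrix_family A I S D by (rule cfam)
interpretation FC: flat_coring A C by (rule flat_coring)

abbreviation "sc i \<equiv> summand_comod A C I S D \<theta> i"

lemma sc_simps [simp]:
 "carrier (sc i) = carrier (S i)" "\<zero>{|sc i|} = \<zero>{|S i|}" "(\<oplus>{|sc i|}) = (\<oplus>{|S i|})" "ract (sc i) = ract (S i)"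
 by (simp_all add: summand_comod_def corestrict_def comatrix_comod_simps)

lemma sc_tensor [simp]:
 "TG R (sc i) N = TG R (S i) N" "tensor R (sc i) N = tensor R (S i) N"
 "TR R (sc i) N = TR R (S i) N" "tmap R (sc i) N = tmap R (S i) N"
 by (rule tensor_cong_left; simp)+

lemma sc_assoc [simp]: "tensor_assoc R (sc i) N P = tensor_assoc R (S i) N P"
 by (rule tensor_assoc_cong_left) simp_all

lemma sc_homs [simp]: "rmod_hom A (sc i) N = rmod_hom A (S i) N" "rmod_hom A N (sc i) = rmod_hom A N (S i)"
 by (simp_all add: rmod_hom_def)

lemma rm_sc: "i : I ==> right_module A (sc i)" by (rule right_module_transfer[OF rm]) simp_all

context
 fixes i assumes i: "i : I"
begin

interpretation c: comatrix A "S i" "D i" by (rule cmx[OF i])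
interpretation T: tensor_pair A "S i" C by (rule tpM[OF rm[OF i]])
interpretation Tg: abelian_group "TG A (S i) C" by (rule T.ab_tensor)

lemma summand_lmod_hom: "(%x. \<theta> (dsum_incl I F.CC i x)) : lmod_hom A c.T C"
 using F.incl_hom[OF i] \<theta>_hom add_maps_comp[of "dsum_incl I F.CC i" c.T F.SS \<theta> C] add_maps_closed[of "dsum_incl I F.CC i" c.T F.SS]
 by (auto simp: bimod_hom_iff lmod_hom_def)

lemmas summand_map = tmap_add_maps[OF c.tpMT tpM[OF rm[OF i]] rmod_hom_id summand_lmod_hom]

lemma summand_map_sum:
 assumes y: "!!k. k < nn i ==> y k .: (S i)" and x: "x .: (S i)"
 shows "tmap A (S i) C id (%x. \<theta> (dsum_incl I F.CC i x)) (\<Oplus>{|TG A (S i) c.T|} k\<in>{..<nn i}. tensor A (S i) c.T (y k) (c.tt (es i k) x))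
  = (\<Oplus>{|TG A (S i) C|} k\<in>{..<nn i}. tensor A (S i) C (y k) (hh i (es i k) x))"
proof -
 note cl = tensor_pair.tensor_closed[OF c.tpMT]
 have "tmap A (S i) C id (%x. \<theta> (dsum_incl I F.CC i x)) (\<Oplus>{|TG A (S i) c.T|} k\<in>{..<nn i}. tensor A (S i) c.T (y k) (c.tt (es i k) x))
  = (\<Oplus>{|TG A (S i) C|} k\<in>{..<nn i}. tmap A (S i) C id (%x. \<theta> (dsum_incl I F.CC i x)) (tensor A (S i) c.T (y k) (c.tt (es i k) x)))"
  by (rule add_maps_finsum[OF tensor_pair.ab_tensor[OF c.tpMT] T.ab_tensor summand_map(1)])
   (use y x c.dbf(2) c.tt_closed cl in auto)
 also have "... = (\<Oplus>{|TG A (S i) C|} k\<in>{..<nn i}. tensor A (S i) C (y k) (hh i (es i k) x))"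
 proof (rule Tg.finsum_cong'[OF refl])
  show "(%k. tensor A (S i) C (y k) (hh i (es i k) x)) : {..<nn i} \<rightarrow> carrier (TG A (S i) C)"
   using T.tensor_closed[OF y hh_closed[OF i c.dbf(2) x]] by auto
  fix k assume "k : {..<nn i}"
  then have k: "k < nn i" by simp
  show "tmap A (S i) C id (%x. \<theta> (dsum_incl I F.CC i x)) (tensor A (S i) c.T (y k) (c.tt (es i k) x)) = tensor A (S i) C (y k) (hh i (es i k) x)"
   unfolding summand_map(2)[OF y[OF k] c.tt_closed[OF c.dbf(2)[OF k] x]] by (simp add: hh_def F.gen_def)
 qed
 finally show ?thesis .
qed

lemma coact_sc:
 assumes x: "x .: (S i)"
 shows "coact (sc i) x = (\<Oplus>{|TG A (S i) C|} k\<in>{..<nn i}. tensor A (S i) C (ev i k) (hh i (es i k) x))"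
proof -
 have "coact (sc i) x = tmap A (S i) C id (%x. \<theta> (dsum_incl I F.CC i x)) (coact (comatrix_comod A (S i) (D i)) x)"
  by (simp add: summand_comod_def corestrict_def tensor_map_comatrix_comod)
 then show ?thesis unfolding comatrix_comod_simps by (simp only: summand_map_sum[OF c.dbf(1) x])
qed

lemma sum_term: "k < nn i ==> x .: (S i) ==> y .: (S i) ==> tensor A (S i) C y (hh i (es i k) x) .: (TG A (S i) C)"
 using T.tensor_closed hh_closed[OF i c.dbf(2)] by simp

lemma coact_sc_add_maps: "coact (sc i) : add_maps (S i) (TG A (S i) C)"
proof -
 have "(%x. \<Oplus>{|TG A (S i) C|} k\<in>{..<nn i}. tensor A (S i) C (ev i k) (hh i (es i k) x)) : add_maps (S i) (TG A (S i) C)"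
 proof (rule add_maps_sum[OF c.ab T.ab_tensor])
  fix k assume "k : {..<nn i}"
  then have k: "k < nn i" by simp
  show "(%x. tensor A (S i) C (ev i k) (hh i (es i k) x)) : add_maps (S i) (TG A (S i) C)"
   by (rule add_maps_comp[OF rmod_hom_add_maps[OF hh_right_hom[OF i c.dbf(2)[OF k]]] T.tensor_right_add_maps[OF c.dbf(1)[OF k]]])
 qed
 moreover have "coact (sc i) : add_maps (S i) (TG A (S i) C) \<longleftrightarrow>
   (%x. \<Oplus>{|TG A (S i) C|} k\<in>{..<nn i}. tensor A (S i) C (ev i k) (hh i (es i k) x)) : add_maps (S i) (TG A (S i) C)"
  by (rule add_maps_cong[OF c.ab coact_sc])
 ultimately show ?thesis by (rule iffD2[rotated])
qed

lemma coact_sc_rmod_hom: "coact (sc i) : rmod_hom A (S i) (TR A (S i) C)"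
proof -
 have "coact (sc i) (x <|{|S i|} a) = coact (sc i) x <|{|TR A (S i) C|} a" if x: "x .: (S i)" and a: "a .: A" for x a
 proof -
  note tr = tensor_ract[OF T.is_pair bim a]
  have "coact (sc i) x <|{|TR A (S i) C|} a
   = (\<Oplus>{|TG A (S i) C|} k\<in>{..<nn i}. tensor A (S i) C (ev i k) (hh i (es i k) x) <|{|TR A (S i) C|} a)"
   unfolding coact_sc[OF x]
   by (rule add_maps_finsum[OF T.ab_tensor T.ab_tensor tr(1)]) (use sum_term[OF _ x c.dbf(1)] in auto)
  also have "... = (\<Oplus>{|TG A (S i) C|} k\<in>{..<nn i}. tensor A (S i) C (ev i k) (hh i (es i k) (x <|{|S i|} a)))"
  proof (rule Tg.finsum_cong'[OF refl])
   show "(%k. tensor A (S i) C (ev i k) (hh i (es i k) (x <|{|S i|} a))) : {..<nn i} \<rightarrow> carrier (TG A (S i) C)"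
    using sum_term[OF _ c.ract_closed[OF x a] c.dbf(1)] by auto
   fix k assume "k : {..<nn i}"
   then have k: "k < nn i" by simp
   show "tensor A (S i) C (ev i k) (hh i (es i k) x) <|{|TR A (S i) C|} a = tensor A (S i) C (ev i k) (hh i (es i k) (x <|{|S i|} a))"
    unfolding tr(2)[OF c.dbf(1)[OF k] hh_closed[OF i c.dbf(2)[OF k] x]] rmod_hom_ract[OF hh_right_hom[OF i c.dbf(2)[OF k]] x a] ..
  qed
  finally show ?thesis unfolding coact_sc[OF c.ract_closed[OF x a]] by simp
 qed
 then show ?thesis using coact_sc_add_maps by (simp add: rmod_hom_iff)
qed

lemma hh_comod_hom:
 assumes p: "\<phi> .: (dl i)" shows "hh i \<phi> : comod_hom A C (sc i) (regc C)"
proof (rule comod_homI)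
 note hr = hh_right_hom[OF i p]
 show "hh i \<phi> : rmod_hom A (sc i) (regc C)" using hr by simp
 fix x assume "x .: (sc i)"
 then have x: "x .: (S i)" by simp
 interpret TC: tensor_pair A C C by (rule tpM[OF is_rmod])
 interpret TCg: abelian_group "TG A C C" by (rule TC.ab_tensor)
 note m = tmap_add_maps[OF T.is_pair TC.is_pair hr lmod_hom_id]
 have "tmap A C C (hh i \<phi>) id (coact (sc i) x)
   = (\<Oplus>{|TG A C C|} k\<in>{..<nn i}. tmap A C C (hh i \<phi>) id (tensor A (S i) C (ev i k) (hh i (es i k) x)))"
  unfolding coact_sc[OF x]
  by (rule add_maps_finsum[OF T.ab_tensor TC.ab_tensor m(1)]) (use sum_term[OF _ x c.dbf(1)] in auto)
 also have "... = (\<Oplus>{|TG A C C|} k\<in>{..<nn i}. tensor A C C (hh i \<phi> (ev i k)) (hh i (es i k) x))"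
  by (rule TCg.finsum_cong')
   (use m(2)[OF c.dbf(1) hh_closed[OF i c.dbf(2) x]] TC.tensor_closed[OF hh_closed[OF i p c.dbf(1)] hh_closed[OF i c.dbf(2) x]] in auto)
 also have "... = comult C (hh i \<phi> x)" by (rule comult_hh[OF i p x, symmetric])
 finally show "tmap A (regc C) C (hh i \<phi>) id (coact (sc i) x) = coact (regc C) (hh i \<phi> x)" by simp
qed

lemma slice_sc:
 assumes l: "l : left_forms A C" and x: "x .: (S i)"
 shows "slice (sc i) l (coact (sc i) x) = (\<Oplus>{|sc i|} k\<in>{..<nn i}. ev i k <|{|S i|} l (hh i (es i k) x))"
proof -
 interpret s: right_module A "sc i" by (rule rm_sc[OF i])
 note sl = slice_add_maps[OF bim rm_sc[OF i] l, simplified]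
 have la: "l : add_maps C A" using l by (simp add: left_forms_def)
 have "slice (sc i) l (coact (sc i) x) = (\<Oplus>{|sc i|} k\<in>{..<nn i}. slice (sc i) l (tensor A (S i) C (ev i k) (hh i (es i k) x)))"
  unfolding coact_sc[OF x]
  by (rule add_maps_finsum[OF T.ab_tensor s.ab sl(1)]) (use sum_term[OF _ x c.dbf(1)] in auto)
 also have "... = (\<Oplus>{|sc i|} k\<in>{..<nn i}. ev i k <|{|S i|} l (hh i (es i k) x))"
  by (rule s.finsum_cong')
   (use sl(2)[OF c.dbf(1) hh_closed[OF i c.dbf(2) x]] c.ract_closed[OF c.dbf(1) add_maps_closed[OF la hh_closed[OF i c.dbf(2) x]]] in auto)
 finally show ?thesis .
qed

lemma finsum_sc: "f : J \<rightarrow> carrier (S i) ==> finite J ==> finsum (sc i) f J = finsum (S i) f J"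
proof -
 interpret s: right_module A "sc i" by (rule rm_sc[OF i])
 assume "finite J" "f : J \<rightarrow> carrier (S i)"
 then show ?thesis
  by (induction J rule: finite_induct) (auto simp: s.finsum_insert c.finsum_insert)
qed

text \<open>Both sides of coassociativity expand to the same double sum over the dual basis, in
  different orders. The counit axiom is the dual basis formula itself.\<close>

lemma comodule_sc: "right_comodule A C (sc i)"
proof (rule right_comodule.intro[OF rm_sc[OF i] right_comodule_axioms.intro])
 show "coact (sc i) : rmod_hom A (sc i) (TR A (sc i) C)" using coact_sc_rmod_hom by simp
next
 fix x assume "x .: (sc i)"
 then have x: "x .: (S i)" by simp
 interpret X: tensor_triple A "S i" C C by (rule triple[OF rm[OF i]])
 interpret Y: abelian_group "TG A (S i) (TB A C C)" by (rule X.ab2)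
 interpret TC: tensor_pair A C C by (rule tpM[OF is_rmod])
 interpret T2: tensor_pair A "S i" "TB A C C" by (rule X.tp2)
 note h = hh_closed[OF i c.dbf(2)] and e = c.dbf(1)
 let ?G = "TG A (S i) (TB A C C)"
 let ?t = "%l k. tensor A (S i) (TB A C C) (ev i l) (tensor A C C (hh i (es i l) (ev i k)) (hh i (es i k) x))"
 have tc: "?t l k .: ?G" if "l < nn i" "k < nn i" for l k
  by (rule T2.tensor_closed[OF e[OF that(1)]]) (use TC.tensor_closed[OF h[OF that(1) e[OF that(2)]] h[OF that(2) x]] in simp)
 note cm = tmap_add_maps[OF X.tpMN X.tp1 coact_sc_rmod_hom lmod_hom_id]
 note dm = tmap_add_maps[OF X.tpMN X.tp2 rmod_hom_id comult_lmod_hom]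
 have am: "(%t. tensor_assoc A (S i) C C (tmap A (TR A (S i) C) C (coact (sc i)) id t)) : add_maps (TG A (S i) C) ?G"
  by (rule add_maps_comp[OF cm(1) X.tensor_assoc_add_maps])
 have 1: "tensor_assoc A (S i) C C (tmap A (TR A (S i) C) C (coact (sc i)) id (tensor A (S i) C (ev i k) (hh i (es i k) x)))
   = (\<Oplus>{|?G|} l\<in>{..<nn i}. ?t l k)" if k: "k < nn i" for k
 proof -
  note hk = h[OF k x]
  interpret T1: tensor_pair A "TR A (S i) C" C by (rule X.tp1)
  have la: "(%t. tensor A (TR A (S i) C) C t (hh i (es i k) x)) : add_maps (TG A (S i) C) (TG A (TR A (S i) C) C)"
   using T1.tensor_left_add_maps[OF hk] by simp
  have "tensor_assoc A (S i) C C (tmap A (TR A (S i) C) C (coact (sc i)) id (tensor A (S i) C (ev i k) (hh i (es i k) x)))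
   = tensor_assoc A (S i) C C (tensor A (TR A (S i) C) C (coact (sc i) (ev i k)) (hh i (es i k) x))"
   using cm(2)[OF e[OF k] hk] by simp
  also have "... = (\<Oplus>{|?G|} l\<in>{..<nn i}. tensor_assoc A (S i) C C (tensor A (TR A (S i) C) C (tensor A (S i) C (ev i l) (hh i (es i l) (ev i k))) (hh i (es i k) x)))"
   unfolding coact_sc[OF e[OF k]]
   by (rule add_maps_finsum[OF T.ab_tensor X.ab2 add_maps_comp[OF la X.tensor_assoc_add_maps]]) (use sum_term[OF _ e[OF k] e] in auto)
  also have "... = (\<Oplus>{|?G|} l\<in>{..<nn i}. ?t l k)"
   by (rule Y.finsum_cong') (use X.tensor_assoc_tensor[OF e h[OF _ e[OF k]] hk] tc[OF _ k] in auto)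
  finally show ?thesis .
 qed
 have 2: "tmap A (S i) (TB A C C) id (comult C) (tensor A (S i) C (ev i l) (hh i (es i l) x)) = (\<Oplus>{|?G|} k\<in>{..<nn i}. ?t l k)"
  if l: "l < nn i" for l
 proof -
  have ra: "tensor A (S i) (TB A C C) (ev i l) : add_maps (TG A C C) ?G"
   using T2.tensor_right_add_maps[OF e[OF l]] by simp
  have "tmap A (S i) (TB A C C) id (comult C) (tensor A (S i) C (ev i l) (hh i (es i l) x))
   = tensor A (S i) (TB A C C) (ev i l) (comult C (hh i (es i l) x))" using dm(2)[OF e[OF l] h[OF l x]] by simp
  also have "... = (\<Oplus>{|?G|} k\<in>{..<nn i}. ?t l k)"
   unfolding comult_hh[OF i c.dbf(2)[OF l] x]
   by (rule add_maps_finsum[OF TC.ab_tensor X.ab2 ra]) (use TC.tensor_closed[OF h[OF l e] h[OF _ x]] in auto)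
  finally show ?thesis .
 qed
 have "tensor_assoc A (S i) C C (tmap A (TR A (S i) C) C (coact (sc i)) id (coact (sc i) x))
  = (\<Oplus>{|?G|} k\<in>{..<nn i}. tensor_assoc A (S i) C C (tmap A (TR A (S i) C) C (coact (sc i)) id (tensor A (S i) C (ev i k) (hh i (es i k) x))))"
  unfolding coact_sc[OF x] by (rule add_maps_finsum[OF T.ab_tensor X.ab2 am]) (use sum_term[OF _ x e] in auto)
 also have "... = (\<Oplus>{|?G|} k\<in>{..<nn i}. \<Oplus>{|?G|} l\<in>{..<nn i}. ?t l k)"
  by (rule Y.finsum_cong') (use 1 tc in "auto intro!: Y.finsum_closed")
 also have "... = (\<Oplus>{|?G|} l\<in>{..<nn i}. \<Oplus>{|?G|} k\<in>{..<nn i}. ?t l k)"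
  by (rule finsum_swap[OF X.ab2]) (use tc in auto)
 also have "... = (\<Oplus>{|?G|} l\<in>{..<nn i}. tmap A (S i) (TB A C C) id (comult C) (tensor A (S i) C (ev i l) (hh i (es i l) x)))"
  by (rule Y.finsum_cong'[symmetric]) (use 2 tc in "auto intro!: Y.finsum_closed")
 also have "... = tmap A (S i) (TB A C C) id (comult C) (coact (sc i) x)"
  unfolding coact_sc[OF x] by (rule add_maps_finsum[OF T.ab_tensor X.ab2 dm(1), symmetric]) (use sum_term[OF _ x e] in auto)
 finally show "tensor_assoc A (sc i) C C (tmap A (TR A (sc i) C) C (coact (sc i)) id (coact (sc i) x))
  = tmap A (sc i) (TB A C C) id (comult C) (coact (sc i) x)" by simp
next
 fix x assume "x .: (sc i)"
 then have x: "x .: (S i)" by simp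
 interpret s: right_module A "sc i" by (rule rm_sc[OF i])
 have "slice (sc i) (counit C) (coact (sc i) x) = (\<Oplus>{|sc i|} k\<in>{..<nn i}. ev i k <|{|S i|} es i k x)"
  unfolding slice_sc[OF counit_left_form x]
  by (rule s.finsum_cong') (use counit_hh[OF i c.dbf(2) x] c.ract_closed[OF c.dbf(1) c.dbf(5)[OF _ x]] in auto)
 also have "... = x" using c.dbf(4)[OF x] by (subst finsum_sc) (use c.ract_closed[OF c.dbf(1) c.dbf(5)[OF _ x]] in auto)
 finally show "tensor_lift (sc i) (%(y, c). y <|{|sc i|} counit C c) (coact (sc i) x) = x" unfolding slice_def .
qed

text \<open>This is \<open>can_D\<close>, transported to C.\<close>

lemma D_comod_hom: assumes d: "d : D i" shows "d : comod_hom A C (sc i) (sc i)"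
proof (rule comod_homI)
 show "d : rmod_hom A (sc i) (sc i)" using D_hom[OF i d] by simp
 fix x assume "x .: (sc i)"
 then have x: "x .: (S i)" by simp
 note m = tmap_add_maps[OF T.is_pair T.is_pair D_hom[OF i d] lmod_hom_id]
 note dc = D_closed[OF i d]
 have "tmap A (S i) C d id (coact (sc i) x)
   = (\<Oplus>{|TG A (S i) C|} k\<in>{..<nn i}. tmap A (S i) C d id (tensor A (S i) C (ev i k) (hh i (es i k) x)))"
  unfolding coact_sc[OF x]
  by (rule add_maps_finsum[OF T.ab_tensor T.ab_tensor m(1)]) (use sum_term[OF _ x c.dbf(1)] in auto)
 also have "... = (\<Oplus>{|TG A (S i) C|} k\<in>{..<nn i}. tensor A (S i) C (d (ev i k)) (hh i (es i k) x))"
  by (rule Tg.finsum_cong') (use m(2)[OF c.dbf(1) hh_closed[OF i c.dbf(2) x]] sum_term[OF _ x dc[OF c.dbf(1)]] in auto)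
 also have "... = tmap A (S i) C id (%x. \<theta> (dsum_incl I F.CC i x)) (c.can (d x))"
  unfolding c.can_D[OF d x, symmetric] by (rule summand_map_sum[OF dc[OF c.dbf(1)] x, symmetric])
 also have "... = coact (sc i) (d x)"
  unfolding c.can_def coact_sc[OF dc[OF x]] by (rule summand_map_sum[OF c.dbf(1) dc[OF x]])
 finally show "tmap A (sc i) C d id (coact (sc i) x) = coact (sc i) (d x)" by simp
qed

text \<open>Zero is not among the units of a division subring, while the identity is; on a zero
  module the two would agree.\<close>

lemma summand_nonzero: "EX x:carrier (S i). x ~= \<zero>{|S i|}"
proof (rule ccontr)
 assume n: "\<not> (EX x:carrier (S i). x ~= \<zero>{|S i|})"
 have one: "\<one>{|End_ring A (S i)|} : D i" by (rule subringE(3)[OF sr[OF i]])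
 have "\<one>{|End_ring A (S i)|} \<otimes>{|End_ring A (S i)|} \<one>{|End_ring A (S i)|} = \<one>{|End_ring A (S i)|}"
  using c.End_ring_ring by (simp add: ring.ring_simprules)
 then have "\<one>{|End_ring A (S i)|} : Units (End_ring A (S i)(|carrier := D i|))" using one by (auto simp: Units_def)
 then have "\<one>{|End_ring A (S i)|} ~= \<zero>{|End_ring A (S i)|}" using un[OF i] by blast
 then show False using n by (auto simp: End_ring_simps restrict_ext_iff)
qed

text \<open>Slicing the coaction by the coordinate functionals recovers the coordinates; this makes
 the comodule generated by a nonzero vector everything and determines all homomorphisms.\<close>

lemma slice_lam:
 assumes j: "j : I" and b: "b : Bs j" and v: "v .: (S j)" and w: "w .: (S i)"
 shows "slice (sc i) (lam j b v) (coact (sc i) w) = (if i = j then cc j b w v else \<zero>{|S i|})"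
proof -
 interpret s: right_module A "sc i" by (rule rm_sc[OF i])
 note lf = lam_left_form[OF j b v]
 show ?thesis
 proof (cases "i = j")
  case True
  note cv = cc_closed[OF j b _ v, folded True, OF w]
  have "slice (sc i) (lam j b v) (coact (sc i) w) = (\<Oplus>{|sc i|} k\<in>{..<nn i}. ev i k <|{|S i|} es i k (cc i b w v))"
   unfolding slice_sc[OF lf w]
   by (rule s.finsum_cong') (use lam(2)[OF j b v i c.dbf(2) w] True c.ract_closed[OF c.dbf(1) c.dbf(5)[OF _ cv]] in auto)
  also have "... = cc i b w v"
   using c.dbf(4)[OF cv] by (subst finsum_sc) (use c.ract_closed[OF c.dbf(1) c.dbf(5)[OF _ cv]] in auto)
  finally show ?thesis using True by simp
 next
  case False
  have "slice (sc i) (lam j b v) (coact (sc i) w) = (\<Oplus>{|sc i|} k\<in>{..<nn i}. \<zero>{|sc i|})"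
   unfolding slice_sc[OF lf w]
   by (rule s.finsum_cong') (use lam(2)[OF j b v i c.dbf(2) w] False c.ract_zero_right[OF c.dbf(1)] in auto)
  also have "... = \<zero>{|sc i|}" by (rule s.finsum_zero)
  finally show ?thesis using False by simp
 qed
qed

text \<open>Some coordinate of w is a nonzero element of D, and e is its inverse. Hence every y is
  the value of a coordinate of w at a suitable vector, that is, a slice of the coaction of
  w.\<close>

lemma coordinate_nonzero:
 assumes w: "w .: (S i)" "w ~= \<zero>{|S i|}"
 obtains b e where "b : Bs i" "e : D i" "!!y. y .: (S i) ==> cc i b w (e y) = y"
proof -
 have "{b\<in>Bs i. cc i b w b ~= \<zero>{|S i|}} ~= {}"
 proof
  assume e: "{b\<in>Bs i. cc i b w b ~= \<zero>{|S i|}} = {}"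
  show False using coord_facts(6)[OF i w(1)] w(2) unfolding e by simp
 qed
 then obtain b where b: "b : Bs i" "cc i b w b ~= \<zero>{|S i|}" by blast
 show thesis
 proof (rule c.D_inverse[OF sr[OF i] un[OF i] coord_facts(2)[OF i b(1) w(1)] coord_facts(1)[OF i b(1)] b(2)])
  fix e assume "e : D i" "!!y. y .: (S i) ==> cc i b w (e y) = y"
  then show thesis by (rule that[OF b(1)])
 qed
qed

text \<open>Slicing is natural and f is colinear, so f may be applied before or after slicing the
  coaction.\<close>

lemma comod_hom_formula:
 assumes j: "j : I" and f: "f : comod_hom A C (sc i) (sc j)" and b: "b : Bs i" and w: "w .: (S i)" and v: "v .: (S i)"
 shows "f (cc i b w v) = slice (sc j) (lam i b v) (coact (sc j) (f w))"
proof -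
 have cw: "coact (sc i) w .: (TG A (sc i) C)" using add_maps_closed[OF coact_sc_add_maps w] by simp
 have "slice (sc j) (lam i b v) (tmap A (sc j) C f id (coact (sc i) w)) = f (slice (sc i) (lam i b v) (coact (sc i) w))"
  by (rule slice_natural[OF bim rm_sc[OF i] rm_sc[OF j] comod_hom_rmod[OF f] lam_left_form[OF i b v] cw])
 moreover have "tmap A (sc j) C f id (coact (sc i) w) = coact (sc j) (f w)"
  by (rule comod_hom_coact[OF f]) (use w in simp)
 moreover have "slice (sc i) (lam i b v) (coact (sc i) w) = cc i b w v" using slice_lam[OF i b v w] by simp
 ultimately show ?thesis by metis
qed

lemma simple_sc: "simple_comodule A C (sc i)"
 unfolding FC.simple_iff
proof (intro conjI allI impI)
 show "right_comodule A C (sc i)" by (rule comodule_sc)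
 show "carrier (sc i) ~= {\<zero>{|sc i|}}" using summand_nonzero by auto
 fix W assume W: "stable A C (sc i) W"
 note Wc = submod_closed[OF stable_submod[OF W]]
 show "W = {\<zero>{|sc i|}} \<or> W = carrier (sc i)"
 proof (rule disjCI)
  assume "W ~= carrier (sc i)"
  show "W = {\<zero>{|sc i|}}"
  proof (rule ccontr)
   assume "W ~= {\<zero>{|sc i|}}"
   then obtain w where w: "w : W" "w ~= \<zero>{|S i|}" using Wc(2) by auto
   have wS: "w .: (S i)" using Wc(1)[OF w(1)] by simp
   have "y : W" if y: "y .: (S i)" for y
   proof (rule coordinate_nonzero[OF wS w(2)])
    fix b e assume b: "b : Bs i" and e: "e : D i" "!!y. y .: (S i) ==> cc i b w (e y) = y"
    note ey = D_closed[OF i e(1) y]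
    have "slice (sc i) (lam i b (e y)) (coact (sc i) w) : W"
    by (rule slice_tspan[OF bim rm_sc[OF i] lam_left_form[OF i b ey] stable_submod[OF W] stable_coact[OF W w(1)]])
    then show "y : W" using slice_lam[OF i b ey wS] e(2)[OF y] by simp
   qed
   then have "W = carrier (sc i)" using Wc(1) by auto
   then show False using \<open>W ~= carrier (sc i)\<close> by simp
  qed
 qed
qed

text \<open>With e the inverse of the coordinate c_b(w), the formula reads f y = c_b(f w) (e y), so
  f is a product of two elements of D.\<close>

lemma comod_End_sc: "comod_hom A C (sc i) (sc i) \<inter> extensional (carrier (S i)) = D i"
proof (intro equalityI subsetI)
 show "d : comod_hom A C (sc i) (sc i) \<inter> extensional (carrier (S i))" if "d : D i" for d
  using D_comod_hom[OF that] c.D_ext[OF that] by simp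
 fix f assume f: "f : comod_hom A C (sc i) (sc i) \<inter> extensional (carrier (S i))"
 then have fh: "f : comod_hom A C (sc i) (sc i)" and fe: "f : extensional (carrier (S i))" by simp_all
 obtain w where w: "w .: (S i)" "w ~= \<zero>{|S i|}" using summand_nonzero by blast
 have fw: "f w .: (S i)" using rmod_hom_closed[OF comod_hom_rmod[OF fh], of w] w(1) by simp
 show "f : D i"
 proof (rule coordinate_nonzero[OF w])
  fix b e assume b: "b : Bs i" and e: "e : D i" "!!y. y .: (S i) ==> cc i b w (e y) = y"
  have "f y = cc i b (f w) (e y)" if y: "y .: (S i)" for y
   using comod_hom_formula[OF i fh b w(1) D_closed[OF i e(1) y]] slice_lam[OF i b D_closed[OF i e(1) y] fw] e(2)[OF y] by simp
  then have "f = compose (carrier (S i)) (cc i b (f w)) e"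
   by (intro extensionalityI[OF fe]) (auto simp: compose_def)
  then show "f : D i" using c.D_comp[OF sr[OF i] un[OF i] coord_facts(2)[OF i b fw] e(1)] by simp
 qed
qed

text \<open>The formula expresses f y as a slice of a coaction in the summand j by a functional that
  is supported on the summand i.\<close>

lemma comod_hom_sc_zero:
 assumes j: "j : I" "i ~= j" and f: "f : comod_hom A C (sc i) (sc j)" and y: "y .: (S i)"
 shows "f y = \<zero>{|S j|}"
proof -
 obtain w where w: "w .: (S i)" "w ~= \<zero>{|S i|}" using summand_nonzero by blast
 have fw: "f w .: (S j)" using rmod_hom_closed[OF comod_hom_rmod[OF f], of w] w(1) by simp
 show ?thesis
 proof (rule coordinate_nonzero[OF w])
  fix b e assume b: "b : Bs i" and e: "e : D i" "!!y. y .: (S i) ==> cc i b w (e y) = y"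
  note ey = D_closed[OF i e(1) y]
  have "slice (sc j) (lam i b (e y)) (coact (sc j) (f w)) = \<zero>{|S j|}"
   using comatrix_decomposed.slice_lam[OF comatrix_decomposed_axioms j(1) i b ey fw] j(2) by simp
  then show "f y = \<zero>{|S j|}" using comod_hom_formula[OF j(1) f b w(1) ey] e(2)[OF y] by simp
 qed
qed

end

end

section \<open>Semisimplicity of sums of simple subcomodules\<close>

context coring begin

lemma stable_ssum:
 assumes M: "precomod A C M" and B: "!!N. N : B ==> stable A C M (F N)"
 shows "stable A C M (ssum M F B)"
proof -
 interpret M: right_module A M by (rule precomod_module[OF M])
 note Bc = submod_closed[OF stable_submod[OF B]]
 have sg: "additive_subgroup (F N) M" if "N : B" for N using stable_submod[OF B[OF that]] by (simp add: submod_def)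
 have FB: "F N <= ssum M F B" if "N : B" for N by (rule ssum_incl[where X = B and F = F, OF M.ab sg subset_refl that])
 have cl: "y .: M" if "y : ssum M F B" for y by (rule ssum_closed[where X = B and F = F, OF M.ab sg subset_refl that])
 note ca = M[unfolded precomod_def, THEN conjunct2]
 have T: "abelian_group (TG A M C)" by (rule tensor_pair.ab_tensor[OF tpM[OF M.is_rmod]])
 have ract: "y <|{|M|} a : ssum M F B" if "y : ssum M F B" "a .: A" for y a
  using that(1)
 proof (induction rule: ssum.induct)
  case zero
  show ?case using M.ract_zero_left[OF that(2)] ssum.zero[of M F B] by simp
 next
  case (add N x y)
  have "(x \<oplus>{|M|} y) <|{|M|} a = x <|{|M|} a \<oplus>{|M|} y <|{|M|} a"
   by (rule M.ract_add_left[OF Bc(1)[OF add(1,2)] cl[OF add(3)] that(2)])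
  also have "... : ssum M F B"
   by (rule ssum.add[of N B "x <|{|M|} a" F "y <|{|M|} a" M, OF add(1) Bc(4)[OF add(1,2) that(2)] add.IH])
  finally show ?case .
 qed
 show ?thesis
 proof (rule stableI)
  show "submod A M (ssum M F B)"
   unfolding submod_def by (intro conjI ballI ssum_subgroup[where X = B and F = F, OF M.ab sg subset_refl] ract)
  fix y assume "y : ssum M F B"
  then show "coact M y : tspan A M C (ssum M F B)"
  proof (induction rule: ssum.induct)
   case zero
   show ?case using add_maps_zero[OF M.ab T ca] tspan.zero[of A M C "ssum M F B"] by simp
  next
   case (add N x y)
   show ?case
    unfolding add_maps_add[OF ca Bc(1)[OF add(1,2)] cl[OF add(3)]]
    by (rule tspan.add[OF tspan_mono[OF stable_coact[OF B[OF add(1)] add(2)] FB[OF add(1)]] add.IH])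
  qed
 qed
qed

end

context flat_coring begin

text \<open>A stable subset of the image is stable in P, and its preimage in M is stable, hence zero
  or everything.\<close>

lemma simple_image:
 fixes M :: "('a, 'c, 'm) comod" and P :: "('a, 'c, 'n) comod"
 assumes M: "simple_comodule A C M" and P: "right_comodule A C P" and f: "f : comod_hom A C M P"
  and x: "x .: M" "f x ~= \<zero>{|P|}"
 shows "simple_comodule A C (sub_comod A C P (f ` carrier M))" "subcomodule A C (sub_comod A C P (f ` carrier M)) P"
proof -
 let ?N = "sub_comod A C P (f ` carrier M)"
 note Pp = right_comodule_precomod[OF P] and Mp = simple_precomod[OF M]
 interpret M: right_module A M by (rule precomod_module[OF Mp])
 interpret P: right_module A P by (rule precomod_module[OF Pp])
 have st: "stable A C P (f ` carrier M)" by (rule stable_image[OF Mp Pp f stable_full[OF Mp]])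
 show sub: "subcomodule A C ?N P" by (rule stable_subcomodule[OF P st])
 then have Nr: "right_comodule A C ?N" and ih: "id : comod_hom A C ?N P" by (simp_all add: subcomodule_def)
 have f0: "f \<zero>{|M|} = \<zero>{|P|}" by (rule add_maps_zero[OF M.ab P.ab rmod_hom_add_maps[OF comod_hom_rmod[OF f]]])
 show "simple_comodule A C ?N"
  unfolding simple_iff
 proof (intro conjI allI impI)
  show "right_comodule A C ?N" by (rule Nr)
  have "f x .: ?N" using x(1) by simp
  then show "carrier ?N ~= {\<zero>{|?N|}}" using x(2) by (metis singletonD sub_comod_simps(2))
  fix W assume W: "stable A C ?N W"
  note Wc = submod_closed[OF stable_submod[OF W]]
  have "stable A C P (id ` W)" by (rule stable_image[OF right_comodule_precomod[OF Nr] Pp ih W])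
  then have "stable A C P W" by simp
  from stable_preimage[OF Mp Pp f this] have pre: "stable A C M {y : carrier M. f y : W}" .
  then have "{y : carrier M. f y : W} = {\<zero>{|M|}} \<or> {y : carrier M. f y : W} = carrier M"
   using M unfolding simple_iff by blast
  then show "W = {\<zero>{|?N|}} \<or> W = carrier ?N"
  proof
   assume e: "{y : carrier M. f y : W} = {\<zero>{|M|}}"
   have wz: "w = \<zero>{|P|}" if w: "w : W" for w
   proof -
    have "w : f ` carrier M" using Wc(1)[OF w] by simp
    then obtain y where y: "w = f y" "y .: M" by (rule imageE)
    then have "y : {y : carrier M. f y : W}" using w by simp
    then have "y = \<zero>{|M|}" unfolding e by simp
    then show ?thesis using y(1) f0 by simp
   qed
   have "W = {\<zero>{|P|}}"
   proof (intro equalityI subsetI)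
    show "w : {\<zero>{|P|}}" if "w : W" for w unfolding wz[OF that] by (rule singletonI)
    show "w : W" if "w : {\<zero>{|P|}}" for w using that Wc(2) by simp
   qed
   then show ?thesis by simp
  next
   assume e: "{y : carrier M. f y : W} = carrier M"
   have "f ` carrier M <= W"
   proof (rule image_subsetI)
    fix y assume "y .: M"
    then have "y : {y : carrier M. f y : W}" unfolding e .
    then show "f y : W" by simp
   qed
   moreover have "W <= f ` carrier M" using Wc(1) by auto
   ultimately show ?thesis by simp
  qed
 qed
qed

text \<open>A simple subcomodule meets a stable sum in a stable subset, hence trivially or
  completely; this is the dichotomy of \<open>exists_independent_spanning\<close>.\<close>

lemma semisimple_regular:
 assumes gen: "!!c. c .: C ==>
  c : ssum (regc C) carrier {N. simple_comodule A C N & subcomodule A C N (regc C)}"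
 shows "semisimple_comodule A C (regc C)"
proof -
 let ?R = "regc C"
 define X where "X = {N. simple_comodule A C N & subcomodule A C N ?R}"
 note rr = regular_comodule and rp = right_comodule_precomod[OF regular_comodule]
 interpret R: right_module A ?R by (rule precomod_module[OF rp])
 have Xs: "simple_comodule A C N" "subcomodule A C N ?R" if "N : X" for N using that by (simp_all add: X_def)
 have st: "stable A C ?R (carrier N)" if "N : X" for N by (rule subcomodule_stable[OF rr Xs(2)[OF that]])
 have sg: "additive_subgroup (carrier N) ?R" if "N : X" for N using stable_submod[OF st[OF that]] by (simp add: submod_def)
 have ih: "id : comod_hom A C N ?R" if "N : X" for N using Xs(2)[OF that] by (simp add: subcomodule_def)
 have abN: "abelian_group N" if "N : X" for N by (rule right_module_ab[OF precomod_module[OF simple_precomod[OF Xs(1)[OF that]]]])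
 have z: "\<zero>{|N|} = \<zero>{|?R|}" if "N : X" for N
  using add_maps_zero[OF abN[OF that] R.ab rmod_hom_add_maps[OF comod_hom_rmod[OF ih[OF that]]]] by simp
 have ad: "x \<oplus>{|N|} y = x \<oplus>{|?R|} y" if "N : X" "x .: N" "y .: N" for N x y
  using add_maps_add[OF rmod_hom_add_maps[OF comod_hom_rmod[OF ih[OF that(1)]]] that(2,3)] by simp
 have dich: "carrier N \<inter> ssum ?R carrier B <= {\<zero>{|?R|}} \<or> carrier N <= ssum ?R carrier B" if N: "N : X" and B: "B <= X" for N B
 proof -
  have "stable A C ?R (ssum ?R carrier B)" by (rule stable_ssum[OF rp]) (rule st[OF subsetD[OF B]])
  from stable_preimage[OF simple_precomod[OF Xs(1)[OF N]] rp ih[OF N] this]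
  have "stable A C N {x : carrier N. id x : ssum ?R carrier B}" .
  then have "{x : carrier N. id x : ssum ?R carrier B} = {\<zero>{|N|}} \<or> {x : carrier N. id x : ssum ?R carrier B} = carrier N"
   using Xs(1)[OF N] unfolding simple_iff by blast
  then show ?thesis
  proof
   assume e: "{x : carrier N. id x : ssum ?R carrier B} = {\<zero>{|N|}}"
   have "carrier N \<inter> ssum ?R carrier B = {x : carrier N. id x : ssum ?R carrier B}" by auto
   then show ?thesis unfolding e z[OF N] by (intro disjI1) (rule equalityD1)
  next
   assume e: "{x : carrier N. id x : ssum ?R carrier B} = carrier N"
   have "carrier N <= ssum ?R carrier B"
   proof
    fix x assume "x .: N"
    then have "x : {x : carrier N. id x : ssum ?R carrier B}" unfolding e .
    then show "x : ssum ?R carrier B" by simp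
   qed
   then show ?thesis by (rule disjI2)
  qed
 qed
 show ?thesis
 proof (rule exists_independent_spanning[where X = X and F = carrier, OF R.ab sg dich])
  fix B assume B: "B <= X" "independent_family ?R carrier B" "!!N. N : X ==> carrier N <= ssum ?R carrier B"
  note BX = subsetD[OF B(1)]
  have sgB: "additive_subgroup (ssum ?R carrier B) ?R" by (rule ssum_subgroup[where X = X and F = carrier, OF R.ab sg B(1)])
  have full: "ssum ?R carrier B = carrier ?R"
  proof (intro equalityI subsetI)
   fix c assume c: "c : ssum ?R carrier B"
   show "c .: ?R" by (rule ssum_closed[where X = X and F = carrier, OF R.ab sg B(1) c])
  next
   fix c assume "c .: ?R"
   then have "c : ssum ?R carrier X" using gen by (simp add: X_def)
   then show "c : ssum ?R carrier B"
   proof (induction rule: ssum.induct)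
    case zero
    show ?case by (rule ssum.zero)
   next
    case (add N x y)
    show ?case by (rule additive_subgroup.a_closed[OF sgB subsetD[OF B(3)[OF add(1)] add(2)] add.IH])
   qed
  qed
  have bij: "bij_betw (dsum_lift B (%N. N) ?R (%_ x. x)) (carrier (dsum B (%N. N))) (carrier ?R)"
   unfolding full[symmetric]
   by (rule independent_dsum_bij[where X = X and F = carrier, OF R.ab sg B(1,2)]) (use abN[OF BX] z[OF BX] ad[OF BX] in simp_all)
  have "{N\<in>B. f N ~= \<zero>{|N|}} = {N\<in>B. f N ~= \<zero>{|?R|}}" for f using z[OF BX] by auto
  then have e: "dsum_lift B (%N. N) ?R (%_ x. x) = (%f. \<Oplus>{|?R|} N\<in>{N\<in>B. f N ~= \<zero>{|?R|}}. f N)"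
   by (simp add: dsum_lift_def[abs_def])
  have "bij_betw (%f. \<Oplus>{|?R|} N\<in>{N\<in>B. f N ~= \<zero>{|?R|}}. f N) (carrier (sum_group B add_monoid)) (carrier ?R)"
   using bij unfolding e by (simp add: dsum_def add_ring_simps)
  then show ?thesis
   unfolding semisimple_comodule_def using rr Xs[OF BX] by blast
 qed
qed

end

section \<open>Classification of the simple comodules and uniqueness of the decomposition\<close>

context comatrix_decomposed begin

interpretation FC: flat_coring A C by (rule flat_coring)

definition "KK = {(sc i, k) | i k. i : I & k : comod_hom A C (sc i) (regc C)}"

lemma KK: "Tk : KK ==> simple_comodule A C (fst Tk) & snd Tk : comod_hom A C (fst Tk) (regc C)"
 by (auto simp: KK_def simple_sc)

lemma KK_closed: "Tk : KK ==> t .: (fst Tk) ==> snd Tk t .: C"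
 using rmod_hom_closed[OF comod_hom_rmod[OF KK[THEN conjunct2]]] by simp

lemma KK_generates: "c .: C ==> EX L. set L <= KK & c : img C L carrier"
proof (induction rule: C_induct)
 case zero
 show ?case by (rule exI[of _ "[]"]) simp
next
 case (gen i \<phi> x)
 have "(sc i, hh i \<phi>) : KK" unfolding KK_def using gen hh_comod_hom by (intro CollectI exI[of _ i] exI[of _ "hh i \<phi>"]) simp
 moreover have "hh i \<phi> x = hh i \<phi> x \<oplus> \<zero>" using hh_closed[OF gen] by simp
 ultimately show ?case using gen(3) by (intro exI[of _ "[(sc i, hh i \<phi>)]"]) auto
next
 case (add c d)
 from add(3) obtain L where L: "set L <= KK" "c : img C L carrier" by (elim exE conjE)
 from add(4) obtain L' where L': "set L' <= KK" "d : img C L' carrier" by (elim exE conjE)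
 have cl: "img C L carrier <= carrier C" if "set L <= KK" for L by (rule img_closed[OF ab]) (rule KK_closed[OF subsetD[OF that]])
 have "c \<oplus> d : img C (L @ L') carrier"
  by (rule img_append[OF ab cl[OF L(1)] cl[OF L'(1)] KK_closed[OF subsetD[OF L(1)]] L(2) L'(2)])
 then show ?case using L(1) L'(1) by (intro exI[of _ "L @ L'"]) simp
qed

text \<open>The coaction of X is nonzero at a nonzero x by counitality, and it lifts through
  finitely many summands. So one of the lifted maps X -> \<open>sc i\<close> is nonzero at x, and it
  is an isomorphism by Schur's lemma.\<close>

lemma simple_iso_summand:
 fixes X :: "('a, 'c, 's) comod"
 assumes X: "simple_comodule A C X" shows "EX i:I. comod_iso A C X (sc i) ~= {}"
proof -
 interpret X: right_comodule A C X by (rule FC.simple_comodule_right[OF X])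
 interpret T: tensor_pair A X C by (rule tpM[OF X.is_rmod])
 obtain x where x: "x .: X" "x ~= \<zero>{|X|}" using X X.zero_closed unfolding simple_comodule_def by blast
 have cx: "coact X x ~= \<zero>{|tensor_comod A C X|}"
 proof
  assume "coact X x = \<zero>{|tensor_comod A C X|}"
  then have "slice X (counit C) (coact X x) = \<zero>{|X|}"
   using add_maps_zero[OF T.ab_tensor X.ab slice_add_maps(1)[OF bim X.is_rmod counit_left_form]] by simp
  then show False using comodule_counit[OF X.right_comodule_axioms x(1)] x(2) by simp
 qed
 have K1: "!!T k. (T, k) : KK ==> simple_comodule A C T & k : comod_hom A C T (regc C)" using KK by fastforce
 obtain L where L: "!!T g. (T, g) : set L ==> EX k u. (T, k) : KK & u .: X & g = (%t. tensor A X C u (k t))"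
  and l: "lifts A C X (tensor_comod A C X) L (coact X)"
  using FC.coact_lifts[OF X K1 KK_generates] by metis
 have p: "precomod A C (tensor_comod A C X)" by (rule precomod_tensor_comod[OF X.is_rmod])
 have "EX Tg:set L. EX s:comod_hom A C X (fst Tg). s x ~= \<zero>{|fst Tg|}"
 proof (rule FC.lifts_nonzero[OF l x(1) cx right_module_ab[OF precomod_module[OF p]]])
  fix Tg assume "Tg : set L"
  then obtain k u where ku: "(fst Tg, k) : KK" "u .: X" "snd Tg = (%t. tensor A X C u (k t))" using L[of "fst Tg" "snd Tg"] by auto
  have "k : rmod_hom A (fst Tg) C" using comod_hom_rmod[OF K1[OF ku(1), THEN conjunct2]] by simp
  then have "snd Tg : add_maps (fst Tg) (tensor_comod A C X)"
   unfolding ku(3) using add_maps_comp[OF rmod_hom_add_maps T.tensor_right_add_maps[OF ku(2)]] by (simp add: add_maps_def)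
  then show "abelian_group (fst Tg) & snd Tg : add_maps (fst Tg) (tensor_comod A C X)"
   using right_module_ab[OF precomod_module[OF FC.simple_precomod[OF K1[OF ku(1), THEN conjunct1]]]] by simp
 qed
 then obtain Tg s where Tg: "Tg : set L" and s: "s : comod_hom A C X (fst Tg)" "s x ~= \<zero>{|fst Tg|}" by blast
 obtain k u where "(fst Tg, k) : KK" using L[of "fst Tg" "snd Tg"] Tg by auto
 then obtain i where i: "i : I" "fst Tg = sc i" by (auto simp: KK_def)
 have s1: "s : comod_hom A C X (sc i)" and s2: "s x ~= \<zero>{|sc i|}" using s unfolding i(2) .
 show ?thesis using FC.schur[OF X simple_sc[OF i(1)] s1 x(1) s2] i(1) by blast
qed

lemma precomod_sc: "i : I ==> precomod A C (sc i)" by (rule right_comodule_precomod[OF comodule_sc])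

lemma iso_sc_unique:
 assumes i: "i : I" and j: "j : I" and f: "f : comod_iso A C (sc i) (sc j)" shows "i = j"
proof (rule ccontr)
 assume ne: "i ~= j"
 obtain y where y: "y .: (S j)" "y ~= \<zero>{|S j|}" using summand_nonzero[OF j] by blast
 have "f ` carrier (sc i) = carrier (sc j)" using f by (simp add: comod_iso_def bij_betw_def)
 then have "y : f ` carrier (sc i)" using y(1) by simp
 then obtain x where x: "y = f x" "x .: (sc i)" by (rule imageE)
 have "f x = \<zero>{|S j|}" by (rule comod_hom_sc_zero[OF i j ne]) (use f x(2) in "simp_all add: comod_iso_def")
 then show False using x(1) y(2) by simp
qed

lemma representatives: "set_of_representatives TYPE('s) A C I (summand_comod A C I S D \<theta>)"
 unfolding set_of_representatives_def
proof (intro conjI ballI allI impI)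
 fix i assume "i : I" then show "simple_comodule A C (sc i)" by (rule simple_sc)
next
 fix X :: "('a, 'c, 's) comod" assume X: "simple_comodule A C X"
 note Xp = FC.simple_precomod[OF X]
 obtain i where i: "i : I" "comod_iso A C X (sc i) ~= {}" using simple_iso_summand[OF X] by blast
 show "EX! i. i : I & comod_iso A C X (sc i) ~= {}"
 proof (rule ex1I)
  show "i : I & comod_iso A C X (sc i) ~= {}" using i by simp
  fix j assume j: "j : I & comod_iso A C X (sc j) ~= {}"
  obtain f g where f: "f : comod_iso A C X (sc i)" and g: "g : comod_iso A C X (sc j)" using i(2) j by blast
  have jI: "j : I" using j by simp
  show "j = i"
   by (rule iso_sc_unique[OF jI i(1) comod_iso_trans[OF precomod_sc[OF jI] Xp precomod_sc[OF i(1)]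
    comod_iso_sym[OF Xp precomod_sc[OF jI] g] f]])
 qed
qed

text \<open>C is generated by the values of the colinear maps \<open>hh i \<phi>\<close>; a nonzero
  value lies in the image of a summand, which is a simple subcomodule.\<close>

lemma cosemisimple: "cosemisimple u A C"
proof -
 let ?R = "regc C"
 let ?X = "{N. simple_comodule A C N & subcomodule A C N ?R}"
 note rp = right_comodule_precomod[OF regular_comodule]
 interpret R: right_module A ?R by (rule precomod_module[OF rp])
 have sg: "additive_subgroup (carrier N) ?R" if "N : ?X" for N
  using stable_submod[OF FC.subcomodule_stable[OF regular_comodule]] that by (simp add: submod_def)
 have sgX: "additive_subgroup (ssum ?R carrier ?X) ?R" by (rule ssum_subgroup[where X = ?X and F = carrier, OF R.ab sg subset_refl])
 have "c : ssum ?R carrier ?X" if "c .: C" for c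
  using that
 proof (induction rule: C_induct)
  case zero
  show ?case using ssum.zero[of ?R carrier ?X] by simp
 next
  case (gen i \<phi> x)
  show ?case
  proof (cases "hh i \<phi> x = \<zero>{|?R|}")
   case True
   show ?thesis unfolding True by (rule ssum.zero)
  next
   case False
   have x: "x .: (sc i)" using gen(3) by simp
   have "simple_comodule A C (sub_comod A C ?R (hh i \<phi> ` carrier (sc i)))"
    "subcomodule A C (sub_comod A C ?R (hh i \<phi> ` carrier (sc i))) ?R"
    by (rule FC.simple_image[OF simple_sc[OF gen(1)] regular_comodule hh_comod_hom[OF gen(1,2)] x False])+
   then have "sub_comod A C ?R (hh i \<phi> ` carrier (sc i)) : ?X" by (intro CollectI conjI)
   from ssum_incl[where X = ?X and F = carrier, OF R.ab sg subset_refl this]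
   have "carrier (sub_comod A C ?R (hh i \<phi> ` carrier (sc i))) <= ssum ?R carrier ?X" by this
   moreover have "hh i \<phi> x .: (sub_comod A C ?R (hh i \<phi> ` carrier (sc i)))"
    unfolding sub_comod_simps by (rule imageI[OF x])
   ultimately show ?thesis by (rule subsetD)
  qed
 next
  case (add c d)
  show ?case using additive_subgroup.a_closed[OF sgX add(3,4)] unfolding regular_comod_simps .
 qed
 then have "semisimple_comodule A C ?R" by (rule FC.semisimple_regular)
 then show ?thesis unfolding cosemisimple_def by (intro conjI coring_axioms left_flat)
qed

end

text \<open>Both families represent the simple comodules, which gives the bijection. An isomorphism
  g of comodules conjugates the colinear endomorphisms of one summand into those of the other, and
  by \<open>comod_End_sc\<close> these are precisely the division subrings.\<close>

lemma decomposition_unique: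
 assumes "comatrix_decomposed A C K \<eta> I S D \<theta>" "comatrix_decomposed A C K \<eta> I' S' D' \<theta>'"
 shows "EX \<phi>. bij_betw \<phi> I I' & (ALL i:I. EX g:rmod_iso A (S i) (S' (\<phi> i)). D' (\<phi> i) = conjugate (S i) (S' (\<phi> i)) g (D i))"
proof -
 interpret P: comatrix_decomposed A C K \<eta> I S D \<theta> by fact
 interpret Q: comatrix_decomposed A C K \<eta> I' S' D' \<theta>' by fact
 have "EX j. j : I' & comod_iso A C (P.sc i) (Q.sc j) ~= {}" if "i : I" for i
  using Q.simple_iso_summand[OF P.simple_sc[OF that]] by blast
 then obtain \<phi> where \<phi>: "!!i. i : I ==> \<phi> i : I'" "!!i. i : I ==> comod_iso A C (P.sc i) (Q.sc (\<phi> i)) ~= {}"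
  by metis
 have "inj_on \<phi> I"
 proof (rule inj_onI)
  fix i j assume i: "i : I" and j: "j : I" and e: "\<phi> i = \<phi> j"
  obtain f where f: "f : comod_iso A C (P.sc i) (Q.sc (\<phi> j))" using \<phi>(2)[OF i] e by auto
  obtain g where g: "g : comod_iso A C (P.sc j) (Q.sc (\<phi> j))" using \<phi>(2)[OF j] by blast
  note q = Q.precomod_sc[OF \<phi>(1)[OF j]]
  show "i = j"
   by (rule P.iso_sc_unique[OF i j P.comod_iso_trans[OF P.precomod_sc[OF i] q P.precomod_sc[OF j] f
    P.comod_iso_sym[OF P.precomod_sc[OF j] q g]]])
 qed
 moreover have "j : \<phi> ` I" if j: "j : I'" for j
 proof -
  obtain i h where i: "i : I" and h: "h : comod_iso A C (Q.sc j) (P.sc i)"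
   using P.simple_iso_summand[OF Q.simple_sc[OF j]] by blast
  obtain f where f: "f : comod_iso A C (P.sc i) (Q.sc (\<phi> i))" using \<phi>(2)[OF i] by blast
  have "j = \<phi> i"
   by (rule Q.iso_sc_unique[OF j \<phi>(1)[OF i] P.comod_iso_trans[OF Q.precomod_sc[OF j] P.precomod_sc[OF i] Q.precomod_sc[OF \<phi>(1)[OF i]] h f]])
  then show ?thesis using i by blast
 qed
 ultimately have bij: "bij_betw \<phi> I I'" unfolding bij_betw_def using \<phi>(1) by blast
 have "EX g:rmod_iso A (S i) (S' (\<phi> i)). D' (\<phi> i) = conjugate (S i) (S' (\<phi> i)) g (D i)" if i: "i : I" for i
 proof -
  let ?N = "S' (\<phi> i)"
  obtain g where g: "g : comod_iso A C (P.sc i) (Q.sc (\<phi> i))" using \<phi>(2)[OF i] by blast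
  note p = P.precomod_sc[OF i] and q = Q.precomod_sc[OF \<phi>(1)[OF i]]
  note pm = precomod_module[OF p] and qm = precomod_module[OF q]
  let ?h = "inv_into (carrier (S i)) g"
  have gh: "g : comod_hom A C (P.sc i) (Q.sc (\<phi> i))" and gb: "bij_betw g (carrier (S i)) (carrier ?N)"
   using g by (simp_all add: comod_iso_def)
  have hh: "?h : comod_hom A C (Q.sc (\<phi> i)) (P.sc i)"
   using P.comod_hom_inverse(1)[OF p q gh] gb by simp
  have gc: "g x .: ?N" "?h (g x) = x" if "x .: (S i)" for x using gb that by (auto simp: bij_betw_def)
  have hc: "?h y .: (S i)" "g (?h y) = y" if "y .: ?N" for y
   using gb that by (auto simp: bij_betw_def inv_into_into f_inv_into_f)
  have "conjugate (S i) ?N g (D i) = D' (\<phi> i)"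
  proof (intro equalityI subsetI)
   fix d' assume "d' : conjugate (S i) ?N g (D i)"
   then obtain d where d: "d : D i" "d' = (\<lambda>y\<in>carrier ?N. g (d (?h y)))" by (auto simp: conjugate_def)
   have "(%y. g (d (?h y))) : comod_hom A C (Q.sc (\<phi> i)) (Q.sc (\<phi> i))"
    by (rule P.comod_hom_comp[OF q pm qm P.comod_hom_comp[OF q pm pm hh P.D_comod_hom[OF i d(1)]] gh])
   then have "d' : comod_hom A C (Q.sc (\<phi> i)) (Q.sc (\<phi> i))"
    unfolding d(2) by (rule P.comod_hom_cong[OF q qm]) simp
   then show "d' : D' (\<phi> i)" using Q.comod_End_sc[OF \<phi>(1)[OF i]] d(2) by blast
  next
   fix d' assume d': "d' : D' (\<phi> i)"
   let ?d = "\<lambda>x\<in>carrier (S i). ?h (d' (g x))"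
   have "(%x. ?h (d' (g x))) : comod_hom A C (P.sc i) (P.sc i)"
    by (rule P.comod_hom_comp[OF p qm pm P.comod_hom_comp[OF p qm qm gh Q.D_comod_hom[OF \<phi>(1)[OF i] d']] hh])
   then have "?d : comod_hom A C (P.sc i) (P.sc i)" by (rule P.comod_hom_cong[OF p pm]) simp
   then have d: "?d : D i" using P.comod_End_sc[OF i] by blast
   have dc: "d' y .: ?N" if "y .: ?N" for y by (rule Q.D_closed[OF \<phi>(1)[OF i] d' that])
   have de: "d' : extensional (carrier ?N)" by (rule comatrix.D_ext[OF Q.cmx[OF \<phi>(1)[OF i]] d'])
   have "d' = (\<lambda>y\<in>carrier ?N. g (?d (?h y)))"
    by (rule extensionalityI[OF de]) (use hc dc in simp_all)
   then show "d' : conjugate (S i) ?N g (D i)" unfolding conjugate_def by (rule image_eqI[OF _ d])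
  qed
  moreover have "g : rmod_iso A (S i) ?N" using comod_hom_rmod[OF gh] gb by (simp add: rmod_iso_def)
  ultimately show ?thesis by (intro bexI[of _ g]) simp_all
 qed
 then show ?thesis using bij by blast
qed

text \<open>The types in the equivalence come from the construction: indices are carriers of simple
  subcomodules of C, hence of type \<open>'c set\<close>, and the modules have elements in C. The
  free types in the second half cover decompositions, comodules and flatness tests that live
  elsewhere.\<close>

theorem theorem4p4:
  fixes K :: "'k ring" and A :: "'a ring" and \<eta> :: "'k \<Rightarrow> 'a" and C :: "('a, 'c) coring"
  assumes "ring_algebra K A \<eta>"
    and "coring A C"
    and "centralizes K \<eta> C"
  shows
    "(cosemisimple TYPE((nat \<Rightarrow> 'a) set) A C \<longleftrightarrow>
       (\<exists>(I :: 'c set set) (S :: 'c set \<Rightarrow> ('a, 'c) rmod) D \<theta>.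
          comatrix_decomposition K \<eta> A C I S D \<theta>)) \<and>
     (\<forall>(I :: 'i set) (S :: 'i \<Rightarrow> ('a, 'm) rmod) D \<theta>.
        comatrix_decomposition K \<eta> A C I S D \<theta> \<longrightarrow>
          cosemisimple TYPE((nat \<Rightarrow> 'a) set) A C \<and> cosemisimple TYPE('u) A C \<and>
          set_of_representatives TYPE('s) A C I (summand_comod A C I S D \<theta>) \<and>
          (\<forall>(I' :: 'j set) (S' :: 'j \<Rightarrow> ('a, 'n) rmod) D' \<theta>'.
             comatrix_decomposition K \<eta> A C I' S' D' \<theta>' \<longrightarrow>
               (\<exists>\<phi>. bij_betw \<phi> I I' \<and>
                 (\<forall>i\<in>I. \<exists>g\<in>rmod_iso A (S i) (S' (\<phi> i)).
                    D' (\<phi> i) = conjugate (S i) (S' (\<phi> i)) g (D i)))))"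
proof -
 show ?thesis
 proof (intro conjI iffI allI impI)
  assume "cosemisimple TYPE((nat => 'a) set) A C"
  then show "EX (I :: 'c set set) (S :: 'c set => ('a, 'c) rmod) D \<theta>. comatrix_decomposition K \<eta> A C I S D \<theta>"
   by (rule cosemisimple_decomposition[OF assms(1,3)])
 next
  assume "EX (I :: 'c set set) (S :: 'c set => ('a, 'c) rmod) D \<theta>. comatrix_decomposition K \<eta> A C I S D \<theta>"
  then obtain I :: "'c set set" and S :: "'c set => ('a, 'c) rmod" and D \<theta>
   where d: "comatrix_decomposition K \<eta> A C I S D \<theta>" by (elim exE)
  show "cosemisimple TYPE((nat => 'a) set) A C"
   by (rule comatrix_decomposed.cosemisimple[OF comatrix_decomposed.intro[OF assms(2) comatrix_decomposed_axioms.intro[OF d]]])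
 next
  fix I :: "'i set" and S :: "'i => ('a, 'm) rmod" and D \<theta>
  assume "comatrix_decomposition K \<eta> A C I S D \<theta>"
  note d = comatrix_decomposed.intro[OF assms(2) comatrix_decomposed_axioms.intro[OF this]]
  show "cosemisimple TYPE((nat => 'a) set) A C" "cosemisimple TYPE('u) A C"
   by (rule comatrix_decomposed.cosemisimple[OF d])+
  show "set_of_representatives TYPE('s) A C I (summand_comod A C I S D \<theta>)"
   by (rule comatrix_decomposed.representatives[OF d])
  fix I' :: "'j set" and S' :: "'j => ('a, 'n) rmod" and D' \<theta>'
  assume "comatrix_decomposition K \<eta> A C I' S' D' \<theta>'"
  note d' = comatrix_decomposed.intro[OF assms(2) comatrix_decomposed_axioms.intro[OF this]]
  show "EX \<phi>. bij_betw \<phi> I I' & (ALL i:I. EX g:rmod_iso A (S i) (S' (\<phi> i)). D' (\<phi> i) = conjugate (S i) (S' (\<phi> i)) g (D i))"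
   by (rule decomposition_unique[OF d d'])
 qed
qed

end
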